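(* Let $r\ge 0$ be an integer and let $\Delta\subset\mathbb{R}^3$ be a tetrahedral partition. Then for all $d\gg 0$ (i.e. there is an integer $d_0$ such that for all integers $d\ge d_0$) we have $\dim \mathcal{S}^r_d(\Delta)\ge \mathrm{LB}(\Delta,d,r)$, where $$ \begin{aligned} \mathrm{LB}(\Delta,d,r) := {}& \bigl(f_3-f^\circ_2+f^\circ_1\bigr)\binom{d+3}{3}+ \Bigl(f^\circ_2-\sum_{\tau\in\Delta^\circ_1} t_\tau \Bigr)\binom{d+2-r}{3}\\ &+\sum_{\tau\in\Delta^\circ_1} \left( a_\tau\binom{d+2-q_\tau}{3}+b_\tau\binom{d+3-q_\tau}{3}\right)-f^\circ_0\binom{r+3}{3}+\sum_{\gamma\in\Delta_0} N_\gamma . \end{aligned} $$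
   Context: A tetrahedral partition is a simplicial 3-manifold with boundary in $\mathbb{R}^3$: a finite simplicial complex $\Delta$ in $\mathbb{R}^3$ that is pure 3-dimensional, in which the link of every vertex is homeomorphic to a 2-sphere (if the vertex is interior) or a 2-disk (if the vertex is on the boundary), and in which every 2-simplex is either the intersection of two tetrahedra of $\Delta$ (interior) or is on the boundary of $\Delta$ and contained in only one tetrahedron. $\Delta$ is identified with its underlying space. $\Delta_i$ and $\Delta_i^\circ$ denote the sets of $i$-faces and interior $i$-faces (those not contained in the boundary of $\Delta$); $f_i=f_i(\Delta)=|\Delta_i|$, $f_i^\circ=f_i^\circ(\Delta)=|\Delta_i^\circ|$. $\mathcal{S}^r_d(\Delta)$ is the real vector space of functions $F:\Delta\to\mathbb{R}$ which are continuously differentiable of order $r$ and whose restriction to each tetrahedron of $\Delta$ is a polynomial in three variables of total degree at most $d$. (Recalled fact, Billera--Rose: a piecewise polynomial $F$ is such a spline if and only if, for any two tetrahedra $\iota,\iota'$ meeting in a common triangle $\sigma$, the polynomial $F|_\iota-F|_{\iota'}$ is divisible by $\ell_\sigma^{r+1}$, where $\ell_\sigma$ is a polynomial of degree one vanishing on $\sigma$.) Convention: $\binom{n}{k}=0$ whenever $n<k$ (including negative $n$). For a real number $x$, $[x]_+=\max\{x,0\}$. Edge data: for $\tau\in\Delta_1$ let $n_\tau$ be the number of 2-faces of $\Delta$ containing $\tau$, $t_\tau=\min\{n_\tau,r+2\}$, $q_\tau=\left\lfloor \frac{t_\tau(r+1)}{t_\tau-1}\right\rfloor$, $a_\tau=t_\tau(r+1)-(t_\tau-1)q_\tau$,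 $b_\tau=t_\tau-1-a_\tau$. Vertex data: for a vertex $\gamma$, the star $\Delta_\gamma$ is the tetrahedral partition consisting of all tetrahedra of $\Delta$ containing $\gamma$ (with their faces). If $\gamma\in\Delta_0^\circ$ ($\Delta_\gamma$ is a closed vertex star), put $D_\gamma=2r$ if $f_1^\circ(\Delta_\gamma)=4$, $D_\gamma=\lfloor(5r+2)/3\rfloor$ if $f_1^\circ(\Delta_\gamma)=5$, $D_\gamma=\lfloor(3r+1)/2\rfloor$ if $f_1^\circ(\Delta_\gamma)\ge 6$, and $$L^{c}_\gamma(d)=2\binom{d+2}{2}+\Bigl(f^\circ_2(\Delta_\gamma)-\sum_{\tau\in(\Delta_\gamma)^\circ_1} t_\tau \Bigr)\binom{d+1-r}{2}+\sum_{\tau\in(\Delta_\gamma)^\circ_1}\left(a_\tau\binom{d+1-q_\tau}{2}+b_\tau\binom{d+2-q_\tau}{2}\right).$$ If $\gamma\in\Delta_0\setminus\Delta_0^\circ$ ($\Delta_\gamma$ is an open vertex star), put $$L^{o}_\gamma(d)=\binom{d+2}{2}+\Bigl(f^\circ_2(\Delta_\gamma)-\sum_{\tau\in(\Delta_\gamma)^\circ_1} t_\tau \Bigr)\binom{d+1-r}{2}+\sum_{\tau\in(\Delta_\gamma)^\circ_1}\left(a_\tau\binom{d+1-q_\tau}{2}+b_\tau\binom{d+2-q_\tau}{2}\right).$$ Finally $$N_\gamma=\sum_{d=r+1}^{D_\gamma}\left[\binom{d+2}{2}-L^c_\gamma(d)\right]+\sum_{d=D_\gamma+1}^{3r+1}\left[\binom{d+2}{2}-L^c_\gamma(d)\right]_+\quad\text{if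 }\gamma\in\Delta_0^\circ,$$ $$N_\gamma=\sum_{d=r+1}^{3r+1}\left[\binom{d+2}{2}-L^o_\gamma(d)\right]_+\quad\text{if }\gamma\in\Delta_0\setminus\Delta_0^\circ.$$ Empty sums are zero; note that in the first sum for interior vertices no positive part is taken. *)

theory Defs
  imports "HOL-Analysis.Analysis" "HOL-Library.Function_Algebras"
begin

subsection \<open>Tetrahedral partitions\<close>

text \<open>
  Faces are represented by point sets, as in the library's \<^const>\<open>simplicial_complex\<close>; a vertex
  is a singleton, and a nonempty complex contains the empty face.  Between members of a simplicial
  complex, \<open>S \<subseteq> T\<close> is the same as \<open>S face_of T\<close>.
\<close>

definition faces :: "nat \<Rightarrow> (real^3) set set \<Rightarrow> (real^3) set set" where
  "faces i \<Delta> = {S \<in> \<Delta>. int i simplex S}"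

definition boundary_triangles :: "(real^3) set set \<Rightarrow> (real^3) set set" where
  "boundary_triangles \<Delta> = {\<sigma> \<in> faces 2 \<Delta>. \<exists>!T. T \<in> faces 3 \<Delta> \<and> \<sigma> \<subseteq> T}"

definition interior_faces :: "nat \<Rightarrow> (real^3) set set \<Rightarrow> (real^3) set set" where
  "interior_faces i \<Delta> = {S \<in> faces i \<Delta>. \<not> S \<subseteq> \<Union>(boundary_triangles \<Delta>)}"

definition vertex_link :: "(real^3) set \<Rightarrow> (real^3) set set \<Rightarrow> (real^3) set set" where
  "vertex_link \<gamma> \<Delta> = {S \<in> \<Delta>. \<not> \<gamma> \<subseteq> S \<and> (\<exists>T\<in>\<Delta>. \<gamma> \<subseteq> T \<and> S \<subseteq> T)}"

definition vertex_star :: "(real^3) set \<Rightarrow> (real^3) set set \<Rightarrow> (real^3) set set" where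
  "vertex_star \<gamma> \<Delta> = {S \<in> \<Delta>. \<exists>T\<in>faces 3 \<Delta>. \<gamma> \<subseteq> T \<and> S \<subseteq> T}"

definition tetrahedral_partition :: "(real^3) set set \<Rightarrow> bool" where
  "tetrahedral_partition \<Delta> \<longleftrightarrow>
     simplicial_complex \<Delta> \<and>
     \<Delta> \<noteq> {} \<and> (\<forall>S\<in>\<Delta>. \<exists>T\<in>faces 3 \<Delta>. S \<subseteq> T) \<and>
     (\<forall>\<gamma>\<in>interior_faces 0 \<Delta>.
        \<Union>(vertex_link \<gamma> \<Delta>) homeomorphic sphere (0::real^3) 1) \<and>
     (\<forall>\<gamma>\<in>faces 0 \<Delta> - interior_faces 0 \<Delta>.
        \<Union>(vertex_link \<gamma> \<Delta>) homeomorphic cball (0::real^2) 1) \<and>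
     (\<forall>\<sigma>\<in>faces 2 \<Delta>.
        (\<exists>T\<in>faces 3 \<Delta>. \<exists>T'\<in>faces 3 \<Delta>. \<sigma> = T \<inter> T') \<or> \<sigma> \<in> boundary_triangles \<Delta>)"


subsection \<open>Spline spaces\<close>

definition polynomial3 :: "nat \<Rightarrow> (real^3 \<Rightarrow> real) \<Rightarrow> bool" where
  "polynomial3 d p \<longleftrightarrow>
     (\<exists>c. \<forall>x. p x = (\<Sum>(i,j,k) | i + j + k \<le> d. c i j k * (x$1)^i * (x$2)^j * (x$3)^k))"

text \<open>
  Order-\<open>r\<close> continuous differentiability on a closed set \<open>X\<close> uses derivatives relative to \<open>X\<close>.
  If \<open>X\<close> is a union of tetrahedra these derivatives are unique at every point, including the
  boundary points of \<open>X\<close>.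
\<close>

primrec cont_diff_on :: "nat \<Rightarrow> (real^3) set \<Rightarrow> (real^3 \<Rightarrow> real) \<Rightarrow> bool" where
  "cont_diff_on 0 X f \<longleftrightarrow> continuous_on X f"
| "cont_diff_on (Suc r) X f \<longleftrightarrow>
     (\<exists>f'. (\<forall>x\<in>X. (f has_derivative f' x) (at x within X)) \<and>
           (\<forall>v. cont_diff_on r X (\<lambda>x. f' x v)))"

text \<open>
  A function on the underlying space \<open>\<Union>\<Delta>\<close> is represented by its extension by zero, so that equality
  of representatives is equality on \<open>\<Union>\<Delta>\<close>.
\<close>

definition spline_space :: "nat \<Rightarrow> nat \<Rightarrow> (real^3) set set \<Rightarrow> (real^3 \<Rightarrow> real) set" where
  "spline_space r d \<Delta> =
     {F. (\<forall>x. x \<notin> \<Union>\<Delta> \<longrightarrow> F x = 0) \<and>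
         cont_diff_on r (\<Union>\<Delta>) F \<and>
         (\<forall>T\<in>faces 3 \<Delta>. \<exists>p. polynomial3 d p \<and> (\<forall>x\<in>T. F x = p x))}"

definition fun_scale :: "real \<Rightarrow> (real^3 \<Rightarrow> real) \<Rightarrow> (real^3 \<Rightarrow> real)" where
  "fun_scale c f = (\<lambda>x. c * f x)"

lemma vector_space_fun_scale: "vector_space fun_scale"
  by unfold_locales (auto simp: fun_scale_def fun_eq_iff algebra_simps)

definition spline_dim :: "nat \<Rightarrow> nat \<Rightarrow> (real^3) set set \<Rightarrow> nat" where
  "spline_dim r d \<Delta> = vector_space.dim fun_scale (spline_space r d \<Delta>)"

lemma polynomial3_zero: "polynomial3 d (\<lambda>x. 0)"
  unfolding polynomial3_def by (rule exI[of _ "\<lambda>i j k. 0"]) auto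

lemma polynomial3_add:
  assumes "polynomial3 d p" "polynomial3 d q"
  shows "polynomial3 d (\<lambda>x. p x + q x)"
proof -
  obtain a b where
    "\<forall>x. p x = (\<Sum>(i,j,k) | i + j + k \<le> d. a i j k * (x$1)^i * (x$2)^j * (x$3)^k)"
    "\<forall>x. q x = (\<Sum>(i,j,k) | i + j + k \<le> d. b i j k * (x$1)^i * (x$2)^j * (x$3)^k)"
    using assms unfolding polynomial3_def by blast
  then show ?thesis
    unfolding polynomial3_def
    by (intro exI[of _ "\<lambda>i j k. a i j k + b i j k"])
       (auto simp: sum.distrib[symmetric] algebra_simps intro!: sum.cong)
qed

lemma polynomial3_scale:
  assumes "polynomial3 d p"
  shows "polynomial3 d (\<lambda>x. c * p x)"
proof -
  obtain a where
    "\<forall>x. p x = (\<Sum>(i,j,k) | i + j + k \<le> d. a i j k * (x$1)^i * (x$2)^j * (x$3)^k)"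
    using assms unfolding polynomial3_def by blast
  then show ?thesis
    unfolding polynomial3_def
    by (intro exI[of _ "\<lambda>i j k. c * a i j k"])
       (auto simp: sum_distrib_left algebra_simps intro!: sum.cong)
qed

lemma cont_diff_on_zero: "cont_diff_on r X (\<lambda>x. 0)"
proof (induction r)
  case (Suc r)
  then show ?case
    unfolding cont_diff_on.simps by (intro exI[of _ "\<lambda>x v. 0"] conjI) simp_all
qed simp

lemma cont_diff_on_add:
  "cont_diff_on r X f \<Longrightarrow> cont_diff_on r X g \<Longrightarrow> cont_diff_on r X (\<lambda>x. f x + g x)"
proof (induction r arbitrary: f g)
  case (Suc r)
  then obtain f' g' where
    "\<forall>x\<in>X. (f has_derivative f' x) (at x within X)" "\<forall>v. cont_diff_on r X (\<lambda>x. f' x v)"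
    "\<forall>x\<in>X. (g has_derivative g' x) (at x within X)" "\<forall>v. cont_diff_on r X (\<lambda>x. g' x v)"
    by auto
  with Suc.IH show ?case
    unfolding cont_diff_on.simps
    by (intro exI[of _ "\<lambda>x v. f' x v + g' x v"] conjI) (simp_all add: has_derivative_add)
qed (auto intro: continuous_on_add)

lemma cont_diff_on_scale:
  "cont_diff_on r X f \<Longrightarrow> cont_diff_on r X (\<lambda>x. c * f x)"
proof (induction r arbitrary: f)
  case (Suc r)
  then obtain f' where
    "\<forall>x\<in>X. (f has_derivative f' x) (at x within X)" "\<forall>v. cont_diff_on r X (\<lambda>x. f' x v)"
    by auto
  with Suc.IH show ?case
    unfolding cont_diff_on.simps
    by (intro exI[of _ "\<lambda>x v. c * f' x v"] conjI) (simp_all add: has_derivative_mult_right)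
qed (auto intro: continuous_on_mult_left)

lemma subspace_spline_space: "module.subspace fun_scale (spline_space r d \<Delta>)"
proof -
  interpret vector_space fun_scale by (rule vector_space_fun_scale)
  show ?thesis
  proof (rule subspaceI)
    show "0 \<in> spline_space r d \<Delta>"
      using polynomial3_zero cont_diff_on_zero by (auto simp: spline_space_def zero_fun_def)
  next
    fix F G assume FG: "F \<in> spline_space r d \<Delta>" "G \<in> spline_space r d \<Delta>"
    have "\<exists>p. polynomial3 d p \<and> (\<forall>x\<in>T. F x + G x = p x)" if T: "T \<in> faces 3 \<Delta>" for T
    proof -
      obtain p where p: "polynomial3 d p" "\<forall>x\<in>T. F x = p x"
        using FG(1) T unfolding spline_space_def by blast
      obtain q where q: "polynomial3 d q" "\<forall>x\<in>T. G x = q x"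
        using FG(2) T unfolding spline_space_def by blast
      have "\<forall>x\<in>T. F x + G x = p x + q x" using p(2) q(2) by simp
      with polynomial3_add[OF p(1) q(1)] show ?thesis by (intro exI conjI)
    qed
    moreover have "cont_diff_on r (\<Union>\<Delta>) (\<lambda>x. F x + G x)"
      using FG by (intro cont_diff_on_add) (simp_all add: spline_space_def)
    moreover have "\<forall>x. x \<notin> \<Union>\<Delta> \<longrightarrow> F x + G x = 0"
      using FG by (simp add: spline_space_def)
    ultimately show "F + G \<in> spline_space r d \<Delta>"
      unfolding spline_space_def plus_fun_def by blast
  next
    fix c F assume F: "F \<in> spline_space r d \<Delta>"
    have "\<exists>p. polynomial3 d p \<and> (\<forall>x\<in>T. c * F x = p x)" if T: "T \<in> faces 3 \<Delta>" for T
    proof -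
      obtain p where p: "polynomial3 d p" "\<forall>x\<in>T. F x = p x"
        using F T unfolding spline_space_def by blast
      have "\<forall>x\<in>T. c * F x = c * p x" using p(2) by simp
      with polynomial3_scale[OF p(1)] show ?thesis by (intro exI conjI)
    qed
    moreover have "cont_diff_on r (\<Union>\<Delta>) (\<lambda>x. c * F x)"
      using F by (intro cont_diff_on_scale) (simp add: spline_space_def)
    moreover have "\<forall>x. x \<notin> \<Union>\<Delta> \<longrightarrow> c * F x = 0"
      using F by (simp add: spline_space_def)
    ultimately show "fun_scale c F \<in> spline_space r d \<Delta>"
      unfolding spline_space_def fun_scale_def by blast
  qed
qed


subsection \<open>The lower bound\<close>

text \<open>Binomial coefficient with the convention that it vanishes whenever \<open>n < k\<close>.\<close>

definition bin :: "int \<Rightarrow> nat \<Rightarrow> int" where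
  "bin n k = (if n < int k then 0 else int (nat n choose k))"

definition pos_part :: "int \<Rightarrow> int" where
  "pos_part x = max x 0"

definition n_edge :: "(real^3) set set \<Rightarrow> (real^3) set \<Rightarrow> nat" where
  "n_edge \<Delta> \<tau> = card {\<sigma> \<in> faces 2 \<Delta>. \<tau> \<subseteq> \<sigma>}"

definition t_edge :: "nat \<Rightarrow> (real^3) set set \<Rightarrow> (real^3) set \<Rightarrow> int" where
  "t_edge r \<Delta> \<tau> = min (int (n_edge \<Delta> \<tau>)) (int r + 2)"

definition q_edge :: "nat \<Rightarrow> (real^3) set set \<Rightarrow> (real^3) set \<Rightarrow> int" where
  "q_edge r \<Delta> \<tau> = \<lfloor>of_int (t_edge r \<Delta> \<tau> * (int r + 1)) / of_int (t_edge r \<Delta> \<tau> - 1) :: real\<rfloor>"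

definition a_edge :: "nat \<Rightarrow> (real^3) set set \<Rightarrow> (real^3) set \<Rightarrow> int" where
  "a_edge r \<Delta> \<tau> = t_edge r \<Delta> \<tau> * (int r + 1) - (t_edge r \<Delta> \<tau> - 1) * q_edge r \<Delta> \<tau>"

definition b_edge :: "nat \<Rightarrow> (real^3) set set \<Rightarrow> (real^3) set \<Rightarrow> int" where
  "b_edge r \<Delta> \<tau> = t_edge r \<Delta> \<tau> - 1 - a_edge r \<Delta> \<tau>"

text \<open>
  In the vertex data the index set consists of faces of the star of \<open>\<gamma>\<close>, interior relative to that
  star, while the edge data are those of \<open>\<Delta>\<close>.
\<close>

definition L_common :: "nat \<Rightarrow> (real^3) set set \<Rightarrow> (real^3) set \<Rightarrow> nat \<Rightarrow> int" where
  "L_common r \<Delta> \<gamma> d =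
     (int (card (interior_faces 2 (vertex_star \<gamma> \<Delta>)))
        - (\<Sum>\<tau>\<in>interior_faces 1 (vertex_star \<gamma> \<Delta>). t_edge r \<Delta> \<tau>)) * bin (int d + 1 - int r) 2
     + (\<Sum>\<tau>\<in>interior_faces 1 (vertex_star \<gamma> \<Delta>).
          a_edge r \<Delta> \<tau> * bin (int d + 1 - q_edge r \<Delta> \<tau>) 2
          + b_edge r \<Delta> \<tau> * bin (int d + 2 - q_edge r \<Delta> \<tau>) 2)"

definition L_closed :: "nat \<Rightarrow> (real^3) set set \<Rightarrow> (real^3) set \<Rightarrow> nat \<Rightarrow> int" where
  "L_closed r \<Delta> \<gamma> d = 2 * bin (int d + 2) 2 + L_common r \<Delta> \<gamma> d"

definition L_open :: "nat \<Rightarrow> (real^3) set set \<Rightarrow> (real^3) set \<Rightarrow> nat \<Rightarrow> int" where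
  "L_open r \<Delta> \<gamma> d = bin (int d + 2) 2 + L_common r \<Delta> \<gamma> d"

text \<open>An interior vertex star always has at least four interior edges, so the last case is
  \<open>f\<^sub>1\<^sup>\<circ> \<ge> 6\<close>.\<close>

definition D_vertex :: "nat \<Rightarrow> (real^3) set set \<Rightarrow> (real^3) set \<Rightarrow> nat" where
  "D_vertex r \<Delta> \<gamma> =
     (let k = card (interior_faces 1 (vertex_star \<gamma> \<Delta>)) in
      if k = 4 then 2 * r
      else if k = 5 then (5 * r + 2) div 3
      else (3 * r + 1) div 2)"

definition N_vertex :: "nat \<Rightarrow> (real^3) set set \<Rightarrow> (real^3) set \<Rightarrow> int" where
  "N_vertex r \<Delta> \<gamma> =
     (if \<gamma> \<in> interior_faces 0 \<Delta> then
        (\<Sum>d = r + 1..D_vertex r \<Delta> \<gamma>. bin (int d + 2) 2 - L_closed r \<Delta> \<gamma> d)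
        + (\<Sum>d = D_vertex r \<Delta> \<gamma> + 1..3 * r + 1. pos_part (bin (int d + 2) 2 - L_closed r \<Delta> \<gamma> d))
      else
        (\<Sum>d = r + 1..3 * r + 1. pos_part (bin (int d + 2) 2 - L_open r \<Delta> \<gamma> d)))"

definition LB :: "(real^3) set set \<Rightarrow> nat \<Rightarrow> nat \<Rightarrow> int" where
  "LB \<Delta> d r =
     (int (card (faces 3 \<Delta>)) - int (card (interior_faces 2 \<Delta>)) + int (card (interior_faces 1 \<Delta>)))
        * bin (int d + 3) 3
     + (int (card (interior_faces 2 \<Delta>)) - (\<Sum>\<tau>\<in>interior_faces 1 \<Delta>. t_edge r \<Delta> \<tau>))
        * bin (int d + 2 - int r) 3
     + (\<Sum>\<tau>\<in>interior_faces 1 \<Delta>.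
          a_edge r \<Delta> \<tau> * bin (int d + 2 - q_edge r \<Delta> \<tau>) 3
          + b_edge r \<Delta> \<tau> * bin (int d + 3 - q_edge r \<Delta> \<tau>) 3)
     - int (card (interior_faces 0 \<Delta>)) * bin (int r + 3) 3
     + (\<Sum>\<gamma>\<in>faces 0 \<Delta>. N_vertex r \<Delta> \<gamma>)"

end

theory Submission
  imports Defs "HOL-Computational_Algebra.Polynomial"
begin

text \<open>
  A spline is a tuple \<open>p\<close> of polynomials, one for each tetrahedron, whose jump \<open>\<delta> p \<sigma>\<close> across each interior
  triangle \<open>\<sigma>\<close> is divisible by \<open>ell \<sigma> ^ (r + 1)\<close>.  By rank-nullity a lower bound for the dimension amounts to an
  upper bound for the space of all \<open>\<delta> p + q\<close> with \<open>q \<sigma>\<close> divisible by \<open>ell \<sigma> ^ (r + 1)\<close>.  Its elements satisfy two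
  kinds of conditions: the signed sum around an interior edge lies in the ideal generated by the powers
  of the forms \<open>ell \<sigma>\<close> at that edge, and the Taylor components of degree \<open>e \<le> 3 * r + 1\<close> at each vertex lie
  in a space \<open>W\<close> that depends only on the star of the vertex.  The edge conditions on tuples vanishing to
  order \<open>3 * r + 2\<close> at the vertices are independent, as Bernstein monomials show.  The space \<open>W\<close> is bounded
  in two ways: by its generators, which gives the summands of \<open>N_vertex\<close> without positive part, and by the
  edge conditions at the vertex, which shows that the contribution is nonnegative.  The second bound
  needs the edge conditions to be independent.  At a boundary vertex this follows from the
  connectedness of the star.  At an interior vertex it also needs that the \<open>(r + 1)\<close>-st powers of the
  linear forms generate all forms of degree \<open>e\<close>; for forms in general position this holds when
  \<open>e > D_vertex\<close>, and the dimension of \<open>W\<close> does not drop under a small perturbation into general position.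
\<close>

subsection \<open>Linear algebra\<close>

text \<open>The order \<open>3 * r + 2\<close> separates the two kinds of conditions. Among data
  vanishing to that order at the ends of an edge, a Bernstein monomial with both exponents off the
  edge at most \<open>r\<close> has exponents above \<open>r\<close> at both ends, so the remaining
  edges of a triangle absorb it. What lies below that order lives in the finitely many degrees of
  \<open>N_vertex\<close>. At an interior vertex the obstacle is the lack of a boundary edge from
  which the edge conditions could be solved one after the other along the link. The powers of the
  linear forms replace it once they generate all forms of degree \<open>e\<close>. To prove this,
  one differentiates along each of the k edge directions in turn. Each form vanishes on two of them,
  so a round lowers the degree by k and the deficiency \<open>e - r\<close> only by 2, and the
  inequality 2 e < min(k, 6) (e - r) persists; it is the origin of \<open>D_vertex\<close>. The cap
  6 is there because only three triangles are guaranteed at an edge. The term with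
  \<open>bin (int r + 3) 3\<close> pays for the degrees up to \<open>r\<close>, in each of which an
  interior vertex may lose one whole space of forms.\<close>

instantiation "fun" :: (type, real_vector) real_vector
begin

definition scaleR_fun :: "real \<Rightarrow> ('a \<Rightarrow> 'b) \<Rightarrow> 'a \<Rightarrow> 'b" where
  "scaleR_fun c f = (\<lambda>x. c *\<^sub>R f x)"

instance
  by standard (simp_all add: scaleR_fun_def fun_eq_iff scaleR_add_left scaleR_add_right)

end

lemma scaleR_fun_apply [simp]: "(c *\<^sub>R f) x = c *\<^sub>R f x"
  by (simp add: scaleR_fun_def)

lemma sum_fun_apply: "(\<Sum>i\<in>I. f i) x = (\<Sum>i\<in>I. f i x)"
  by (induction I rule: infinite_finite_induct) auto

lemma linear_fun_apply: "linear (\<lambda>q. q i)"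
  by (rule linearI) auto

text \<open>\<open>dim\<close> of an infinite-dimensional set is 0 by default, so comparisons of
  dimensions need this side condition.\<close>

definition fin_dim :: "'a::real_vector set \<Rightarrow> bool" where
  "fin_dim S \<longleftrightarrow> (\<exists>B. finite B \<and> S \<subseteq> span B)"

lemma fin_dim_finite: "finite B \<Longrightarrow> fin_dim B"
  unfolding fin_dim_def using span_superset by blast

lemma fin_dim_subset: "fin_dim T \<Longrightarrow> S \<subseteq> span T \<Longrightarrow> fin_dim S"
  unfolding fin_dim_def by (metis span_mono span_span subset_trans)

lemma fin_dim_mono: "fin_dim T \<Longrightarrow> S \<subseteq> T \<Longrightarrow> fin_dim S"
  unfolding fin_dim_def by blast

lemma fin_dim_span: "fin_dim S \<Longrightarrow> fin_dim (span S)"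
  by (erule fin_dim_subset) simp

lemma fin_dim_Un: "fin_dim S \<Longrightarrow> fin_dim T \<Longrightarrow> fin_dim (S \<union> T)"
proof -
  assume "fin_dim S" "fin_dim T"
  then obtain B C where B: "finite B" "S \<subseteq> span B" and C: "finite C" "T \<subseteq> span C"
    by (auto simp: fin_dim_def)
  have "S \<union> T \<subseteq> span (B \<union> C)"
    using B(2) C(2) span_mono[of B "B \<union> C"] span_mono[of C "B \<union> C"] by auto
  with B(1) C(1) show ?thesis unfolding fin_dim_def by blast
qed

lemma fin_dim_UN: "finite I \<Longrightarrow> (\<And>i. i \<in> I \<Longrightarrow> fin_dim (S i)) \<Longrightarrow> fin_dim (\<Union>i\<in>I. S i)"
  by (induction I rule: finite_induct) (auto intro: fin_dim_Un fin_dim_finite)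

lemma fin_dim_image:
  assumes "linear f" "fin_dim S"
  shows "fin_dim (f ` S)"
proof -
  obtain B where B: "finite B" "S \<subseteq> span B" using assms(2) by (auto simp: fin_dim_def)
  have "f ` S \<subseteq> span (f ` B)"
    using B(2) linear_span_image[OF assms(1), of B] by auto
  with B(1) show ?thesis unfolding fin_dim_def by blast
qed

lemma fin_dim_basis:
  assumes "fin_dim V"
  obtains B where "B \<subseteq> V" "independent B" "finite B" "V \<subseteq> span B" "card B = dim V"
proof -
  obtain B where B: "B \<subseteq> V" "independent B" "V \<subseteq> span B" "card B = dim V"
    using basis_exists by blast
  obtain C where C: "finite C" "V \<subseteq> span C" using assms by (auto simp: fin_dim_def)
  have "finite B"
    using independent_span_bound[OF C(1) B(2)] B(1) C(2) by auto
  with B that show ?thesis by blast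
qed

lemma dim_le_dim:
  assumes "fin_dim T" "S \<subseteq> span T"
  shows "dim S \<le> dim T"
proof -
  obtain B where B: "independent B" "finite B" "T \<subseteq> span B" "card B = dim T"
    using fin_dim_basis[OF assms(1)] by metis
  have "S \<subseteq> span B" using assms(2) B(3) by (metis span_mono span_span subset_trans)
  from dim_le_card[OF this B(2)] B(4) show ?thesis by simp
qed

lemma dim_mono': "fin_dim T \<Longrightarrow> S \<subseteq> T \<Longrightarrow> dim S \<le> dim T"
  by (rule dim_le_dim) (auto intro: span_base)

lemma dim_zero [simp]: "dim {0::'a::real_vector} = 0"
  by (metis dim_eq_card_independent dim_span card.empty independent_empty span_empty)

text \<open>Rank-nullity without a finite-dimensional ambient space: a basis of the kernel is
  extended to \<open>V\<close>, and the added vectors map injectively onto a basis of the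
  image.\<close>

lemma dim_kernel_image:
  assumes f: "linear f" and V: "subspace V" "fin_dim V"
  shows "dim V = dim {v\<in>V. f v = 0} + dim (f ` V)"
proof -
  let ?K = "{v\<in>V. f v = 0}"
  have "fin_dim ?K" by (rule fin_dim_mono[OF V(2)]) auto
  then obtain B0 where B0: "B0 \<subseteq> ?K" "independent B0" "finite B0" "?K \<subseteq> span B0" "card B0 = dim ?K"
    by (rule fin_dim_basis)
  obtain B where B: "B0 \<subseteq> B" "B \<subseteq> V" "independent B" "V \<subseteq> span B"
    using maximal_independent_subset_extend[of B0 V] B0 by blast
  have fB: "finite B"
    using V(2) B(2,3) independent_span_bound unfolding fin_dim_def by blast
  have dimV: "card B = dim V"
    using B fB by (metis basis_card_eq_dim)
  let ?C = "B - B0"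
  have sC: "span ?C \<subseteq> V" using B(2) V(1) by (meson Diff_subset span_minimal subset_trans)
  have ker0: "x = 0" if x: "x \<in> span ?C" "f x = 0" for x
  proof -
    have "x \<in> span B0" using x sC B0(4) by auto
    then obtain w where w: "x = (\<Sum>a\<in>B0. w a *\<^sub>R a)"
      using span_finite[OF B0(3)] by auto
    obtain u where u: "x = (\<Sum>a\<in>?C. u a *\<^sub>R a)"
      using x(1) span_finite[of ?C] fB by auto
    let ?c = "\<lambda>a. if a \<in> B0 then - w a else u a"
    have "(\<Sum>a\<in>B. ?c a *\<^sub>R a) = (\<Sum>a\<in>?C. ?c a *\<^sub>R a) + (\<Sum>a\<in>B0. ?c a *\<^sub>R a)"
      using B(1) fB by (rule sum.subset_diff)
    also have "(\<Sum>a\<in>?C. ?c a *\<^sub>R a) = x" unfolding u by (rule sum.cong) auto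
    also have "(\<Sum>a\<in>B0. ?c a *\<^sub>R a) = - x" unfolding w by (simp add: sum_negf)
    finally have "(\<Sum>a\<in>B. ?c a *\<^sub>R a) = 0" by simp
    then have "\<forall>a\<in>B. ?c a = 0" using independentD[OF B(3) fB order_refl, of ?c] by blast
    then show "x = 0" unfolding u by (intro sum.neutral) (auto split: if_splits)
  qed
  have inj: "inj_on f (span ?C)"
    using ker0 linear_injective_on_subspace_0[OF f, of "span ?C"] by auto
  have "independent (f ` ?C)"
    using linear_independent_injective_image[OF f _ inj] independent_mono[OF B(3), of ?C] by blast
  moreover have "f ` V \<subseteq> span (f ` ?C)"
  proof
    fix y assume "y \<in> f ` V"
    then obtain v where v: "v \<in> V" "y = f v" by auto
    have "f v \<in> f ` span B" using v B(4) by auto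
    then have "f v \<in> span (f ` B)" by (simp add: linear_span_image[OF f])
    moreover have "f ` B \<subseteq> insert 0 (f ` ?C)" using B0(1) by auto
    ultimately show "y \<in> span (f ` ?C)" using v by (metis span_insert_0 span_mono subsetD)
  qed
  moreover have "f ` ?C \<subseteq> f ` V" using B(2) by auto
  ultimately have "dim (f ` V) = card (f ` ?C)"
    by (metis basis_card_eq_dim)
  also have "\<dots> = card ?C"
    by (rule card_image) (meson inj inj_on_subset span_superset)
  also have "\<dots> = card B - card B0" using B(1) B0(3) by (simp add: card_Diff_subset)
  finally show ?thesis using dimV B0(5) card_mono[OF fB B(1)] by simp
qed

lemma dim_image_inj:
  assumes "linear f" "subspace V" "fin_dim V" "\<And>v. v \<in> V \<Longrightarrow> f v = 0 \<Longrightarrow> v = 0"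
  shows "dim (f ` V) = dim V"
proof -
  have "{v\<in>V. f v = 0} = {0}"
    using assms(4) subspace_0[OF assms(2)] linear_0[OF assms(1)] by auto
  then show ?thesis using dim_kernel_image[OF assms(1-3)] by simp
qed

lemma dim_image_le':
  assumes "linear f" "subspace V" "fin_dim V"
  shows "dim (f ` V) \<le> dim V"
  using dim_kernel_image[OF assms] by simp

lemma fin_dim_Times:
  assumes "fin_dim V" "fin_dim W"
  shows "fin_dim (V \<times> W)"
proof -
  have l: "linear (\<lambda>v::'a. (v, 0::'b))" "linear (\<lambda>w::'b. (0::'a, w))"
    by (auto intro!: linearI)
  have "fin_dim ((\<lambda>v. (v, 0)) ` V \<union> (\<lambda>w. (0, w)) ` W)"
    using assms by (intro fin_dim_Un fin_dim_image l)
  moreover have "V \<times> W \<subseteq> span ((\<lambda>v. (v, 0)) ` V \<union> (\<lambda>w. (0, w)) ` W)"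
  proof
    fix p assume "p \<in> V \<times> W"
    then obtain v w where p: "p = (v, 0) + (0, w)" "v \<in> V" "w \<in> W" by auto
    show "p \<in> span ((\<lambda>v. (v, 0)) ` V \<union> (\<lambda>w. (0, w)) ` W)"
      unfolding p(1) using p by (intro span_add span_base) auto
  qed
  ultimately show ?thesis by (rule fin_dim_subset)
qed

lemma dim_Times':
  assumes "subspace V" "fin_dim V" "subspace W" "fin_dim W"
  shows "dim (V \<times> W) = dim V + dim W"
proof -
  have "dim (V \<times> W) = dim {p \<in> V \<times> W. fst p = 0} + dim (fst ` (V \<times> W))"
    using assms by (intro dim_kernel_image linear_fst subspace_Times fin_dim_Times)
  also have "fst ` (V \<times> W) = V" using subspace_0[OF assms(3)] by force
  also have "{p \<in> V \<times> W. fst p = 0} = Pair 0 ` W" using subspace_0[OF assms(1)] by auto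
  also have "dim (Pair (0::'a) ` W) = dim W"
    using assms by (intro dim_image_inj) (auto intro!: linearI simp: zero_prod_def)
  finally show ?thesis by simp
qed

text \<open>Rank-nullity for the map taking (v, w) to f v - w on V x W: its kernel is a copy of the
  preimage and its image is the span. Splines and tuples satisfying edge conditions are both such
  preimages, so an upper bound for a span becomes a lower bound for a preimage and
  conversely.\<close>

lemma dim_vimage:
  assumes f: "linear f" and V: "subspace V" "fin_dim V" and W: "subspace W" "fin_dim W"
  shows "dim {v\<in>V. f v \<in> W} + dim (span (f ` V \<union> W)) = dim V + dim W"
proof -
  let ?g = "\<lambda>p. f (fst p) - snd p"
  have g: "linear ?g"
    using f by (intro linear_compose_sub linear_compose[of fst f, unfolded o_def] linear_fst linear_snd)
  let ?K = "{p \<in> V \<times> W. ?g p = 0}"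
  have sK: "subspace ?K"
    using subspace_inter[OF subspace_Times[OF V(1) W(1)] linear_subspace_kernel[OF g]]
    by (simp add: Int_def)
  have "dim V + dim W = dim (V \<times> W)" using assms by (simp add: dim_Times')
  also have "\<dots> = dim ?K + dim (?g ` (V \<times> W))"
    using assms by (intro dim_kernel_image g subspace_Times fin_dim_Times)
  also have "?g ` (V \<times> W) = span (f ` V \<union> W)"
  proof -
    have "span (f ` V \<union> W) = {x + y |x y. x \<in> f ` V \<and> y \<in> W}"
        using linear_subspace_image[OF f V(1)] W(1) by (simp only: span_Un span_eq_iff[THEN iffD2])
    also have "\<dots> = ?g ` (V \<times> W)"
    proof -
      have "f v + w \<in> ?g ` (V \<times> W)" if "v \<in> V" "w \<in> W" for v w
        by (rule image_eqI[of _ _ "(v, - w)"]) (use that W(1) subspace_neg in auto)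
      moreover have "\<exists>x y. f v - w = x + y \<and> x \<in> f ` V \<and> y \<in> W" if "v \<in> V" "w \<in> W" for v w
        by (rule exI[of _ "f v"], rule exI[of _ "- w"]) (use that W(1) subspace_neg in auto)
      ultimately show ?thesis by auto
    qed
    finally show ?thesis ..
  qed
  also have "dim ?K = dim (fst ` ?K)"
    by (rule dim_image_inj[symmetric, OF linear_fst sK fin_dim_mono[OF fin_dim_Times[OF V(2) W(2)]]])
       (auto simp: zero_prod_def linear_0[OF f])
  also have "fst ` ?K = {v\<in>V. f v \<in> W}" by force
  finally show ?thesis by simp
qed

lemma dim_span_Un_le:
  assumes "fin_dim S" "fin_dim T"
  shows "dim (S \<union> T) \<le> dim S + dim T"
proof -
  obtain B where B: "finite B" "S \<subseteq> span B" "card B = dim S"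
    using fin_dim_basis[OF assms(1)] by metis
  obtain C where C: "finite C" "T \<subseteq> span C" "card C = dim T"
    using fin_dim_basis[OF assms(2)] by metis
  have "S \<union> T \<subseteq> span (B \<union> C)"
    using B(2) C(2) span_mono[of B "B \<union> C"] span_mono[of C "B \<union> C"] by auto
  then have "dim (S \<union> T) \<le> card (B \<union> C)"
    using B C by (intro dim_le_card) auto
  also have "\<dots> \<le> card B + card C" by (rule card_Un_le)
  finally show ?thesis using B C by simp
qed

lemma dim_UN_le:
  assumes "finite I" "\<And>i. i \<in> I \<Longrightarrow> fin_dim (S i)"
  shows "dim (\<Union>i\<in>I. S i) \<le> (\<Sum>i\<in>I. dim (S i))"
  using assms
proof (induction I rule: finite_induct)
  case empty
  then show ?case by (metis SUP_empty dim_empty sum.empty order_refl dim_eq_card_independent card.empty independent_empty)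
next
  case (insert i I)
  have "dim (\<Union>j\<in>insert i I. S j) \<le> dim (S i) + dim (\<Union>j\<in>I. S j)"
    using insert by (simp add: dim_span_Un_le fin_dim_UN)
  with insert show ?case by simp
qed

text \<open>Coefficients are indexed by \<open>F\<close> and not by the image, so repeated values of
  \<open>f\<close> are harmless.\<close>

lemma span_family:
  assumes "finite F"
  shows "span (f ` F) = {x. \<exists>c. x = (\<Sum>a\<in>F. c a *\<^sub>R f a)}"
proof (intro subset_antisym subsetI)
  fix x assume "x \<in> span (f ` F)"
  then show "x \<in> {x. \<exists>c. x = (\<Sum>a\<in>F. c a *\<^sub>R f a)}"
  proof (induction rule: span_induct_alt)
    case base
    show ?case by (auto intro!: exI[of _ "\<lambda>_. 0"])
  next
    case (step c x y)
    then obtain a d where "a \<in> F" "x = f a" "y = (\<Sum>a\<in>F. d a *\<^sub>R f a)" by auto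
    then have "c *\<^sub>R x + y = (\<Sum>b\<in>F. (if b = a then c + d b else d b) *\<^sub>R f b)"
      using assms by (simp add: sum.remove[of F a] scaleR_add_left)
    then show ?case by (intro CollectI exI)
  qed
next
  fix x assume "x \<in> {x. \<exists>c. x = (\<Sum>a\<in>F. c a *\<^sub>R f a)}"
  then show "x \<in> span (f ` F)" by (auto intro!: span_sum span_scale intro: span_base)
qed

lemma dim_span_family_le: "finite F \<Longrightarrow> dim (span (f ` F)) \<le> card F"
  by (metis card_image_le dim_le_card dim_span finite_imageI order_trans span_superset)

text \<open>Independence over the index set also forces injectivity: a coincidence of two values is
  the relation with coefficients 1 and -1.\<close>

lemma dim_span_family:
  assumes "finite F" and ind: "\<And>c. (\<Sum>a\<in>F. c a *\<^sub>R f a) = 0 \<Longrightarrow> \<forall>a\<in>F. c a = 0"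
  shows "dim (span (f ` F)) = card F"
proof -
  have inj: "inj_on f F"
  proof (rule inj_onI, rule ccontr)
    fix a b assume ab: "a \<in> F" "b \<in> F" "f a = f b" "a \<noteq> b"
    let ?c = "\<lambda>x. if x = a then 1 else if x = b then - 1 else 0 :: real"
    have "(\<Sum>x\<in>F. ?c x *\<^sub>R f x) = (\<Sum>x\<in>{a, b}. ?c x *\<^sub>R f x)"
      using ab assms(1) by (intro sum.mono_neutral_right) auto
    also have "\<dots> = 0" using ab by simp
    finally show False using ind ab by fastforce
  qed
  have "independent (f ` F)"
  proof (rule independent_if_scalars_zero)
    show "finite (f ` F)" using assms by simp
    fix c x assume "(\<Sum>x\<in>f ` F. c x *\<^sub>R x) = 0" "x \<in> f ` F"
    moreover have "(\<Sum>x\<in>f ` F. c x *\<^sub>R x) = (\<Sum>a\<in>F. c (f a) *\<^sub>R f a)"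
      by (simp add: sum.reindex[OF inj])
    ultimately show "c x = 0" using ind[of "\<lambda>a. c (f a)"] by auto
  qed
  then show ?thesis using card_image[OF inj] by (metis dim_span_eq_card_independent)
qed

text \<open>Tuples are total functions that are 0 off \<open>I\<close>; tuples over different index
  sets then share one function space, and their equality is equality of functions.\<close>

definition dsum :: "'i set \<Rightarrow> ('i \<Rightarrow> 'a::real_vector set) \<Rightarrow> ('i \<Rightarrow> 'a) set" where
  "dsum I V = {q. (\<forall>i\<in>I. q i \<in> V i) \<and> (\<forall>i. i \<notin> I \<longrightarrow> q i = 0)}"

definition unit :: "'i \<Rightarrow> 'a::zero \<Rightarrow> 'i \<Rightarrow> 'a" where
  "unit i x = (\<lambda>j. if j = i then x else 0)"

lemma linear_unit: "linear (unit i :: 'a::real_vector \<Rightarrow> _)"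
  by (rule linearI) (auto simp: unit_def fun_eq_iff)

lemma subspace_dsum: "(\<And>i. i \<in> I \<Longrightarrow> subspace (V i)) \<Longrightarrow> subspace (dsum I V)"
  by (auto simp: subspace_def dsum_def)

lemma unit_in_dsum:
  "i \<in> I \<Longrightarrow> x \<in> V i \<Longrightarrow> (\<And>j. j \<in> I \<Longrightarrow> subspace (V j)) \<Longrightarrow> unit i x \<in> dsum I V"
  by (auto simp: dsum_def unit_def subspace_0)

lemma dsum_eq_sum_unit:
  assumes "finite I" "q \<in> dsum I V"
  shows "q = (\<Sum>i\<in>I. unit i (q i))"
proof
  fix j
  show "q j = (\<Sum>i\<in>I. unit i (q i)) j"
    using assms by (auto simp: sum_fun_apply unit_def dsum_def)
qed

lemma dsum_subset_span_unit:
  assumes "finite I"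
  shows "dsum I V \<subseteq> span (\<Union>i\<in>I. unit i ` V i)"
proof
  fix q assume q: "q \<in> dsum I V"
  have "(\<Sum>i\<in>I. unit i (q i)) \<in> span (\<Union>i\<in>I. unit i ` V i)"
    using q by (intro span_sum span_base) (auto simp: dsum_def)
  then show "q \<in> span (\<Union>i\<in>I. unit i ` V i)"
    using dsum_eq_sum_unit[OF assms q] by simp
qed

lemma fin_dim_dsum:
  assumes "finite I" "\<And>i. i \<in> I \<Longrightarrow> fin_dim (V i)"
  shows "fin_dim (dsum I V)"
  using assms
  by (intro fin_dim_subset[OF _ dsum_subset_span_unit] fin_dim_UN fin_dim_image linear_unit) auto

lemma dim_dsum:
  assumes "finite I" "\<And>i. i \<in> I \<Longrightarrow> subspace (V i)" "\<And>i. i \<in> I \<Longrightarrow> fin_dim (V i)"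
  shows "dim (dsum I V) = (\<Sum>i\<in>I. dim (V i))"
  using assms
proof (induction I rule: finite_induct)
  case empty
  have "dsum {} V = {0}" by (auto simp: dsum_def fun_eq_iff)
  then show ?case by simp
next
  case (insert i I)
  have "dim (dsum (insert i I) V) = dim {q \<in> dsum (insert i I) V. q i = 0} + dim ((\<lambda>q. q i) ` dsum (insert i I) V)"
    using insert by (intro dim_kernel_image linear_fun_apply subspace_dsum fin_dim_dsum) auto
  also have "{q \<in> dsum (insert i I) V. q i = 0} = dsum I V"
    using insert by (auto simp: dsum_def subspace_0) metis
  also have "(\<lambda>q. q i) ` dsum (insert i I) V = V i"
  proof (intro subset_antisym subsetI)
    fix x assume "x \<in> V i"
    then show "x \<in> (\<lambda>q. q i) ` dsum (insert i I) V"
      using insert by (intro image_eqI[of _ _ "unit i x"] unit_in_dsum) (auto simp: unit_def)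
  qed (auto simp: dsum_def)
  finally show ?case using insert by simp
qed

text \<open>Gaussian elimination inside \<open>\<Phi>\<close>. The dual functionals have to come
  from a prescribed space, which in the application consists of functionals continuous along a
  family.\<close>

lemma dual_family_exists:
  fixes v :: "'k \<Rightarrow> 'a::real_vector" and \<Phi> :: "('a \<Rightarrow> real) set"
  assumes "finite K" and "\<And>\<phi>. \<phi> \<in> \<Phi> \<Longrightarrow> linear \<phi>" and sub: "subspace \<Phi>"
    and sep: "\<And>x. (\<And>\<phi>. \<phi> \<in> \<Phi> \<Longrightarrow> \<phi> x = 0) \<Longrightarrow> x = 0"
    and ind: "\<And>c. (\<Sum>k\<in>K. c k *\<^sub>R v k) = 0 \<Longrightarrow> \<forall>k\<in>K. c k = 0"
  shows "\<exists>\<phi>. (\<forall>k\<in>K. \<phi> k \<in> \<Phi>) \<and> (\<forall>k\<in>K. \<forall>j\<in>K. \<phi> k (v j) = (if j = k then 1 else 0))"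
  using assms(1) ind
proof (induction K rule: finite_induct)
  case (insert x K)
  have indK: "\<forall>k\<in>K. c k = 0" if "(\<Sum>k\<in>K. c k *\<^sub>R v k) = 0" for c
  proof -
    let ?c = "\<lambda>k. if k = x then 0 else c k"
    have "(\<Sum>k\<in>insert x K. ?c k *\<^sub>R v k) = (\<Sum>k\<in>K. ?c k *\<^sub>R v k)" using insert.hyps by simp
    also have "\<dots> = (\<Sum>k\<in>K. c k *\<^sub>R v k)" using insert.hyps by (intro sum.cong) auto
    finally have "\<forall>k\<in>insert x K. ?c k = 0" using that by (intro insert.prems) simp
    then have "\<forall>k\<in>K. ?c k = 0" by blast
    moreover have "?c k = c k" if "k \<in> K" for k using insert.hyps that by auto
    ultimately show ?thesis by simp
  qed
  then obtain \<phi> where \<phi>: "\<forall>k\<in>K. \<phi> k \<in> \<Phi>" "\<forall>k\<in>K. \<forall>j\<in>K. \<phi> k (v j) = (if j = k then 1 else 0)"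
    using insert.IH[OF indK] by blast
  \<comment> \<open>The part of \<open>v x\<close> not seen by the functionals found so far.
    Independence makes it nonzero, so some member of \<open>\<Phi>\<close> detects it.\<close>
  define u where "u = v x - (\<Sum>k\<in>K. \<phi> k (v x) *\<^sub>R v k)"
  have "u \<noteq> 0"
  proof
    assume u0: "u = 0"
    let ?c = "\<lambda>k. if k = x then 1 else - \<phi> k (v x)"
    have "(\<Sum>k\<in>insert x K. ?c k *\<^sub>R v k) = v x + (\<Sum>k\<in>K. ?c k *\<^sub>R v k)" using insert.hyps by simp
    also have "(\<Sum>k\<in>K. ?c k *\<^sub>R v k) = - (\<Sum>k\<in>K. \<phi> k (v x) *\<^sub>R v k)"
      unfolding sum_negf[symmetric] using insert.hyps by (intro sum.cong) auto
    finally have "\<forall>k\<in>insert x K. ?c k = 0" using u0 by (intro insert.prems) (simp add: u_def)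
    then show False by simp
  qed
  then obtain ev where ev: "ev \<in> \<Phi>" "ev u \<noteq> 0" using sep by blast
  define w where "w = inverse (ev u) *\<^sub>R (ev - (\<Sum>k\<in>K. ev (v k) *\<^sub>R \<phi> k))"
  have w\<Phi>: "w \<in> \<Phi>" unfolding w_def
    using sub ev \<phi> by (intro subspace_scale subspace_diff subspace_sum) auto
  have w0: "w (v j) = 0" if "j \<in> K" for j
  proof -
    have "(\<Sum>k\<in>K. ev (v k) * \<phi> k (v j)) = (\<Sum>k\<in>K. if k = j then ev (v j) else 0)"
      using \<phi>(2) that by (intro sum.cong) auto
    then show ?thesis using that insert.hyps by (simp add: w_def sum_fun_apply)
  qed
  have "linear ev" using assms(2) ev by auto
  then have "ev u = ev (v x) - (\<Sum>k\<in>K. \<phi> k (v x) * ev (v k))"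
    unfolding u_def by (simp add: linear_diff linear_sum linear_scale)
  then have w1: "w (v x) = 1"
    using ev(2) by (simp add: w_def sum_fun_apply mult.commute)
  \<comment> \<open>Since \<open>w\<close> is 1 at \<open>v x\<close> and 0 on the old vectors,
    subtracting multiples of it corrects the old functionals at \<open>v x\<close>.\<close>
  let ?\<psi> = "\<lambda>k. if k = x then w else \<phi> k - \<phi> k (v x) *\<^sub>R w"
  show ?case
    using \<phi> w\<Phi> w0 w1 insert.hyps sub
    by (intro exI[of _ ?\<psi>]) (auto intro!: subspace_diff subspace_scale)
qed simp

text \<open>Vectors independent at 0 have dual functionals, and for small t the matrix of values of
  these functionals stays near the identity, hence is diagonally dominant and invertible.\<close>

lemma dim_span_lower_semicontinuous:
  fixes f :: "'k \<Rightarrow> real \<Rightarrow> 'a::real_vector" and E :: "('a \<Rightarrow> real) set"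
  assumes K: "finite K" and E: "\<And>\<phi>. \<phi> \<in> E \<Longrightarrow> linear \<phi>"
    and sep: "\<And>x. (\<And>\<phi>. \<phi> \<in> E \<Longrightarrow> \<phi> x = 0) \<Longrightarrow> x = 0"
    and cont: "\<And>\<phi> k. \<phi> \<in> E \<Longrightarrow> k \<in> K \<Longrightarrow> ((\<lambda>t. \<phi> (f k t)) \<longlongrightarrow> \<phi> (f k 0)) (at 0)"
  shows "eventually (\<lambda>t. dim (span ((\<lambda>k. f k 0) ` K)) \<le> dim (span ((\<lambda>k. f k t) ` K))) (at 0)"
proof -
  \<comment> \<open>The functionals continuous at 0 along the family form a subspace containing
    \<open>E\<close>, so the dual family can be chosen among them.\<close>
  define \<Phi> :: "('a \<Rightarrow> real) set" where "\<Phi> = {\<phi>. linear \<phi> \<and> (\<forall>k\<in>K. ((\<lambda>t. \<phi> (f k t)) \<longlongrightarrow> \<phi> (f k 0)) (at 0))}"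
  have sub: "subspace \<Phi>"
    unfolding subspace_def \<Phi>_def
    by (auto simp: linear_iff algebra_simps intro!: tendsto_add tendsto_mult_left)
  have sep\<Phi>: "x = 0" if "\<And>\<phi>. \<phi> \<in> \<Phi> \<Longrightarrow> \<phi> x = 0" for x
    using that E cont by (intro sep) (auto simp: \<Phi>_def)
  obtain B where B: "B \<subseteq> (\<lambda>k. f k 0) ` K" "independent B" "(\<lambda>k. f k 0) ` K \<subseteq> span B"
    "card B = dim ((\<lambda>k. f k 0) ` K)"
    using basis_exists by blast
  obtain K' where K': "K' \<subseteq> K" "inj_on (\<lambda>k. f k 0) K'" "B = (\<lambda>k. f k 0) ` K'"
    using B(1) subset_image_inj[of B "\<lambda>k. f k 0" K] by blast
  have fK': "finite K'" using K K' finite_subset by blast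
  have indK: "\<forall>k\<in>K'. c k = 0" if "(\<Sum>k\<in>K'. c k *\<^sub>R f k 0) = 0" for c
  proof -
    let ?g = "the_inv_into K' (\<lambda>k. f k 0)"
    have "(\<Sum>b\<in>B. c (?g b) *\<^sub>R b) = (\<Sum>k\<in>K'. c k *\<^sub>R f k 0)"
      unfolding K'(3) by (subst sum.reindex[OF K'(2)]) (auto simp: the_inv_into_f_f[OF K'(2)])
    then have "\<forall>b\<in>B. c (?g b) = 0"
      using that independentD[OF B(2) _ order_refl] fK' K'(3) by (metis finite_imageI)
    then show ?thesis using K'(3) the_inv_into_f_f[OF K'(2)] by force
  qed
  obtain \<phi> where \<phi>: "\<forall>k\<in>K'. \<phi> k \<in> \<Phi>" "\<forall>k\<in>K'. \<forall>j\<in>K'. \<phi> k (f j 0) = (if j = k then 1 else 0)"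
    using dual_family_exists[where v = "\<lambda>k. f k 0", OF fK' _ sub sep\<Phi> indK] by (auto simp: \<Phi>_def)
  \<comment> \<open>With n vectors, n errors below 1/(n + 1) add up to less than 1 in each
    row.\<close>
  define \<epsilon> where "\<epsilon> = 1 / (real (card K') + 1)"
  have \<epsilon>: "\<epsilon> > 0" by (simp add: \<epsilon>_def)
  have "eventually (\<lambda>t. \<forall>k\<in>K'. \<forall>j\<in>K'. \<bar>\<phi> k (f j t) - (if j = k then 1 else 0)\<bar> < \<epsilon>) (at 0)"
  proof (intro eventually_ball_finite fK' ballI)
    fix k j assume kj: "k \<in> K'" "j \<in> K'"
    then have "((\<lambda>t. \<phi> k (f j t)) \<longlongrightarrow> (if j = k then 1 else 0)) (at 0)"
      using \<phi> K'(1) unfolding \<Phi>_def by fastforce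
    from tendstoD[OF this \<epsilon>] show "\<forall>\<^sub>F t in at 0. \<bar>\<phi> k (f j t) - (if j = k then 1 else 0)\<bar> < \<epsilon>"
      by (simp add: dist_real_def)
  qed
  then show ?thesis
  proof (rule eventually_mono)
    fix t assume t: "\<forall>k\<in>K'. \<forall>j\<in>K'. \<bar>\<phi> k (f j t) - (if j = k then 1 else 0)\<bar> < \<epsilon>"
    have "\<forall>k\<in>K'. c k = 0" if c: "(\<Sum>k\<in>K'. c k *\<^sub>R f k t) = 0" for c
    proof (rule ccontr)
      assume "\<not> (\<forall>k\<in>K'. c k = 0)"
      then have ne: "K' \<noteq> {}" by auto
      \<comment> \<open>Testing the relation with the functional that belongs to a largest
        coefficient yields M < M.\<close>
      define M where "M = Max ((\<lambda>k. \<bar>c k\<bar>) ` K')"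
      have le: "\<bar>c k\<bar> \<le> M" if "k \<in> K'" for k using that fK' by (simp add: M_def)
      obtain i where i: "i \<in> K'" "\<bar>c i\<bar> = M"
        using Max_in[of "(\<lambda>k. \<bar>c k\<bar>) ` K'"] fK' ne unfolding M_def by (smt (verit) finite_imageI image_iff image_is_empty)
      have Mpos: "M > 0" using le \<open>\<not> (\<forall>k\<in>K'. c k = 0)\<close> by fastforce
      have lin: "linear (\<phi> i)" using \<phi>(1) i by (auto simp: \<Phi>_def)
      have "0 = (\<Sum>k\<in>K'. c k * \<phi> i (f k t))"
        using arg_cong[OF c, of "\<phi> i"] lin by (simp add: linear_sum linear_scale linear_0)
      also have "\<dots> = c i + (\<Sum>k\<in>K'. c k * (\<phi> i (f k t) - (if k = i then 1 else 0)))"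
        using i fK' by (simp add: right_diff_distrib sum_subtractf if_distrib[of "\<lambda>z. _ * z"] cong: if_cong)
      finally have "M = \<bar>\<Sum>k\<in>K'. c k * (\<phi> i (f k t) - (if k = i then 1 else 0))\<bar>"
        using i by linarith
      also have "\<dots> \<le> (\<Sum>k\<in>K'. \<bar>c k\<bar> * \<bar>\<phi> i (f k t) - (if k = i then 1 else 0)\<bar>)"
        unfolding abs_mult[symmetric] by (rule sum_abs)
      also have "\<dots> \<le> (\<Sum>k\<in>K'. M * \<epsilon>)"
      proof (intro sum_mono mult_mono)
        fix k assume k: "k \<in> K'"
        then show "\<bar>\<phi> i (f k t) - (if k = i then 1 else 0)\<bar> \<le> \<epsilon>" using t i by (intro less_imp_le) blast
      qed (use le Mpos in auto)
      also have "\<dots> = M * (real (card K') / (real (card K') + 1))" by (simp add: \<epsilon>_def)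
      also have "\<dots> < M * 1" using Mpos by (intro mult_strict_left_mono) auto
      finally show False by simp
    qed
    then have "card K' = dim (span ((\<lambda>k. f k t) ` K'))"
      using dim_span_family[OF fK', of "\<lambda>k. f k t"] by metis
    also have "\<dots> \<le> dim (span ((\<lambda>k. f k t) ` K))"
      using K K'(1) by (intro dim_mono' fin_dim_span fin_dim_finite span_mono) auto
    finally show "dim (span ((\<lambda>k. f k 0) ` K)) \<le> dim (span ((\<lambda>k. f k t) ` K))"
      using B(4) K'(2,3) by (simp add: card_image)
  qed
qed

subsection \<open>Polynomial functions\<close>

instance "fun" :: (type, real_algebra_1) real_algebra_1
  by standard (simp_all add: fun_eq_iff)

lemma power_fun_apply [simp]: "(f ^ n) x = (f x :: 'b::monoid_mult) ^ n"
  by (induction n) auto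

lemma prod_fun_apply: "(\<Prod>i\<in>I. f i) x = (\<Prod>i\<in>I. f i x :: 'b::comm_monoid_mult)"
  by (induction I rule: infinite_finite_induct) auto

lemma span_mult:
  fixes A B :: "'a::real_algebra set"
  assumes "x \<in> span A" "y \<in> span B"
  shows "x * y \<in> span {a * b |a b. a \<in> A \<and> b \<in> B}"
proof -
  have 1: "x * b \<in> span {a * b |a b. a \<in> A \<and> b \<in> B}" if "b \<in> B" for b
    using assms(1)
  proof (induction rule: span_induct_alt)
    case base
    then show ?case by (simp add: span_zero)
  next
    case (step c a y)
    then show ?case using that by (auto simp: distrib_right intro!: span_add span_scale intro: span_base)
  qed
  show ?thesis
    using assms(2)
  proof (induction rule: span_induct_alt)
    case base
    then show ?case by (simp add: span_zero)
  next
    case (step c b y)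
    then show ?case using 1 by (auto simp: distrib_left intro!: span_add span_scale)
  qed
qed

lemma linear_mult_left: "linear (\<lambda>x::'a::real_algebra. a * x)"
  by (rule linearI) (simp_all add: distrib_left)

lemma subspace_mult_image: "subspace S \<Longrightarrow> subspace ((\<lambda>x::'a::real_algebra. a * x) ` S)"
  by (rule linear_subspace_image[OF linear_mult_left])

text \<open>Forms, polynomials of bounded degree, binary forms and multiples of one power all arise
  by varying \<open>G\<close>; multiplication and monotonicity are therefore proved for general
  generators.\<close>

primrec pw :: "('a \<Rightarrow> real) set \<Rightarrow> nat \<Rightarrow> ('a \<Rightarrow> real) set" where
  "pw G 0 = span {1}"
| "pw G (Suc d) = span {g * p |g p. g \<in> G \<and> p \<in> pw G d}"

lemma subspace_pw [simp]: "subspace (pw G d)"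
  by (cases d) auto

lemma span_pw [simp]: "span (pw G d) = pw G d"
  by simp

lemma pw_0_iff: "p \<in> pw G 0 \<longleftrightarrow> (\<exists>c. p = (\<lambda>x. c))"
  by (auto simp: span_singleton fun_eq_iff)

lemma one_in_pw: "1 \<in> pw G 0"
  by (simp add: span_base)

lemma pw_SucI: "g \<in> G \<Longrightarrow> p \<in> pw G d \<Longrightarrow> g * p \<in> pw G (Suc d)"
  by (auto intro: span_base)

lemma pw_mult: "p \<in> pw G a \<Longrightarrow> q \<in> pw G b \<Longrightarrow> p * q \<in> pw G (a + b)"
proof (induction a arbitrary: p)
  case 0
  then obtain c where "p = (\<lambda>x. c)" by (auto simp only: pw_0_iff)
  then have "p * q = c *\<^sub>R q" by (auto simp: fun_eq_iff)
  then show ?case using subspace_scale[OF subspace_pw 0(2)] by (simp only: add_0)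
next
  case (Suc a)
  from Suc.prems(1) have "p \<in> span {g * p |g p. g \<in> G \<and> p \<in> pw G a}" by simp
  then show ?case
  proof (induction rule: span_induct_alt)
    case base
    show ?case using subspace_0[OF subspace_pw] by (simp only: mult_zero_left)
  next
    case (step c x y)
    then obtain g p' where x: "x = g * p'" "g \<in> G" "p' \<in> pw G a" by auto
    have "x * q \<in> pw G (Suc a + b)"
      unfolding x(1) mult.assoc add_Suc by (rule pw_SucI[OF x(2) Suc.IH[OF x(3) Suc.prems(2)]])
    then have "c *\<^sub>R (x * q) + y * q \<in> pw G (Suc a + b)"
      by (rule subspace_add[OF subspace_pw subspace_scale[OF subspace_pw] step(2)])
    then show ?case by (simp only: distrib_right mult_scaleR_left)
  qed
qed

lemma pw_1: "g \<in> G \<Longrightarrow> g \<in> pw G 1"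
  using pw_SucI[OF _ one_in_pw] by fastforce

lemma pw_power: "p \<in> pw G a \<Longrightarrow> p ^ n \<in> pw G (n * a)"
  by (induction n) (auto simp del: pw.simps simp: one_in_pw pw_mult)

lemma pw_power1: "g \<in> G \<Longrightarrow> g ^ n \<in> pw G n"
  using pw_power[OF pw_1, of g G n] by (simp del: pw.simps)

lemma pw_prod:
  "finite X \<Longrightarrow> (\<And>i. i \<in> X \<Longrightarrow> f i \<in> pw G (a i)) \<Longrightarrow> prod f X \<in> pw G (sum a X)"
  by (induction X rule: finite_induct) (auto simp del: pw.simps simp: one_in_pw pw_mult)

lemma pw_mono: "G \<subseteq> G' \<Longrightarrow> pw G d \<subseteq> pw G' d"
proof (induction d)
  case (Suc d)
  then show ?case unfolding pw.simps by (intro span_mono) blast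
qed simp

section \<open>Monomials and their independence\<close>

definition exps :: "'i set \<Rightarrow> nat \<Rightarrow> ('i \<Rightarrow> nat) set" where
  "exps X d = {\<alpha>. (\<forall>i. i \<notin> X \<longrightarrow> \<alpha> i = 0) \<and> sum \<alpha> X = d}"

text \<open>The codomain is any commutative monoid because monomials are formed both of functions
  and of their values at a point.\<close>

definition mon :: "'i set \<Rightarrow> ('i \<Rightarrow> 'a::comm_monoid_mult) \<Rightarrow> ('i \<Rightarrow> nat) \<Rightarrow> 'a" where
  "mon X b \<alpha> = (\<Prod>i\<in>X. b i ^ \<alpha> i)"

lemma mon_apply: "mon X b \<alpha> x = mon X (\<lambda>i. b i x) \<alpha>" for b :: "'i \<Rightarrow> 'a \<Rightarrow> real"
  by (simp add: mon_def prod_fun_apply)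

lemma mon_cong: "(\<And>i. i \<in> X \<Longrightarrow> \<alpha> i = \<beta> i) \<Longrightarrow> mon X b \<alpha> = mon X b \<beta>"
  by (simp add: mon_def)

lemma mon_single: "finite X \<Longrightarrow> i \<in> X \<Longrightarrow> b i * mon X b \<alpha> = mon X b (\<alpha>(i := Suc (\<alpha> i)))"
  by (simp add: mon_def prod.remove[of X i] mult.assoc)

lemma mon_remove: "finite X \<Longrightarrow> i \<in> X \<Longrightarrow> mon X b \<alpha> = b i ^ \<alpha> i * mon (X - {i}) b \<alpha>"
  by (simp add: mon_def prod.remove[of X i])

lemma mon_in_pw:
  "finite X \<Longrightarrow> b ` X \<subseteq> G \<Longrightarrow> mon X b \<alpha> \<in> pw G (sum \<alpha> X)"
  unfolding mon_def by (intro pw_prod pw_power1) auto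

lemma exps_le: "finite X \<Longrightarrow> \<alpha> \<in> exps X d \<Longrightarrow> \<alpha> i \<le> d"
  by (cases "i \<in> X") (auto simp: exps_def member_le_sum)

lemma exps_Suc: "finite X \<Longrightarrow> i \<in> X \<Longrightarrow> \<alpha> \<in> exps X d \<Longrightarrow> \<alpha>(i := Suc (\<alpha> i)) \<in> exps X (Suc d)"
  by (auto simp: exps_def sum.remove[of X i])

lemma finite_exps [simp]: "finite X \<Longrightarrow> finite (exps X d)"
proof -
  assume X: "finite X"
  have "exps X d \<subseteq> {\<alpha>. \<forall>i. (i \<in> X \<longrightarrow> \<alpha> i \<in> {..d}) \<and> (i \<notin> X \<longrightarrow> \<alpha> i = 0)}"
    using exps_le[OF X] by (auto simp: exps_def)
  then show ?thesis
    using finite_set_of_finite_funs[OF X, of "{..d}" 0] finite_subset by blast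
qed

lemma exps_restrict:
  assumes "finite X" "i \<in> X" "k \<le> d"
  shows "bij_betw (\<lambda>\<alpha>. \<alpha>(i := 0)) {\<alpha> \<in> exps X d. \<alpha> i = k} (exps (X - {i}) (d - k))"
proof (rule bij_betwI[where g = "\<lambda>\<alpha>. \<alpha>(i := k)"])
  show "(\<lambda>\<alpha>. \<alpha>(i := 0)) \<in> {\<alpha> \<in> exps X d. \<alpha> i = k} \<rightarrow> exps (X - {i}) (d - k)"
    using assms by (auto simp: exps_def sum.remove[of X i])
  show "(\<lambda>\<alpha>. \<alpha>(i := k)) \<in> exps (X - {i}) (d - k) \<rightarrow> {\<alpha> \<in> exps X d. \<alpha> i = k}"
    using assms by (auto simp: exps_def sum.remove[of X i])
qed (auto simp: fun_eq_iff exps_def)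

lemma card_exps_restrict:
  "finite X \<Longrightarrow> i \<in> X \<Longrightarrow> k \<le> d \<Longrightarrow> card {\<alpha> \<in> exps X d. \<alpha> i = k} = card (exps (X - {i}) (d - k))"
  by (rule bij_betw_same_card[OF exps_restrict])

lemma card_exps_sum:
  assumes "finite X" "i \<in> X"
  shows "card (exps X d) = (\<Sum>k\<le>d. card (exps (X - {i}) k))"
proof -
  have "exps X d = (\<Union>k\<in>{..d}. {\<alpha> \<in> exps X d. \<alpha> i = k})"
    using exps_le[OF assms(1)] by auto
  then have "card (exps X d) = (\<Sum>k\<le>d. card {\<alpha> \<in> exps X d. \<alpha> i = k})"
    using assms by (subst \<open>exps X d = _\<close>, subst card_UN_disjoint) auto
  also have "\<dots> = (\<Sum>k\<le>d. card (exps (X - {i}) (d - k)))"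
    using assms by (intro sum.cong card_exps_restrict) auto
  also have "\<dots> = (\<Sum>k\<le>d. card (exps (X - {i}) k))"
    by (rule sum.nat_diff_reindex[of "\<lambda>k. card (exps (X - {i}) k)" "Suc d", simplified lessThan_Suc_atMost diff_Suc_Suc])
  finally show ?thesis .
qed

text \<open>Stars and bars: sorting by the exponent of one variable leaves one variable fewer, and
  the counts add up by the hockey-stick identity.\<close>

lemma card_exps:
  assumes "finite X" "card X = Suc m"
  shows "card (exps X d) = (d + m) choose m"
  using assms
proof (induction m arbitrary: X d)
  case 0
  then obtain i where X: "X = {i}" by (metis card_1_singletonE One_nat_def)
  then have "exps X d = {(\<lambda>_. 0)(i := d)}" by (auto simp: exps_def fun_eq_iff)
  then show ?case by simp
next
  case (Suc m)
  then obtain i where i: "i \<in> X" by fastforce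
  have "card (exps X d) = (\<Sum>k\<le>d. (k + m) choose m)"
    using Suc i by (simp add: card_exps_sum[of X i])
  also have "\<dots> = (d + Suc m) choose Suc m"
    using choose_rising_sum(1)[of m d] by (simp add: add.commute)
  finally show ?case .
qed

text \<open>Induction on the number of variables: with the others fixed, the sum is a univariate
  polynomial in the variable \<open>x\<close> that vanishes everywhere, so each of its coefficients
  is a vanishing sum in fewer variables.\<close>

lemma mon_independent:
  fixes c :: "('i \<Rightarrow> nat) \<Rightarrow> real"
  assumes "finite X" "finite F" "\<And>\<alpha> i. \<alpha> \<in> F \<Longrightarrow> i \<notin> X \<Longrightarrow> \<alpha> i = 0"
    and "\<And>s. (\<Sum>\<alpha>\<in>F. c \<alpha> * mon X s \<alpha>) = 0"
  shows "\<forall>\<alpha>\<in>F. c \<alpha> = 0"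
  using assms
proof (induction X arbitrary: F c rule: finite_induct)
  case empty
  then have "F \<subseteq> {\<lambda>_. 0}" by (auto simp: fun_eq_iff)
  then consider "F = {}" | "F = {\<lambda>_. 0}" by blast
  then show ?case using empty(3)[of "\<lambda>_. 0"] by cases (auto simp: mon_def)
next
  case (insert x X)
  show ?case
  proof
    fix \<alpha>0 assume \<alpha>0: "\<alpha>0 \<in> F"
    let ?k = "\<alpha>0 x"
    let ?Fk = "{\<alpha> \<in> F. \<alpha> x = ?k}"
    let ?z = "\<lambda>\<alpha>. \<alpha>(x := 0 :: nat)"
    have inj: "inj_on ?z ?Fk"
      by (rule inj_onI) (metis (mono_tags, lifting) fun_upd_triv fun_upd_upd mem_Collect_eq)
    have eq: "(\<Sum>\<beta>\<in>?z ` ?Fk. c (\<beta>(x := ?k)) * mon X s \<beta>) = 0" for s :: "'i \<Rightarrow> real"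
    proof -
      define Q where "Q = (\<Sum>\<alpha>\<in>F. monom (c \<alpha> * mon X s \<alpha>) (\<alpha> x))"
      have "poly Q u = 0" for u
      proof -
        have "mon X (s(x := u)) \<alpha> = mon X s \<alpha>" for \<alpha>
          unfolding mon_def using insert.hyps by (intro prod.cong) auto
        then have "poly Q u = (\<Sum>\<alpha>\<in>F. c \<alpha> * mon (insert x X) (s(x := u)) \<alpha>)"
          using insert.hyps by (auto simp: Q_def poly_sum poly_monom mon_def intro!: sum.cong)
        then show ?thesis using insert.prems(3) by simp
      qed
      then have "Q = 0" by (metis poly_0 poly_eq_poly_eq_iff ext)
      then have "0 = coeff Q ?k" by simp
      also have "\<dots> = (\<Sum>\<alpha>\<in>?Fk. c \<alpha> * mon X s \<alpha>)"
        using insert.prems(1) by (simp add: Q_def coeff_sum sum.If_cases Int_def)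
      also have "\<dots> = (\<Sum>\<alpha>\<in>?Fk. c ((?z \<alpha>)(x := ?k)) * mon X s (?z \<alpha>))"
      proof (rule sum.cong[OF refl])
        fix \<alpha> assume a: "\<alpha> \<in> ?Fk"
        then have "(?z \<alpha>)(x := ?k) = \<alpha>" by (metis (mono_tags, lifting) fun_upd_triv fun_upd_upd mem_Collect_eq)
        moreover have "mon X s (?z \<alpha>) = mon X s \<alpha>" using insert.hyps by (intro mon_cong) auto
        ultimately show "c \<alpha> * mon X s \<alpha> = c ((?z \<alpha>)(x := ?k)) * mon X s (?z \<alpha>)" by simp
      qed
      finally show ?thesis by (simp add: sum.reindex[OF inj])
    qed
    have "\<forall>\<beta>\<in>?z ` ?Fk. c (\<beta>(x := ?k)) = 0"
    proof (rule insert.IH[OF _ _ eq])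
      show "\<alpha> i = 0" if "\<alpha> \<in> ?z ` ?Fk" "i \<notin> X" for \<alpha> i
        using that insert.prems(2) by (auto split: if_splits)
    qed (use insert.prems(1) in auto)
    then show "c \<alpha>0 = 0" using \<alpha>0 by auto
  qed
qed

text \<open>The vectors \<open>w\<close> are dual to the forms \<open>b\<close>, so at a suitable
  point the forms take any prescribed values \<open>s\<close>; an identity of functions thus becomes
  one in free variables.\<close>

lemma mon_independent_fun:
  fixes b :: "'i \<Rightarrow> 'a::real_vector \<Rightarrow> real"
  assumes "finite X" "\<And>i. i \<in> X \<Longrightarrow> linear (b i)"
    and w: "\<And>i j. i \<in> X \<Longrightarrow> j \<in> X \<Longrightarrow> b i (w j) = (if i = j then 1 else 0)"
    and F: "finite F" "\<And>\<alpha> i. \<alpha> \<in> F \<Longrightarrow> i \<notin> X \<Longrightarrow> \<alpha> i = 0"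
    and 0: "(\<Sum>\<alpha>\<in>F. c \<alpha> *\<^sub>R mon X b \<alpha>) = 0"
  shows "\<forall>\<alpha>\<in>F. c \<alpha> = 0"
proof (rule mon_independent[of X])
  show "finite X" "finite F" using assms by auto
  show "\<alpha> i = 0" if "\<alpha> \<in> F" "i \<notin> X" for \<alpha> i using F(2) that .
  fix s :: "'i \<Rightarrow> real"
  let ?x = "\<Sum>j\<in>X. s j *\<^sub>R w j"
  have "b i ?x = s i" if "i \<in> X" for i
  proof -
    have "b i ?x = (\<Sum>j\<in>X. s j * (if i = j then 1 else 0))"
      using assms(2)[OF that] w that by (simp add: linear_sum linear_scale)
    also have "\<dots> = (\<Sum>j\<in>X. if i = j then s j else 0)" by (intro sum.cong) auto
    finally show ?thesis using that assms(1) by simp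
  qed
  then have "mon X (\<lambda>i. b i ?x) \<alpha> = mon X s \<alpha>" for \<alpha>
    unfolding mon_def by (intro prod.cong) auto
  then show "(\<Sum>\<alpha>\<in>F. c \<alpha> * mon X s \<alpha>) = 0"
    using fun_cong[OF 0, of ?x] by (simp add: sum_fun_apply mon_apply)
qed

lemma pw_eq_span_mon:
  assumes "finite X" "b ` X \<subseteq> G" "G \<subseteq> span (b ` X)"
  shows "pw G d = span (mon X b ` exps X d)"
proof (intro subset_antisym)
  show "span (mon X b ` exps X d) \<subseteq> pw G d"
    using mon_in_pw[OF assms(1,2)] by (intro span_minimal) (auto simp: exps_def)
  show "pw G d \<subseteq> span (mon X b ` exps X d)"
  proof (induction d)
    case 0
    have "(\<lambda>_. 0) \<in> exps X 0" by (simp add: exps_def)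
    then have "mon X b (\<lambda>_. 0) \<in> mon X b ` exps X 0" by blast
    then have "1 \<in> mon X b ` exps X 0" by (simp add: mon_def)
    then show ?case by (simp add: span_base span_minimal)
  next
    case (Suc d)
    have "g * p \<in> span (mon X b ` exps X (Suc d))" if "g \<in> G" "p \<in> pw G d" for g p
    proof -
      have "g * p \<in> span {a * m |a m. a \<in> b ` X \<and> m \<in> mon X b ` exps X d}"
        using that assms(3) Suc by (intro span_mult) auto
      moreover have "{a * m |a m. a \<in> b ` X \<and> m \<in> mon X b ` exps X d} \<subseteq> mon X b ` exps X (Suc d)"
        using mon_single[OF assms(1)] exps_Suc[OF assms(1)] by fastforce
      ultimately show ?thesis using span_mono by blast
    qed
    then show ?case unfolding pw.simps by (intro span_minimal) auto
  qed
qed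

lemma fin_dim_span_mon: "finite X \<Longrightarrow> fin_dim (span (mon X b ` exps X d))"
  for b :: "'i \<Rightarrow> 'a \<Rightarrow> real"
  by (intro fin_dim_span fin_dim_finite) auto

section \<open>Linear and affine functions\<close>

definition lin :: "('a::real_inner \<Rightarrow> real) set" where
  "lin = {l. \<exists>a. l = (\<lambda>x. a \<bullet> x)}"

definition aff :: "('a::real_inner \<Rightarrow> real) set" where
  "aff = {l. \<exists>c a. l = (\<lambda>x. c + a \<bullet> x)}"

lemma subspace_lin: "subspace lin"
proof -
  have "\<exists>a. l + m = (\<lambda>x. a \<bullet> x)" if "l = (\<lambda>x. a1 \<bullet> x)" "m = (\<lambda>x. a2 \<bullet> x)" for l m :: "'a \<Rightarrow> real" and a1 a2
    using that by (intro exI[of _ "a1 + a2"]) (auto simp: inner_add_left)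
  moreover have "\<exists>a. k *\<^sub>R l = (\<lambda>x. a \<bullet> x)" if "l = (\<lambda>x. a1 \<bullet> x)" for l :: "'a \<Rightarrow> real" and k a1
    using that by (intro exI[of _ "k *\<^sub>R a1"]) auto
  moreover have "\<exists>a. (0 :: 'a \<Rightarrow> real) = (\<lambda>x. a \<bullet> x)"
    by (intro exI[of _ 0]) auto
  ultimately show ?thesis unfolding subspace_def lin_def by blast
qed

lemma subspace_aff: "subspace aff"
proof -
  have "\<exists>c a. l + m = (\<lambda>x. c + a \<bullet> x)" if "l = (\<lambda>x. c1 + a1 \<bullet> x)" "m = (\<lambda>x. c2 + a2 \<bullet> x)"
    for l m :: "'a \<Rightarrow> real" and a1 a2 c1 c2
    using that by (intro exI[of _ "c1 + c2"] exI[of _ "a1 + a2"]) (auto simp: inner_add_left)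
  moreover have "\<exists>c a. k *\<^sub>R l = (\<lambda>x. c + a \<bullet> x)" if "l = (\<lambda>x. c1 + a1 \<bullet> x)" for l :: "'a \<Rightarrow> real" and k a1 c1
    using that by (intro exI[of _ "k * c1"] exI[of _ "k *\<^sub>R a1"]) (auto simp: distrib_left)
  moreover have "\<exists>c a. (0 :: 'a \<Rightarrow> real) = (\<lambda>x. c + a \<bullet> x)"
    by (intro exI[of _ 0]) auto
  ultimately show ?thesis unfolding subspace_def aff_def by blast
qed

lemma lin_linear: "l \<in> lin \<Longrightarrow> linear l"
  by (auto simp: lin_def intro!: linearI simp: inner_add_right)

lemma linear_lin: "linear l \<Longrightarrow> l \<in> lin" for l :: "'a::euclidean_space \<Rightarrow> real"
proof -
  assume l: "linear l"
  have "l x = (\<Sum>b\<in>Basis. l b *\<^sub>R b) \<bullet> x" for x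
  proof -
    have "l x = l (\<Sum>b\<in>Basis. (x \<bullet> b) *\<^sub>R b)" by (simp add: euclidean_representation)
    also have "\<dots> = (\<Sum>b\<in>Basis. (x \<bullet> b) * l b)" using l by (simp add: linear_sum linear_scale)
    also have "\<dots> = (\<Sum>b\<in>Basis. l b *\<^sub>R b) \<bullet> x"
      unfolding inner_sum_left by (intro sum.cong) (simp_all add: inner_commute mult.commute)
    finally show ?thesis .
  qed
  then show ?thesis unfolding lin_def by blast
qed

lemma lin_subset_aff: "lin \<subseteq> aff"
proof
  fix l :: "'a \<Rightarrow> real" assume "l \<in> lin"
  then obtain a where "l = (\<lambda>x. 0 + a \<bullet> x)" by (auto simp: lin_def)
  then show "l \<in> aff" unfolding aff_def by blast
qed

text \<open>As \<open>aff\<close> contains the constants, \<open>P d\<close> consists of all polynomials of degree at most \<open>d\<close>,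
  whereas \<open>H e\<close> consists of the forms of degree \<open>e\<close>.\<close>

abbreviation H :: "nat \<Rightarrow> (real^3 \<Rightarrow> real) set" where "H \<equiv> pw lin"
abbreviation P :: "nat \<Rightarrow> (real^3 \<Rightarrow> real) set" where "P \<equiv> pw aff"

text \<open>The linear part of an affine function, which is also its derivative.\<close>

definition ldir :: "(real^3 \<Rightarrow> real) \<Rightarrow> real^3 \<Rightarrow> real" where
  "ldir l = (\<lambda>y. l y - l 0)"

lemma ldir_lin: "l \<in> aff \<Longrightarrow> ldir l \<in> lin"
  by (auto simp: aff_def lin_def ldir_def)

lemma aff_line: "l \<in> aff \<Longrightarrow> l (x + t *\<^sub>R y) = l x + t * ldir l y"
  by (auto simp: aff_def ldir_def inner_add_right)

lemma aff_plus: "l \<in> aff \<Longrightarrow> l (x + y) = l x + ldir l y"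
  using aff_line[of l x 1 y] by simp

section \<open>Taylor components at a point\<close>

lemma lagrange_coeff_exists:
  "\<exists>c. \<forall>q::real poly. degree q \<le> d \<longrightarrow> coeff q e = (\<Sum>j\<le>d. c j * poly q (real j))"
proof -
  \<comment> \<open>The Lagrange basis polynomials for the nodes 0, ..., d.\<close>
  define L where "L j = (\<Prod>i\<in>{..d} - {j}. smult (1 / (real j - real i)) [:- real i, 1:])" for j :: nat
  have L1: "poly (L j) (real k) = (if k = j then 1 else 0)" if "j \<le> d" "k \<le> d" for j k
  proof (cases "k = j")
    case False
    then have "k \<in> {..d} - {j}" using that by simp
    then show ?thesis using False by (auto simp: L_def poly_prod intro!: prod_zero bexI[of _ k])
  qed (auto simp: L_def poly_prod diff_divide_distrib[symmetric] intro!: prod.neutral)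
  have degL: "degree (L j) \<le> d" if "j \<le> d" for j
  proof -
    have "degree (L j) \<le> (\<Sum>i\<in>{..d} - {j}. 1)"
      unfolding L_def by (rule order_trans[OF degree_prod_sum_le]) (auto intro!: sum_mono order_trans[OF degree_smult_le])
    then show ?thesis using that by simp
  qed
  have "coeff q e = (\<Sum>j\<le>d. coeff (L j) e * poly q (real j))" if q: "degree q \<le> d" for q :: "real poly"
  proof -
    define R where "R = (\<Sum>j\<le>d. smult (poly q (real j)) (L j)) - q"
    have "degree (\<Sum>j\<le>d. smult (poly q (real j)) (L j)) \<le> d"
      using degL by (intro degree_sum_le) (auto intro: order_trans[OF degree_smult_le])
    then have degR: "degree R \<le> d" unfolding R_def using q by (intro degree_diff_le)
    have "poly R (real k) = 0" if "k \<le> d" for k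
    proof -
      have "(\<Sum>j\<le>d. poly q (real j) * poly (L j) (real k)) = (\<Sum>j\<le>d. if j = k then poly q (real j) else 0)"
        using L1 that by (intro sum.cong) auto
      then show ?thesis using that by (simp add: R_def poly_sum)
    qed
    then have sub: "real ` {..d} \<subseteq> {x. poly R x = 0}" by auto
    \<comment> \<open>The interpolation error has degree at most \<open>d\<close> and
      \<open>d + 1\<close> roots.\<close>
    have "R = 0"
    proof (rule ccontr)
      assume R: "R \<noteq> 0"
      have "Suc d = card (real ` {..d})" by (simp add: card_image)
      also have "\<dots> \<le> card {x. poly R x = 0}"
        using sub poly_roots_finite[OF R] by (rule card_mono[rotated])
      also have "\<dots> \<le> d" using card_poly_roots_bound[OF R] degR by linarith
      finally show False by simp
    qed
    then have "q = (\<Sum>j\<le>d. smult (poly q (real j)) (L j))" by (simp add: R_def)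
    then have "coeff q e = coeff (\<Sum>j\<le>d. smult (poly q (real j)) (L j)) e" by simp
    then show ?thesis by (simp add: coeff_sum mult.commute)
  qed
  then show ?thesis by (intro exI[of _ "\<lambda>j. coeff (L j) e"]) auto
qed

definition lagrange_coeff :: "nat \<Rightarrow> nat \<Rightarrow> nat \<Rightarrow> real" where
  "lagrange_coeff d e = (SOME c. \<forall>q::real poly. degree q \<le> d \<longrightarrow> coeff q e = (\<Sum>j\<le>d. c j * poly q (real j)))"

lemma lagrange_coeff:
  "degree q \<le> d \<Longrightarrow> coeff q e = (\<Sum>j\<le>d. lagrange_coeff d e j * poly q (real j))"
  using someI_ex[OF lagrange_coeff_exists, of d e] unfolding lagrange_coeff_def by blast

text \<open>The degree-\<open>e\<close> Taylor component at \<open>\<gamma>\<close> of a polynomial of degree at most \<open>d\<close>.  Writing it as a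
  combination of point evaluations makes it linear on all functions.\<close>

definition comp :: "nat \<Rightarrow> real^3 \<Rightarrow> nat \<Rightarrow> (real^3 \<Rightarrow> real) \<Rightarrow> real^3 \<Rightarrow> real" where
  "comp d \<gamma> e p = (\<lambda>y. \<Sum>j\<le>d. lagrange_coeff d e j * p (\<gamma> + real j *\<^sub>R y))"

lemma linear_comp: "linear (comp d \<gamma> e)"
  by (rule linearI) (auto simp: comp_def fun_eq_iff sum.distrib sum_distrib_left algebra_simps)

text \<open>On each line through \<open>\<gamma>\<close> this is an identity of univariate
  polynomials in \<open>t\<close>, so \<open>h e\<close> is determined for \<open>e \<le> d\<close>;
  beyond \<open>d\<close> it is arbitrary.\<close>

definition expansion :: "real^3 \<Rightarrow> nat \<Rightarrow> (real^3 \<Rightarrow> real) \<Rightarrow> (nat \<Rightarrow> real^3 \<Rightarrow> real) \<Rightarrow> bool" where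
  "expansion \<gamma> d p h \<longleftrightarrow> (\<forall>y t. p (\<gamma> + t *\<^sub>R y) = (\<Sum>e\<le>d. h e y * t ^ e))"

lemma comp_expansion:
  assumes "expansion \<gamma> d p h" "e \<le> d"
  shows "comp d \<gamma> e p = h e"
proof
  fix y
  define Q where "Q = (\<Sum>e\<le>d. monom (h e y) e)"
  have Q: "poly Q t = p (\<gamma> + t *\<^sub>R y)" for t
    using assms(1) by (simp add: Q_def poly_sum poly_monom expansion_def)
  have "degree Q \<le> d"
    unfolding Q_def by (intro degree_sum_le) (auto intro: order_trans[OF degree_monom_le])
  from lagrange_coeff[OF this, of e] have "comp d \<gamma> e p y = coeff Q e"
    by (simp add: comp_def Q)
  also have "\<dots> = h e y" using assms(2) by (simp add: Q_def coeff_sum)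
  finally show "comp d \<gamma> e p y = h e y" .
qed

text \<open>On the line, \<open>l\<close> equals \<open>l \<gamma> + t * ldir l y\<close>: the first
  term keeps the order and the second raises it by one.\<close>

lemma expansion_mult_aff:
  assumes "l \<in> aff" "expansion \<gamma> d p h"
  shows "expansion \<gamma> (Suc d) (l * p)
    (\<lambda>e. (if e \<le> d then l \<gamma> *\<^sub>R h e else 0) + (if e = 0 then 0 else ldir l * h (e - 1)))"
  unfolding expansion_def
proof (intro allI)
  fix y t
  have "(l * p) (\<gamma> + t *\<^sub>R y) = (l \<gamma> + t * ldir l y) * (\<Sum>e\<le>d. h e y * t ^ e)"
    using assms by (simp add: expansion_def aff_line)
  also have "\<dots> = (\<Sum>e\<le>d. l \<gamma> * h e y * t ^ e) + (\<Sum>e\<le>d. ldir l y * h e y * t ^ Suc e)"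
    by (simp add: distrib_right distrib_left sum_distrib_left sum.distrib[symmetric] mult_ac)
  also have "(\<Sum>e\<le>d. l \<gamma> * h e y * t ^ e) = (\<Sum>e\<le>Suc d. (if e \<le> d then l \<gamma> *\<^sub>R h e else 0) y * t ^ e)"
    by simp
  also have "(\<Sum>e\<le>d. ldir l y * h e y * t ^ Suc e) = (\<Sum>e\<le>Suc d. (if e = 0 then 0 else ldir l * h (e - 1)) y * t ^ e)"
    by (simp only: sum.atMost_Suc_shift[of _ d]) simp
  finally show "(l * p) (\<gamma> + t *\<^sub>R y) =
      (\<Sum>e\<le>Suc d. ((if e \<le> d then l \<gamma> *\<^sub>R h e else 0) + (if e = 0 then 0 else ldir l * h (e - 1))) y * t ^ e)"
    by (simp only: plus_fun_apply sum.distrib[symmetric] distrib_right)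
qed

lemma expansion_exists:
  "p \<in> P d \<Longrightarrow> \<exists>h. expansion \<gamma> d p h \<and> (\<forall>e. h e \<in> H e)"
proof (induction d arbitrary: p)
  case 0
  then obtain c where "p = (\<lambda>x. c)" by (auto simp only: pw_0_iff)
  moreover have "(\<lambda>x. c) \<in> H 0" by (auto simp only: pw_0_iff)
  ultimately show ?case
    by (intro exI[of _ "\<lambda>e. if e = 0 then (\<lambda>_. c) else 0"]) (auto simp: expansion_def subspace_0[OF subspace_pw] simp del: pw.simps)
next
  case (Suc d)
  from Suc.prems have "p \<in> span {g * p |g p. g \<in> aff \<and> p \<in> P d}" by simp
  then show ?case
  proof (induction rule: span_induct_alt)
    case base
    show ?case by (intro exI[of _ "\<lambda>_. 0"] conjI allI subspace_0 subspace_pw) (simp add: expansion_def)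
  next
    case (step c x y)
    then obtain g p' h h' where x: "x = g * p'" "g \<in> aff" "p' \<in> P d"
      and h: "expansion \<gamma> (Suc d) y h" "\<forall>e. h e \<in> H e"
      and h': "expansion \<gamma> d p' h'" "\<forall>e. h' e \<in> H e"
      using Suc.IH by blast
    let ?k = "\<lambda>e. (if e \<le> d then g \<gamma> *\<^sub>R h' e else 0) + (if e = 0 then 0 else ldir g * h' (e - 1))"
    have k: "expansion \<gamma> (Suc d) x ?k" using expansion_mult_aff[OF x(2) h'(1)] x(1) by simp
    have kH: "?k e \<in> H e" for e
    proof (intro subspace_add subspace_pw)
      show "(if e \<le> d then g \<gamma> *\<^sub>R h' e else 0) \<in> H e"
        using h' by (auto simp: subspace_scale subspace_0)
      show "(if e = 0 then 0 else ldir g * h' (e - 1)) \<in> H e"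
        using h'(2) pw_SucI[OF ldir_lin[OF x(2)], of "h' (e - 1)" "e - 1"] by (auto simp: subspace_0 simp del: pw.simps)
    qed
    have "expansion \<gamma> (Suc d) (c *\<^sub>R x + y) (\<lambda>e. c *\<^sub>R ?k e + h e)"
      using k h(1) unfolding expansion_def
      by (simp add: sum.distrib[symmetric] sum_distrib_left algebra_simps del: sum.atMost_Suc)
    moreover have "c *\<^sub>R ?k e + h e \<in> H e" for e
      by (rule subspace_add[OF subspace_pw subspace_scale[OF subspace_pw kH]]) (use h(2) in blast)
    ultimately show ?case by (intro exI conjI allI)
  qed
qed

lemma comp_in_H: "p \<in> P d \<Longrightarrow> e \<le> d \<Longrightarrow> comp d \<gamma> e p \<in> H e"
  using expansion_exists[of p d \<gamma>] comp_expansion by metis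

lemma expansion_power_mult:
  assumes "l \<in> aff" "l \<gamma> = 0" "expansion \<gamma> d q h"
  shows "expansion \<gamma> (d + s) (l ^ s * q) (\<lambda>e. if e < s then 0 else ldir l ^ s * h (e - s))"
proof (induction s)
  case 0
  then show ?case using assms by simp
next
  case (Suc s)
  have "(\<lambda>e. (if e \<le> d + s then l \<gamma> *\<^sub>R (if e < s then 0 else ldir l ^ s * h (e - s)) else 0)
     + (if e = 0 then 0 else ldir l * (if e - 1 < s then 0 else ldir l ^ s * h (e - 1 - s))))
     = (\<lambda>e. if e < Suc s then 0 else ldir l ^ Suc s * h (e - Suc s))"
    using assms(2) by (auto simp: fun_eq_iff)
  moreover have "l ^ Suc s * q = l * (l ^ s * q)" by (simp add: mult.assoc fun_eq_iff)
  ultimately show ?case using expansion_mult_aff[OF assms(1) Suc] by (simp only: add_Suc_right)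
qed

text \<open>A factor vanishing at \<open>\<gamma>\<close> is t times its linear part on lines
  through \<open>\<gamma>\<close>. Divisibility by a power of \<open>l\<close> thus passes to the
  components, with \<open>ldir l\<close> in place of \<open>l\<close>.\<close>

lemma comp_power_mult:
  assumes "l \<in> aff" "l \<gamma> = 0" "q \<in> P k" "d = k + s" "e \<le> d"
  shows "comp d \<gamma> e (l ^ s * q) = (if e < s then 0 else ldir l ^ s * comp k \<gamma> (e - s) q)"
proof -
  obtain h where h: "expansion \<gamma> k q h" using expansion_exists[OF assms(3)] by blast
  have "comp d \<gamma> e (l ^ s * q) = (if e < s then 0 else ldir l ^ s * h (e - s))"
    using comp_expansion[OF expansion_power_mult[OF assms(1,2) h, of s], of e] assms(4,5) by simp
  moreover have "comp k \<gamma> (e - s) q = h (e - s)" if "\<not> e < s"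
    using comp_expansion[OF h] assms(4,5) that by simp
  ultimately show ?thesis by simp
qed

section \<open>The dimension of the spaces of ternary forms\<close>

lemma lin_basis: "lin = span ((\<lambda>i x. x $ i) ` (UNIV :: 3 set))"
proof (intro subset_antisym subsetI)
  fix l :: "real^3 \<Rightarrow> real" assume "l \<in> lin"
  then obtain a where "l = (\<lambda>x. a \<bullet> x)" by (auto simp: lin_def)
  then have "l = (\<Sum>i\<in>UNIV. a $ i *\<^sub>R (\<lambda>x. x $ i))" by (auto simp: fun_eq_iff sum_fun_apply inner_vec_def)
  also have "\<dots> \<in> span ((\<lambda>i x. x $ i) ` (UNIV :: 3 set))" by (intro span_sum span_scale span_base) auto
  finally show "l \<in> span ((\<lambda>i x. x $ i) ` (UNIV :: 3 set))" .
next
  fix l :: "real^3 \<Rightarrow> real" assume "l \<in> span ((\<lambda>i x. x $ i) ` (UNIV :: 3 set))"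
  then show "l \<in> lin"
  proof (rule subsetD[OF span_minimal[OF _ subspace_lin], rotated])
    show "(\<lambda>i x. x $ i) ` (UNIV :: 3 set) \<subseteq> (lin :: (real^3 \<Rightarrow> real) set)"
      by (auto intro!: linear_lin linearI)
  qed
qed

lemma H_eq: "H e = span (mon UNIV (\<lambda>i x. x $ i) ` exps (UNIV :: 3 set) e)"
  by (intro pw_eq_span_mon) (auto simp: lin_basis intro: span_base)

lemma fin_dim_H: "fin_dim (H e)"
  unfolding H_eq by (intro fin_dim_span_mon) auto

lemma dim_H: "dim (H e) = (e + 2) choose 2"
proof -
  have "dim (H e) = card (exps (UNIV :: 3 set) e)"
    unfolding H_eq
  proof (intro dim_span_family finite_exps)
    fix c assume "(\<Sum>\<alpha>\<in>exps (UNIV :: 3 set) e. c \<alpha> *\<^sub>R mon UNIV (\<lambda>i (x::real^3). x $ i) \<alpha>) = 0"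
    then show "\<forall>\<alpha>\<in>exps (UNIV :: 3 set) e. c \<alpha> = 0"
      by (rule mon_independent_fun[rotated 5, where w = "\<lambda>j. axis j 1"])
         (auto intro!: linearI simp: axis_def)
  qed auto
  then show ?thesis using card_exps[of "UNIV :: 3 set" 2 e] by simp
qed

subsection \<open>Powers of ternary linear forms\<close>

text \<open>The derivative along \<open>v\<close> as a relation, so that arbitrary functions need no
  derivative operator; \<open>p'\<close> is unique where it exists.\<close>

definition dd :: "'a::real_vector \<Rightarrow> ('a \<Rightarrow> real) \<Rightarrow> ('a \<Rightarrow> real) \<Rightarrow> bool" where
  "dd v p p' \<longleftrightarrow> (\<forall>x t. ((\<lambda>s. p (x + s *\<^sub>R v)) has_field_derivative p' (x + t *\<^sub>R v)) (at t))"

lemma dd_add: "dd v p p' \<Longrightarrow> dd v q q' \<Longrightarrow> dd v (p + q) (p' + q')"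
  unfolding dd_def plus_fun_apply by (auto intro: DERIV_add)

lemma dd_diff: "dd v p p' \<Longrightarrow> dd v q q' \<Longrightarrow> dd v (p - q) (p' - q')"
  unfolding dd_def minus_apply by (auto intro: DERIV_diff)

lemma dd_scale: "dd v p p' \<Longrightarrow> dd v (c *\<^sub>R p) (c *\<^sub>R p')"
  unfolding dd_def scaleR_fun_apply real_scaleR_def by (auto intro: DERIV_cmult)

lemma dd_mult: "dd v p p' \<Longrightarrow> dd v q q' \<Longrightarrow> dd v (p * q) (p' * q + p * q')"
  unfolding dd_def plus_fun_apply times_fun_apply
  by (auto intro!: DERIV_mult' simp: add.commute)

lemma dd_const: "dd v (\<lambda>x. c) 0"
  unfolding dd_def zero_fun_apply by simp

lemma dd_zero: "dd v 0 0"
  using dd_const[of v 0] by (simp add: zero_fun_def)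

lemma dd_linear: "linear l \<Longrightarrow> dd v l (l v *\<^sub>R 1)"
  unfolding dd_def
  by (auto simp: linear_add linear_scale intro!: derivative_eq_intros)

lemma dd_power:
  assumes "linear l"
  shows "dd v (l ^ Suc s) ((real (Suc s) * l v) *\<^sub>R l ^ s)"
proof (induction s)
  case 0
  have "l ^ Suc 0 = l" "(real (Suc 0) * l v) *\<^sub>R l ^ 0 = l v *\<^sub>R 1" by simp_all
  then show ?case using dd_linear[OF assms, of v] by (simp only:)
next
  case (Suc s)
  have "(l v *\<^sub>R 1) * l ^ Suc s + l * ((real (Suc s) * l v) *\<^sub>R l ^ s)
      = (real (Suc (Suc s)) * l v) *\<^sub>R l ^ Suc s"
    by (auto simp: fun_eq_iff algebra_simps)
  then show ?case using dd_mult[OF dd_linear[OF assms] Suc] by (simp only: power_Suc)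
qed

lemma dd_zero_const:
  assumes "dd v p 0"
  shows "p (x + t *\<^sub>R v) = p x"
proof -
  have "\<forall>s. ((\<lambda>s. p (x + s *\<^sub>R v)) has_field_derivative 0) (at s)"
    using assms unfolding dd_def by simp
  then have "p (x + t *\<^sub>R v) = p (x + 0 *\<^sub>R v)"
    by (rule DERIV_isconst_all)
  then show ?thesis by simp
qed

lemma dd_exists:
  assumes "Y \<subseteq> lin" "p \<in> pw Y (Suc e)"
  shows "\<exists>p'\<in>pw Y e. dd v p p'"
  using assms(2)
proof (induction e arbitrary: p)
  case 0
  then have "p \<in> span {g * p |g p. g \<in> Y \<and> p \<in> pw Y 0}" by simp
  then show ?case
  proof (induction rule: span_induct_alt)
    case base
    show ?case using dd_zero subspace_0[OF subspace_pw] by blast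
  next
    case (step c x y)
    then obtain g q where x: "x = g * q" "g \<in> Y" "q \<in> pw Y 0" by auto
    obtain k where k: "q = (\<lambda>_. k)" using x(3) by (auto simp only: pw_0_iff)
    have "g * q = k *\<^sub>R g" by (auto simp: k fun_eq_iff)
    then have "dd v x (k *\<^sub>R (g v *\<^sub>R 1))"
      using dd_scale[OF dd_linear[OF lin_linear]] x assms(1) by auto
    moreover have "k *\<^sub>R (g v *\<^sub>R 1) \<in> pw Y 0"
      by (intro subspace_scale subspace_pw one_in_pw)
    moreover obtain y' where "y' \<in> pw Y 0" "dd v y y'" using step by blast
    ultimately show ?case
      using dd_add[OF dd_scale] subspace_add[OF subspace_pw subspace_scale[OF subspace_pw]] by blast
  qed
next
  case (Suc e)
  then have "p \<in> span {g * p |g p. g \<in> Y \<and> p \<in> pw Y (Suc e)}" by simp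
  then show ?case
  proof (induction rule: span_induct_alt)
    case base
    show ?case using dd_zero subspace_0[OF subspace_pw] by blast
  next
    case (step c x y)
    then obtain g q where x: "x = g * q" "g \<in> Y" "q \<in> pw Y (Suc e)" by auto
    obtain q' where q': "q' \<in> pw Y e" "dd v q q'" using Suc.IH[OF x(3)] by blast
    have "linear g" using x assms(1) lin_linear by auto
    from dd_mult[OF dd_linear[OF this] q'(2)]
    have 1: "dd v x ((g v *\<^sub>R 1) * q + g * q')" unfolding x(1) .
    have "(g v *\<^sub>R 1) * q = g v *\<^sub>R q" by (auto simp: fun_eq_iff)
    then have 2: "(g v *\<^sub>R 1) * q + g * q' \<in> pw Y (Suc e)"
      using subspace_add[OF subspace_pw subspace_scale[OF subspace_pw x(3)] pw_SucI[OF x(2) q'(1)]] by simp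
    obtain y' where "y' \<in> pw Y (Suc e)" "dd v y y'" using step by blast
    then show ?case
      using 1 2 dd_add[OF dd_scale] subspace_add[OF subspace_pw subspace_scale[OF subspace_pw]] by blast
  qed
qed

lemma pw_killed_const:
  assumes "\<And>y. y \<in> Y \<Longrightarrow> linear y" "\<And>y. y \<in> Y \<Longrightarrow> y v = 0" "p \<in> pw Y e"
  shows "p (x + t *\<^sub>R v) = p x"
  using assms(3)
proof (induction e arbitrary: p)
  case 0
  then show ?case by (auto simp only: pw_0_iff)
next
  case (Suc e)
  then have "p \<in> span {g * p |g p. g \<in> Y \<and> p \<in> pw Y e}" by simp
  then show ?case
  proof (induction rule: span_induct_alt)
    case (step c z y)
    then obtain g q where z: "z = g * q" "g \<in> Y" "q \<in> pw Y e" by auto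
    have "g (x + t *\<^sub>R v) = g x" using assms(1,2) z(2) by (simp add: linear_add linear_scale)
    then show ?case using step z Suc.IH by simp
  qed simp
qed

lemma dd_killed:
  assumes "\<And>y. y \<in> Y \<Longrightarrow> linear y" "\<And>y. y \<in> Y \<Longrightarrow> y v = 0" "p \<in> pw Y e"
  shows "dd v p 0"
proof -
  have "(\<lambda>s. p (x + s *\<^sub>R v)) = (\<lambda>s. p x)" for x
    by (rule ext) (rule pw_killed_const[OF assms])
  then show ?thesis unfolding dd_def by simp
qed

text \<open>Division with remainder by \<open>\<mu>\<close>: each generator is a multiple of
  \<open>\<mu>\<close> plus an element of the hyperplane \<open>Y0\<close>, so the remainder is
  formed from \<open>Y0\<close> alone.\<close>

lemma pw_split:
  assumes Y: "subspace Y" "Y \<subseteq> lin" and mu: "\<mu> \<in> Y" "\<mu> v \<noteq> 0"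
    and Y0: "Y0 = {y \<in> Y. y v = 0}" and p: "p \<in> pw Y (Suc e)"
  shows "\<exists>y\<in>pw Y0 (Suc e). \<exists>q\<in>pw Y e. p = y + \<mu> * q"
  using p
proof (induction e arbitrary: p)
  case 0
  then have "p \<in> span {g * p |g p. g \<in> Y \<and> p \<in> pw Y 0}" by simp
  then show ?case
  proof (induction rule: span_induct_alt)
    case base
    show ?case by (intro bexI[of _ 0] subspace_0 subspace_pw) simp
  next
    case (step c x z)
    then obtain g q where x: "x = g * q" "g \<in> Y" "q \<in> pw Y 0" by auto
    obtain y' q' where z: "y' \<in> pw Y0 (Suc 0)" "q' \<in> pw Y 0" "z = y' + \<mu> * q'" using step by blast
    let ?g0 = "g - (g v / \<mu> v) *\<^sub>R \<mu>"
    have g0: "?g0 \<in> Y0" unfolding Y0 using x mu Y by (auto intro!: subspace_diff subspace_scale)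
    have "?g0 * q \<in> pw Y0 (Suc 0)"
      using x(3) by (intro pw_SucI g0) (simp only: pw.simps)
    then have "c *\<^sub>R (?g0 * q) + y' \<in> pw Y0 (Suc 0)"
      by (rule subspace_add[OF subspace_pw subspace_scale[OF subspace_pw] z(1)])
    moreover have "(c * (g v / \<mu> v)) *\<^sub>R q + q' \<in> pw Y 0"
      by (rule subspace_add[OF subspace_pw subspace_scale[OF subspace_pw x(3)] z(2)])
    moreover have "c *\<^sub>R x + z = (c *\<^sub>R (?g0 * q) + y') + \<mu> * ((c * (g v / \<mu> v)) *\<^sub>R q + q')"
      unfolding x(1) z(3) by (auto simp: fun_eq_iff algebra_simps)
    ultimately show ?case by blast
  qed
next
  case (Suc e)
  then have "p \<in> span {g * p |g p. g \<in> Y \<and> p \<in> pw Y (Suc e)}" by simp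
  then show ?case
  proof (induction rule: span_induct_alt)
    case base
    show ?case by (intro bexI[of _ 0] subspace_0 subspace_pw) simp
  next
    case (step c x z)
    then obtain g q where x: "x = g * q" "g \<in> Y" "q \<in> pw Y (Suc e)" by auto
    obtain y' q' where z: "y' \<in> pw Y0 (Suc (Suc e))" "q' \<in> pw Y (Suc e)" "z = y' + \<mu> * q'" using step by blast
    obtain y1 q1 where q: "y1 \<in> pw Y0 (Suc e)" "q1 \<in> pw Y e" "q = y1 + \<mu> * q1" using Suc.IH[OF x(3)] by blast
    let ?g0 = "g - (g v / \<mu> v) *\<^sub>R \<mu>"
    have g0: "?g0 \<in> Y0" unfolding Y0 using x mu Y by (auto intro!: subspace_diff subspace_scale)
    then have g0Y: "?g0 \<in> Y" unfolding Y0 by blast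
    have "c *\<^sub>R (?g0 * y1) + y' \<in> pw Y0 (Suc (Suc e))"
      by (rule subspace_add[OF subspace_pw subspace_scale[OF subspace_pw pw_SucI[OF g0 q(1)]] z(1)])
    moreover have "(c * (g v / \<mu> v)) *\<^sub>R q + (c *\<^sub>R (?g0 * q1) + q') \<in> pw Y (Suc e)"
      by (intro subspace_add subspace_scale subspace_pw x(3) z(2) pw_SucI[OF g0Y q(2)])
    moreover have "c *\<^sub>R x + z = (c *\<^sub>R (?g0 * y1) + y') + \<mu> * ((c * (g v / \<mu> v)) *\<^sub>R q + (c *\<^sub>R (?g0 * q1) + q'))"
      unfolding x(1) z(3) q(3) using mu(2) by (auto simp: fun_eq_iff algebra_simps)
    ultimately show ?case by blast
  qed
qed

text \<open>A function constant along \<open>v\<close> may be evaluated where the line through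
  \<open>x\<close> in direction \<open>v\<close> meets the zero set of \<open>\<mu>\<close>, and
  there only the remainder modulo \<open>\<mu>\<close> survives.\<close>

lemma dd_kernel:
  assumes Y: "subspace Y" "Y \<subseteq> lin" and mu: "\<mu> \<in> Y" "\<mu> v \<noteq> 0"
    and p: "p \<in> pw Y e" "dd v p 0"
  shows "p \<in> pw {y \<in> Y. y v = 0} e"
proof (cases e)
  case 0
  then show ?thesis using p by (simp only: pw.simps)
next
  case (Suc e')
  let ?Y0 = "{y \<in> Y. y v = 0}"
  obtain y q where yq: "y \<in> pw ?Y0 (Suc e')" "p = y + \<mu> * q"
    using pw_split[OF Y mu refl] p(1) Suc by blast
  have "p x = y x" for x
  proof -
    let ?t = "- (\<mu> x / \<mu> v)"
    have lin: "linear \<mu>" using mu Y lin_linear by auto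
    have "p x = p (x + ?t *\<^sub>R v)" by (rule dd_zero_const[OF p(2), symmetric])
    also have "\<dots> = y (x + ?t *\<^sub>R v)"
      using mu(2) by (simp add: yq(2) linear_diff[OF lin] linear_scale[OF lin])
    also have "\<dots> = y x"
      by (rule pw_killed_const[OF _ _ yq(1)]) (use Y lin_linear in auto)
    finally show ?thesis .
  qed
  then have "p = y" by auto
  then show ?thesis using yq Suc by simp
qed

text \<open>An antiderivative that gains a factor \<open>l\<close>. In q = y + l q1 the part
  \<open>y\<close> is constant along \<open>v\<close>, so l^s y integrates to a multiple of l^(s+1)
  y; what remains is l^(s+1) q1 with a cofactor of lower degree, hence the induction with
  \<open>s\<close> arbitrary.\<close>

lemma dd_lift:
  assumes Y: "subspace Y" "Y \<subseteq> lin" and l: "l \<in> Y" "l v \<noteq> 0" and "q \<in> pw Y k"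
  shows "\<exists>q'\<in>pw Y k. dd v (l ^ Suc s * q') (l ^ s * q)"
  using assms(5)
proof (induction k arbitrary: q s)
  case 0
  then obtain c where q: "q = (\<lambda>_. c)" by (auto simp only: pw_0_iff)
  have lin: "linear l" using l Y lin_linear by auto
  let ?q' = "(\<lambda>_. c / (real (Suc s) * l v)) :: 'a \<Rightarrow> real"
  have "?q' \<in> pw Y 0" by (auto simp only: pw_0_iff)
  moreover have "dd v (l ^ Suc s * ?q') ((real (Suc s) * l v) *\<^sub>R l ^ s * ?q' + l ^ Suc s * 0)"
    by (rule dd_mult[OF dd_power[OF lin] dd_const])
  moreover have "(real (Suc s) * l v) *\<^sub>R l ^ s * ?q' + l ^ Suc s * 0 = l ^ s * q"
    using l(2) by (simp add: q fun_eq_iff del: of_nat_Suc)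
  ultimately show ?case by (intro bexI[of _ ?q']) (simp_all only:)
next
  case (Suc k)
  have lin: "linear l" using l Y lin_linear by auto
  obtain y q1 where q: "y \<in> pw {y \<in> Y. y v = 0} (Suc k)" "q1 \<in> pw Y k" "q = y + l * q1"
    using pw_split[OF Y l refl Suc.prems] by blast
  obtain q1' where q1': "q1' \<in> pw Y k" "dd v (l ^ Suc (Suc s) * q1') (l ^ Suc s * q1)"
    using Suc.IH[OF q(2)] by blast
  let ?c = "1 / (real (Suc s) * l v)"
  let ?q' = "?c *\<^sub>R y + l * q1'"
  have "y \<in> pw Y (Suc k)" using q(1) pw_mono[of "{y \<in> Y. y v = 0}" Y "Suc k"] by auto
  then have mem: "?q' \<in> pw Y (Suc k)"
    by (rule subspace_add[OF subspace_pw subspace_scale[OF subspace_pw] pw_SucI[OF l(1) q1'(1)]])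
  have "dd v y 0" by (rule dd_killed[OF _ _ q(1)]) (use Y lin_linear in auto)
  from dd_add[OF dd_scale[OF dd_mult[OF dd_power[OF lin, of v s] this], of ?c] q1'(2)]
  have "dd v (?c *\<^sub>R (l ^ Suc s * y) + l ^ Suc (Suc s) * q1')
     (?c *\<^sub>R ((real (Suc s) * l v) *\<^sub>R l ^ s * y + l ^ Suc s * 0) + l ^ Suc s * q1)" .
  moreover have "?c *\<^sub>R (l ^ Suc s * y) + l ^ Suc (Suc s) * q1' = l ^ Suc s * ?q'"
    by (auto simp: fun_eq_iff algebra_simps)
  moreover have "?c *\<^sub>R ((real (Suc s) * l v) *\<^sub>R l ^ s * y + l ^ Suc s * 0) + l ^ Suc s * q1 = l ^ s * q"
    unfolding q(3) using l(2) by (simp add: fun_eq_iff distrib_left del: of_nat_Suc)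
  ultimately show ?case using mem by (intro bexI[of _ ?q']) (simp_all only:)
qed

text \<open>Here \<open>l\<close> is constant along \<open>v\<close>, so only the cofactor is
  integrated and the exponent of \<open>l\<close> stays as it is; this is how such a form loses one
  unit of deficiency.\<close>

lemma dd_lift_killed:
  assumes Y: "subspace Y" "Y \<subseteq> lin" and mu: "\<mu> \<in> Y" "\<mu> v \<noteq> 0"
    and l: "l \<in> Y" "l v = 0" and q: "q \<in> pw Y k"
  shows "\<exists>q'\<in>pw Y (Suc k). dd v (l ^ s * q') (l ^ s * q)"
proof -
  obtain q1 where q1: "q1 \<in> pw Y k" "dd v (\<mu> ^ Suc 0 * q1) (\<mu> ^ 0 * q)"
    using dd_lift[OF Y mu q, of 0] by blast
  have "\<mu> * q1 \<in> pw Y (Suc k)" by (rule pw_SucI[OF mu(1) q1(1)])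
  moreover have "dd v (l ^ s) 0"
    by (rule dd_killed[OF _ _ pw_power1[of l "{l}"]]) (use l Y lin_linear in auto)
  from dd_mult[OF this q1(2)] have "dd v (l ^ s * (\<mu> * q1)) (l ^ s * q)" by simp
  ultimately show ?thesis by blast
qed

text \<open>The degree-\<open>e\<close> part of the ideal generated by the powers \<open>l j ^ (e + 1 - m j)\<close>.  The condition on
  \<open>s\<close> avoids truncated subtraction.\<close>

definition power_ideal ::
  "('a \<Rightarrow> real) set \<Rightarrow> 'j set \<Rightarrow> ('j \<Rightarrow> 'a \<Rightarrow> real) \<Rightarrow> ('j \<Rightarrow> nat) \<Rightarrow> nat \<Rightarrow> ('a \<Rightarrow> real) set" where
  "power_ideal Y J l m e =
     span {l j ^ s * q |j s k q. j \<in> J \<and> q \<in> pw Y k \<and> s + k = e \<and> e + 1 \<le> s + m j}"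

lemma power_idealI:
  "j \<in> J \<Longrightarrow> q \<in> pw Y k \<Longrightarrow> s + k = e \<Longrightarrow> e + 1 \<le> s + m j \<Longrightarrow> l j ^ s * q \<in> power_ideal Y J l m e"
  unfolding power_ideal_def by (intro span_base) blast

lemma power_ideal_cong:
  assumes "\<And>j. j \<in> J \<Longrightarrow> m j = m' j"
  shows "power_ideal Y J l m e = power_ideal Y J l m' e"
  unfolding power_ideal_def
  by (intro arg_cong[where f = span] Collect_cong ex_cong1 conj_cong refl) (simp_all add: assms)

lemma subspace_power_ideal: "subspace (power_ideal Y J l m e)"
  by (simp add: power_ideal_def)

text \<open>One derivative lowers the degree.  It preserves the deficiency \<open>m j\<close> of the forms that do not
  vanish on \<open>v\<close> and lowers that of the others by one.\<close>

lemma power_ideal_derivative_step: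
  assumes Y: "subspace Y" "Y \<subseteq> lin" and l: "\<And>j. j \<in> J \<Longrightarrow> l j \<in> Y"
    and mu: "\<mu> \<in> Y" "\<mu> v \<noteq> 0"
    and ker: "pw {y \<in> Y. y v = 0} e \<subseteq> power_ideal Y J l m e"
    and step: "\<And>e'. e = Suc e' \<Longrightarrow>
      pw Y e' \<subseteq> power_ideal Y J l (\<lambda>j. if l j v = 0 then m j - 1 else m j) e'"
  shows "pw Y e \<subseteq> power_ideal Y J l m e"
proof
  fix p assume p: "p \<in> pw Y e"
  show "p \<in> power_ideal Y J l m e"
  proof (cases e)
    case 0
    then have "p \<in> pw {y \<in> Y. y v = 0} e" using p by (simp only: pw.simps)
    then show ?thesis using ker by blast
  next
    case (Suc e')
    have lift: "\<exists>G\<in>power_ideal Y J l m e. dd v G g"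
      if "g \<in> power_ideal Y J l (\<lambda>j. if l j v = 0 then m j - 1 else m j) e'" for g
      using that unfolding power_ideal_def[of _ _ _ _ e']
    proof (induction rule: span_induct_alt)
      case base
      show ?case using dd_zero subspace_0[OF subspace_power_ideal] by blast
    next
      case (step c x y)
      then obtain j s k q where x: "x = l j ^ s * q" "j \<in> J" "q \<in> pw Y k" "s + k = e'"
        "e' + 1 \<le> s + (if l j v = 0 then m j - 1 else m j)" by blast
      obtain G' where G': "G' \<in> power_ideal Y J l m e" "dd v G' y" using step by blast
      have "\<exists>G\<in>power_ideal Y J l m e. dd v G x"
      proof (cases "l j v = 0")
        case True
        obtain q' where q': "q' \<in> pw Y (Suc k)" "dd v (l j ^ s * q') (l j ^ s * q)"
          using dd_lift_killed[OF Y mu l[OF x(2)] True x(3)] by blast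
        have "l j ^ s * q' \<in> power_ideal Y J l m e"
          using x True Suc by (intro power_idealI[OF x(2) q'(1)]) auto
        then show ?thesis using q'(2) x(1) by blast
      next
        case False
        obtain q' where q': "q' \<in> pw Y k" "dd v (l j ^ Suc s * q') (l j ^ s * q)"
          using dd_lift[OF Y l[OF x(2)] False x(3)] by blast
        have "l j ^ Suc s * q' \<in> power_ideal Y J l m e"
          using x False Suc by (intro power_idealI[OF x(2) q'(1)]) auto
        then show ?thesis using q'(2) x(1) by blast
      qed
      then show ?case
        using G' dd_add[OF dd_scale] subspace_add[OF subspace_power_ideal subspace_scale[OF subspace_power_ideal]]
        by blast
    qed
    obtain p' where p': "p' \<in> pw Y e'" "dd v p p'"
      using dd_exists[OF Y(2)] p Suc by blast
    obtain G where G: "G \<in> power_ideal Y J l m e" "dd v G p'"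
      using lift step[OF Suc] p'(1) by blast
    have "power_ideal Y J l m e \<subseteq> pw Y e"
      unfolding power_ideal_def
    proof (rule span_minimal[OF _ subspace_pw])
      show "{l j ^ s * q |j s k q. j \<in> J \<and> q \<in> pw Y k \<and> s + k = e \<and> e + 1 \<le> s + m j} \<subseteq> pw Y e"
        using pw_mult[OF pw_power1[OF l]] by blast
    qed
    then have "p - G \<in> pw Y e" using p G(1) by (intro subspace_diff subspace_pw) auto
    moreover have "dd v (p - G) 0" using dd_diff[OF p'(2) G(2)] by simp
    \<comment> \<open>\<open>G\<close> has the same derivative as \<open>p\<close>, so the
      difference is a form on the hyperplane killed by \<open>v\<close>, where \<open>ker\<close>
      applies.\<close>
    ultimately have "p - G \<in> power_ideal Y J l m e"
      using dd_kernel[OF Y mu] ker by blast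
    then have "p - G + G \<in> power_ideal Y J l m e"
      by (rule subspace_add[OF subspace_power_ideal _ G(1)])
    then show ?thesis by simp
  qed
qed

section \<open>Power ideals in two and three variables\<close>

lemma pw_span_singleton: "pw (span {l}) e = span {l ^ e}" for l :: "'a \<Rightarrow> real"
proof (induction e)
  case 0
  show ?case by (simp only: pw.simps power_0)
next
  case (Suc e)
  have "g * p \<in> span {l ^ Suc e}" if gp: "g \<in> span {l}" "p \<in> span {l ^ e}" for g p
  proof -
    obtain a b where "g = a *\<^sub>R l" "p = b *\<^sub>R l ^ e" using gp unfolding span_singleton by blast
    then have "g * p = (a * b) *\<^sub>R l ^ Suc e" by (auto simp: fun_eq_iff)
    then show ?thesis by (metis span_base span_scale singletonI)
  qed
  moreover have "l ^ Suc e \<in> {g * p |g p. g \<in> span {l} \<and> p \<in> span {l ^ e}}"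
    using span_base[of l "{l}"] span_base[of "l ^ e" "{l ^ e}"] by (auto simp only: power_Suc singletonI)
  ultimately have "span {g * p |g p. g \<in> span {l} \<and> p \<in> span {l ^ e}} = span {l ^ Suc e}"
    unfolding span_eq by (auto simp del: power_Suc intro: span_base)
  then show ?case by (simp only: pw.simps Suc)
qed

text \<open>The sum of the deficiencies is compared with \<open>e + 1\<close>, the dimension of the
  binary forms. Differentiating along the zero \<open>v j\<close> of a form with
  \<open>m j \<noteq> 0\<close> lowers the degree and the sum by one each; the kernel consists of
  multiples of the power of \<open>l j\<close>, which lies in the ideal.\<close>

lemma binary_forms_power_ideal:
  assumes Y: "subspace Y" "Y \<subseteq> lin" and J: "finite J" and l: "\<And>j. j \<in> J \<Longrightarrow> l j \<in> Y"
    and lv: "\<And>j k. j \<in> J \<Longrightarrow> k \<in> J \<Longrightarrow> l j (v k) = 0 \<longleftrightarrow> j = k"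
    and ker: "\<And>j y. j \<in> J \<Longrightarrow> y \<in> Y \<Longrightarrow> y (v j) = 0 \<Longrightarrow> y \<in> span {l j}"
    and m: "e < sum m J"
  shows "pw Y e \<subseteq> power_ideal Y J l m e"
  using m
proof (induction e arbitrary: m)
  case 0
  then obtain j where "j \<in> J" "m j \<noteq> 0" by (metis not_less_zero sum.neutral)
  show ?case
  proof
    fix q assume "q \<in> pw Y 0"
    then have "l j ^ 0 * q \<in> power_ideal Y J l m 0"
      by (rule power_idealI[OF \<open>j \<in> J\<close>]) (use \<open>m j \<noteq> 0\<close> in auto)
    then show "q \<in> power_ideal Y J l m 0" by simp
  qed
next
  case (Suc e)
  show ?case
  proof (cases "\<exists>j\<in>J. Suc e + 1 \<le> m j")
    case True
    then obtain j where "j \<in> J" "Suc e + 1 \<le> m j" by blast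
    show ?thesis
    proof
      fix q assume "q \<in> pw Y (Suc e)"
      then have "l j ^ 0 * q \<in> power_ideal Y J l m (Suc e)"
        by (rule power_idealI[OF \<open>j \<in> J\<close>]) (use \<open>Suc e + 1 \<le> m j\<close> in auto)
      then show "q \<in> power_ideal Y J l m (Suc e)" by simp
    qed
  next
    case False
    obtain j where j: "j \<in> J" "m j \<noteq> 0"
      using Suc.prems by (metis not_less_zero sum.neutral)
    have "sum m J = m j + sum m (J - {j})" using J j by (simp add: sum.remove)
    then have "sum m (J - {j}) \<noteq> 0" using Suc.prems False j(1) by fastforce
    \<comment> \<open>Any other form of the family is nonzero on \<open>v j\<close> and serves as
      the \<open>\<mu>\<close> of the derivative step.\<close>
    then obtain k where k: "k \<in> J" "k \<noteq> j" by (metis DiffE singletonI sum.neutral)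
    let ?m = "\<lambda>i. if l i (v j) = 0 then m i - 1 else m i"
    have "sum ?m J = (m j - 1) + sum m (J - {j})"
      using J j lv by (subst sum.remove[of J j]) (auto intro!: sum.cong)
    then have "e < sum ?m J" using Suc.prems \<open>sum m J = _\<close> j by linarith
    then have 1: "pw Y e \<subseteq> power_ideal Y J l ?m e" by (rule Suc.IH)
    have "{y \<in> Y. y (v j) = 0} \<subseteq> span {l j}" using ker[OF j(1)] by blast
    then have "pw {y \<in> Y. y (v j) = 0} (Suc e) \<subseteq> span {l j ^ Suc e}"
      using pw_mono[of _ _ "Suc e"] pw_span_singleton[of "l j" "Suc e"] by blast
    also have "\<dots> \<subseteq> power_ideal Y J l m (Suc e)"
    proof (rule span_minimal[OF _ subspace_power_ideal])
      have "l j ^ Suc e * 1 \<in> power_ideal Y J l m (Suc e)"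
        by (rule power_idealI[OF j(1) one_in_pw]) (use j in auto)
      then show "{l j ^ Suc e} \<subseteq> power_ideal Y J l m (Suc e)" by simp
    qed
    finally have 2: "pw {y \<in> Y. y (v j) = 0} (Suc e) \<subseteq> power_ideal Y J l m (Suc e)" .
    show ?thesis
      by (rule power_ideal_derivative_step[OF Y l l[OF k(1)] _ 2]) (use lv k j 1 in auto)
  qed
qed

text \<open>\<open>V\<close> and \<open>E\<close> are a graph, and \<open>lf a\<close> is the form
  vanishing at the two ends of the edge \<open>a\<close>. One derivative is taken along each
  \<open>w i\<close>; afterwards the degree has dropped by \<open>card V\<close> and every
  deficiency by 2, and the outer induction applies. The kernel met at a vertex consists of binary
  forms, which the three or more edges there generate because the cap 6 gives
  \<open>e < 3 * m\<close>.\<close>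

lemma ternary_forms_power_ideal:
  fixes w :: "'v \<Rightarrow> real^3" and lf :: "'v set \<Rightarrow> real^3 \<Rightarrow> real"
  assumes V: "finite V" and E: "\<And>a. a \<in> E \<Longrightarrow> a \<subseteq> V \<and> card a = 2"
    and lf: "\<And>a. a \<in> E \<Longrightarrow> lf a \<in> lin"
    and w: "\<And>i. i \<in> V \<Longrightarrow> w i \<noteq> 0"
    and lfw: "\<And>a i. a \<in> E \<Longrightarrow> i \<in> V \<Longrightarrow> lf a (w i) = 0 \<longleftrightarrow> i \<in> a"
    and ker: "\<And>a y. a \<in> E \<Longrightarrow> y \<in> lin \<Longrightarrow> (\<And>i. i \<in> a \<Longrightarrow> y (w i) = 0) \<Longrightarrow> y \<in> span {lf a}"
    and deg: "\<And>i. i \<in> V \<Longrightarrow> 3 \<le> card {a \<in> E. i \<in> a}"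
    and n: "4 \<le> card V" and m: "2 * e < min (card V) 6 * m"
  shows "H e \<subseteq> power_ideal lin E lf (\<lambda>_. m) e"
  using m
proof (induction e arbitrary: m rule: less_induct)
  case (less e)
  have finE: "finite E" using V E by (meson Pow_iff finite_Pow_iff finite_subset subsetI)
  have e3: "e < 3 * m"
  proof -
    have "min (card V) 6 * m \<le> 6 * m" by (intro mult_right_mono) auto
    then show ?thesis using less.prems by linarith
  qed
  \<comment> \<open>\<open>A\<close> collects the directions already used; an edge has lost one unit
    for each of its ends in \<open>A\<close>.\<close>
  have sub: "H (e - card A) \<subseteq> power_ideal lin E lf (\<lambda>a. m - card (a \<inter> A)) (e - card A)"
    if "A \<subseteq> V" "card A \<le> e" for A
    using that
  proof (induction "card (V - A)" arbitrary: A)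
    case 0
    then have A: "A = V" using V by auto
    then have en: "card V \<le> e" using 0 by simp
    \<comment> \<open>For \<open>m \<le> 1\<close> the hypothesis would give
      \<open>2 * e < card V\<close>, against \<open>card V \<le> e\<close>.\<close>
    have "2 \<le> m"
    proof (rule ccontr)
      assume "\<not> 2 \<le> m"
      then have "min (card V) 6 * m \<le> min (card V) 6 * 1" by (intro mult_left_mono) auto
      then show False using less.prems en n by linarith
    qed
    then obtain m' where m': "m = m' + 2" by (metis add.commute le_Suc_ex)
    \<comment> \<open>The left side has fallen by \<open>2 * card V\<close>, the right side by twice
      the minimum, which is no larger.\<close>
    have "2 * (e - card V) < min (card V) 6 * m'"
      using less.prems en unfolding m' by (auto simp: distrib_left min_def split: if_splits)
    then have "H (e - card V) \<subseteq> power_ideal lin E lf (\<lambda>_. m') (e - card V)"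
      using en n by (intro less.IH) auto
    also have "power_ideal lin E lf (\<lambda>_. m') (e - card V) = power_ideal lin E lf (\<lambda>a. m - card (a \<inter> A)) (e - card V)"
    proof -
      have "m - card (a \<inter> A) = m'" if "a \<in> E" for a
        using E[OF that] A m' by (simp add: Int_absorb2)
      then show ?thesis by (intro power_ideal_cong) simp
    qed
    finally show ?case using A by simp
  next
    case (Suc x)
    have "card (V - A) \<noteq> 0" using Suc.hyps(2) by simp
    then have "V - A \<noteq> {}" by (metis card.empty)
    then obtain k where k: "k \<in> V" "k \<notin> A" by blast
    have finA: "finite A" using Suc.prems V finite_subset by blast
    let ?M = "\<lambda>a. m - card (a \<inter> A)"
    let ?e = "e - card A"
    let ?J = "{a \<in> E. k \<in> a}"
    define v where "v a = w (SOME j. j \<in> a \<and> j \<noteq> k)" for a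
    have other: "\<exists>j\<in>V. a = {k, j} \<and> j \<noteq> k \<and> v a = w j" if a: "a \<in> ?J" for a
    proof -
      obtain j where j: "a = {k, j}" "j \<noteq> k"
        using a E[of a] by (auto simp: card_2_iff)
      then have "(SOME j. j \<in> a \<and> j \<noteq> k) = j" by (intro some_equality) auto
      then show ?thesis using j a E[of a] by (auto simp: v_def)
    qed
    let ?Y = "{y \<in> lin. y (w k) = 0}"
    have sY: "subspace ?Y" using subspace_lin by (auto simp: subspace_def)
    have "?e < sum ?M ?J"
    proof -
      \<comment> \<open>Edges at \<open>k\<close> have distinct other ends and \<open>k\<close> is
        not in \<open>A\<close>, so \<open>A\<close> is met at most \<open>card A\<close> times in
        total.\<close>
      have "(\<Sum>a\<in>?J. card (a \<inter> A)) = card (\<Union>a\<in>?J. a \<inter> A)"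
      proof (rule card_UN_disjoint[symmetric])
        show "finite ?J" using finE by simp
        show "\<forall>a\<in>?J. finite (a \<inter> A)" using finA by auto
        show "\<forall>a\<in>?J. \<forall>b\<in>?J. a \<noteq> b \<longrightarrow> a \<inter> A \<inter> (b \<inter> A) = {}"
          using other k(2) by fastforce
      qed
      also have "\<dots> \<le> card A" using finA by (intro card_mono) auto
      finally have 1: "(\<Sum>a\<in>?J. card (a \<inter> A)) \<le> card A" .
      have "3 * m \<le> (\<Sum>a\<in>?J. m)" using deg[OF k(1)] by simp
      also have "\<dots> \<le> (\<Sum>a\<in>?J. ?M a + card (a \<inter> A))" by (intro sum_mono) auto
      also have "\<dots> \<le> sum ?M ?J + card A" using 1 by (simp add: sum.distrib)
      finally show ?thesis using e3 Suc.prems by linarith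
    qed
    then have "pw ?Y ?e \<subseteq> power_ideal ?Y ?J lf ?M ?e"
    proof (rule binary_forms_power_ideal[OF sY, rotated -1, where v = v])
      show "?Y \<subseteq> lin" "finite ?J" using finE by auto
      show "lf j \<in> ?Y" if "j \<in> ?J" for j using that lf lfw k by auto
      show "lf a (v b) = 0 \<longleftrightarrow> a = b" if ab: "a \<in> ?J" "b \<in> ?J" for a b
      proof -
        obtain j where j: "j \<in> V" "b = {k, j}" "j \<noteq> k" "v b = w j" using other[OF ab(2)] by blast
        obtain i where i: "a = {k, i}" "i \<noteq> k" using other[OF ab(1)] by blast
        show ?thesis using lfw[of a j] ab i j by (auto simp: doubleton_eq_iff)
      qed
      show "y \<in> span {lf a}" if "a \<in> ?J" "y \<in> ?Y" "y (v a) = 0" for a y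
        using other[OF that(1)] that by (intro ker) auto
    qed
    also have "\<dots> \<subseteq> power_ideal lin E lf ?M ?e"
    proof -
      have "pw ?Y k' \<subseteq> H k'" for k' by (intro pw_mono) auto
      then show ?thesis unfolding power_ideal_def by (intro span_mono) blast
    qed
    finally have 1: "pw ?Y ?e \<subseteq> power_ideal lin E lf ?M ?e" .
    show ?case
    proof (rule power_ideal_derivative_step[OF subspace_lin order_refl lf, where \<mu> = "\<lambda>x. w k \<bullet> x" and v = "w k"])
      show "(\<lambda>x. w k \<bullet> x) \<in> lin" by (auto simp: lin_def)
      show "w k \<bullet> w k \<noteq> 0" using w k by simp
      show "pw ?Y ?e \<subseteq> power_ideal lin E lf ?M ?e" by (rule 1)
      fix e' assume e': "e - card A = Suc e'"
      let ?M' = "\<lambda>j. if lf j (w k) = 0 then ?M j - 1 else ?M j"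
      have "card (insert k A) = Suc (card A)" using k finA by simp
      then have eq: "e' = e - card (insert k A)" and le: "card (insert k A) \<le> e" using e' by linarith+
      have "x = card (V - insert k A)"
        using Suc.hyps(2) k V by (metis Diff_insert card_Diff_singleton Diff_iff diff_Suc_1)
      then have "H e' \<subseteq> power_ideal lin E lf (\<lambda>a. m - card (a \<inter> insert k A)) e'"
        unfolding eq using Suc.prems k le by (intro Suc.hyps(1)) auto
      also have "\<dots> = power_ideal lin E lf ?M' e'"
      proof -
        have "m - card (a \<inter> insert k A) = ?M' a" if "a \<in> E" for a
        proof (cases "k \<in> a")
          case True
          then have "a \<inter> insert k A = insert k (a \<inter> A)" by auto
          then show ?thesis using True that lfw k finA by simp
        qed (use that lfw k in auto)
        then show ?thesis by (rule power_ideal_cong)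
      qed
      finally show "H e' \<subseteq> power_ideal lin E lf ?M' e'" .
    qed
  qed
  show ?case using sub[of "{}"] by simp
qed

text \<open>For the deficiency \<open>e - r\<close> the condition on the exponent reads
  \<open>r + 1 \<le> s\<close>.\<close>

lemma power_ideal_subset_powers:
  assumes "\<And>j. j \<in> J \<Longrightarrow> l j \<in> lin" "r + 1 \<le> e"
  shows "power_ideal lin J l (\<lambda>_. e - r) e \<subseteq> span {l j ^ (r + 1) * q |j q. j \<in> J \<and> q \<in> pw lin (e - (r + 1))}"
  unfolding power_ideal_def
proof (rule span_mono, rule subsetI)
  fix x assume "x \<in> {l j ^ s * q |j s k q. j \<in> J \<and> q \<in> pw lin k \<and> s + k = e \<and> e + 1 \<le> s + (e - r)}"
  then obtain j s k q where x: "x = l j ^ s * q" "j \<in> J" "q \<in> pw lin k" "s + k = e" "e + 1 \<le> s + (e - r)"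
    by blast
  then have "r + 1 \<le> s" using assms(2) by linarith
  then obtain u where u: "s = (r + 1) + u" by (auto simp: le_iff_add)
  have "l j ^ u * q \<in> pw lin (u + k)" by (rule pw_mult[OF pw_power1[OF assms(1)[OF x(2)]] x(3)])
  moreover have "u + k = e - (r + 1)" using u x(4) by linarith
  moreover have "x = l j ^ (r + 1) * (l j ^ u * q)" unfolding x(1) u power_add by (simp add: mult.assoc)
  ultimately show "x \<in> {l j ^ (r + 1) * q |j q. j \<in> J \<and> q \<in> pw lin (e - (r + 1))}" using x(2) by auto
qed

subsection \<open>Bernstein bases\<close>

text \<open>The \<open>b w\<close> are barycentric coordinates. Their monomials of degree
  \<open>d\<close> are the Bernstein basis up to multinomial factors, and the exponent at a vertex
  governs the order of vanishing there.\<close>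

locale bary_tet =
  fixes X :: "(real^3) set" and b :: "real^3 \<Rightarrow> real^3 \<Rightarrow> real"
  assumes finX: "finite X" and cardX: "card X = 4"
    and b_aff: "w \<in> X \<Longrightarrow> b w \<in> aff"
    and b_delta: "w \<in> X \<Longrightarrow> w' \<in> X \<Longrightarrow> b w w' = (if w = w' then 1 else 0)"
    and b_sum: "(\<Sum>w\<in>X. b w x) = 1"
    and b_point: "(\<Sum>w\<in>X. b w x *\<^sub>R w) = x"

text \<open>The differences to one vertex \<open>g\<close> form a basis of the space; its dual basis
  gives three coordinates, and that of \<open>g\<close> completes the sum to 1.\<close>

lemma bary_tet_exists:
  assumes "\<not> affine_dependent X" "card X = 4"
  shows "\<exists>b. bary_tet X b"
proof -
  have fin: "finite X" using assms(2) by (metis card.infinite zero_neq_numeral)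
  obtain g where g: "g \<in> X" using assms(2) by fastforce
  define B where "B = (\<lambda>w. w - g) ` (X - {g})"
  have "X = insert g (X - {g})" using g by auto
  then have indB: "independent B"
    using assms(1) affine_dependent_iff_dependent[of g "X - {g}"] unfolding B_def
    by (metis Diff_iff image_cong insertI1 uminus_add_conv_diff)
  have injB: "inj_on (\<lambda>w. w - g) (X - {g})" by (auto intro: inj_onI)
  have cardB: "card B = 3" unfolding B_def using card_image[OF injB] g fin assms(2) by simp
  have "dim B = 3" using indB cardB dim_eq_card_independent by metis
  then have spanB: "span B = UNIV"
    using dim_eq_full[of B] by (simp add: DIM_cart)
  have "\<exists>l. linear l \<and> (\<forall>x\<in>B. l x = (if x = w - g then 1 else 0 :: real))" for w
    using linear_independent_extend[OF indB, of "\<lambda>x. if x = w - g then 1 else 0 :: real"] by blast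
  then obtain l where l: "\<And>w. linear (l w)" "\<And>w x. x \<in> B \<Longrightarrow> l w x = (if x = w - g then 1 else 0 :: real)"
    by metis
  have rep: "y = (\<Sum>w\<in>X - {g}. l w y *\<^sub>R (w - g))" for y
  proof -
    have "y \<in> span B" using spanB by simp
    then show ?thesis
    proof (induction rule: span_induct_alt)
      case base
      then show ?case by (simp add: linear_0[OF l(1)])
    next
      case (step c x y)
      obtain v where v: "v \<in> X - {g}" "x = v - g" using step(1) by (auto simp: B_def)
      have "(\<Sum>w\<in>X - {g}. l w x *\<^sub>R (w - g)) = (\<Sum>w\<in>X - {g}. if w = v then w - g else 0)"
        using v l(2)[OF step(1)] by (intro sum.cong) auto
      also have "\<dots> = x" using v fin by simp
      finally show ?case using step(2)
        by (simp add: linear_add[OF l(1)] linear_scale[OF l(1)] scaleR_add_left sum.distrib scaleR_sum_right[symmetric] flip: scaleR_scaleR)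
    qed
  qed
  define b where "b w x = (if w = g then 1 - (\<Sum>w\<in>X - {g}. l w (x - g)) else l w (x - g))" for w x
  have "bary_tet X b"
  proof
    show "finite X" "card X = 4" using fin assms by auto
    show "b w w' = (if w = w' then 1 else 0)" if "w \<in> X" "w' \<in> X" for w w'
    proof -
      have lw: "l v (w' - g) = (if v = w' \<and> w' \<noteq> g then 1 else 0)" if "v \<in> X - {g}" for v
      proof (cases "w' = g")
        case False
        then have "w' - g \<in> B" using \<open>w' \<in> X\<close> by (auto simp: B_def)
        then show ?thesis using l(2) False by auto
      qed (simp add: linear_0[OF l(1)])
      have "(\<Sum>v\<in>X - {g}. l v (w' - g)) = (\<Sum>v\<in>X - {g}. if v = w' then (if w' \<noteq> g then 1 else 0) else 0)"
        using lw by (intro sum.cong) auto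
      also have "\<dots> = (if w' = g then 0 else 1)" using that fin by auto
      finally show ?thesis using lw that by (auto simp: b_def)
    qed
    have split: "(\<Sum>w\<in>X. f w) = f g + (\<Sum>w\<in>X - {g}. f w)" for f :: "real^3 \<Rightarrow> 'z::comm_monoid_add"
      using g fin by (simp add: sum.remove)
    show "(\<Sum>w\<in>X. b w x) = 1" for x
      unfolding split by (simp add: b_def)
    show "(\<Sum>w\<in>X. b w x *\<^sub>R w) = x" for x
    proof -
      have "(\<Sum>w\<in>X. b w x *\<^sub>R w) = g + (\<Sum>w\<in>X - {g}. l w (x - g) *\<^sub>R (w - g))"
        unfolding split by (simp add: b_def scaleR_diff_left scaleR_sum_left scaleR_diff_right sum_subtractf)
      also have "\<dots> = g + (x - g)" using rep[of "x - g"] by simp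
      finally show ?thesis by simp
    qed
    have l_aff: "(\<lambda>x. l w (x - g)) \<in> aff" for w
    proof -
      obtain a where "l w = (\<lambda>x. a \<bullet> x)" using linear_lin[OF l(1)] by (auto simp: lin_def)
      then have "(\<lambda>x. l w (x - g)) = (\<lambda>x. - (a \<bullet> g) + a \<bullet> x)" by (auto simp: inner_diff_right)
      then show ?thesis unfolding aff_def by blast
    qed
    have "(\<lambda>x. 1) = (\<lambda>x::real^3. 1 + 0 \<bullet> x)" by simp
    then have "(\<lambda>x::real^3. 1) \<in> aff" unfolding aff_def by blast
    then have "(\<lambda>x. 1) - (\<Sum>w\<in>X - {g}. (\<lambda>x. l w (x - g))) \<in> aff"
      by (intro subspace_diff subspace_sum subspace_aff l_aff)
    moreover have "(\<lambda>x. 1) - (\<Sum>w\<in>X - {g}. (\<lambda>x. l w (x - g))) = b g"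
      by (auto simp: fun_eq_iff b_def sum_fun_apply)
    moreover have "b w = (\<lambda>x. l w (x - g))" if "w \<noteq> g" for w using that by (auto simp: b_def)
    ultimately show "b w \<in> aff" if "w \<in> X" for w using l_aff by (cases "w = g") auto
  qed
  then show ?thesis by blast
qed

context bary_tet
begin

lemma aff_eq:
  assumes "l \<in> aff"
  shows "l = (\<Sum>w\<in>X. l w *\<^sub>R b w)"
proof
  fix x
  obtain c a where l: "l = (\<lambda>x. c + a \<bullet> x)" using assms by (auto simp: aff_def)
  have "(\<Sum>w\<in>X. l w *\<^sub>R b w) x = c * (\<Sum>w\<in>X. b w x) + a \<bullet> (\<Sum>w\<in>X. b w x *\<^sub>R w)"
    by (simp add: sum_fun_apply l inner_sum_right sum_distrib_left sum.distrib algebra_simps)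
  then show "l x = (\<Sum>w\<in>X. l w *\<^sub>R b w) x" by (simp add: b_sum b_point l)
qed

lemma P_eq: "P d = span (mon X b ` exps X d)"
proof (rule pw_eq_span_mon[OF finX])
  show "b ` X \<subseteq> aff" using b_aff by auto
  show "aff \<subseteq> span (b ` X)"
  proof
    fix l :: "real^3 \<Rightarrow> real" assume "l \<in> aff"
    then show "l \<in> span (b ` X)"
      by (subst aff_eq) (auto intro!: span_sum span_scale intro: span_base)
  qed
qed

lemma mon_in_P: "\<alpha> \<in> exps X d \<Longrightarrow> mon X b \<alpha> \<in> P d"
  unfolding P_eq by (intro span_base) auto

text \<open>On a line through \<open>\<gamma>\<close> the coordinate of \<open>\<gamma>\<close> is 1
  + t u and the others are t times linear forms. The monomial therefore has order
  \<open>d - \<alpha> \<gamma>\<close>, and the binomial theorem gives the higher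
  components.\<close>

lemma comp_mon:
  assumes "\<gamma> \<in> X" "\<alpha> \<in> exps X d" "e \<le> d"
  shows "comp d \<gamma> e (mon X b \<alpha>) = (if e < d - \<alpha> \<gamma> then 0 else
    real (\<alpha> \<gamma> choose (e - (d - \<alpha> \<gamma>))) *\<^sub>R (ldir (b \<gamma>) ^ (e - (d - \<alpha> \<gamma>)) * mon (X - {\<gamma>}) (\<lambda>w. ldir (b w)) \<alpha>))"
proof -
  let ?k = "\<alpha> \<gamma>" and ?M = "mon (X - {\<gamma>}) (\<lambda>w. ldir (b w)) \<alpha>"
  let ?o = "d - ?k"
  have kd: "?k \<le> d" using exps_le[OF finX assms(2)] .
  have so: "sum \<alpha> (X - {\<gamma>}) = ?o"
    using assms finX sum.remove[of X \<gamma> \<alpha>] by (auto simp: exps_def)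
  let ?h = "\<lambda>e. if e < ?o then 0 else real (?k choose (e - ?o)) *\<^sub>R (ldir (b \<gamma>) ^ (e - ?o) * ?M)"
  have "expansion \<gamma> d (mon X b \<alpha>) ?h"
    unfolding expansion_def
  proof (intro allI)
    fix y t
    let ?u = "ldir (b \<gamma>) y"
    have bw: "b w (\<gamma> + t *\<^sub>R y) = t * ldir (b w) y" if "w \<in> X - {\<gamma>}" for w
      using aff_line[OF b_aff, of w \<gamma> t y] b_delta assms(1) that by auto
    have bg: "b \<gamma> (\<gamma> + t *\<^sub>R y) = 1 + t * ?u"
      using aff_line[OF b_aff[OF assms(1)], of \<gamma> t y] b_delta assms(1) by auto
    have "mon X b \<alpha> (\<gamma> + t *\<^sub>R y) = mon X (\<lambda>w. b w (\<gamma> + t *\<^sub>R y)) \<alpha>" by (rule mon_apply)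
    also have "\<dots> = b \<gamma> (\<gamma> + t *\<^sub>R y) ^ ?k * (\<Prod>w\<in>X - {\<gamma>}. b w (\<gamma> + t *\<^sub>R y) ^ \<alpha> w)"
      unfolding mon_def using finX assms(1) by (simp add: prod.remove[of X \<gamma>])
    also have "(\<Prod>w\<in>X - {\<gamma>}. b w (\<gamma> + t *\<^sub>R y) ^ \<alpha> w) = (\<Prod>w\<in>X - {\<gamma>}. t ^ \<alpha> w * ldir (b w) y ^ \<alpha> w)"
      using bw by (intro prod.cong) (auto simp: power_mult_distrib)
    also have "\<dots> = t ^ ?o * ?M y"
    proof -
      have "?M y = (\<Prod>w\<in>X - {\<gamma>}. ldir (b w) y ^ \<alpha> w)" by (simp only: mon_apply) (simp only: mon_def)
      then show ?thesis by (simp add: prod.distrib power_sum so[symmetric])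
    qed
    also have "b \<gamma> (\<gamma> + t *\<^sub>R y) ^ ?k = (\<Sum>i\<le>?k. real (?k choose i) * (t * ?u) ^ i)"
      unfolding bg using binomial_ring[of "t * ?u" 1 ?k] by (simp add: add.commute mult.assoc)
    also have "\<dots> * (t ^ ?o * ?M y) = (\<Sum>i\<in>{0..?k}. real (?k choose i) * ?u ^ i * ?M y * t ^ (i + ?o))"
      by (simp add: sum_distrib_left sum_distrib_right power_mult_distrib power_add mult_ac atMost_atLeast0)
    also have "\<dots> = (\<Sum>i\<in>{0..?k}. ?h (i + ?o) y * t ^ (i + ?o))"
      by (intro sum.cong) auto
    also have "\<dots> = (\<Sum>e\<in>{0 + ?o..?k + ?o}. ?h e y * t ^ e)"
      by (rule sum.shift_bounds_cl_nat_ivl[symmetric])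
    also have "\<dots> = (\<Sum>e\<le>d. ?h e y * t ^ e)"
      using kd by (intro sum.mono_neutral_left) auto
    finally show "mon X b \<alpha> (\<gamma> + t *\<^sub>R y) = (\<Sum>e\<le>d. ?h e y * t ^ e)" .
  qed
  from comp_expansion[OF this assms(3)] show ?thesis .
qed

text \<open>Triangularity at one vertex: in degree \<open>d - \<alpha> \<gamma>\<close>, monomials
  with a smaller exponent at \<open>\<gamma>\<close> have not yet started, those with a larger one
  have coefficient 0 by induction, and the rest are monomials in three independent linear
  forms.\<close>

lemma coeffs_vanish_at_vertex:
  assumes g: "\<gamma> \<in> X" and N: "N \<le> Suc d"
    and p: "p = (\<Sum>\<alpha>\<in>exps X d. c \<alpha> *\<^sub>R mon X b \<alpha>)" and van: "\<And>e. e < N \<Longrightarrow> comp d \<gamma> e p = 0"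
    and a: "\<alpha> \<in> exps X d" "d - \<alpha> \<gamma> < N"
  shows "c \<alpha> = 0"
  using a
proof (induction "d - \<alpha> \<gamma>" arbitrary: \<alpha> rule: less_induct)
  case less
  let ?o = "d - \<alpha> \<gamma>"
  let ?S = "{\<beta> \<in> exps X d. \<beta> \<gamma> = \<alpha> \<gamma>}"
  let ?b = "\<lambda>w. ldir (b w)"
  have od: "?o \<le> d" by simp
  have ak: "\<alpha> \<gamma> \<le> d" using exps_le[OF finX less.prems(1)] .
  have "0 = comp d \<gamma> ?o p" using van less.prems(2) by simp
  also have "\<dots> = (\<Sum>\<beta>\<in>exps X d. c \<beta> *\<^sub>R comp d \<gamma> ?o (mon X b \<beta>))"
    unfolding p by (simp only: linear_sum[OF linear_comp] linear_scale[OF linear_comp])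
  also have "\<dots> = (\<Sum>\<beta>\<in>?S. c \<beta> *\<^sub>R mon (X - {\<gamma>}) ?b \<beta>)"
  proof (rule sum.mono_neutral_cong_right)
    show "\<forall>\<beta>\<in>exps X d - ?S. c \<beta> *\<^sub>R comp d \<gamma> ?o (mon X b \<beta>) = 0"
    proof
      fix \<beta> assume \<beta>: "\<beta> \<in> exps X d - ?S"
      then have \<beta>1: "\<beta> \<in> exps X d" "\<beta> \<gamma> \<noteq> \<alpha> \<gamma>" "\<beta> \<gamma> \<le> d" using exps_le[OF finX] by auto
      show "c \<beta> *\<^sub>R comp d \<gamma> ?o (mon X b \<beta>) = 0"
      proof (cases "\<beta> \<gamma> < \<alpha> \<gamma>")
        case True
        then have "comp d \<gamma> ?o (mon X b \<beta>) = 0"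
          using comp_mon[OF g \<beta>1(1) od] \<beta>1 ak by auto
        then show ?thesis by simp
      next
        case False
        then have "c \<beta> = 0" using less.hyps[of \<beta>] \<beta>1 less.prems(2) ak by auto
        then show ?thesis by simp
      qed
    qed
    show "c \<beta> *\<^sub>R comp d \<gamma> ?o (mon X b \<beta>) = c \<beta> *\<^sub>R mon (X - {\<gamma>}) ?b \<beta>" if "\<beta> \<in> ?S" for \<beta>
      using comp_mon[OF g _ od, of \<beta>] that by auto
  qed (use finX in auto)
  also have "\<dots> = (\<Sum>\<beta>\<in>?S. c ((\<beta>(\<gamma> := 0))(\<gamma> := \<alpha> \<gamma>)) *\<^sub>R mon (X - {\<gamma>}) ?b (\<beta>(\<gamma> := 0)))"
  proof (rule sum.cong[OF refl])
    fix \<beta> assume "\<beta> \<in> ?S"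
    then have "(\<beta>(\<gamma> := 0))(\<gamma> := \<alpha> \<gamma>) = \<beta>" by (auto simp: fun_eq_iff)
    moreover have "mon (X - {\<gamma>}) ?b (\<beta>(\<gamma> := 0)) = mon (X - {\<gamma>}) ?b \<beta>" by (intro mon_cong) auto
    ultimately show "c \<beta> *\<^sub>R mon (X - {\<gamma>}) ?b \<beta> = c ((\<beta>(\<gamma> := 0))(\<gamma> := \<alpha> \<gamma>)) *\<^sub>R mon (X - {\<gamma>}) ?b (\<beta>(\<gamma> := 0))"
      by (simp only:)
  qed
  also have "\<dots> = (\<Sum>\<beta>\<in>exps (X - {\<gamma>}) ?o. c (\<beta>(\<gamma> := \<alpha> \<gamma>)) *\<^sub>R mon (X - {\<gamma>}) ?b \<beta>)"
    by (rule sum.reindex_bij_betw[OF exps_restrict[OF finX g ak]])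
  finally have eq: "(\<Sum>\<beta>\<in>exps (X - {\<gamma>}) ?o. c (\<beta>(\<gamma> := \<alpha> \<gamma>)) *\<^sub>R mon (X - {\<gamma>}) ?b \<beta>) = 0" by (rule sym)
  have "\<forall>\<beta>\<in>exps (X - {\<gamma>}) ?o. c (\<beta>(\<gamma> := \<alpha> \<gamma>)) = 0"
  proof (rule mon_independent_fun[OF _ _ _ _ _ eq, where w = "\<lambda>w. w - \<gamma>"])
    show "linear (?b i)" if "i \<in> X - {\<gamma>}" for i using ldir_lin[OF b_aff] lin_linear that by blast
    show "?b i (j - \<gamma>) = (if i = j then 1 else 0)" if "i \<in> X - {\<gamma>}" "j \<in> X - {\<gamma>}" for i j
    proof -
      have "b i (\<gamma> + (j - \<gamma>)) = b i \<gamma> + ?b i (j - \<gamma>)" using that by (intro aff_plus b_aff) auto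
      then show ?thesis using that b_delta g by auto
    qed
    show "finite (exps (X - {\<gamma>}) ?o)" using finX by simp
    show "\<beta> i = 0" if "\<beta> \<in> exps (X - {\<gamma>}) ?o" "i \<notin> X - {\<gamma>}" for \<beta> i
    proof -
      have "\<forall>i. i \<notin> X - {\<gamma>} \<longrightarrow> \<beta> i = 0"
        using that(1)[unfolded exps_def mem_Collect_eq, THEN conjunct1] .
      from this[rule_format, OF that(2)] show ?thesis .
    qed
  qed (use finX in auto)
  moreover have "\<alpha>(\<gamma> := 0) \<in> exps (X - {\<gamma>}) ?o"
    using exps_restrict[OF finX g ak] less.prems(1) unfolding bij_betw_def by blast
  ultimately have "c ((\<alpha>(\<gamma> := 0))(\<gamma> := \<alpha> \<gamma>)) = 0" by blast
  then show ?case by simp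
qed

text \<open>At a single vertex, \<open>N = d + 1\<close> reaches every exponent.\<close>

lemma bernstein_independent:
  assumes "(\<Sum>\<alpha>\<in>exps X d. c \<alpha> *\<^sub>R mon X b \<alpha>) = 0" "\<alpha> \<in> exps X d"
  shows "c \<alpha> = 0"
proof -
  obtain g where "g \<in> X" using cardX by fastforce
  then show ?thesis
    using assms linear_0[OF linear_comp]
    by (intro coeffs_vanish_at_vertex[of g "Suc d" d 0 c \<alpha>]) auto
qed

lemma P_coeffs:
  assumes "p \<in> P d" obtains c where "p = (\<Sum>\<alpha>\<in>exps X d. c \<alpha> *\<^sub>R mon X b \<alpha>)"
  using assms unfolding P_eq span_family[OF finite_exps[OF finX]] by blast

lemma dim_span_mon: "F \<subseteq> exps X d \<Longrightarrow> dim (span (mon X b ` F)) = card F"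
proof (rule dim_span_family)
  assume F: "F \<subseteq> exps X d"
  show "finite F" using F finX finite_exps finite_subset by blast
  fix c assume 0: "(\<Sum>\<alpha>\<in>F. c \<alpha> *\<^sub>R mon X b \<alpha>) = 0"
  have "(\<Sum>\<alpha>\<in>exps X d. (if \<alpha> \<in> F then c \<alpha> else 0) *\<^sub>R mon X b \<alpha>) = (\<Sum>\<alpha>\<in>F. c \<alpha> *\<^sub>R mon X b \<alpha>)"
    using F finX by (intro sum.mono_neutral_cong_right) auto
  then have 1: "(if \<alpha> \<in> F then c \<alpha> else 0) = 0" if "\<alpha> \<in> exps X d" for \<alpha>
    using bernstein_independent[of "\<lambda>\<alpha>. if \<alpha> \<in> F then c \<alpha> else 0" d] 0 that by auto
  show "\<forall>\<alpha>\<in>F. c \<alpha> = 0"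
  proof
    fix \<alpha> assume "\<alpha> \<in> F"
    then show "c \<alpha> = 0" using 1[of \<alpha>] F by (simp add: subsetD)
  qed
qed

lemma dim_P: "dim (P d) = (d + 3) choose 3"
  using dim_span_mon[of "exps X d" d] card_exps[OF finX, of 3 d] cardX by (simp add: P_eq)

lemma fin_dim_P: "fin_dim (P d)"
  unfolding P_eq by (intro fin_dim_span_mon finX)

lemma mon_factor:
  assumes "w \<in> X" "\<alpha> \<in> exps X d" "s \<le> \<alpha> w"
  shows "mon X b \<alpha> = b w ^ s * mon X b (\<alpha>(w := \<alpha> w - s))" "\<alpha>(w := \<alpha> w - s) \<in> exps X (d - s)"
proof -
  have "mon X b \<alpha> = b w ^ \<alpha> w * mon (X - {w}) b \<alpha>" by (rule mon_remove[OF finX assms(1)])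
  also have "b w ^ \<alpha> w = b w ^ s * b w ^ (\<alpha> w - s)" using assms(3) by (simp add: power_add[symmetric])
  also have "mon (X - {w}) b \<alpha> = mon (X - {w}) b (\<alpha>(w := \<alpha> w - s))" by (intro mon_cong) auto
  finally show "mon X b \<alpha> = b w ^ s * mon X b (\<alpha>(w := \<alpha> w - s))"
    by (subst (2) mon_remove[OF finX assms(1)]) (simp only: mult.assoc fun_upd_same)
  have "sum \<alpha> X = \<alpha> w + sum \<alpha> (X - {w})" using finX assms(1) by (simp add: sum.remove)
  moreover have "sum (\<alpha>(w := \<alpha> w - s)) X = (\<alpha> w - s) + sum \<alpha> (X - {w})"
    using finX assms(1) by (subst sum.remove[of X w]) (auto intro!: sum.cong)
  ultimately show "\<alpha>(w := \<alpha> w - s) \<in> exps X (d - s)"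
    using assms by (auto simp: exps_def)
qed

text \<open>Multiplication by a power of a coordinate shifts exponents, so distinct Bernstein
  monomials stay distinct.\<close>

lemma inj_on_mult_power:
  assumes "w \<in> X" "q \<in> P k" "b w ^ s * q = 0"
  shows "q = 0"
proof -
  obtain c where c: "q = (\<Sum>\<alpha>\<in>exps X k. c \<alpha> *\<^sub>R mon X b \<alpha>)" using P_coeffs[OF assms(2)] .
  let ?f = "\<lambda>\<alpha>. \<alpha>(w := \<alpha> w + s)"
  have f: "?f \<alpha> \<in> exps X (k + s)" if "\<alpha> \<in> exps X k" for \<alpha>
  proof -
    have "sum \<alpha> X = \<alpha> w + sum \<alpha> (X - {w})" using finX assms(1) by (simp add: sum.remove)
    moreover have "sum (?f \<alpha>) X = (\<alpha> w + s) + sum \<alpha> (X - {w})"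
      using finX assms(1) by (subst sum.remove[of X w]) (auto intro!: sum.cong)
    ultimately show ?thesis using that assms(1) by (auto simp: exps_def)
  qed
  have inj: "inj_on ?f (exps X k)"
    by (rule inj_onI) (metis add_right_cancel fun_upd_eqD fun_upd_triv fun_upd_upd)
  have "b w ^ s * q = (\<Sum>\<alpha>\<in>exps X k. c \<alpha> *\<^sub>R mon X b (?f \<alpha>))"
    unfolding c sum_distrib_left
  proof (rule sum.cong[OF refl])
    fix \<alpha> assume a: "\<alpha> \<in> exps X k"
    have "mon X b (?f \<alpha>) = b w ^ s * mon X b ((?f \<alpha>)(w := ?f \<alpha> w - s))"
      by (rule mon_factor(1)[OF assms(1) f[OF a]]) simp
    then have "mon X b (?f \<alpha>) = b w ^ s * mon X b \<alpha>" by (simp only: fun_upd_same add_diff_cancel_right' fun_upd_upd fun_upd_triv)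
    then show "b w ^ s * (c \<alpha> *\<^sub>R mon X b \<alpha>) = c \<alpha> *\<^sub>R mon X b (?f \<alpha>)" by (simp only: mult_scaleR_right)
  qed
  also have "\<dots> = (\<Sum>\<beta>\<in>?f ` exps X k. c (\<beta>(w := \<beta> w - s)) *\<^sub>R mon X b \<beta>)"
    by (subst sum.reindex[OF inj]) (simp add: o_def)
  also have "\<dots> = (\<Sum>\<beta>\<in>exps X (k + s). (if \<beta> \<in> ?f ` exps X k then c (\<beta>(w := \<beta> w - s)) else 0) *\<^sub>R mon X b \<beta>)"
    using f finX by (intro sum.mono_neutral_cong_left) auto
  finally have 0: "(\<Sum>\<beta>\<in>exps X (k + s). (if \<beta> \<in> ?f ` exps X k then c (\<beta>(w := \<beta> w - s)) else 0) *\<^sub>R mon X b \<beta>) = 0"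
    using assms(3) by simp
  have "c \<alpha> = 0" if a: "\<alpha> \<in> exps X k" for \<alpha>
    using bernstein_independent[OF 0 f[OF a]] a by simp
  then show ?thesis unfolding c by simp
qed

lemma dim_mult_power:
  assumes "w \<in> X"
  shows "dim ((\<lambda>q. b w ^ s * q) ` P k) = (k + 3) choose 3"
  using dim_image_inj[OF linear_mult_left[of "b w ^ s"] subspace_pw fin_dim_P] inj_on_mult_power[OF assms] dim_P
  by simp

text \<open>For \<open>S \<subseteq> X\<close>, the exponents of the Bernstein monomials vanishing
  to order \<open>N\<close> at the points of \<open>S\<close>; the additive inequality avoids
  truncated subtraction.\<close>

definition flat :: "nat \<Rightarrow> nat \<Rightarrow> (real^3) set \<Rightarrow> (real^3 \<Rightarrow> nat) set" where
  "flat d N S = {\<alpha> \<in> exps X d. \<forall>\<gamma>\<in>S. \<alpha> \<gamma> + N \<le> d}"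

lemma flat_subset: "flat d N S \<subseteq> exps X d" by (auto simp: flat_def)

lemma flat_space_eq:
  assumes "S \<subseteq> X" "N \<le> d"
  shows "{p \<in> P d. \<forall>\<gamma>\<in>S. \<forall>e<N. comp d \<gamma> e p = 0} = span (mon X b ` flat d N S)"
proof (intro subset_antisym subsetI)
  fix p assume p: "p \<in> {p \<in> P d. \<forall>\<gamma>\<in>S. \<forall>e<N. comp d \<gamma> e p = 0}"
  then obtain c where c: "p = (\<Sum>\<alpha>\<in>exps X d. c \<alpha> *\<^sub>R mon X b \<alpha>)" using P_coeffs by blast
  have "c \<alpha> = 0" if a: "\<alpha> \<in> exps X d - flat d N S" for \<alpha>
  proof -
    obtain \<gamma> where "\<gamma> \<in> S" "\<not> \<alpha> \<gamma> + N \<le> d" using a by (auto simp: flat_def)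
    moreover have "\<alpha> \<gamma> \<le> d" using a exps_le[OF finX] by blast
    ultimately show ?thesis
      using p c a assms by (intro coeffs_vanish_at_vertex[of \<gamma> N d p c \<alpha>]) auto
  qed
  then have "p = (\<Sum>\<alpha>\<in>flat d N S. c \<alpha> *\<^sub>R mon X b \<alpha>)"
    unfolding c using finX flat_subset by (intro sum.mono_neutral_right) auto
  then show "p \<in> span (mon X b ` flat d N S)" by (auto intro!: span_sum span_scale intro: span_base)
next
  fix p assume p: "p \<in> span (mon X b ` flat d N S)"
  have "subspace {p \<in> P d. \<forall>\<gamma>\<in>S. \<forall>e<N. comp d \<gamma> e p = 0}"
    unfolding subspace_def
    by (auto simp: linear_0[OF linear_comp] linear_add[OF linear_comp] linear_scale[OF linear_comp]
      intro: subspace_0 subspace_add subspace_scale simp del: pw.simps)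
  moreover have "mon X b ` flat d N S \<subseteq> {p \<in> P d. \<forall>\<gamma>\<in>S. \<forall>e<N. comp d \<gamma> e p = 0}"
  proof (clarify, intro CollectI conjI ballI allI impI)
    fix \<alpha> assume a: "\<alpha> \<in> flat d N S"
    then show "mon X b \<alpha> \<in> P d" using mon_in_P by (simp add: flat_def)
    fix \<gamma> e assume "\<gamma> \<in> S" "e < N"
    moreover have "e < d - \<alpha> \<gamma>" using a calculation by (auto simp: flat_def)
    ultimately show "comp d \<gamma> e (mon X b \<alpha>) = 0"
      using comp_mon[of \<gamma> \<alpha> d e] a assms by (auto simp: flat_def)
  qed
  ultimately show "p \<in> {p \<in> P d. \<forall>\<gamma>\<in>S. \<forall>e<N. comp d \<gamma> e p = 0}"
    using p span_minimal by blast
qed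

text \<open>The exponents excluded at one vertex are as many as the monomials of degree below
  \<open>N\<close> in three variables. No exponent is excluded at two vertices, since with
  \<open>2 * N \<le> d\<close> the two entries would sum to more than \<open>d\<close>.\<close>

lemma card_flat:
  assumes "S \<subseteq> X" "2 * N \<le> d"
  shows "card (flat d N S) + card S * ((N + 2) choose 3) = (d + 3) choose 3"
proof -
  have finS: "finite S" using assms finX finite_subset by blast
  let ?bad = "\<lambda>\<gamma>. {\<alpha> \<in> exps X d. d < \<alpha> \<gamma> + N}"
  have badc: "card (?bad \<gamma>) = (N + 2) choose 3" if g: "\<gamma> \<in> X" for \<gamma>
  proof (cases N)
    case 0
    have "?bad \<gamma> = {}" using exps_le[OF finX, of _ d \<gamma>] 0 by (auto simp: not_less)
    then have "card (?bad \<gamma>) = 0" by (simp only: card.empty)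
    then show ?thesis using 0 by (simp add: binomial_eq_0)
  next
    case (Suc N')
    have "?bad \<gamma> = (\<Union>k\<in>{..N'}. {\<alpha> \<in> exps X d. \<alpha> \<gamma> = d - k})"
    proof (intro subset_antisym subsetI)
      fix \<alpha> assume "\<alpha> \<in> ?bad \<gamma>"
      then have "\<alpha> \<in> exps X d" "d - \<alpha> \<gamma> \<le> N'" "\<alpha> \<gamma> = d - (d - \<alpha> \<gamma>)" using Suc exps_le[OF finX] by auto
      then show "\<alpha> \<in> (\<Union>k\<in>{..N'}. {\<alpha> \<in> exps X d. \<alpha> \<gamma> = d - k})" by blast
    qed (use Suc assms in auto)
    then have "card (?bad \<gamma>) = (\<Sum>k\<le>N'. card {\<alpha> \<in> exps X d. \<alpha> \<gamma> = d - k})"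
      using finX Suc assms by (simp only:, subst card_UN_disjoint) auto
    also have "\<dots> = (\<Sum>k\<le>N'. (k + 2) choose 2)"
    proof (rule sum.cong[OF refl])
      fix k assume "k \<in> {..N'}"
      then have "k \<le> d" using Suc assms by auto
      moreover have "card (X - {\<gamma>}) = Suc 2" using g cardX finX by simp
      ultimately show "card {\<alpha> \<in> exps X d. \<alpha> \<gamma> = d - k} = (k + 2) choose 2"
        using card_exps_restrict[OF finX g, of "d - k" d] card_exps[of "X - {\<gamma>}" 2 k] finX by simp
    qed
    also have "\<dots> = (N + 2) choose 3"
      using choose_rising_sum(1)[of 2 N'] Suc by (simp add: add.commute eval_nat_numeral)
    finally show ?thesis .
  qed
  have "exps X d = flat d N S \<union> (\<Union>\<gamma>\<in>S. ?bad \<gamma>)" by (auto simp: flat_def)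
  moreover have "flat d N S \<inter> (\<Union>\<gamma>\<in>S. ?bad \<gamma>) = {}" by (auto simp: flat_def)
  ultimately have "card (exps X d) = card (flat d N S) + card (\<Union>\<gamma>\<in>S. ?bad \<gamma>)"
    using finX finS by (metis (no_types, lifting) card_Un_disjoint finite_Un finite_exps)
  also have "card (\<Union>\<gamma>\<in>S. ?bad \<gamma>) = (\<Sum>\<gamma>\<in>S. card (?bad \<gamma>))"
  proof (rule card_UN_disjoint[OF finS])
    show "\<forall>i\<in>S. \<forall>j\<in>S. i \<noteq> j \<longrightarrow> ?bad i \<inter> ?bad j = {}"
    proof (intro ballI impI equals0I)
      fix i j \<alpha> assume ij: "i \<in> S" "j \<in> S" "i \<noteq> j" "\<alpha> \<in> ?bad i \<inter> ?bad j"
      have "sum \<alpha> {i, j} \<le> sum \<alpha> X" using ij assms finX by (intro sum_mono2) auto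
      then show False using ij assms(2) by (auto simp: exps_def)
    qed
  qed (use finX in auto)
  also have "\<dots> = card S * ((N + 2) choose 3)"
    using badc assms(1) by (simp add: subset_iff)
  finally show ?thesis using card_exps[OF finX, of 3 d] cardX by simp
qed

lemma dim_flat_space:
  assumes "S \<subseteq> X" "2 * N \<le> d"
  shows "dim {p \<in> P d. \<forall>\<gamma>\<in>S. \<forall>e<N. comp d \<gamma> e p = 0} + card S * ((N + 2) choose 3) = (d + 3) choose 3"
  using flat_space_eq[of S N d] dim_span_mon[OF flat_subset, of d N S] card_flat[OF assms] assms by simp

end

subsection \<open>Ideals of powers along an edge\<close>

text \<open>A lower bound for the codimension, among the binary forms of degree \<open>i\<close>, of the ideal generated by
  the \<open>(r + 1)\<close>-st powers of \<open>n\<close> linear forms.\<close>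

definition gdim :: "nat \<Rightarrow> nat \<Rightarrow> nat \<Rightarrow> nat" where
  "gdim n r i = (i + 1) - min (i + 1) (n * (i - r))"

text \<open>Indexing by \<open>bool\<close> also covers the case \<open>x = y\<close>.\<close>

lemma pw_pair_eq:
  "pw (span {x, y}) k = span (mon UNIV (\<lambda>t. if t then x else y) ` exps (UNIV :: bool set) k)"
proof (rule pw_eq_span_mon)
  show "(\<lambda>t. if t then x else y) ` UNIV \<subseteq> span {x, y}" by (auto intro: span_base)
  have "{x, y} \<subseteq> (\<lambda>t. if t then x else y) ` (UNIV :: bool set)" by (auto simp: UNIV_bool)
  then show "span {x, y} \<subseteq> span ((\<lambda>t. if t then x else y) ` UNIV)" by (rule span_mono)
qed simp

lemma fin_dim_pw_pair: "fin_dim (pw (span {x, y}) k)"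
  unfolding pw_pair_eq by (intro fin_dim_span_mon) simp

lemma dim_pw_pair: "dim (pw (span {x, y}) k) \<le> k + 1"
proof -
  have "dim (pw (span {x, y}) k) \<le> card (exps (UNIV :: bool set) k)"
    unfolding pw_pair_eq by (intro dim_span_family_le finite_exps) simp
  then show ?thesis using card_exps[of "UNIV :: bool set" 1 k] by (simp add: UNIV_bool)
qed

text \<open>The forms at an edge involve only two coordinates \<open>x\<close> and \<open>y\<close>,
  so an edge ideal is a sum of such pieces, one for each monomial \<open>f\<close> in the remaining
  coordinates.\<close>

definition block ::
  "nat \<Rightarrow> 'j set \<Rightarrow> ('j \<Rightarrow> 'a \<Rightarrow> real) \<Rightarrow> ('a \<Rightarrow> real) \<Rightarrow> ('a \<Rightarrow> real) \<Rightarrow> ('a \<Rightarrow> real) \<Rightarrow> nat \<Rightarrow> ('a \<Rightarrow> real) set" where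
  "block r L l x y f i = (\<Union>j\<in>L. (\<lambda>q. (l j ^ (r + 1) * f) * q) ` (if r + 1 \<le> i then pw (span {x, y}) (i - (r + 1)) else {}))"

lemma fin_dim_block: "finite L \<Longrightarrow> fin_dim (block r L l x y f i)"
  unfolding block_def
  by (intro fin_dim_UN fin_dim_image linear_mult_left) (auto intro: fin_dim_pw_pair fin_dim_finite)

lemma block_subset:
  assumes "\<And>j. j \<in> L \<Longrightarrow> l j \<in> span {x, y}"
  shows "block r L l x y f i \<subseteq> (\<lambda>q. f * q) ` pw (span {x, y}) i"
proof
  fix p assume "p \<in> block r L l x y f i"
  then obtain j q where p: "p = (l j ^ (r + 1) * f) * q" "j \<in> L" "r + 1 \<le> i" "q \<in> pw (span {x, y}) (i - (r + 1))"
    unfolding block_def by (auto split: if_splits)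
  have "l j ^ (r + 1) * q \<in> pw (span {x, y}) ((r + 1) + (i - (r + 1)))"
    by (rule pw_mult[OF pw_power1[OF assms[OF p(2)]] p(4)])
  then have "l j ^ (r + 1) * q \<in> pw (span {x, y}) i" using p(3) by simp
  moreover have "p = f * (l j ^ (r + 1) * q)" unfolding p(1) by (simp only: mult_ac)
  ultimately show "p \<in> (\<lambda>q. f * q) ` pw (span {x, y}) i"
    using image_eqI[of p "\<lambda>q. f * q" "l j ^ (r + 1) * q"] by blast
qed

text \<open>All binary forms of degree \<open>i\<close> give the first bound, \<open>i - r\<close>
  independent cofactors for each generator the second; truncated subtraction makes the latter 0 for
  \<open>i \<le> r\<close>.\<close>

lemma dim_block:
  assumes L: "finite L" and l: "\<And>j. j \<in> L \<Longrightarrow> l j \<in> span {x, y}"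
  shows "dim (block r L l x y f i) \<le> min (i + 1) (card L * (i - r))"
proof -
  have "dim (block r L l x y f i) \<le> dim ((\<lambda>q. f * q) ` pw (span {x, y}) i)"
    by (intro dim_mono' fin_dim_image linear_mult_left fin_dim_pw_pair block_subset l)
  also have "\<dots> \<le> i + 1"
    by (rule order_trans[OF dim_image_le'[OF linear_mult_left subspace_pw fin_dim_pw_pair] dim_pw_pair])
  finally have 1: "dim (block r L l x y f i) \<le> i + 1" .
  let ?S = "if r + 1 \<le> i then pw (span {x, y}) (i - (r + 1)) else {}"
  have "dim (block r L l x y f i) \<le> (\<Sum>j\<in>L. dim ((\<lambda>q. (l j ^ (r + 1) * f) * q) ` ?S))"
    unfolding block_def using L
    by (intro dim_UN_le fin_dim_image linear_mult_left) (auto intro: fin_dim_pw_pair fin_dim_finite)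
  also have "\<dots> \<le> (\<Sum>j\<in>L. i - r)"
  proof (rule sum_mono)
    fix j
    show "dim ((\<lambda>q. (l j ^ (r + 1) * f) * q) ` ?S) \<le> i - r"
    proof (cases "r + 1 \<le> i")
      case True
      have "dim ((\<lambda>q. (l j ^ (r + 1) * f) * q) ` pw (span {x, y}) (i - (r + 1))) \<le> (i - (r + 1)) + 1"
        by (rule order_trans[OF dim_image_le'[OF linear_mult_left subspace_pw fin_dim_pw_pair] dim_pw_pair])
      then show ?thesis using True by simp
    next
      case False
      then have "(\<lambda>q. (l j ^ (r + 1) * f) * q) ` ?S = {}" by simp
      moreover have "dim S = 0" if "S = {}" for S :: "('b \<Rightarrow> real) set"
        using that dim_le_card[of S "{}"] by simp
      ultimately show ?thesis by (simp only: le0)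
    qed
  qed
  also have "\<dots> = card L * (i - r)" by simp
  finally show ?thesis using 1 by simp
qed

lemma sum_choose_2: "(\<Sum>i\<le>e. i + 1) = (e + 2) choose 2"
  using choose_rising_sum(1)[of 1 e] by (simp add: add.commute eval_nat_numeral)

text \<open>The forms vanishing on \<open>u\<close> are combinations of two forms \<open>x\<close>
  and \<open>y\<close>. Splitting by the power of a third form \<open>z\<close> leaves binary ideals
  in the degrees \<open>e - c\<close>.\<close>

lemma hom_edge_dim:
  fixes u :: "real^3"
  assumes u: "u \<noteq> 0" and L: "finite L" and l: "\<And>j. j \<in> L \<Longrightarrow> l j \<in> lin" "\<And>j. j \<in> L \<Longrightarrow> l j u = 0"
  shows "dim (span {l j ^ (r + 1) * q |j q. j \<in> L \<and> r + 1 \<le> e \<and> q \<in> H (e - (r + 1))}) + (\<Sum>i\<le>e. gdim (card L) r i)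
     \<le> (e + 2) choose 2"
proof -
  have "dim {a. u \<bullet> a = 0} = 2"
    using dim_hyperplane[OF u] by (simp add: DIM_cart)
  then obtain B where B: "B \<subseteq> {a. u \<bullet> a = 0}" "{a. u \<bullet> a = 0} \<subseteq> span B" "card B = 2"
    using basis_exists by metis
  then obtain a1 a2 where a: "B = {a1, a2}" by (auto simp: card_2_iff)
  define x y z where xyz: "x = (\<lambda>v. a1 \<bullet> v)" "y = (\<lambda>v. a2 \<bullet> v)" "z = (\<lambda>v. u \<bullet> v)"
  have ann: "g \<in> span {x, y}" if g: "g \<in> lin" "g u = 0" for g
  proof -
    obtain c where c: "g = (\<lambda>v. c \<bullet> v)" using g by (auto simp: lin_def)
    then have "c \<in> span {a1, a2}" using B(2) g(2) a by (auto simp: inner_commute)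
    then obtain k1 k2 where "c = k1 *\<^sub>R a1 + k2 *\<^sub>R a2"
      unfolding span_insert by (auto simp: span_singleton algebra_simps)
    then have "g = k1 *\<^sub>R x + k2 *\<^sub>R y" by (auto simp: c xyz fun_eq_iff inner_add_left)
    then show ?thesis by (auto intro!: span_add span_scale intro: span_base)
  qed
  have uu: "u \<bullet> u \<noteq> 0" using u by simp
  have dec: "\<exists>k g0. g = k *\<^sub>R z + g0 \<and> g0 \<in> span {x, y}" if "g \<in> lin" for g
  proof -
    let ?k = "g u / (u \<bullet> u)"
    have "z \<in> lin" by (auto simp: xyz lin_def)
    then have "g - ?k *\<^sub>R z \<in> lin" using that by (intro subspace_diff subspace_scale subspace_lin)
    moreover have "(g - ?k *\<^sub>R z) u = 0" using uu by (simp add: xyz)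
    ultimately have "g - ?k *\<^sub>R z \<in> span {x, y}" by (rule ann)
    moreover have "g = ?k *\<^sub>R z + (g - ?k *\<^sub>R z)" by simp
    ultimately show ?thesis by blast
  qed
  have Hsub: "H k \<subseteq> span (\<Union>c\<le>k. (\<lambda>q. z ^ c * q) ` pw (span {x, y}) (k - c))" for k
  proof (induction k)
    case 0
    show ?case by (auto simp del: pw.simps simp: pw_0_iff intro!: span_base)
  next
    case (Suc k)
    let ?S = "\<lambda>k. \<Union>c\<le>k. (\<lambda>q. z ^ c * q) ` pw (span {x, y}) (k - c)"
    have gen: "g * p \<in> span (?S (Suc k))" if gp: "g \<in> lin" "p \<in> ?S k" for g p
    proof -
      obtain c q where p: "p = z ^ c * q" "c \<le> k" "q \<in> pw (span {x, y}) (k - c)" using gp(2) by auto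
      obtain t g0 where g: "g = t *\<^sub>R z + g0" "g0 \<in> span {x, y}" using dec[OF gp(1)] by blast
      have "z ^ Suc c * q \<in> ?S (Suc k)" using p by (intro UN_I[of "Suc c"] imageI) auto
      moreover have "g0 * q \<in> pw (span {x, y}) (Suc (k - c))" by (rule pw_SucI[OF g(2) p(3)])
      then have "z ^ c * (g0 * q) \<in> ?S (Suc k)"
        using p(2) by (intro UN_I[of c] imageI) (auto simp only: Suc_diff_le atMost_iff)
      moreover have "g * p = t *\<^sub>R (z ^ Suc c * q) + z ^ c * (g0 * q)"
        unfolding g(1) p(1) by (auto simp: fun_eq_iff algebra_simps)
      ultimately show ?thesis by (simp only: span_add span_scale span_base)
    qed
    have "g * p \<in> span (?S (Suc k))" if "g \<in> lin" "p \<in> H k" for g p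
    proof -
      have "g * p \<in> span {a * b |a b. a \<in> lin \<and> b \<in> ?S k}"
        by (rule span_mult[OF span_base[OF that(1)] subsetD[OF Suc that(2)]])
      also have "\<dots> \<subseteq> span (?S (Suc k))" using gen by (intro span_minimal) auto
      finally show ?thesis .
    qed
    then show ?case unfolding pw.simps(2) by (intro span_minimal[OF _ subspace_span]) blast
  qed
  let ?J = "{l j ^ (r + 1) * q |j q. j \<in> L \<and> r + 1 \<le> e \<and> q \<in> H (e - (r + 1))}"
  let ?U = "\<lambda>c. block r L l x y (z ^ c) (e - c)"
  have "?J \<subseteq> span (\<Union>c\<le>e. ?U c)"
  proof
    fix p assume "p \<in> ?J"
    then obtain j q where p: "p = l j ^ (r + 1) * q" "j \<in> L" "r + 1 \<le> e" "q \<in> H (e - (r + 1))" by blast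
    have "p \<in> span {a * b |a b. a \<in> {l j ^ (r + 1)} \<and> b \<in> (\<Union>c\<le>e - (r + 1). (\<lambda>q. z ^ c * q) ` pw (span {x, y}) (e - (r + 1) - c))}"
      unfolding p(1) by (rule span_mult[OF span_base[OF singletonI] subsetD[OF Hsub p(4)]])
    also have "\<dots> \<subseteq> span (\<Union>c\<le>e. ?U c)"
    proof (rule span_mono, rule subsetI)
      fix w assume "w \<in> {a * b |a b. a \<in> {l j ^ (r + 1)} \<and> b \<in> (\<Union>c\<le>e - (r + 1). (\<lambda>q. z ^ c * q) ` pw (span {x, y}) (e - (r + 1) - c))}"
      then obtain c q' where w: "w = l j ^ (r + 1) * (z ^ c * q')" "c \<le> e - (r + 1)" "q' \<in> pw (span {x, y}) (e - (r + 1) - c)"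
        by auto
      have 1: "r + 1 \<le> e - c" "e - (r + 1) - c = e - c - (r + 1)" "c \<le> e" using w(2) p(3) by linarith+
      have "w = (l j ^ (r + 1) * z ^ c) * q'" unfolding w(1) by (simp only: mult.assoc)
      then have "w \<in> ?U c" unfolding block_def using 1 w(3) p(2) by (auto simp del: pw.simps power_Suc)
      then show "w \<in> (\<Union>c\<le>e. ?U c)" using 1 by blast
    qed
    finally show "p \<in> span (\<Union>c\<le>e. ?U c)" .
  qed
  then have "dim (span ?J) \<le> dim (\<Union>c\<le>e. ?U c)"
    using L by (intro dim_le_dim fin_dim_UN fin_dim_block) (auto intro: span_minimal[THEN subsetD])
  also have "\<dots> \<le> (\<Sum>c\<le>e. dim (?U c))" using L by (intro dim_UN_le fin_dim_block) auto
  also have "\<dots> \<le> (\<Sum>c\<le>e. min ((e - c) + 1) (card L * ((e - c) - r)))"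
    using L l ann by (intro sum_mono dim_block) auto
  also have "\<dots> = (\<Sum>i\<le>e. min (i + 1) (card L * (i - r)))"
    by (rule sum.nat_diff_reindex[of "\<lambda>i. min (i + 1) (card L * (i - r))" "Suc e", simplified lessThan_Suc_atMost diff_Suc_Suc])
  finally have "dim (span ?J) \<le> (\<Sum>i\<le>e. min (i + 1) (card L * (i - r)))" .
  moreover have "(\<Sum>i\<le>e. min (i + 1) (card L * (i - r))) + (\<Sum>i\<le>e. gdim (card L) r i) = (\<Sum>i\<le>e. i + 1)"
    unfolding sum.distrib[symmetric] gdim_def by (intro sum.cong) auto
  ultimately show ?thesis using sum_choose_2[of e] by linarith
qed

section \<open>Edge ideals in barycentric coordinates\<close>

context bary_tet
begin

text \<open>Affine functions vanishing at \<open>v2\<close> and \<open>v3\<close> are combinations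
  of the coordinates of \<open>v0\<close> and \<open>v1\<close>, so the ideal splits by the
  exponents at \<open>v2\<close> and \<open>v3\<close>. The vanishing that defines \<open>C\<close>
  restricts exactly these two exponents, namely to \<open>G\<close>.\<close>

lemma edge_dim:
  assumes X: "X = {v0, v1, v2, v3}" and dist: "distinct [v0, v1, v2, v3]"
    and L: "finite L" and l: "\<And>j. j \<in> L \<Longrightarrow> l j \<in> aff" "\<And>j. j \<in> L \<Longrightarrow> l j v2 = 0" "\<And>j. j \<in> L \<Longrightarrow> l j v3 = 0"
    and d: "2 * N \<le> d" "r + 1 \<le> d"
    and G: "G = {(c, e). c + N \<le> d \<and> e + N \<le> d \<and> c + e \<le> d}"
    and J: "J = span {l j ^ (r + 1) * q |j q. j \<in> L \<and> q \<in> P (d - (r + 1))}"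
    and C: "C = {p \<in> P d. \<forall>\<gamma>\<in>{v2, v3}. \<forall>e<N. comp d \<gamma> e p = 0}"
  shows "dim (J \<inter> C) + (\<Sum>(c, e)\<in>G. gdim (card L) r (d - c - e)) \<le> dim C"
proof -
  let ?x = "b v0" and ?y = "b v1"
  let ?f = "\<lambda>c e. b v2 ^ c * b v3 ^ e"
  let ?U = "\<lambda>(c, e). block r L l ?x ?y (?f c e) (d - c - e)"
  let ?A = "\<lambda>(c, e). {\<alpha> \<in> exps X d. \<alpha> v2 = c \<and> \<alpha> v3 = e}"
  let ?All = "{(c, e). c + e \<le> d}"
  have finAll: "finite ?All"
    by (rule finite_subset[of _ "{..d} \<times> {..d}"]) auto
  have GAll: "G \<subseteq> ?All" unfolding G by auto
  have finG: "finite G" using GAll finAll finite_subset by blast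
  have lsp: "l j \<in> span {?x, ?y}" if j: "j \<in> L" for j
  proof -
    have "l j = (\<Sum>w\<in>X. l j w *\<^sub>R b w)" using aff_eq l(1)[OF j] by blast
    also have "\<dots> = l j v0 *\<^sub>R ?x + l j v1 *\<^sub>R ?y"
      unfolding X using dist l(2,3)[OF j] by simp
    finally have "l j = l j v0 *\<^sub>R ?x + l j v1 *\<^sub>R ?y" .
    moreover have "l j v0 *\<^sub>R ?x + l j v1 *\<^sub>R ?y \<in> span {?x, ?y}"
      by (intro span_add span_scale span_base) auto
    ultimately show ?thesis by simp
  qed
  have ne: "v1 \<noteq> v0" "v2 \<noteq> v0" "v3 \<noteq> v0" "v2 \<noteq> v1" "v3 \<noteq> v1" "v3 \<noteq> v2"
    using dist by auto
  have monX: "mon X b \<alpha> = b v0 ^ \<alpha> v0 * b v1 ^ \<alpha> v1 * (b v2 ^ \<alpha> v2 * b v3 ^ \<alpha> v3)" for \<alpha>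
    unfolding mon_def X using dist by (simp add: mult_ac)
  have sumX: "sum \<alpha> X = \<alpha> v0 + \<alpha> v1 + \<alpha> v2 + \<alpha> v3" for \<alpha> :: "real^3 \<Rightarrow> nat"
    unfolding X using dist by simp
  have Jsub: "J \<subseteq> span (\<Union>t\<in>?All. ?U t)"
    unfolding J
  proof (rule span_minimal[OF _ subspace_span], rule subsetI)
    fix p assume "p \<in> {l j ^ (r + 1) * q |j q. j \<in> L \<and> q \<in> P (d - (r + 1))}"
    then obtain j q where p: "p = l j ^ (r + 1) * q" "j \<in> L" "q \<in> P (d - (r + 1))" by blast
    have "p \<in> span {g * h |g h. g \<in> {l j ^ (r + 1)} \<and> h \<in> mon X b ` exps X (d - (r + 1))}"
      unfolding p(1) using p(3) unfolding P_eq by (intro span_mult) (auto intro: span_base)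
    also have "\<dots> \<subseteq> span (\<Union>t\<in>?All. ?U t)"
    proof (rule span_mono, rule subsetI)
      fix w assume "w \<in> {g * h |g h. g \<in> {l j ^ (r + 1)} \<and> h \<in> mon X b ` exps X (d - (r + 1))}"
      then obtain \<alpha> where w: "w = l j ^ (r + 1) * mon X b \<alpha>" "\<alpha> \<in> exps X (d - (r + 1))" by auto
      have s: "\<alpha> v0 + \<alpha> v1 + \<alpha> v2 + \<alpha> v3 = d - (r + 1)" using w(2) sumX by (auto simp: exps_def)
      have 1: "r + 1 \<le> d - \<alpha> v2 - \<alpha> v3" "d - \<alpha> v2 - \<alpha> v3 - (r + 1) = \<alpha> v0 + \<alpha> v1"
        "(\<alpha> v2, \<alpha> v3) \<in> ?All" using s d(2) by auto
      have "?x ^ \<alpha> v0 * ?y ^ \<alpha> v1 \<in> pw (span {?x, ?y}) (\<alpha> v0 + \<alpha> v1)"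
        by (intro pw_mult pw_power1 span_base) auto
      moreover have "w = (l j ^ (r + 1) * ?f (\<alpha> v2) (\<alpha> v3)) * (?x ^ \<alpha> v0 * ?y ^ \<alpha> v1)"
        unfolding w(1) monX by (simp only: mult_ac)
      ultimately have "w \<in> ?U (\<alpha> v2, \<alpha> v3)"
        unfolding block_def prod.case using 1(1,2) p(2) by (auto simp del: pw.simps power_Suc)
      then show "w \<in> (\<Union>t\<in>?All. ?U t)" using 1(3) by blast
    qed
    finally show "p \<in> span (\<Union>t\<in>?All. ?U t)" .
  qed
  have ext: "(\<lambda>i. if i = v0 then a else if i = v1 then a' else if i = v2 then c else if i = v3 then e else 0) \<in> ?A (c, e)"
    if "a + a' + c + e = d" for a a' c e
    using that dist X by (auto simp: exps_def sumX)
  have Usub: "?U (c, e) \<subseteq> span (mon X b ` ?A (c, e))" if ce: "c + e \<le> d" for c e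
  proof -
    have "?U (c, e) \<subseteq> (\<lambda>q. ?f c e * q) ` pw (span {?x, ?y}) (d - c - e)"
      unfolding prod.case by (rule block_subset[OF lsp])
    also have "\<dots> \<subseteq> (\<lambda>q. ?f c e * q) ` span (mon UNIV (\<lambda>t. if t then ?x else ?y) ` exps (UNIV :: bool set) (d - c - e))"
      by (simp only: pw_pair_eq order_refl)
    also have "\<dots> = span ((\<lambda>q. ?f c e * q) ` (mon UNIV (\<lambda>t. if t then ?x else ?y) ` exps (UNIV :: bool set) (d - c - e)))"
      by (rule linear_span_image[OF linear_mult_left, symmetric])
    also have "\<dots> \<subseteq> span (mon X b ` ?A (c, e))"
    proof (rule span_mono, unfold image_image, rule image_subsetI)
      fix \<beta> assume "\<beta> \<in> exps (UNIV :: bool set) (d - c - e)"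
      then have s: "\<beta> True + \<beta> False + c + e = d" using ce by (auto simp: exps_def UNIV_bool)
      let ?\<alpha> = "\<lambda>i. if i = v0 then \<beta> True else if i = v1 then \<beta> False else if i = v2 then c else if i = v3 then e else 0"
      have "?f c e * mon UNIV (\<lambda>t. if t then ?x else ?y) \<beta> = mon X b ?\<alpha>"
        unfolding monX by (simp add: mon_def UNIV_bool mult_ac ne)
      then show "?f c e * mon UNIV (\<lambda>t. if t then ?x else ?y) \<beta> \<in> mon X b ` ?A (c, e)"
        using ext[OF s] by (rule image_eqI)
    qed
    finally show ?thesis .
  qed
  have Gflat: "?A t \<subseteq> flat d N {v2, v3}" if "t \<in> G" for t
    using that unfolding G flat_def by auto
  have Ceq: "C = span (mon X b ` flat d N {v2, v3})"
    unfolding C using X d(1) by (intro flat_space_eq) auto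
  \<comment> \<open>Blocks outside \<open>G\<close> involve only monomials outside \<open>C\<close>;
    by independence of the Bernstein monomials their total contribution to an element of
    \<open>C\<close> is 0.\<close>
  have JC: "J \<inter> C \<subseteq> span (\<Union>t\<in>G. ?U t)"
  proof
    fix p assume p: "p \<in> J \<inter> C"
    have "(\<Union>t\<in>?All. ?U t) = (\<Union>t\<in>G. ?U t) \<union> (\<Union>t\<in>?All - G. ?U t)" using GAll by blast
    then have "p \<in> span ((\<Union>t\<in>G. ?U t) \<union> (\<Union>t\<in>?All - G. ?U t))" using p Jsub by auto
    then obtain p1 p2 where p12: "p = p1 + p2" "p1 \<in> span (\<Union>t\<in>G. ?U t)" "p2 \<in> span (\<Union>t\<in>?All - G. ?U t)"
      unfolding span_Un by blast
    have "(\<Union>t\<in>G. ?U t) \<subseteq> C"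
    proof (rule UN_least)
      fix t assume t: "t \<in> G"
      obtain c e where ce: "t = (c, e)" by (cases t)
      have "?U t \<subseteq> span (mon X b ` ?A t)" using Usub[of c e] t GAll ce by auto
      also have "\<dots> \<subseteq> C" unfolding Ceq using Gflat[OF t] by (intro span_mono image_mono)
      finally show "?U t \<subseteq> C" .
    qed
    then have "p1 \<in> C" using p12(2) unfolding Ceq by (rule subsetD[OF span_minimal[OF _ subspace_span]])
    moreover have "p2 = p - p1" using p12(1) by simp
    ultimately have p2C: "p2 \<in> C" using p unfolding Ceq by (simp only: span_diff IntD2)
    have "(\<Union>t\<in>?All - G. ?U t) \<subseteq> span (mon X b ` (exps X d - flat d N {v2, v3}))"
    proof (rule UN_least)
      fix t assume t: "t \<in> ?All - G"
      obtain c e where ce: "t = (c, e)" by (cases t)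
      have "?U t \<subseteq> span (mon X b ` ?A t)" using Usub[of c e] t ce by auto
      also have "\<dots> \<subseteq> span (mon X b ` (exps X d - flat d N {v2, v3}))"
        using t unfolding G flat_def ce by (intro span_mono image_mono) auto
      finally show "?U t \<subseteq> span (mon X b ` (exps X d - flat d N {v2, v3}))" .
    qed
    then have p2B: "p2 \<in> span (mon X b ` (exps X d - flat d N {v2, v3}))"
      using p12(3) by (rule subsetD[OF span_minimal[OF _ subspace_span]])
    obtain c where c: "p2 = (\<Sum>\<alpha>\<in>flat d N {v2, v3}. c \<alpha> *\<^sub>R mon X b \<alpha>)"
      using p2C finite_subset[OF flat_subset finite_exps[OF finX]] unfolding Ceq
      by (auto simp: span_family)
    obtain c' where c': "p2 = (\<Sum>\<alpha>\<in>exps X d - flat d N {v2, v3}. c' \<alpha> *\<^sub>R mon X b \<alpha>)"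
      using p2B finX by (auto simp: span_family)
    let ?c = "\<lambda>\<alpha>. if \<alpha> \<in> flat d N {v2, v3} then c \<alpha> else - c' \<alpha>"
    have "(\<Sum>\<alpha>\<in>exps X d. ?c \<alpha> *\<^sub>R mon X b \<alpha>) = (\<Sum>\<alpha>\<in>exps X d - flat d N {v2, v3}. ?c \<alpha> *\<^sub>R mon X b \<alpha>) + (\<Sum>\<alpha>\<in>flat d N {v2, v3}. ?c \<alpha> *\<^sub>R mon X b \<alpha>)"
      by (rule sum.subset_diff[OF flat_subset finite_exps[OF finX]])
    also have "(\<Sum>\<alpha>\<in>flat d N {v2, v3}. ?c \<alpha> *\<^sub>R mon X b \<alpha>) = p2" unfolding c by (intro sum.cong) auto
    also have "(\<Sum>\<alpha>\<in>exps X d - flat d N {v2, v3}. ?c \<alpha> *\<^sub>R mon X b \<alpha>) = - p2"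
      unfolding c' sum_negf[symmetric] by (intro sum.cong) auto
    finally have "(\<Sum>\<alpha>\<in>exps X d. ?c \<alpha> *\<^sub>R mon X b \<alpha>) = 0" by (simp only: left_minus)
    then have "?c \<alpha> = 0" if "\<alpha> \<in> flat d N {v2, v3}" for \<alpha>
      using bernstein_independent[of ?c d \<alpha>] that flat_subset by blast
    then have "p2 = 0" unfolding c by (intro sum.neutral) auto
    then show "p \<in> span (\<Union>t\<in>G. ?U t)" using p12 by simp
  qed
  have "dim (J \<inter> C) \<le> dim (\<Union>t\<in>G. ?U t)"
    using JC finG L by (intro dim_le_dim fin_dim_UN) (auto intro: fin_dim_block)
  also have "\<dots> \<le> (\<Sum>t\<in>G. dim (?U t))"
    using finG L by (intro dim_UN_le) (auto intro: fin_dim_block)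
  also have "\<dots> \<le> (\<Sum>(c, e)\<in>G. min ((d - c - e) + 1) (card L * ((d - c - e) - r)))"
    using L lsp by (intro sum_mono) (auto intro!: dim_block[THEN order_trans])
  finally have 1: "dim (J \<inter> C) \<le> (\<Sum>(c, e)\<in>G. min ((d - c - e) + 1) (card L * ((d - c - e) - r)))" .
  have "dim C = card (flat d N {v2, v3})"
    unfolding Ceq by (rule dim_span_mon[OF flat_subset])
  also have "flat d N {v2, v3} = (\<Union>t\<in>G. ?A t)"
  proof (intro subset_antisym subsetI)
    fix \<alpha> assume a: "\<alpha> \<in> flat d N {v2, v3}"
    then have "sum \<alpha> X = d" by (auto simp: flat_def exps_def)
    then have "(\<alpha> v2, \<alpha> v3) \<in> G" using a sumX[of \<alpha>] unfolding G flat_def by auto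
    moreover have "\<alpha> \<in> ?A (\<alpha> v2, \<alpha> v3)" using a flat_subset by auto
    ultimately show "\<alpha> \<in> (\<Union>t\<in>G. ?A t)" by blast
  qed (use Gflat in blast)
  also have "card (\<Union>t\<in>G. ?A t) = (\<Sum>t\<in>G. card (?A t))"
    using finG finX by (intro card_UN_disjoint) auto
  also have "\<dots> \<ge> (\<Sum>(c, e)\<in>G. (d - c - e) + 1)"
  proof (rule sum_mono)
    fix t assume t: "t \<in> G"
    obtain c e where tce: "t = (c, e)" by (cases t)
    then have ce: "c + e \<le> d" using t unfolding G by auto
    \<comment> \<open>The remaining degree can be divided between \<open>v0\<close> and
      \<open>v1\<close> in \<open>d - c - e + 1\<close> ways.\<close>
    let ?h = "\<lambda>a i. if i = v0 then a else if i = v1 then d - c - e - a else if i = v2 then c else if i = v3 then e else 0"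
    have "?h ` {..d - c - e} \<subseteq> ?A (c, e)"
      using ext[of _ _ c e] ce by force
    moreover have "inj_on ?h {..d - c - e}"
    proof (rule inj_onI)
      fix a a' assume "?h a = ?h a'"
      then have "?h a v0 = ?h a' v0" by (rule fun_cong)
      then show "a = a'" by simp
    qed
    ultimately have "card {..d - c - e} \<le> card (?A (c, e))"
      using finX by (intro card_inj_on_le[of ?h]) auto
    then show "(case t of (c, e) \<Rightarrow> (d - c - e) + 1) \<le> card (?A t)" by (simp add: tce)
  qed
  finally have 2: "(\<Sum>(c, e)\<in>G. (d - c - e) + 1) \<le> dim C" .
  have "(\<Sum>(c, e)\<in>G. min ((d - c - e) + 1) (card L * ((d - c - e) - r))) + (\<Sum>(c, e)\<in>G. gdim (card L) r (d - c - e))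
     = (\<Sum>(c, e)\<in>G. (d - c - e) + 1)"
    unfolding sum.distrib[symmetric] gdim_def by (intro sum.cong) auto
  with 1 2 show ?thesis by linarith
qed

end

subsection \<open>Vertex sets of a tetrahedral partition\<close>

lemma aff_affine_comb:
  assumes "l \<in> aff" "sum u S = 1"
  shows "l (\<Sum>w\<in>S. u w *\<^sub>R w) = (\<Sum>w\<in>S. u w * l w)"
proof -
  obtain c a where l: "l = (\<lambda>x. c + a \<bullet> x)" using assms by (auto simp: aff_def)
  have "(\<Sum>w\<in>S. u w * l w) = c * sum u S + a \<bullet> (\<Sum>w\<in>S. u w *\<^sub>R w)"
    by (simp add: l inner_sum_right sum_distrib_left sum.distrib algebra_simps)
  then show ?thesis by (simp add: l assms(2))
qed

lemma (in bary_tet) convex_hull_iff: "x \<in> convex hull X \<longleftrightarrow> (\<forall>w\<in>X. 0 \<le> b w x)"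
proof
  assume "x \<in> convex hull X"
  then obtain u where u: "\<forall>w\<in>X. 0 \<le> u w" "sum u X = 1" "(\<Sum>w\<in>X. u w *\<^sub>R w) = x"
    by (auto simp: convex_hull_finite[OF finX])
  show "\<forall>w\<in>X. 0 \<le> b w x"
  proof
    fix w assume w: "w \<in> X"
    have "b w x = (\<Sum>v\<in>X. u v * b w v)"
      using aff_affine_comb[OF b_aff[OF w] u(2)] u(3) by simp
    also have "\<dots> = (\<Sum>v\<in>X. if v = w then u v else 0)"
      using b_delta[OF w] by (intro sum.cong) auto
    also have "\<dots> = u w" using w finX by simp
    finally show "0 \<le> b w x" using u(1) w by simp
  qed
next
  assume "\<forall>w\<in>X. 0 \<le> b w x"
  then show "x \<in> convex hull X"
    using b_sum[of x] b_point[of x] unfolding convex_hull_finite[OF finX]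
    by (intro CollectI exI[of _ "\<lambda>w. b w x"] conjI)
qed

lemma filter_image: "{y \<in> f ` S. Q y} = f ` {x \<in> S. Q (f x)}"
  by blast

locale tet_part =
  fixes \<Delta> :: "(real^3) set set"
  assumes tp: "tetrahedral_partition \<Delta>"
begin

lemma simpl: "simplicial_complex \<Delta>" using tp by (simp add: tetrahedral_partition_def)

text \<open>Simplices are represented by their vertex sets: \<open>T4\<close> are the tetrahedra, \<open>BD\<close> the boundary triangles,
  and \<open>Int_faces k\<close> the interior faces with \<open>k\<close> vertices, hence of dimension \<open>k - 1\<close>.\<close>

definition K :: "(real^3) set set" where
  "K = {C. finite C \<and> \<not> affine_dependent C \<and> convex hull C \<in> \<Delta>}"

definition T4 :: "(real^3) set set" where "T4 = {C \<in> K. card C = 4}"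

definition BD :: "(real^3) set set" where
  "BD = {C \<in> K. card C = 3 \<and> (\<exists>!Y. Y \<in> T4 \<and> C \<subseteq> Y)}"

definition Int_faces :: "nat \<Rightarrow> (real^3) set set" where
  "Int_faces k = {C \<in> K. card C = k \<and> \<not> (\<exists>Z\<in>BD. C \<subseteq> Z)}"

lemma K_D: "C \<in> K \<Longrightarrow> finite C" "C \<in> K \<Longrightarrow> \<not> affine_dependent C" "C \<in> K \<Longrightarrow> convex hull C \<in> \<Delta>"
  by (auto simp: K_def)

text \<open>The vertices of a simplex are recovered as its extreme points.\<close>

lemma hull_inj:
  assumes "C \<in> K" "D \<in> K" "convex hull C = convex hull D"
  shows "C = D"
proof -
  have "x \<in> C \<longleftrightarrow> x \<in> D" for x
    using extreme_point_of_convex_hull_affine_independent[of C x] extreme_point_of_convex_hull_affine_independent[of D x]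
      assms K_D by metis
  then show ?thesis by blast
qed

lemma inj_hull: "inj_on ((hull) convex) S" if "S \<subseteq> K" for S
  using that hull_inj by (intro inj_onI) blast

lemma K_subset: "C \<in> K \<Longrightarrow> C' \<subseteq> C \<Longrightarrow> C' \<in> K"
proof -
  assume C: "C \<in> K" and sub: "C' \<subseteq> C"
  have "convex hull C' face_of convex hull C"
    using face_of_convex_hull_affine_independent[OF K_D(2)[OF C]] sub by blast
  then have "convex hull C' \<in> \<Delta>" using simpl K_D(3)[OF C] unfolding simplicial_complex_def by blast
  then show "C' \<in> K"
    using C sub affine_independent_subset[of C C'] finite_subset unfolding K_def by blast
qed

text \<open>The intersection is a face of either simplex, hence the hull of some vertices of each,
  and by \<open>hull_inj\<close> these two vertex sets agree.\<close>

lemma K_Int: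
  assumes "C \<in> K" "D \<in> K"
  shows "convex hull C \<inter> convex hull D = convex hull (C \<inter> D)"
proof -
  have face: "(convex hull A \<inter> convex hull B) face_of convex hull A" if "A \<in> K" "B \<in> K" for A B
    using simpl K_D(3) that unfolding simplicial_complex_def by blast
  obtain C' where C': "C' \<subseteq> C" "convex hull C \<inter> convex hull D = convex hull C'"
    using face[OF assms] face_of_convex_hull_affine_independent[OF K_D(2)[OF assms(1)]] by blast
  obtain D' where D': "D' \<subseteq> D" "convex hull D \<inter> convex hull C = convex hull D'"
    using face[OF assms(2,1)] face_of_convex_hull_affine_independent[OF K_D(2)[OF assms(2)]] by blast
  have "C' = D'"
    using hull_inj[of C' D'] K_subset assms C' D' by (metis Int_commute)
  then have "convex hull C \<inter> convex hull D \<subseteq> convex hull (C \<inter> D)"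
    unfolding C'(2) using C'(1) D'(1) by (intro hull_mono) auto
  moreover have "convex hull (C \<inter> D) \<subseteq> convex hull C \<inter> convex hull D"
    by (meson Int_lower1 Int_lower2 Int_greatest hull_mono)
  ultimately show ?thesis by blast
qed

lemma hull_subset_iff:
  assumes "C \<in> K" "D \<in> K"
  shows "convex hull C \<subseteq> convex hull D \<longleftrightarrow> C \<subseteq> D"
proof
  assume "convex hull C \<subseteq> convex hull D"
  then have "convex hull C = convex hull (C \<inter> D)" using K_Int[OF assms] by blast
  then have "C = C \<inter> D" by (rule hull_inj[OF assms(1) K_subset[OF assms(1) Int_lower1]])
  then show "C \<subseteq> D" by blast
qed (rule hull_mono)

lemma faces_eq: "faces i \<Delta> = (hull) convex ` {C \<in> K. card C = i + 1}"
proof (intro subset_antisym subsetI)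
  fix S assume "S \<in> faces i \<Delta>"
  then obtain C where C: "\<not> affine_dependent C" "int (card C) = int i + 1" "S = convex hull C" "S \<in> \<Delta>"
    by (auto simp: faces_def simplex_def)
  then show "S \<in> (hull) convex ` {C \<in> K. card C = i + 1}"
    using aff_independent_finite[OF C(1)] by (auto simp: K_def)
next
  fix S assume "S \<in> (hull) convex ` {C \<in> K. card C = i + 1}"
  then show "S \<in> faces i \<Delta>"
    unfolding faces_def simplex_def K_def by fastforce
qed

lemma Delta_eq: "\<Delta> = (hull) convex ` K"
proof (intro subset_antisym subsetI)
  fix S assume S: "S \<in> \<Delta>"
  then obtain n where "n simplex S" using simpl unfolding simplicial_complex_def by blast
  then obtain C where "\<not> affine_dependent C" "S = convex hull C" by (auto simp: simplex_def)
  then show "S \<in> (hull) convex ` K" using S aff_independent_finite by (auto simp: K_def)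
qed (auto simp: K_def)

lemma finite_K: "finite K"
proof -
  have "finite ((hull) convex ` K)" using simpl Delta_eq unfolding simplicial_complex_def by simp
  then show ?thesis using inj_hull[of K] finite_imageD by auto
qed

lemma faces3_eq: "faces 3 \<Delta> = (hull) convex ` T4"
  by (simp add: faces_eq T4_def)

lemma T4_K: "Y \<in> T4 \<Longrightarrow> Y \<in> K" by (simp add: T4_def)
lemma T4_card: "Y \<in> T4 \<Longrightarrow> card Y = 4" by (simp add: T4_def)
lemma T4_finite: "Y \<in> T4 \<Longrightarrow> finite Y" using T4_K K_D by blast
lemma finite_T4: "finite T4" using finite_K by (simp add: T4_def)

lemma pure: "C \<in> K \<Longrightarrow> \<exists>Y\<in>T4. C \<subseteq> Y"
proof -
  assume C: "C \<in> K"
  then obtain T where T: "T \<in> faces 3 \<Delta>" "convex hull C \<subseteq> T"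
    using tp K_D(3) unfolding tetrahedral_partition_def by blast
  then obtain Y where "Y \<in> T4" "T = convex hull Y" unfolding faces3_eq by auto
  then show ?thesis using T(2) hull_subset_iff[OF C T4_K] by blast
qed

lemma K_nonempty: "\<exists>Y. Y \<in> T4"
proof -
  have "K \<noteq> {}" using tp Delta_eq unfolding tetrahedral_partition_def by auto
  then show ?thesis using pure by blast
qed

text \<open>Stated for a subset of the tetrahedra, so that it serves both for
  \<open>\<Delta>\<close> and for vertex stars.\<close>

lemma bd_eq_aux:
  assumes "T' \<subseteq> T4" "S3 \<subseteq> {C \<in> K. card C = 3}"
  shows "{\<sigma> \<in> (hull) convex ` S3. \<exists>!T. T \<in> (hull) convex ` T' \<and> \<sigma> \<subseteq> T}
     = (hull) convex ` {C \<in> S3. \<exists>!Y. Y \<in> T' \<and> C \<subseteq> Y}"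
proof -
  have iff: "(\<exists>!T. T \<in> (hull) convex ` T' \<and> convex hull C \<subseteq> T) \<longleftrightarrow> (\<exists>!Y. Y \<in> T' \<and> C \<subseteq> Y)" if C: "C \<in> S3" for C
  proof -
    have CK: "C \<in> K" and TK: "\<And>Y. Y \<in> T' \<Longrightarrow> Y \<in> K" using C assms T4_K by auto
    have sub: "\<And>Y. Y \<in> T' \<Longrightarrow> convex hull C \<subseteq> convex hull Y \<longleftrightarrow> C \<subseteq> Y" by (rule hull_subset_iff[OF CK TK])
    show ?thesis
  proof
    assume "\<exists>!T. T \<in> (hull) convex ` T' \<and> convex hull C \<subseteq> T"
    then obtain T where T0: "T \<in> (hull) convex ` T' \<and> convex hull C \<subseteq> T"
      and u0: "\<forall>T2. T2 \<in> (hull) convex ` T' \<and> convex hull C \<subseteq> T2 \<longrightarrow> T2 = T" by (rule ex1E)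
    have T: "T \<in> (hull) convex ` T'" "convex hull C \<subseteq> T" using T0 by simp_all
    have u: "T2 = T" if "T2 \<in> (hull) convex ` T'" "convex hull C \<subseteq> T2" for T2 using u0 that by simp
    from T obtain Y where Y: "Y \<in> T'" "T = convex hull Y" by auto
    show "\<exists>!Y. Y \<in> T' \<and> C \<subseteq> Y"
    proof (rule ex1I[of _ Y])
      show "Y \<in> T' \<and> C \<subseteq> Y" using Y T(2) sub[OF Y(1)] by simp
      fix Y' assume Y': "Y' \<in> T' \<and> C \<subseteq> Y'"
      then have "convex hull Y' = convex hull Y" using u[of "convex hull Y'"] Y(2) sub[of Y'] by simp
      then show "Y' = Y" using hull_inj[of Y' Y] TK Y Y' by simp
    qed
  next
    assume "\<exists>!Y. Y \<in> T' \<and> C \<subseteq> Y"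
    then obtain Y where Y0: "Y \<in> T' \<and> C \<subseteq> Y" and u0: "\<forall>Y2. Y2 \<in> T' \<and> C \<subseteq> Y2 \<longrightarrow> Y2 = Y" by (rule ex1E)
    have Y: "Y \<in> T'" "C \<subseteq> Y" using Y0 by simp_all
    have u: "Y2 = Y" if "Y2 \<in> T'" "C \<subseteq> Y2" for Y2 using u0 that by simp
    show "\<exists>!T. T \<in> (hull) convex ` T' \<and> convex hull C \<subseteq> T"
    proof (rule ex1I[of _ "convex hull Y"])
      show "convex hull Y \<in> (hull) convex ` T' \<and> convex hull C \<subseteq> convex hull Y" using Y sub by simp
      fix T assume T: "T \<in> (hull) convex ` T' \<and> convex hull C \<subseteq> T"
      then obtain Y' where Y': "Y' \<in> T'" "T = convex hull Y'" by auto
      then have "C \<subseteq> Y'" using T sub[OF Y'(1)] by simp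
      then show "T = convex hull Y" using u[OF Y'(1)] Y' by simp
    qed
  qed
  qed
  have "{C \<in> S3. \<exists>!T. T \<in> (hull) convex ` T' \<and> convex hull C \<subseteq> T} = {C \<in> S3. \<exists>!Y. Y \<in> T' \<and> C \<subseteq> Y}"
    using iff by (intro Collect_cong conj_cong refl)
  then show ?thesis by (simp only: filter_image)
qed

lemma bd_eq: "boundary_triangles \<Delta> = (hull) convex ` BD"
proof -
  have "boundary_triangles \<Delta> = {\<sigma> \<in> (hull) convex ` {C \<in> K. card C = 3}. \<exists>!T. T \<in> (hull) convex ` T4 \<and> \<sigma> \<subseteq> T}"
    unfolding boundary_triangles_def faces3_eq by (simp add: faces_eq)
  also have "\<dots> = (hull) convex ` {C \<in> {C \<in> K. card C = 3}. \<exists>!Y. Y \<in> T4 \<and> C \<subseteq> Y}"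
    by (rule bd_eq_aux) auto
  also have "{C \<in> {C \<in> K. card C = 3}. \<exists>!Y. Y \<in> T4 \<and> C \<subseteq> Y} = BD" by (auto simp: BD_def)
  finally show ?thesis .
qed

text \<open>A relative interior point of \<open>C\<close> lies in some \<open>Z\<close>; the face
  spanned by \<open>C \<inter> Z\<close> then meets the relative interior and is therefore all of
  \<open>C\<close>.\<close>

lemma hull_cover:
  assumes "C \<in> K" "C \<noteq> {}" "F \<subseteq> K" "convex hull C \<subseteq> \<Union>((hull) convex ` F)"
  shows "\<exists>Z\<in>F. C \<subseteq> Z"
proof -
  have "rel_interior (convex hull C) \<noteq> {}"
    using assms(2) by (simp add: rel_interior_eq_empty)
  then obtain x where x: "x \<in> rel_interior (convex hull C)" by blast
  then have xC: "x \<in> convex hull C" using rel_interior_subset by blast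
  then obtain Z where Z: "Z \<in> F" "x \<in> convex hull Z" using assms(4) by auto
  then have xCZ: "x \<in> convex hull (C \<inter> Z)" using K_Int[of C Z] assms xC by blast
  have face: "convex hull (C \<inter> Z) face_of convex hull C"
    using face_of_convex_hull_affine_independent[OF K_D(2)[OF assms(1)]] by blast
  have "convex hull (C \<inter> Z) = convex hull C"
    using face_of_disjoint_rel_interior[OF face] x xCZ by blast
  then have "C \<inter> Z = C" by (rule hull_inj[OF K_subset[OF assms(1) Int_lower1] assms(1)])
  then show ?thesis using Z by blast
qed

lemma interior_aux:
  assumes "F \<subseteq> K" "C \<in> K" "C \<noteq> {}"
  shows "convex hull C \<subseteq> \<Union>((hull) convex ` F) \<longleftrightarrow> (\<exists>Z\<in>F. C \<subseteq> Z)"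
  using hull_cover[OF assms(2,3,1)] hull_mono[of C _ convex] by blast

lemma BD_K: "BD \<subseteq> K" by (auto simp: BD_def)

lemma interior_faces_eq: "interior_faces i \<Delta> = (hull) convex ` Int_faces (i + 1)"
proof -
  have "\<not> convex hull C \<subseteq> \<Union>(boundary_triangles \<Delta>) \<longleftrightarrow> \<not> (\<exists>Z\<in>BD. C \<subseteq> Z)" if "C \<in> K" "card C = i + 1" for C
    unfolding bd_eq using that by (subst interior_aux[OF BD_K]) auto
  then show ?thesis unfolding interior_faces_def faces_eq Int_faces_def by blast
qed

section \<open>Vertex stars\<close>

definition Stf :: "real^3 \<Rightarrow> (real^3) set set" where
  "Stf g = {Y \<in> T4. g \<in> Y}"

lemma star_eq:
  assumes g: "{g} \<in> K"
  shows "vertex_star {g} \<Delta> = (hull) convex ` {C \<in> K. \<exists>Y\<in>Stf g. C \<subseteq> Y}"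
proof (intro subset_antisym subsetI)
  have gi: "{g} \<subseteq> convex hull Y \<longleftrightarrow> g \<in> Y" if "Y \<in> K" for Y
    using hull_subset_iff[OF g that] by simp
  fix S
  { assume "S \<in> vertex_star {g} \<Delta>"
    then obtain T where S: "S \<in> \<Delta>" "T \<in> faces 3 \<Delta>" "{g} \<subseteq> T" "S \<subseteq> T" by (auto simp: vertex_star_def)
    obtain C where C: "C \<in> K" "S = convex hull C" using S(1) Delta_eq by auto
    obtain Y where Y: "Y \<in> T4" "T = convex hull Y" using S(2) faces3_eq by auto
    have "C \<subseteq> Y" "g \<in> Y" using C Y S hull_subset_iff[OF C(1) T4_K[OF Y(1)]] gi[OF T4_K[OF Y(1)]] by auto
    then show "S \<in> (hull) convex ` {C \<in> K. \<exists>Y\<in>Stf g. C \<subseteq> Y}" using C Y by (auto simp: Stf_def) }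
  { assume "S \<in> (hull) convex ` {C \<in> K. \<exists>Y\<in>Stf g. C \<subseteq> Y}"
    then obtain C Y where C: "C \<in> K" "S = convex hull C" "Y \<in> T4" "g \<in> Y" "C \<subseteq> Y" by (auto simp: Stf_def)
    then have "S \<in> \<Delta>" "convex hull Y \<in> faces 3 \<Delta>" "{g} \<subseteq> convex hull Y" "S \<subseteq> convex hull Y"
      using Delta_eq faces3_eq gi[OF T4_K] hull_mono[of C Y convex] by auto
    then show "S \<in> vertex_star {g} \<Delta>" unfolding vertex_star_def by blast }
qed

lemma star_faces_eq:
  assumes g: "{g} \<in> K"
  shows "faces i (vertex_star {g} \<Delta>) = (hull) convex ` {C \<in> K. card C = i + 1 \<and> (\<exists>Y\<in>Stf g. C \<subseteq> Y)}"
proof -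
  have "faces i (vertex_star {g} \<Delta>) = {S \<in> faces i \<Delta>. S \<in> vertex_star {g} \<Delta>}"
    unfolding faces_def vertex_star_def by blast
  also have "\<dots> = (hull) convex ` {C \<in> K. card C = i + 1 \<and> (\<exists>Y\<in>Stf g. C \<subseteq> Y)}"
  proof (intro subset_antisym subsetI)
    fix S assume S: "S \<in> {S \<in> faces i \<Delta>. S \<in> vertex_star {g} \<Delta>}"
    then obtain C where C: "C \<in> K" "card C = i + 1" "S = convex hull C" unfolding faces_eq by auto
    obtain D Y where D: "D \<in> K" "Y \<in> Stf g" "D \<subseteq> Y" "S = convex hull D" using S unfolding star_eq[OF g] by auto
    have "C = D" using hull_inj C D by auto
    then show "S \<in> (hull) convex ` {C \<in> K. card C = i + 1 \<and> (\<exists>Y\<in>Stf g. C \<subseteq> Y)}" using C D by blast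
  next
    fix S assume "S \<in> (hull) convex ` {C \<in> K. card C = i + 1 \<and> (\<exists>Y\<in>Stf g. C \<subseteq> Y)}"
    then show "S \<in> {S \<in> faces i \<Delta>. S \<in> vertex_star {g} \<Delta>}" unfolding faces_eq star_eq[OF g] by blast
  qed
  finally show ?thesis .
qed

text \<open>A face of the star without \<open>g\<close> lies in the triangle opposite to
  \<open>g\<close> in some tetrahedron; that triangle belongs to no other tetrahedron at
  \<open>g\<close>, so it is on the boundary of the star. Triangles containing \<open>g\<close> are
  boundary triangles of the star and of \<open>\<Delta>\<close> simultaneously.\<close>

lemma star_interior_eq:
  assumes g: "{g} \<in> K" and i: "i = 1 \<or> i = 2"
  shows "interior_faces i (vertex_star {g} \<Delta>) = (hull) convex ` {C \<in> Int_faces (i + 1). g \<in> C}"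
proof -
  let ?S = "vertex_star {g} \<Delta>"
  let ?S3 = "{C \<in> K. card C = 3 \<and> (\<exists>Y\<in>Stf g. C \<subseteq> Y)}"
  have f3: "faces 3 ?S = (hull) convex ` Stf g"
  proof -
    have "{C \<in> K. card C = 3 + 1 \<and> (\<exists>Y\<in>Stf g. C \<subseteq> Y)} = Stf g"
    proof (intro subset_antisym subsetI)
      fix C assume C: "C \<in> {C \<in> K. card C = 3 + 1 \<and> (\<exists>Y\<in>Stf g. C \<subseteq> Y)}"
      then obtain Y where Y: "Y \<in> Stf g" "C \<subseteq> Y" by blast
      then have "C = Y" using C T4_card[of Y] T4_finite[of Y] by (intro card_subset_eq) (auto simp: Stf_def)
      then show "C \<in> Stf g" using Y by simp
    qed (auto simp: Stf_def T4_def)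
    then show ?thesis using star_faces_eq[OF g, of 3] by simp
  qed
  define B where "B = {C \<in> ?S3. \<exists>!Y. Y \<in> Stf g \<and> C \<subseteq> Y}"
  have "boundary_triangles ?S = {\<sigma> \<in> (hull) convex ` ?S3. \<exists>!T. T \<in> (hull) convex ` Stf g \<and> \<sigma> \<subseteq> T}"
    unfolding boundary_triangles_def f3 by (simp add: star_faces_eq[OF g])
  also have "\<dots> = (hull) convex ` B"
    unfolding B_def by (rule bd_eq_aux) (auto simp: Stf_def)
  finally have bd: "boundary_triangles ?S = (hull) convex ` B" .
  have BK: "B \<subseteq> K" by (auto simp: B_def)
  have BBD: "Z \<in> B \<longleftrightarrow> Z \<in> BD" if "g \<in> Z" for Z
    using that pure unfolding B_def BD_def Stf_def by auto (metis subsetD)+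
  have "interior_faces i ?S = (hull) convex ` {C \<in> K. card C = i + 1 \<and> (\<exists>Y\<in>Stf g. C \<subseteq> Y) \<and> \<not> (\<exists>Z\<in>B. C \<subseteq> Z)}"
  proof -
    have "\<not> convex hull C \<subseteq> \<Union>(boundary_triangles ?S) \<longleftrightarrow> \<not> (\<exists>Z\<in>B. C \<subseteq> Z)" if "C \<in> K" "card C = i + 1" for C
      unfolding bd using that by (subst interior_aux[OF BK]) auto
    then show ?thesis unfolding interior_faces_def star_faces_eq[OF g] by blast
  qed
  also have "{C \<in> K. card C = i + 1 \<and> (\<exists>Y\<in>Stf g. C \<subseteq> Y) \<and> \<not> (\<exists>Z\<in>B. C \<subseteq> Z)} = {C \<in> Int_faces (i + 1). g \<in> C}"
  proof (intro subset_antisym subsetI)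
    fix C assume C: "C \<in> {C \<in> K. card C = i + 1 \<and> (\<exists>Y\<in>Stf g. C \<subseteq> Y) \<and> \<not> (\<exists>Z\<in>B. C \<subseteq> Z)}"
    then obtain Y where Y: "Y \<in> T4" "g \<in> Y" "C \<subseteq> Y" by (auto simp: Stf_def)
    have "g \<in> C"
    proof (rule ccontr)
      assume "g \<notin> C"
      then have CY: "C \<subseteq> Y - {g}" using Y by blast
      have "Y - {g} \<in> B"
      proof -
        have "Y - {g} \<in> K" "card (Y - {g}) = 3"
          using K_subset[OF T4_K[OF Y(1)]] T4_card[OF Y(1)] T4_finite[OF Y(1)] Y(2) by auto
        moreover have "\<exists>!Y'. Y' \<in> Stf g \<and> Y - {g} \<subseteq> Y'"
        proof (rule ex1I[of _ Y])
          fix Y' assume Y': "Y' \<in> Stf g \<and> Y - {g} \<subseteq> Y'"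
          then have "Y \<subseteq> Y'" by (auto simp: Stf_def)
          then show "Y' = Y" using Y' T4_card[OF Y(1)] T4_card[of Y'] T4_finite[of Y']
            by (metis (no_types, lifting) Stf_def card_subset_eq mem_Collect_eq)
        qed (use Y in \<open>auto simp: Stf_def\<close>)
        ultimately show ?thesis unfolding B_def by blast
      qed
      then show False using C CY by blast
    qed
    moreover have "\<not> (\<exists>Z\<in>BD. C \<subseteq> Z)" using C BBD calculation by blast
    ultimately show "C \<in> {C \<in> Int_faces (i + 1). g \<in> C}" using C by (simp add: Int_faces_def)
  next
    fix C assume C: "C \<in> {C \<in> Int_faces (i + 1). g \<in> C}"
    then obtain Y where "Y \<in> T4" "C \<subseteq> Y" using pure[of C] by (auto simp: Int_faces_def)
    moreover have "\<not> (\<exists>Z\<in>B. C \<subseteq> Z)" using C BBD by (auto simp: Int_faces_def)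
    ultimately show "C \<in> {C \<in> K. card C = i + 1 \<and> (\<exists>Y\<in>Stf g. C \<subseteq> Y) \<and> \<not> (\<exists>Z\<in>B. C \<subseteq> Z)}"
      using C by (auto simp: Int_faces_def Stf_def)
  qed
  finally show ?thesis .
qed

section \<open>The two sides of an interior triangle\<close>

lemma Int_faces_up: "C \<in> Int_faces k \<Longrightarrow> C \<subseteq> D \<Longrightarrow> D \<in> K \<Longrightarrow> card D = k' \<Longrightarrow> D \<in> Int_faces k'"
  unfolding Int_faces_def by blast

lemma Int_faces_K: "C \<in> Int_faces k \<Longrightarrow> C \<in> K" by (simp add: Int_faces_def)

lemma finite_Int_faces: "finite (Int_faces k)" using finite_K by (simp add: Int_faces_def)

lemma tet_bary: "Y \<in> T4 \<Longrightarrow> \<exists>b. bary_tet Y b"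
  using bary_tet_exists K_D(2) T4_K T4_card by blast

text \<open>Otherwise moving slightly from the centroid \<open>m\<close> of the triangle towards
  \<open>c\<close> stays in both tetrahedra, hence in the triangle, and \<open>c\<close> would lie
  in its plane.\<close>

lemma opposite_side:
  assumes Y: "insert a X \<in> T4" "insert c X \<in> T4" and X: "card X = 3" "a \<noteq> c" "a \<notin> X" "c \<notin> X"
    and b: "bary_tet (insert a X) b"
  shows "b a c < 0"
proof (rule ccontr)
  interpret bary_tet "insert a X" b by (rule b)
  assume nn: "\<not> b a c < 0"
  have finX': "finite X" using X(1) by (metis card.infinite zero_neq_numeral)
  have Xne: "X \<noteq> {}" using X(1) by auto
  define m where "m = (\<Sum>w\<in>X. (1/3) *\<^sub>R w)"
  have s1: "(\<Sum>w\<in>X. 1/3 :: real) = 1" using X(1) by simp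
  have mX: "m \<in> convex hull X"
    unfolding m_def by (rule convex_sum[OF finX' convex_convex_hull]) (use s1 hull_inc in auto)
  have bm: "b w m = (if w = a then 0 else 1/3)" if "w \<in> insert a X" for w
  proof -
    have "b w m = (\<Sum>v\<in>X. (1/3) * b w v)"
      unfolding m_def using aff_affine_comb[OF b_aff[OF that], of "\<lambda>_. 1/3" X] s1 by simp
    also have "\<dots> = (\<Sum>v\<in>X. if v = w then 1/3 else 0)"
      using b_delta[OF that] by (intro sum.cong) auto
    also have "\<dots> = (if w = a then 0 else 1/3)" using that X(3) finX' by auto
    finally show ?thesis .
  qed
  define M where "M = (\<Sum>w\<in>insert a X. \<bar>b w c\<bar>) + 1"
  have M: "M > 0" "\<bar>b w c\<bar> \<le> M" if "w \<in> insert a X" for w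
  proof -
    have "\<bar>b w c\<bar> \<le> (\<Sum>w\<in>insert a X. \<bar>b w c\<bar>)" using that finX by (intro member_le_sum) auto
    then show "\<bar>b w c\<bar> \<le> M" by (simp add: M_def)
    show "M > 0" unfolding M_def by (intro add_nonneg_pos sum_nonneg) auto
  qed
  have Mp: "M > 0" using M by blast
  \<comment> \<open>Chosen so that \<open>e\<close> times any coordinate of \<open>c\<close> is at
    most (1 - e)/3, the weight that the first summand gives to each vertex of
    \<open>X\<close>.\<close>
  define e where "e = 1 / (3 * M + 3)"
  have e: "0 < e" "e < 1" "e * M \<le> 1/3 - e * (1/3)" using Mp by (auto simp: e_def field_simps)
  define x where "x = (1 - e) *\<^sub>R m + e *\<^sub>R c"
  have bx: "b w x = (1 - e) * b w m + e * b w c" if "w \<in> insert a X" for w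
  proof -
    have "b w \<in> aff" by (rule b_aff[OF that])
    then obtain k v where "b w = (\<lambda>x. k + v \<bullet> x)" by (auto simp: aff_def)
    then show ?thesis by (simp add: x_def inner_add_right algebra_simps)
  qed
  have "x \<in> convex hull (insert a X)"
    unfolding convex_hull_iff
  proof
    fix w assume w: "w \<in> insert a X"
    show "0 \<le> b w x"
    proof (cases "w = a")
      case True
      then show ?thesis using bx[OF w] bm[OF w] nn e by simp
    next
      case False
      have "e * \<bar>b w c\<bar> \<le> e * M" using M(2)[OF w] e(1) by simp
      moreover have "e * (- b w c) \<le> e * \<bar>b w c\<bar>" using e(1) by (intro mult_left_mono) auto
      ultimately have "e * b w c \<ge> - (1/3 - e * (1/3))" using e(3) by linarith
      moreover have "b w x = 1/3 - e * (1/3) + e * b w c"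
        using bx[OF w] bm[OF w] False by (simp add: left_diff_distrib diff_divide_distrib)
      ultimately show ?thesis by linarith
    qed
  qed
  moreover have "x \<in> convex hull (insert c X)"
  proof -
    have "m \<in> convex hull (insert c X)" using mX hull_mono[of X "insert c X" convex] by blast
    moreover have "c \<in> convex hull (insert c X)" by (simp add: hull_inc)
    ultimately show ?thesis unfolding x_def using e
      by (intro convexD[OF convex_convex_hull]) auto
  qed
  ultimately have "x \<in> convex hull (insert a X \<inter> insert c X)" using K_Int T4_K Y by blast
  also have "insert a X \<inter> insert c X = X" using X by auto
  finally have xX: "x \<in> affine hull X" using convex_hull_subset_affine_hull by blast
  have "m \<in> affine hull X" using mX convex_hull_subset_affine_hull by blast
  then have "(1 - 1/e) *\<^sub>R m + (1/e) *\<^sub>R x \<in> affine hull X"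
    using xX by (intro mem_affine[OF affine_affine_hull]) auto
  moreover have "(1 - 1/e) *\<^sub>R m + (1/e) *\<^sub>R x = c"
    using e by (simp add: x_def algebra_simps)
  ultimately have "c \<in> affine hull X" by simp
  then have "affine_dependent (insert c X)"
    unfolding affine_dependent_def using X(4) by (intro bexI[of _ c]) auto
  then show False using K_D(2) T4_K Y(2) by blast
qed

text \<open>A second tetrahedron exists since the triangle is not on the boundary. A third is
  impossible because three points cannot lie pairwise on opposite sides of one plane.\<close>

lemma two_tets:
  assumes s: "\<sigma> \<in> Int_faces 3"
  shows "\<exists>a c. a \<noteq> c \<and> a \<notin> \<sigma> \<and> c \<notin> \<sigma> \<and> {Y \<in> T4. \<sigma> \<subseteq> Y} = {insert a \<sigma>, insert c \<sigma>}"
proof -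
  have sK: "\<sigma> \<in> K" "card \<sigma> = 3" and nbd: "\<sigma> \<notin> BD" using s by (auto simp: Int_faces_def)
  have fs: "finite \<sigma>" using sK K_D by blast
  have form: "\<exists>a. a \<notin> \<sigma> \<and> Y = insert a \<sigma>" if Y: "Y \<in> T4" "\<sigma> \<subseteq> Y" for Y
  proof -
    have "card (Y - \<sigma>) = 1" using Y T4_card[OF Y(1)] sK fs by (simp add: card_Diff_subset)
    then obtain a where "Y - \<sigma> = {a}" by (metis card_1_singletonE)
    then show ?thesis using Y(2) by blast
  qed
  obtain Y where Y: "Y \<in> T4" "\<sigma> \<subseteq> Y" using pure[OF sK(1)] by blast
  then obtain a where a: "a \<notin> \<sigma>" "Y = insert a \<sigma>" using form by blast
  obtain Y' where Y': "Y' \<in> T4" "\<sigma> \<subseteq> Y'" "Y' \<noteq> Y"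
    using nbd Y sK unfolding BD_def by blast
  then obtain c where c: "c \<notin> \<sigma>" "Y' = insert c \<sigma>" using form by blast
  have ac: "a \<noteq> c" using Y' a c by auto
  have "Z = Y \<or> Z = Y'" if Z: "Z \<in> T4" "\<sigma> \<subseteq> Z" for Z
  proof (rule ccontr)
    assume "\<not> (Z = Y \<or> Z = Y')"
    moreover obtain d where d: "d \<notin> \<sigma>" "Z = insert d \<sigma>" using form[OF Z] by blast
    ultimately have ne: "d \<noteq> a" "d \<noteq> c" using a c by auto
    obtain b where b: "bary_tet (insert a \<sigma>) b" using tet_bary Y a by blast
    obtain b' where b': "bary_tet (insert c \<sigma>) b'" using tet_bary Y' c by blast
    interpret A: bary_tet "insert a \<sigma>" b by (rule b)
    have 1: "b a c < 0" "b a d < 0"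
      using opposite_side[of a \<sigma> c b] opposite_side[of a \<sigma> d b] Y Y' Z a c d ac ne b sK by auto
    have 2: "b' c d < 0" using opposite_side[of c \<sigma> d b'] Y' Z c d ne b' sK by auto
    interpret C: bary_tet "insert c \<sigma>" b' by (rule b')
    have "b a \<in> aff" using A.b_aff by blast
    \<comment> \<open>\<open>b a\<close> vanishes on \<open>\<sigma>\<close>, so it is a multiple of
      the coordinate of \<open>c\<close> in the second tetrahedron; a product of two negative values
      then contradicts \<open>b a d < 0\<close>.\<close>
    then have "b a = (\<Sum>w\<in>insert c \<sigma>. b a w *\<^sub>R b' w)" using C.aff_eq by blast
    also have "\<dots> = b a c *\<^sub>R b' c"
    proof -
      have "(\<Sum>w\<in>\<sigma>. b a w *\<^sub>R b' w) = 0" using A.b_delta a(1) by (intro sum.neutral) auto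
      then show ?thesis using fs c by simp
    qed
    finally have "b a d = b a c * b' c d" by (metis scaleR_fun_apply real_scaleR_def)
    then show False using 1 2 mult_neg_neg[of "b a c" "b' c d"] by simp
  qed
  then have "{Y \<in> T4. \<sigma> \<subseteq> Y} = {insert a \<sigma>, insert c \<sigma>}" using Y Y' a c by auto
  then show ?thesis using a c ac by blast
qed

end

subsection \<open>Connectivity of stars\<close>

text \<open>A small ball around \<open>f x\<close> cuts a convex set out of \<open>C\<close>, and a
  convex set minus a point is connected unless it is one-dimensional. The homeomorphism carries this
  back to \<open>S\<close>.\<close>

lemma punctured_neighbourhood:
  fixes S :: "'a::euclidean_space set" and C :: "'b::euclidean_space set"
  assumes hom: "S homeomorphic C" and C: "convex C"
    and dimC: "\<And>y \<delta>. y \<in> C \<Longrightarrow> 0 < \<delta> \<Longrightarrow> aff_dim (C \<inter> ball y \<delta>) \<noteq> 1"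
    and x: "x \<in> S" "open V" "x \<in> V"
  shows "\<exists>W. openin (top_of_set S) W \<and> x \<in> W \<and> W \<subseteq> V \<and> connected (W - {x})"
proof -
  obtain f h where fh: "homeomorphism S C f h" using hom by (auto simp: homeomorphic_def)
  have h: "continuous_on C h" "h ` C = S" "\<And>y. y \<in> C \<Longrightarrow> f (h y) = y" and f: "continuous_on S f" "f ` S = C" "\<And>y. y \<in> S \<Longrightarrow> h (f y) = y"
    using fh by (auto simp: homeomorphism_def)
  have fx: "f x \<in> C" using f x by auto
  have "h (f x) \<in> V" using f(3) x by simp
  then obtain \<delta> where \<delta>: "0 < \<delta>" "\<And>y. y \<in> C \<Longrightarrow> dist y (f x) < \<delta> \<Longrightarrow> h y \<in> V"
  proof -
    obtain e where e: "0 < e" "ball (h (f x)) e \<subseteq> V"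
      using openE[OF x(2) \<open>h (f x) \<in> V\<close>] by blast
    obtain d where "0 < d" "\<forall>y\<in>C. dist y (f x) < d \<longrightarrow> dist (h y) (h (f x)) < e"
      using h(1) fx e(1) unfolding continuous_on_iff by blast
    then show ?thesis using e(2) by (intro that[of d]) (auto simp: mem_ball dist_commute)
  qed
  define B where "B = C \<inter> ball (f x) \<delta>"
  define W where "W = S \<inter> f -` ball (f x) \<delta>"
  have "openin (top_of_set S) W"
    unfolding W_def using f(1) by (intro continuous_openin_preimage_gen) auto
  moreover have "x \<in> W" using x \<delta> by (simp add: W_def)
  moreover have "W \<subseteq> V"
  proof
    fix y assume "y \<in> W"
    then have "y \<in> S" "dist (f y) (f x) < \<delta>" by (auto simp: W_def dist_commute)
    then show "y \<in> V" using \<delta>(2)[of "f y"] f by auto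
  qed
  moreover have "connected (W - {x})"
  proof -
    have "convex B" unfolding B_def using C by (intro convex_Int) auto
    then have "connected (B - {f x})"
      using path_connected_punctured_convex[of B "f x"] dimC[OF fx \<delta>(1)] path_connected_imp_connected
      unfolding B_def by blast
    then have "connected (h ` (B - {f x}))"
      by (rule connected_continuous_image[rotated]) (rule continuous_on_subset[OF h(1)], auto simp: B_def)
    moreover have "h ` (B - {f x}) = W - {x}"
    proof (intro subset_antisym subsetI)
      fix y assume "y \<in> h ` (B - {f x})"
      then obtain z where "z \<in> B - {f x}" "y = h z" by blast
      then have z: "z \<in> C" "z \<in> ball (f x) \<delta>" "z \<noteq> f x" "y = h z" unfolding B_def by blast+
      then have "y \<in> S" "f y = z" using h by auto
      then show "y \<in> W - {x}" using z by (auto simp: W_def)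
    next
      fix y assume "y \<in> W - {x}"
      then have "y \<in> S" "f y \<in> ball (f x) \<delta>" "y \<noteq> x" by (auto simp: W_def)
      then have "f y \<in> B - {f x}" "y = h (f y)" using f x by (auto simp: B_def) (metis f(3) x(1))
      then show "y \<in> h ` (B - {f x})" by blast
    qed
    ultimately show ?thesis by simp
  qed
  ultimately show ?thesis by blast
qed

lemma aff_dim_Int_ball:
  fixes y :: "real^2"
  assumes "open U" "U \<subseteq> C" "U \<inter> ball y \<delta> \<noteq> {}"
  shows "aff_dim (C \<inter> ball y \<delta>) \<noteq> 1"
proof -
  have "U \<inter> ball y \<delta> \<subseteq> interior (C \<inter> ball y \<delta>)"
    using assms by (intro interior_maximal) auto
  then have "interior (C \<inter> ball y \<delta>) \<noteq> {}" using assms(3) by blast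
  then have "aff_dim (C \<inter> ball y \<delta>) = DIM(real^2)"
    by (rule aff_dim_nonempty_interior)
  then show ?thesis by simp
qed

lemma punctured_neighbourhood_disk:
  fixes S :: "(real^3) set"
  assumes "S homeomorphic cball (0::real^2) 1" "x \<in> S" "open V" "x \<in> V"
  shows "\<exists>W. openin (top_of_set S) W \<and> x \<in> W \<and> W \<subseteq> V \<and> connected (W - {x})"
proof (rule punctured_neighbourhood[OF assms(1) convex_cball _ assms(2-4)])
  fix y :: "real^2" and \<delta> :: real assume "y \<in> cball 0 1" "0 < \<delta>"
  then have "y \<in> ball y \<delta> \<inter> closure (ball 0 1)" by simp
  then have "ball 0 1 \<inter> ball y \<delta> \<noteq> {}"
    using open_Int_closure_eq_empty[OF open_ball, of y \<delta> "ball 0 1"] by blast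
  then show "aff_dim (cball 0 1 \<inter> ball y \<delta>) \<noteq> 1"
    by (intro aff_dim_Int_ball[of "ball 0 1"]) auto
qed

text \<open>The sphere is not convex, but removing a second point \<open>p\<close> turns it into a
  plane by stereographic projection, and what is open there is open in \<open>S\<close>.\<close>

lemma punctured_neighbourhood_sphere:
  fixes S :: "(real^3) set"
  assumes hom: "S homeomorphic sphere (0::real^3) 1" and x: "x \<in> S" "open V" "x \<in> V"
    and p: "p \<in> S" "p \<noteq> x"
  shows "\<exists>W. openin (top_of_set S) W \<and> x \<in> W \<and> W \<subseteq> V \<and> connected (W - {x})"
proof -
  obtain f h where fh: "homeomorphism S (sphere (0::real^3) 1) f h" using hom by (auto simp: homeomorphic_def)
  have fp: "f p \<in> sphere 0 1" using fh p by (auto simp: homeomorphism_def)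
  have "homeomorphism (S - {p}) (sphere 0 1 - {f p}) f h"
  proof (rule homeomorphism_of_subsets[OF fh])
    show "f ` (S - {p}) = sphere 0 1 - {f p}"
    proof -
      have "inj_on f S" using homeomorphism_apply1[OF fh] by (rule inj_on_inverseI)
      then have "f ` (S - {p}) = f ` S - f ` {p}" using p by (intro inj_on_image_set_diff) auto
      then show ?thesis using homeomorphism_image1[OF fh] by simp
    qed
  qed auto
  then have "(S - {p}) homeomorphic (sphere (0::real^3) 1 - {f p})" by (auto simp: homeomorphic_def)
  also have "(sphere (0::real^3) 1 - {f p}) homeomorphic {x::real^3. axis 1 1 \<bullet> x = 0}"
    using fp by (intro homeomorphic_punctured_sphere_hyperplane) (auto simp: axis_eq_0_iff)
  also have "{x::real^3. axis 1 1 \<bullet> x = 0} homeomorphic (UNIV :: (real^2) set)"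
  proof (rule homeomorphic_affine_sets)
    have "(axis 1 1 :: real^3) \<noteq> 0" by (simp add: axis_eq_0_iff)
    then have "aff_dim {x::real^3. axis 1 1 \<bullet> x = 0} = 2"
      using aff_dim_hyperplane[of "axis 1 1 :: real^3" 0] by simp
    then show "aff_dim {x::real^3. axis 1 1 \<bullet> x = 0} = aff_dim (UNIV :: (real^2) set)" by simp
  qed (auto simp: affine_hyperplane)
  finally have hom2: "(S - {p}) homeomorphic (UNIV :: (real^2) set)" .
  have "\<exists>W. openin (top_of_set (S - {p})) W \<and> x \<in> W \<and> W \<subseteq> V \<and> connected (W - {x})"
  proof (rule punctured_neighbourhood[OF hom2 convex_UNIV])
    fix y :: "real^2" and \<delta> :: real assume "0 < \<delta>"
    then show "aff_dim (UNIV \<inter> ball y \<delta>) \<noteq> 1"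
      by (intro aff_dim_Int_ball[of UNIV]) auto
  qed (use x p in auto)
  moreover have "openin (top_of_set S) (S - {p})" by (intro openin_delete) auto
  ultimately show ?thesis using openin_trans by blast
qed

lemma connected_closed_cover:
  assumes "connected S" "S \<subseteq> A \<union> B" "closed A" "closed B" "A \<inter> S \<noteq> {}" "B \<inter> S \<noteq> {}"
  shows "A \<inter> B \<inter> S \<noteq> {}"
  using assms unfolding connected_closed by blast

section \<open>Chains of tetrahedra and the edge graph of a link\<close>

context tet_part
begin

definition L :: "real^3 \<Rightarrow> (real^3) set" where
  "L g = (\<Union>Y\<in>Stf g. convex hull (Y - {g}))"

lemma Stf_D: "Y \<in> Stf g \<Longrightarrow> Y \<in> T4" "Y \<in> Stf g \<Longrightarrow> g \<in> Y" by (auto simp: Stf_def)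

lemma Stf_minus: "Y \<in> Stf g \<Longrightarrow> Y - {g} \<in> K"
  using K_subset T4_K Stf_D by blast

lemma link_eq:
  assumes g: "{g} \<in> K"
  shows "\<Union>(vertex_link {g} \<Delta>) = L g"
proof (intro subset_antisym subsetI)
  have gi: "{g} \<subseteq> convex hull Y \<longleftrightarrow> g \<in> Y" if "Y \<in> K" for Y
    using hull_subset_iff[OF g that] by simp
  fix x
  { assume "x \<in> \<Union>(vertex_link {g} \<Delta>)"
    then obtain S T where S: "x \<in> S" "S \<in> \<Delta>" "\<not> {g} \<subseteq> S" "T \<in> \<Delta>" "{g} \<subseteq> T" "S \<subseteq> T"
      by (auto simp: vertex_link_def)
    obtain C where C: "C \<in> K" "S = convex hull C" using S(2) Delta_eq by auto
    obtain D where D: "D \<in> K" "T = convex hull D" using S(4) Delta_eq by auto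
    have "C \<subseteq> D" "g \<in> D" "g \<notin> C" using S C D gi hull_subset_iff by auto
    moreover obtain Y where "Y \<in> T4" "D \<subseteq> Y" using pure[OF D(1)] by blast
    ultimately have "Y \<in> Stf g" "C \<subseteq> Y - {g}" by (auto simp: Stf_def)
    then show "x \<in> L g" unfolding L_def using S(1) C(2) hull_mono[of C "Y - {g}" convex] by blast }
  { assume "x \<in> L g"
    then obtain Y where Y: "Y \<in> Stf g" "x \<in> convex hull (Y - {g})" by (auto simp: L_def)
    have "convex hull (Y - {g}) \<in> \<Delta>" using K_D(3) Stf_minus[OF Y(1)] by blast
    moreover have "\<not> {g} \<subseteq> convex hull (Y - {g})" using gi[OF Stf_minus[OF Y(1)]] by blast
    moreover have "convex hull Y \<in> \<Delta>" "{g} \<subseteq> convex hull Y" using K_D(3) T4_K Stf_D[OF Y(1)] gi by blast+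
    moreover have "convex hull (Y - {g}) \<subseteq> convex hull Y" by (intro hull_mono) auto
    ultimately show "x \<in> \<Union>(vertex_link {g} \<Delta>)" using Y(2) unfolding vertex_link_def by blast }
qed

lemma vertex_face: "{g} \<in> K \<Longrightarrow> {g} \<in> faces 0 \<Delta>"
  unfolding faces_eq by (rule image_eqI[of _ _ "{g}"]) auto

lemma L_cases:
  assumes "{g} \<in> K"
  shows "L g homeomorphic sphere (0::real^3) 1 \<or> L g homeomorphic cball (0::real^2) 1"
  using tp vertex_face[OF assms] link_eq[OF assms] unfolding tetrahedral_partition_def by (metis Diff_iff)

lemma connected_L:
  assumes "{g} \<in> K" shows "connected (L g)"
  using L_cases[OF assms] homeomorphic_connectedness[of "L g" "sphere (0::real^3) 1"]
    homeomorphic_connectedness[of "L g" "cball (0::real^2) 1"] connected_sphere[of "0::real^3" 1] connected_cball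
  by auto

lemma closed_hulls: "F \<subseteq> Stf g \<Longrightarrow> closed (\<Union>Y\<in>F. convex hull (Y - {g}))"
proof (intro closed_UN ballI)
  assume F: "F \<subseteq> Stf g"
  then have "F \<subseteq> T4" using Stf_D by blast
  then show "finite F" using finite_T4 finite_subset by blast
  fix Y assume "Y \<in> F"
  then have "finite (Y - {g})" using F Stf_D T4_finite by blast
  then show "closed (convex hull (Y - {g}))" by (intro compact_imp_closed compact_convex_hull finite_imp_compact)
qed

lemma hull_minus_Int:
  "Y \<in> Stf g \<Longrightarrow> Y' \<in> Stf g \<Longrightarrow> convex hull (Y - {g}) \<inter> convex hull (Y' - {g}) = convex hull (Y \<inter> Y' - {g})"
  using K_Int[OF Stf_minus Stf_minus, of Y g Y' g] by (simp add: Int_Diff Diff_Int_distrib2 Int_commute Diff_Int2)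

text \<open>A step through a common triangle. Its reflexive transitive closure
  \<open>reach Z\<close> expresses connectedness of the dual graph of the star of
  \<open>Z\<close>.\<close>

definition adj :: "(real^3) set \<Rightarrow> (real^3) set \<Rightarrow> (real^3) set \<Rightarrow> bool" where
  "adj Z Y Y' \<longleftrightarrow> Y \<in> T4 \<and> Y' \<in> T4 \<and> Z \<subseteq> Y \<and> Z \<subseteq> Y' \<and> card (Y \<inter> Y') = 3"

abbreviation reach :: "(real^3) set \<Rightarrow> (real^3) set \<Rightarrow> (real^3) set \<Rightarrow> bool" where
  "reach Z \<equiv> (adj Z)\<^sup>*\<^sup>*"

lemma reach_mono: "reach Z Y Y' \<Longrightarrow> Z' \<subseteq> Z \<Longrightarrow> reach Z' Y Y'"
proof (induction rule: rtranclp_induct)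
  case (step Y' Y'')
  then have "adj Z' Y' Y''" by (auto simp: adj_def)
  then show ?case using step by auto
qed simp

lemma T4_Int_card:
  assumes "Y \<in> T4" "Y' \<in> T4" "Y \<noteq> Y'" shows "card (Y \<inter> Y') < 4"
proof (rule ccontr)
  assume "\<not> card (Y \<inter> Y') < 4"
  then have "4 \<le> card (Y \<inter> Y')" by simp
  then have "Y \<inter> Y' = Y"
    using T4_card[OF assms(1)] by (intro card_seteq T4_finite[OF assms(1)]) auto
  moreover have "Y \<inter> Y' = Y'"
    using T4_card[OF assms(2)] \<open>4 \<le> card (Y \<inter> Y')\<close> by (intro card_seteq T4_finite[OF assms(2)]) auto
  ultimately show False using assms(3) by blast
qed

text \<open>Seen from \<open>g\<close>, the tetrahedra at the edge are the triangles around the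
  point \<open>h\<close> of the link. If they fell into two classes, a small connected punctured
  neighbourhood of \<open>h\<close> would be covered by two closed sets; these meet at a point other
  than \<open>h\<close>, and tetrahedra meeting there share a triangle.\<close>

lemma reach_edge:
  assumes gh: "g \<noteq> h" and Y: "Y \<in> T4" "{g, h} \<subseteq> Y" and Y': "Y' \<in> T4" "{g, h} \<subseteq> Y'"
  shows "reach {g, h} Y Y'"
proof (rule ccontr)
  assume nr: "\<not> reach {g, h} Y Y'"
  define A where "A = {Z \<in> T4. {g, h} \<subseteq> Z \<and> reach {g, h} Y Z}"
  define B where "B = {Z \<in> T4. {g, h} \<subseteq> Z \<and> \<not> reach {g, h} Y Z}"
  have AB: "Y \<in> A" "Y' \<in> B" using Y Y' nr by (auto simp: A_def B_def)
  have AS: "A \<subseteq> Stf g" "B \<subseteq> Stf g" by (auto simp: A_def B_def Stf_def)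
  have gK: "{g} \<in> K" by (rule K_subset[OF T4_K[OF Y(1)]]) (use Y in blast)
  let ?F = "\<lambda>S. \<Union>Y\<in>S. convex hull (Y - {g})"
  \<comment> \<open>The triangles of the link that miss \<open>h\<close> form a closed set not
    containing \<open>h\<close>; the neighbourhood is taken in its complement.\<close>
  let ?R = "{Z \<in> Stf g. h \<notin> Z}"
  have hin: "h \<in> convex hull (Z - {g})" if "Z \<in> A \<union> B" for Z
  proof (rule hull_inc)
    have "{g, h} \<subseteq> Z" using that unfolding A_def B_def by blast
    then show "h \<in> Z - {g}" using gh by blast
  qed
  have hL: "h \<in> L g" using hin[of Y] AB AS unfolding L_def by blast
  have hK: "{h} \<in> K" by (rule K_subset[OF T4_K[OF Y(1)]]) (use Y in blast)
  have hR: "h \<notin> ?F ?R"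
  proof
    assume "h \<in> ?F ?R"
    then obtain Z where Z: "Z \<in> Stf g" "h \<notin> Z" "h \<in> convex hull (Z - {g})" by blast
    then have "convex hull {h} \<subseteq> convex hull (Z - {g})" by simp
    then show False using hull_subset_iff[OF hK Stf_minus[OF Z(1)]] Z(2) by blast
  qed
  obtain v where v: "v \<in> Y" "v \<noteq> g" "v \<noteq> h"
  proof -
    have "card (Y - {g, h}) = 2" using T4_card[OF Y(1)] T4_finite[OF Y(1)] Y(2) gh by (simp add: card_Diff_subset)
    then have "Y - {g, h} \<noteq> {}" by (metis card.empty zero_neq_numeral)
    then show ?thesis using that by blast
  qed
  have vL: "v \<in> L g" unfolding L_def using AB(1) AS(1) v hull_inc[of v "Y - {g}" convex] by blast
  have "\<exists>W. openin (top_of_set (L g)) W \<and> h \<in> W \<and> W \<subseteq> - ?F ?R \<and> connected (W - {h})"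
  proof -
    have op: "open (- ?F ?R)" using closed_hulls[of ?R g] by (auto simp: open_closed)
    have hV: "h \<in> - ?F ?R" using hR by blast
    show ?thesis
      using L_cases[OF gK] punctured_neighbourhood_sphere[OF _ hL op hV vL v(3)]
        punctured_neighbourhood_disk[OF _ hL op hV] by blast
  qed
  then obtain W where W: "openin (top_of_set (L g)) W" "h \<in> W" "W \<subseteq> - ?F ?R" "connected (W - {h})" by blast
  have WL: "W \<subseteq> L g" using W(1) openin_imp_subset by blast
  have cover: "W \<subseteq> ?F A \<union> ?F B"
  proof
    fix x assume x: "x \<in> W"
    then obtain Z where Z: "Z \<in> Stf g" "x \<in> convex hull (Z - {g})" using WL by (auto simp: L_def)
    have "h \<in> Z" using W(3) x Z by blast
    then have "Z \<in> A \<union> B" using Z(1) by (auto simp: A_def B_def Stf_def)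
    then show "x \<in> ?F A \<union> ?F B" using Z(2) by blast
  qed
  have near: "?F S \<inter> (W - {h}) \<noteq> {}" if S: "Z \<in> S" "Z \<in> A \<union> B" for Z S
  proof -
    have Z: "Z \<in> T4" "{g, h} \<subseteq> Z" using S by (auto simp: A_def B_def)
    have "card (Z - {g, h}) = 2" using T4_card[OF Z(1)] T4_finite[OF Z(1)] Z(2) gh by (simp add: card_Diff_subset)
    then have "Z - {g, h} \<noteq> {}" by (metis card.empty zero_neq_numeral)
    then obtain u where u: "u \<in> Z" "u \<noteq> g" "u \<noteq> h" by blast
    obtain e where e: "0 < e" "ball h e \<inter> L g \<subseteq> W"
      using W(1,2) unfolding openin_contains_ball by blast
    \<comment> \<open>At most half the radius along the segment from \<open>h\<close> to
      \<open>u\<close>: the point is inside the ball and different from \<open>h\<close>.\<close>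
    define t where "t = min 1 (e / (2 * norm (u - h)))"
    have nu: "0 < norm (u - h)" using u by simp
    have t: "0 < t" "t \<le> 1" "t * norm (u - h) < e"
    proof -
      show "0 < t" "t \<le> 1" using e nu by (auto simp: t_def)
      have "t * norm (u - h) \<le> (e / (2 * norm (u - h))) * norm (u - h)"
        using nu by (intro mult_right_mono) (auto simp: t_def)
      also have "\<dots> = e / 2" using nu by simp
      finally show "t * norm (u - h) < e" using e by linarith
    qed
    let ?x = "(1 - t) *\<^sub>R h + t *\<^sub>R u"
    have xh: "?x \<in> convex hull (Z - {g})"
      using t u hin[OF S(2)] hull_inc[of u "Z - {g}" convex]
      by (intro convexD[OF convex_convex_hull]) auto
    have "?x - h = t *\<^sub>R (u - h)" by (simp add: algebra_simps)
    then have "norm (?x - h) = t * norm (u - h)" using t(1) by simp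
    then have "dist h ?x < e" "?x \<noteq> h" using t nu by (auto simp: dist_norm norm_minus_commute)
    moreover have "?x \<in> L g" using xh S(2) AS unfolding L_def by blast
    ultimately have "?x \<in> W - {h}" using e(2) by auto
    then show ?thesis using xh S(1) by blast
  qed
  have "?F A \<inter> ?F B \<inter> (W - {h}) \<noteq> {}"
    using W(4) cover closed_hulls[OF AS(1)] closed_hulls[OF AS(2)] near[of Y A] near[of Y' B] AB
    by (intro connected_closed_cover) auto
  then obtain x Z1 Z2 where x: "x \<noteq> h" "Z1 \<in> A" "Z2 \<in> B" "x \<in> convex hull (Z1 - {g})" "x \<in> convex hull (Z2 - {g})" by blast
  have Z12: "Z1 \<in> T4" "Z2 \<in> T4" "{g, h} \<subseteq> Z1" "{g, h} \<subseteq> Z2" "reach {g, h} Y Z1" "\<not> reach {g, h} Y Z2"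
    using x by (auto simp: A_def B_def)
  have "card (Z1 \<inter> Z2) \<noteq> 3"
  proof
    assume "card (Z1 \<inter> Z2) = 3"
    then have "adj {g, h} Z1 Z2" using Z12 by (simp add: adj_def)
    then show False using Z12(5,6) by (meson rtranclp.rtrancl_into_rtrancl)
  qed
  moreover have "card (Z1 \<inter> Z2) < 4" using T4_Int_card[OF Z12(1,2)] Z12(5,6) by auto
  moreover have "card {g, h} \<le> card (Z1 \<inter> Z2)" using Z12 T4_finite by (intro card_mono) auto
  ultimately have "card (Z1 \<inter> Z2) = card {g, h}" using gh by auto
  then have "{g, h} = Z1 \<inter> Z2" using Z12 T4_finite by (intro card_subset_eq) auto
  moreover have "x \<in> convex hull (Z1 \<inter> Z2 - {g})" using hull_minus_Int[of Z1 g Z2] x AS by blast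
  ultimately have "x \<in> convex hull {h}" using gh by (metis insert_Diff_if insert_Diff1 singletonI Diff_insert_absorb insert_absorb insert_not_empty singletonD)
  then show False using x(1) by simp
qed

text \<open>The link is connected, so the closed sets of two classes would meet; tetrahedra meeting
  there share an edge at \<open>g\<close>, and \<open>reach_edge\<close> joins them.\<close>

lemma reach_vertex:
  assumes Y: "Y \<in> Stf g" and Y': "Y' \<in> Stf g"
  shows "reach {g} Y Y'"
proof (rule ccontr)
  assume nr: "\<not> reach {g} Y Y'"
  define A where "A = {Z \<in> Stf g. reach {g} Y Z}"
  define B where "B = {Z \<in> Stf g. \<not> reach {g} Y Z}"
  have AB: "Y \<in> A" "Y' \<in> B" using Y Y' nr by (auto simp: A_def B_def)
  have AS: "A \<subseteq> Stf g" "B \<subseteq> Stf g" by (auto simp: A_def B_def)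
  have gK: "{g} \<in> K" by (rule K_subset[OF T4_K[OF Stf_D(1)[OF Y]]]) (use Stf_D(2)[OF Y] in blast)
  let ?F = "\<lambda>S. \<Union>Y\<in>S. convex hull (Y - {g})"
  have ne: "convex hull (Z - {g}) \<inter> L g \<noteq> {}" if Z: "Z \<in> Stf g" for Z
  proof -
    have "card (Z - {g}) = 3" using T4_card T4_finite Stf_D[OF Z] by simp
    then have "Z - {g} \<noteq> {}" by (metis card.empty zero_neq_numeral)
    then show ?thesis using Z hull_inc[of _ "Z - {g}" convex] unfolding L_def by blast
  qed
  have "?F A \<inter> ?F B \<inter> L g \<noteq> {}"
  proof (rule connected_closed_cover[OF connected_L[OF gK]])
    show "L g \<subseteq> ?F A \<union> ?F B" unfolding L_def A_def B_def by blast
    show "?F A \<inter> L g \<noteq> {}" "?F B \<inter> L g \<noteq> {}" using ne[OF Y] ne[OF Y'] AB by blast+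
  qed (use closed_hulls AS in auto)
  then obtain x Z1 Z2 where x: "Z1 \<in> A" "Z2 \<in> B" "x \<in> convex hull (Z1 - {g})" "x \<in> convex hull (Z2 - {g})" by blast
  then have "x \<in> convex hull (Z1 \<inter> Z2 - {g})" using hull_minus_Int AS by blast
  then have "Z1 \<inter> Z2 - {g} \<noteq> {}" by (metis convex_hull_empty empty_iff)
  then obtain h where h: "h \<in> Z1" "h \<in> Z2" "h \<noteq> g" by blast
  have Z12: "Z1 \<in> T4" "Z2 \<in> T4" "g \<in> Z1" "g \<in> Z2" "reach {g} Y Z1" "\<not> reach {g} Y Z2"
    using x Stf_D by (auto simp: A_def B_def)
  have "reach {g, h} Z1 Z2" using h Z12 by (intro reach_edge) auto
  then have "reach {g} Z1 Z2" by (rule reach_mono) auto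
  then show False using Z12(5,6) by (meson rtranclp_trans)
qed

lemma reach_Int:
  assumes Y: "Y \<in> T4" and Y': "Y' \<in> T4" and ne: "Y \<inter> Y' \<noteq> {}"
  shows "reach (Y \<inter> Y') Y Y'"
proof (cases "Y = Y'")
  case False
  then have c4: "card (Y \<inter> Y') < 4" using T4_Int_card Y Y' by blast
  have "card (Y \<inter> Y') \<noteq> 0" using ne T4_finite[OF Y] by simp
  then consider "card (Y \<inter> Y') = 1" | "card (Y \<inter> Y') = 2" | "card (Y \<inter> Y') = 3" using c4 by linarith
  then show ?thesis
  proof cases
    case 1
    then obtain g where g: "Y \<inter> Y' = {g}" by (metis card_1_singletonE)
    then have "Y \<in> Stf g" "Y' \<in> Stf g" using Y Y' by (auto simp: Stf_def)
    from reach_vertex[OF this] show ?thesis unfolding g .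
  next
    case 2
    then obtain g h where g: "Y \<inter> Y' = {g, h}" "g \<noteq> h" by (auto simp: card_2_iff)
    have "{g, h} \<subseteq> Y" "{g, h} \<subseteq> Y'" using g(1) by blast+
    from reach_edge[OF g(2) Y this(1) Y' this(2)] show ?thesis unfolding g(1) .
  next
    case 3
    then have "adj (Y \<inter> Y') Y Y'" using Y Y' by (simp add: adj_def)
    then show ?thesis by blast
  qed
qed simp

text \<open>If no edge of the link left \<open>U\<close>, each triangle would have its vertices all
  in \<open>U\<close> or all outside, and the link would split into two disjoint nonempty closed
  sets.\<close>

lemma skeleton_connected:
  assumes g: "{g} \<in> K" and U: "h \<in> U" "{g, h} \<in> K" "h \<noteq> g" and V: "k \<notin> U" "{g, k} \<in> K" "k \<noteq> g"
  shows "\<exists>h k. h \<in> U \<and> k \<notin> U \<and> h \<noteq> g \<and> k \<noteq> g \<and> {g, h, k} \<in> K"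
proof (rule ccontr)
  assume no: "\<not> ?thesis"
  define A where "A = {Y \<in> Stf g. Y - {g} \<subseteq> U}"
  define B where "B = {Y \<in> Stf g. (Y - {g}) \<inter> U = {}}"
  let ?F = "\<lambda>S. \<Union>Y\<in>S. convex hull (Y - {g})"
  have AB: "Y \<in> A \<union> B" if Y: "Y \<in> Stf g" for Y
  proof (rule ccontr)
    assume "Y \<notin> A \<union> B"
    then obtain a b where ab: "a \<in> Y - {g}" "a \<notin> U" "b \<in> Y - {g}" "b \<in> U" using Y by (auto simp: A_def B_def)
    have "{g, b, a} \<in> K" by (rule K_subset[OF T4_K[OF Stf_D(1)[OF Y]]]) (use Stf_D(2)[OF Y] ab in blast)
    then show False using no ab by blast
  qed
  have ex: "\<exists>Y\<in>Stf g. v \<in> Y" if "{g, v} \<in> K" for v using pure[OF that] by (auto simp: Stf_def)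
  obtain Y where Y: "Y \<in> Stf g" "h \<in> Y" using ex U by blast
  obtain Y' where Y': "Y' \<in> Stf g" "k \<in> Y'" using ex V by blast
  have YA: "Y \<in> A" "Y' \<in> B" using AB[OF Y(1)] AB[OF Y'(1)] Y Y' U V by (auto simp: A_def B_def)
  have "?F A \<inter> ?F B \<inter> L g \<noteq> {}"
  proof (rule connected_closed_cover[OF connected_L[OF g]])
    show "L g \<subseteq> ?F A \<union> ?F B" unfolding L_def using AB by blast
    show "closed (?F A)" "closed (?F B)" by (auto intro!: closed_hulls simp: A_def B_def)
    show "?F A \<inter> L g \<noteq> {}" using YA Y U hull_inc[of h "Y - {g}" convex] unfolding L_def by blast
    show "?F B \<inter> L g \<noteq> {}" using YA Y' V hull_inc[of k "Y' - {g}" convex] unfolding L_def by blast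
  qed
  then obtain x Z1 Z2 where x: "Z1 \<in> A" "Z2 \<in> B" "x \<in> convex hull (Z1 - {g})" "x \<in> convex hull (Z2 - {g})" by blast
  have "Z1 \<in> Stf g" "Z2 \<in> Stf g" using x by (auto simp: A_def B_def)
  then have "x \<in> convex hull (Z1 \<inter> Z2 - {g})" using hull_minus_Int x by blast
  moreover have "Z1 \<inter> Z2 - {g} = {}" using x by (auto simp: A_def B_def)
  ultimately show False by (simp only: convex_hull_empty empty_iff)
qed

lemma boundary_edge_exists:
  assumes "{g} \<in> K" "{g} \<notin> Int_faces 1"
  shows "\<exists>h. h \<noteq> g \<and> {g, h} \<in> K \<and> {g, h} \<notin> Int_faces 2"
proof -
  obtain Z where Z: "Z \<in> BD" "g \<in> Z" using assms by (auto simp: Int_faces_def)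
  have "card (Z - {g}) = 2" using Z BD_def K_D(1) by auto
  then have "Z - {g} \<noteq> {}" by (metis card.empty zero_neq_numeral)
  then obtain h where "h \<in> Z" "h \<noteq> g" by blast
  then show ?thesis using Z K_subset[of Z "{g, h}"] BD_K by (auto simp: Int_faces_def)
qed

text \<open>A tetrahedron at the edge gives two triangles, through \<open>a\<close> and
  \<open>b\<close>. The one through \<open>a\<close> is interior, and the second tetrahedron on it
  supplies a third vertex \<open>c\<close>.\<close>

lemma edge_degree:
  assumes \<tau>: "\<tau> \<in> Int_faces 2"
  shows "3 \<le> card {\<sigma> \<in> K. card \<sigma> = 3 \<and> \<tau> \<subseteq> \<sigma>}"
proof -
  have tK: "\<tau> \<in> K" "card \<tau> = 2" using \<tau> by (auto simp: Int_faces_def)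
  have ft: "finite \<tau>" using tK K_D by blast
  have tri: "insert x \<tau> \<in> Int_faces 3" if "insert x \<tau> \<subseteq> Y" "Y \<in> T4" "x \<notin> \<tau>" for x Y
    using Int_faces_up[OF \<tau>, of "insert x \<tau>" 3] K_subset[OF T4_K[OF that(2)] that(1)] that(3) tK ft by auto
  obtain Y where Y: "Y \<in> T4" "\<tau> \<subseteq> Y" using pure[OF tK(1)] by blast
  have "card (Y - \<tau>) = 2" using T4_card[OF Y(1)] tK Y ft by (simp add: card_Diff_subset)
  then obtain a b where ab: "Y - \<tau> = {a, b}" "a \<noteq> b" by (auto simp: card_2_iff)
  have a: "insert a \<tau> \<in> Int_faces 3" and b: "insert b \<tau> \<in> Int_faces 3" using tri[of _ Y] ab Y by auto
  obtain p q where pq: "p \<noteq> q" "p \<notin> insert a \<tau>" "q \<notin> insert a \<tau>" "{Y \<in> T4. insert a \<tau> \<subseteq> Y} = {insert p (insert a \<tau>), insert q (insert a \<tau>)}"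
    using two_tets[OF a] by blast
  have "\<exists>c. c \<noteq> b \<and> c \<notin> insert a \<tau> \<and> insert c (insert a \<tau>) \<in> T4"
    using pq by (metis (no_types, lifting) insertI1 insert_commute mem_Collect_eq)
  then obtain c where c: "c \<noteq> b" "c \<notin> insert a \<tau>" "insert c (insert a \<tau>) \<in> T4" by blast
  have "insert c \<tau> \<in> Int_faces 3" using tri[of c "insert c (insert a \<tau>)"] c by auto
  then have sub: "{insert a \<tau>, insert b \<tau>, insert c \<tau>} \<subseteq> {\<sigma> \<in> K. card \<sigma> = 3 \<and> \<tau> \<subseteq> \<sigma>}"
    using a b by (auto simp: Int_faces_def)
  have c3: "card {insert a \<tau>, insert b \<tau>, insert c \<tau>} = 3"
  proof -
    have "insert a \<tau> \<noteq> insert b \<tau>" "insert a \<tau> \<noteq> insert c \<tau>" "insert b \<tau> \<noteq> insert c \<tau>"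
      using ab c by auto
    then show ?thesis by simp
  qed
  have "finite {\<sigma> \<in> K. card \<sigma> = 3 \<and> \<tau> \<subseteq> \<sigma>}"
    by (rule finite_subset[OF _ finite_K]) blast
  from card_mono[OF this sub] show ?thesis unfolding c3 .
qed

end

subsection \<open>Splines as tuples of polynomials\<close>

lemma P_mono_Suc: "P d \<subseteq> P (Suc d)"
proof
  fix p :: "real^3 \<Rightarrow> real" assume p: "p \<in> P d"
  have "1 = (\<lambda>x::real^3. 1 + 0 \<bullet> x)" by (auto simp: fun_eq_iff)
  then have "(1 :: real^3 \<Rightarrow> real) \<in> aff" unfolding aff_def by blast
  from pw_SucI[OF this p] show "p \<in> P (Suc d)" by simp
qed

lemma P_mono: "d \<le> e \<Longrightarrow> P d \<subseteq> P e"
  by (induction e rule: nat_induct_at_least) (use P_mono_Suc in blast)+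

lemma P_const: "(\<lambda>x. c) \<in> P d"
  using P_mono[of 0 d] pw_0_iff[of "\<lambda>x. c" aff] by blast

section \<open>Vanishing to order r and gluing of polynomial pieces\<close>

definition dfr :: "(real^3 \<Rightarrow> real) \<Rightarrow> (real^3 \<Rightarrow> real^3 \<Rightarrow> real) \<Rightarrow> bool" where
  "dfr p D \<longleftrightarrow> (\<forall>x. (p has_derivative D x) (at x))"

lemma dfr_unique: "dfr p D \<Longrightarrow> dfr p D' \<Longrightarrow> D = D'"
  unfolding dfr_def using has_derivative_unique by blast

lemma dfr_add: "dfr p D \<Longrightarrow> dfr q E \<Longrightarrow> dfr (p + q) (\<lambda>x v. D x v + E x v)"
  unfolding dfr_def plus_fun_def by (auto intro: has_derivative_add)

lemma dfr_scale: "dfr p D \<Longrightarrow> dfr (c *\<^sub>R p) (\<lambda>x v. c * D x v)"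
  unfolding dfr_def scaleR_fun_def real_scaleR_def by (auto intro: has_derivative_mult_right)

lemma dfr_mult: "dfr p D \<Longrightarrow> dfr q E \<Longrightarrow> dfr (p * q) (\<lambda>x v. p x * E x v + D x v * q x)"
  unfolding dfr_def times_fun_def by (auto intro: has_derivative_mult)

lemma dfr_const: "dfr (\<lambda>x. c) (\<lambda>x v. 0)"
  unfolding dfr_def by simp

lemma dfr_aff: "l \<in> aff \<Longrightarrow> dfr l (\<lambda>x. ldir l)"
  unfolding dfr_def aff_def ldir_def by (auto intro!: derivative_eq_intros)

lemma dfr_exists: "p \<in> P d \<Longrightarrow> \<exists>D. dfr p D \<and> (\<forall>v. (\<lambda>x. D x v) \<in> P d)"
proof (induction d arbitrary: p)
  case 0
  then obtain c where "p = (\<lambda>x. c)" by (auto simp only: pw_0_iff)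
  then show ?case using dfr_const P_const by blast
next
  case (Suc d)
  from Suc.prems have "p \<in> span {g * p |g p. g \<in> aff \<and> p \<in> P d}" by simp
  then show ?case
  proof (induction rule: span_induct_alt)
    case base
    show ?case using dfr_const[of 0] P_const[of 0] unfolding zero_fun_def by blast
  next
    case (step c x y)
    then obtain g p' E D' where x: "x = g * p'" "g \<in> aff" "p' \<in> P d"
      and E: "dfr y E" "\<And>v. (\<lambda>x. E x v) \<in> P (Suc d)"
      and D': "dfr p' D'" "\<And>v. (\<lambda>x. D' x v) \<in> P d"
      using Suc.IH by blast
    have "dfr (c *\<^sub>R x + y) (\<lambda>x v. c * (g x * D' x v + ldir g v * p' x) + E x v)"
      unfolding x(1) by (intro dfr_add dfr_scale dfr_mult D' E dfr_aff x(2))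
    moreover have "(\<lambda>x. c * (g x * D' x v + ldir g v * p' x) + E x v) \<in> P (Suc d)" for v
    proof -
      have "c *\<^sub>R (g * (\<lambda>x. D' x v) + ldir g v *\<^sub>R p') + (\<lambda>x. E x v) \<in> P (Suc d)"
        using pw_SucI[OF x(2) D'(2)] P_mono_Suc x(3) E(2)
        by (intro subspace_add subspace_scale subspace_pw) blast+
      moreover have "c *\<^sub>R (g * (\<lambda>x. D' x v) + ldir g v *\<^sub>R p') + (\<lambda>x. E x v)
          = (\<lambda>x. c * (g x * D' x v + ldir g v * p' x) + E x v)"
        by (auto simp: fun_eq_iff)
      ultimately show ?thesis by (simp only:)
    qed
    ultimately show ?case by (intro exI conjI allI)
  qed
qed

text \<open>The derivatives up to order \<open>r\<close> vanish at \<open>x\<close>. The quantifier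
  over \<open>D\<close> replaces a derivative operator; for polynomials \<open>D\<close> exists and
  is unique.\<close>

primrec vanish :: "nat \<Rightarrow> real^3 \<Rightarrow> (real^3 \<Rightarrow> real) \<Rightarrow> bool" where
  "vanish 0 x f \<longleftrightarrow> f x = 0"
| "vanish (Suc r) x f \<longleftrightarrow> f x = 0 \<and> (\<forall>D. dfr f D \<longrightarrow> (\<forall>v. vanish r x (\<lambda>y. D y v)))"

lemma vanish_0: "vanish r x f \<Longrightarrow> f x = 0"
  by (cases r) auto

lemma vanish_zero: "vanish r x (\<lambda>y. 0)"
proof (induction r)
  case (Suc r)
  have "D = (\<lambda>x v. 0)" if "dfr (\<lambda>y. 0) D" for D
    using dfr_unique[OF that dfr_const] .
  then show ?case using Suc by auto
qed simp

lemma vanish_comb: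
  assumes "f \<in> P d" "g \<in> P d" "vanish r x f" "vanish r x g"
  shows "vanish r x (\<lambda>y. c * f y + g y)"
  using assms
proof (induction r arbitrary: f g)
  case (Suc r)
  obtain D where D: "dfr f D" "\<And>v. (\<lambda>x. D x v) \<in> P d" using dfr_exists Suc.prems(1) by blast
  obtain E where E: "dfr g E" "\<And>v. (\<lambda>x. E x v) \<in> P d" using dfr_exists Suc.prems(2) by blast
  have eq: "c *\<^sub>R f + g = (\<lambda>y. c * f y + g y)" by (auto simp: fun_eq_iff)
  have dd: "dfr (\<lambda>y. c * f y + g y) (\<lambda>x v. c * D x v + E x v)"
    using dfr_add[OF dfr_scale[OF D(1)] E(1), of c] unfolding eq .
  have "vanish r x (\<lambda>y. c * D y v + E y v)" for v
    using Suc.prems D E by (intro Suc.IH) auto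
  then show ?case using dfr_unique[OF dd] Suc.prems by auto
qed simp

text \<open>A derivative of l^(r+2) q is l^(r+1) times another polynomial, so the induction
  continues with a new cofactor.\<close>

lemma vanish_power:
  assumes "l \<in> aff" "l x = 0" "q \<in> P d"
  shows "vanish r x (l ^ (r + 1) * q)"
  using assms(3)
proof (induction r arbitrary: q d)
  case 0
  then show ?case using assms(2) by simp
next
  case (Suc r)
  obtain D where D: "dfr q D" "\<And>v. (\<lambda>x. D x v) \<in> P d" using dfr_exists Suc.prems by blast
  have pow: "dfr (l ^ Suc n) (\<lambda>x v. real (Suc n) * l x ^ n * ldir l v)" for n
  proof (induction n)
    case 0
    then show ?case using dfr_aff[OF assms(1)] by simp
  next
    case (Suc n)
    have "(\<lambda>x v. l x * (real (Suc n) * l x ^ n * ldir l v) + ldir l v * (l ^ Suc n) x)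
        = (\<lambda>x v. real (Suc (Suc n)) * l x ^ Suc n * ldir l v)"
      by (auto simp: fun_eq_iff algebra_simps)
    then show ?case using dfr_mult[OF dfr_aff[OF assms(1)] Suc] by (simp only: power_Suc)
  qed
  have dd: "dfr (l ^ (Suc r + 1) * q) (\<lambda>x v. (l ^ (Suc r + 1)) x * D x v + (real (Suc (Suc r)) * l x ^ Suc r * ldir l v) * q x)"
    using dfr_mult[OF pow[of "Suc r"] D(1)] by (simp only: Suc_eq_plus1)
  have "vanish r x (\<lambda>y. (l ^ (Suc r + 1)) y * D y v + (real (Suc (Suc r)) * l y ^ Suc r * ldir l v) * q y)" for v
  proof -
    have "l * (\<lambda>y. D y v) + (real (Suc (Suc r)) * ldir l v) *\<^sub>R q \<in> P (Suc d)"
      using pw_SucI[OF assms(1) D(2)] P_mono_Suc Suc.prems by (intro subspace_add subspace_scale subspace_pw) blast+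
    from Suc.IH[OF this]
    have "vanish r x (l ^ (r + 1) * (l * (\<lambda>y. D y v) + (real (Suc (Suc r)) * ldir l v) *\<^sub>R q))" .
    moreover have "l ^ (r + 1) * (l * (\<lambda>y. D y v) + (real (Suc (Suc r)) * ldir l v) *\<^sub>R q)
      = (\<lambda>y. (l ^ (Suc r + 1)) y * D y v + (real (Suc (Suc r)) * l y ^ Suc r * ldir l v) * q y)"
      by (auto simp: fun_eq_iff algebra_simps)
    ultimately show ?thesis by (simp only:)
  qed
  moreover have "(l ^ (Suc r + 1) * q) x = 0" using assms(2) by simp
  ultimately show ?case using dfr_unique[OF dd] unfolding vanish.simps by blast
qed

lemma tendsto_within_UN:
  assumes "finite I" "\<And>i. i \<in> I \<Longrightarrow> (f \<longlongrightarrow> l) (at x within S i)"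
  shows "(f \<longlongrightarrow> l) (at x within (\<Union>i\<in>I. S i))"
  using assms
proof (induction I rule: finite_induct)
  case (insert i I)
  then have "(f \<longlongrightarrow> l) (sup (at x within S i) (at x within (\<Union>i\<in>I. S i)))"
    by (intro filterlim_sup) auto
  then show ?case by (simp add: at_within_union)
qed simp

text \<open>On overlaps the pieces share their derivatives up to order \<open>r\<close>, so the
  derivative at \<open>x\<close> may be taken from any piece containing \<open>x\<close>, and the
  derivatives glue again with the order lowered by one. Limits along a finite union reduce to limits
  along the pieces.\<close>

lemma glue_cont_diff:
  fixes T :: "'t set" and S :: "'t \<Rightarrow> (real^3) set"
  assumes T: "finite T" "\<And>Y. Y \<in> T \<Longrightarrow> closed (S Y)"
    and p: "\<And>Y. Y \<in> T \<Longrightarrow> p Y \<in> P d" and F: "\<And>Y x. Y \<in> T \<Longrightarrow> x \<in> S Y \<Longrightarrow> F x = p Y x"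
    and vanish: "\<And>Y Y' x. Y \<in> T \<Longrightarrow> Y' \<in> T \<Longrightarrow> x \<in> S Y \<Longrightarrow> x \<in> S Y' \<Longrightarrow> vanish r x (\<lambda>y. p Y y - p Y' y)"
  shows "cont_diff_on r (\<Union>Y\<in>T. S Y) F"
  using p F vanish
proof (induction r arbitrary: p F)
  case 0
  have "continuous_on (S Y) F" if Y: "Y \<in> T" for Y
  proof -
    obtain D where "dfr (p Y) D" using dfr_exists 0(1)[OF Y] by blast
    then have "continuous_on (S Y) (p Y)"
      unfolding dfr_def by (meson has_derivative_at_withinI has_derivative_continuous_on)
    then show ?thesis using 0(2)[OF Y] by (simp cong: continuous_on_cong)
  qed
  then show ?case using T by (simp add: continuous_on_closed_Union)
next
  case (Suc r)
  obtain D where D: "\<And>Y. Y \<in> T \<Longrightarrow> dfr (p Y) (D Y)" "\<And>Y v. Y \<in> T \<Longrightarrow> (\<lambda>x. D Y x v) \<in> P d"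
  proof -
    have "\<forall>Y\<in>T. \<exists>D. dfr (p Y) D \<and> (\<forall>v. (\<lambda>x. D x v) \<in> P d)" using dfr_exists Suc.prems(1) by blast
    from bchoice[OF this] that show ?thesis by blast
  qed
  define tet where "tet x = (SOME Y. Y \<in> T \<and> x \<in> S Y)" for x
  define f' where "f' x = D (tet x) x" for x
  have tet: "tet x \<in> T" "x \<in> S (tet x)" if "x \<in> (\<Union>Y\<in>T. S Y)" for x
    using that someI_ex[of "\<lambda>Y. Y \<in> T \<and> x \<in> S Y"] unfolding tet_def by blast+
  have Dagr: "vanish r x (\<lambda>y. D Y y v - D Y' y v)" if "Y \<in> T" "Y' \<in> T" "x \<in> S Y" "x \<in> S Y'" for Y Y' x v
  proof -
    have "dfr (\<lambda>y. p Y y - p Y' y) (\<lambda>y v. D Y y v - D Y' y v)"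
      using D(1)[OF that(1)] D(1)[OF that(2)] unfolding dfr_def by (auto intro: has_derivative_diff)
    then show ?thesis using Suc.prems(3)[OF that] unfolding vanish.simps by blast
  qed
  have f'_eq: "f' x = D Y x" if "Y \<in> T" "x \<in> S Y" for Y x
  proof -
    have x: "x \<in> (\<Union>Y\<in>T. S Y)" using that by blast
    show ?thesis unfolding f'_def
      using vanish_0[OF Dagr[OF tet(1)[OF x] that(1) tet(2)[OF x] that(2)]] by (auto simp: fun_eq_iff)
  qed
  have der: "(F has_derivative f' x) (at x within (\<Union>Y\<in>T. S Y))" if x: "x \<in> (\<Union>Y\<in>T. S Y)" for x
    unfolding has_derivative_at_within
  proof (intro conjI tendsto_within_UN T(1))
    have "(p (tet x) has_derivative f' x) (at x)"
      using D(1)[OF tet(1)[OF x]] unfolding f'_def dfr_def by blast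
    then show "bounded_linear (f' x)" by (rule has_derivative_bounded_linear)
    fix Y assume Y: "Y \<in> T"
    show "((\<lambda>y. (F y - F x - f' x (y - x)) /\<^sub>R norm (y - x)) \<longlongrightarrow> 0) (at x within S Y)"
    proof (cases "x \<in> S Y")
      case False
      \<comment> \<open>A closed piece without \<open>x\<close> has no points near
        \<open>x\<close>.\<close>
      then have "at x within S Y = bot"
        using T(2)[OF Y] by (simp add: at_within_eq_bot_iff closure_closed)
      then show ?thesis by simp
    next
      case True
      have "(p Y has_derivative D Y x) (at x within S Y)"
        using D(1)[OF Y] unfolding dfr_def by (blast intro: has_derivative_at_withinI)
      then have lim: "((\<lambda>y. (p Y y - p Y x - D Y x (y - x)) /\<^sub>R norm (y - x)) \<longlongrightarrow> 0) (at x within S Y)"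
        unfolding has_derivative_at_within by blast
      have ev: "\<forall>\<^sub>F y in at x within S Y. (F y - F x - f' x (y - x)) /\<^sub>R norm (y - x) = (p Y y - p Y x - D Y x (y - x)) /\<^sub>R norm (y - x)"
        unfolding eventually_at_filter using Suc.prems(2)[OF Y] True f'_eq[OF Y True] by (intro always_eventually) auto
      show ?thesis by (rule iffD2[OF tendsto_cong[OF ev] lim])
    qed
  qed
  have "cont_diff_on r (\<Union>Y\<in>T. S Y) (\<lambda>x. f' x v)" for v
    by (rule Suc.IH[of "\<lambda>Y x. D Y x v"]) (use D(2) f'_eq Dagr in auto)
  then show ?case using der by auto
qed

lemma aff_zero_on_hull:
  assumes "l \<in> aff" "\<And>w. w \<in> X \<Longrightarrow> l w = 0" "x \<in> convex hull X"
  shows "l x = 0"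
proof -
  obtain c a where l: "l = (\<lambda>x. c + a \<bullet> x)" using assms(1) by (auto simp: aff_def)
  have "X \<subseteq> {x. a \<bullet> x = - c}"
    using assms(2) l by (auto simp: eq_neg_iff_add_eq_0 add.commute)
  then have "convex hull X \<subseteq> {x. a \<bullet> x = - c}"
    using convex_hyperplane[of a "- c"] by (metis hull_minimal)
  then show ?thesis using assms(3) l by auto
qed

lemma polynomial3_mono: "i + j + k \<le> d \<Longrightarrow> polynomial3 d (\<lambda>x. x$1 ^ i * x$2 ^ j * x$3 ^ k)"
  unfolding polynomial3_def
proof (rule exI[of _ "\<lambda>i' j' k'. if (i', j', k') = (i, j, k) then 1 else 0"], rule allI)
  fix x :: "real^3"
  assume ijk: "i + j + k \<le> d"
  have fin: "finite {(i', j', k'). i' + j' + k' \<le> d}"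
    by (rule finite_subset[of _ "{..d} \<times> {..d} \<times> {..d}"]) auto
  have "(\<Sum>(i',j',k') | i' + j' + k' \<le> d. (if (i', j', k') = (i, j, k) then 1 else 0) * x$1 ^ i' * x$2 ^ j' * x$3 ^ k')
     = (\<Sum>t | (case t of (i', j', k') \<Rightarrow> i' + j' + k' \<le> d). if t = (i, j, k) then x$1 ^ i * x$2 ^ j * x$3 ^ k else 0)"
  proof (rule sum.cong[OF refl])
    fix t :: "nat \<times> nat \<times> nat"
    show "(case t of (i', j', k') \<Rightarrow> (if (i', j', k') = (i, j, k) then 1 else 0) * x$1 ^ i' * x$2 ^ j' * x$3 ^ k')
        = (if t = (i, j, k) then x$1 ^ i * x$2 ^ j * x$3 ^ k else 0)"
      by (cases "t = (i, j, k)") (auto split: prod.splits)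
  qed
  also have "\<dots> = x$1 ^ i * x$2 ^ j * x$3 ^ k" using ijk fin by simp
  finally show "x$1 ^ i * x$2 ^ j * x$3 ^ k = (\<Sum>(i',j',k') | i' + j' + k' \<le> d. (if (i', j', k') = (i, j, k) then 1 else 0) * x$1 ^ i' * x$2 ^ j' * x$3 ^ k')"
    by simp
qed

text \<open>Homogenization: the index \<open>None\<close> stands for the constant 1 and takes up the
  missing degree, so total degree exactly \<open>d\<close> in four generators means degree at most
  \<open>d\<close> in three.\<close>

lemma P_polynomial3:
  assumes "p \<in> P d" shows "polynomial3 d p"
proof -
  let ?b = "\<lambda>i::3 option. case i of None \<Rightarrow> 1 | Some i \<Rightarrow> (\<lambda>x::real^3. x $ i)"
  have "P d = span (mon UNIV ?b ` exps UNIV d)"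
  proof (rule pw_eq_span_mon)
    have one: "(1 :: real^3 \<Rightarrow> real) = (\<lambda>x. 1 + 0 \<bullet> x)" by (auto simp: fun_eq_iff)
    have "(\<lambda>x::real^3. x $ i) \<in> aff" for i
      by (rule subsetD[OF lin_subset_aff linear_lin]) (auto intro!: linearI)
    moreover have "(1 :: real^3 \<Rightarrow> real) \<in> aff" unfolding aff_def using one by blast
    ultimately show "range ?b \<subseteq> aff" by (auto split: option.splits)
    show "aff \<subseteq> span (range ?b)"
    proof
      fix l :: "real^3 \<Rightarrow> real" assume "l \<in> aff"
      then obtain c a where l: "l = (\<lambda>x. c + a \<bullet> x)" by (auto simp: aff_def)
      have "l = c *\<^sub>R ?b None + (\<Sum>i\<in>UNIV. a $ i *\<^sub>R ?b (Some i))"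
        by (auto simp: l fun_eq_iff sum_fun_apply inner_vec_def)
      also have "\<dots> \<in> span (range ?b)" by (intro span_add span_scale span_sum span_base rangeI)
      finally show "l \<in> span (range ?b)" .
    qed
  qed simp
  then have "p \<in> span (mon UNIV ?b ` exps UNIV d)" using assms by simp
  then show ?thesis
  proof (induction rule: span_induct_alt)
    case base
    show ?case using polynomial3_zero unfolding zero_fun_def .
  next
    case (step c x y)
    then obtain \<alpha> where \<alpha>: "\<alpha> \<in> exps UNIV d" "x = mon UNIV ?b \<alpha>" by auto
    have U: "(UNIV :: 3 option set) = {None, Some 1, Some 2, Some 3}"
      using UNIV_3 UNIV_option_conv by (metis image_empty image_insert)
    have "\<alpha> (Some 1) + \<alpha> (Some 2) + \<alpha> (Some 3) \<le> d"
      using \<alpha>(1) by (simp add: exps_def U)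
    moreover have "x = (\<lambda>z. z$1 ^ \<alpha> (Some 1) * z$2 ^ \<alpha> (Some 2) * z$3 ^ \<alpha> (Some 3))"
      unfolding \<alpha>(2) by (rule ext, simp only: mon_apply) (simp add: mon_def U mult.assoc)
    ultimately have "polynomial3 d x" using polynomial3_mono by simp
    then have "polynomial3 d (\<lambda>z. c * x z + y z)" by (intro polynomial3_add polynomial3_scale step)
    moreover have "(\<lambda>z. c * x z + y z) = c *\<^sub>R x + y" by (auto simp: fun_eq_iff)
    ultimately show ?case by (simp only:)
  qed
qed

text \<open>On the line from the centroid to \<open>z\<close> the polynomial is univariate and
  vanishes on an interval.\<close>

lemma (in bary_tet) P_zero_on_hull:
  assumes p: "p \<in> P d" and 0: "\<And>x. x \<in> convex hull X \<Longrightarrow> p x = 0"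
  shows "p = 0"
proof
  fix z
  define g where "g = (\<Sum>w\<in>X. (1/4) *\<^sub>R w)"
  have bg: "b w g = 1/4" if w: "w \<in> X" for w
  proof -
    have "b w g = (\<Sum>v\<in>X. (1/4) * b w v)"
      unfolding g_def using aff_affine_comb[OF b_aff[OF w], of "\<lambda>_. 1/4" X] cardX by simp
    also have "\<dots> = (\<Sum>v\<in>X. if v = w then 1/4 else 0)" using b_delta[OF w] by (intro sum.cong) auto
    finally show ?thesis using w finX by simp
  qed
  let ?y = "z - g"
  obtain h where "expansion g d p h" using expansion_exists[OF p] by blast
  then have ex: "p (g + t *\<^sub>R ?y) = (\<Sum>e\<le>d. h e ?y * t ^ e)" for t by (simp add: expansion_def)
  define Q where "Q = (\<Sum>e\<le>d. monom (h e ?y) e)"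
  have Q: "poly Q t = p (g + t *\<^sub>R ?y)" for t by (simp add: Q_def poly_sum poly_monom ex)
  \<comment> \<open>All coordinates of the centroid are 1/4 and \<open>M\<close> bounds their
    slopes, so the line stays in the tetrahedron up to the parameter
    \<open>1 / (4 * M)\<close>.\<close>
  define M where "M = (\<Sum>w\<in>X. \<bar>ldir (b w) ?y\<bar>) + 1"
  have M: "\<bar>ldir (b w) ?y\<bar> \<le> M" if "w \<in> X" for w
    using member_le_sum[of w X "\<lambda>w. \<bar>ldir (b w) ?y\<bar>"] that finX by (simp add: M_def)
  have Mp: "M > 0" unfolding M_def by (intro add_nonneg_pos sum_nonneg) auto
  have "poly Q t = 0" if t: "t \<in> {0..1 / (4 * M)}" for t
  proof -
    have "g + t *\<^sub>R ?y \<in> convex hull X"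
      unfolding convex_hull_iff
    proof
      fix w assume w: "w \<in> X"
      have "\<bar>t * ldir (b w) ?y\<bar> \<le> (1 / (4 * M)) * M"
        unfolding abs_mult using t M[OF w] Mp by (intro mult_mono) auto
      then have "\<bar>t * ldir (b w) ?y\<bar> \<le> 1/4" using Mp by simp
      then show "0 \<le> b w (g + t *\<^sub>R ?y)" using aff_line[OF b_aff[OF w], of g t ?y] bg[OF w] by linarith
    qed
    then show ?thesis using 0 Q by simp
  qed
  then have "{0..1 / (4 * M)} \<subseteq> {t. poly Q t = 0}" by blast
  moreover have "infinite {0..1 / (4 * M)}" using Mp by (simp add: infinite_Icc)
  ultimately have "Q = 0" using poly_roots_finite finite_subset by blast
  then have "p (g + 1 *\<^sub>R ?y) = 0" using Q[of 1] by simp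
  then show "p z = 0 z" by simp
qed

section \<open>Jumps across interior triangles\<close>

context tet_part
begin

abbreviation SS :: "(real^3) set set" where "SS \<equiv> Int_faces 3"
abbreviation EE :: "(real^3) set set" where "EE \<equiv> Int_faces 2"

definition ell :: "(real^3) set \<Rightarrow> real^3 \<Rightarrow> real" where
  "ell \<sigma> = (SOME l. l \<in> aff \<and> l \<noteq> 0 \<and> (\<forall>w\<in>\<sigma>. l w = 0))"

text \<open>For a tetrahedron \<open>Y\<close> containing the triangle the sum has a single term,
  the sign of \<open>ell \<sigma>\<close> at the opposite vertex; it records the side on which
  \<open>Y\<close> lies.\<close>

definition sg :: "(real^3) set \<Rightarrow> (real^3) set \<Rightarrow> real" where
  "sg \<sigma> Y = (\<Sum>a\<in>Y - \<sigma>. sgn (ell \<sigma> a))"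

lemma ell:
  assumes "\<sigma> \<in> K" "card \<sigma> = 3"
  shows "ell \<sigma> \<in> aff" "ell \<sigma> \<noteq> 0" "\<And>w. w \<in> \<sigma> \<Longrightarrow> ell \<sigma> w = 0"
proof -
  obtain Y where Y: "Y \<in> T4" "\<sigma> \<subseteq> Y" using pure[OF assms(1)] by blast
  obtain b where b: "bary_tet Y b" using tet_bary[OF Y(1)] by blast
  interpret bary_tet Y b by (rule b)
  have "card (Y - \<sigma>) = 1" using assms Y cardX K_D(1)[OF assms(1)] by (simp add: card_Diff_subset)
  then obtain a where a: "Y - \<sigma> = {a}" by (metis card_1_singletonE)
  have aY: "a \<in> Y" using a by blast
  then have "b a a = 1" using b_delta by simp
  then have "b a \<noteq> 0" by auto
  moreover have "\<forall>w\<in>\<sigma>. b a w = 0"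
  proof
    fix w assume "w \<in> \<sigma>"
    then have "w \<in> Y" "a \<noteq> w" using a Y by auto
    then show "b a w = 0" using b_delta aY by simp
  qed
  ultimately have "\<exists>l. l \<in> aff \<and> l \<noteq> 0 \<and> (\<forall>w\<in>\<sigma>. l w = 0)" using b_aff a by blast
  from someI_ex[OF this] show "ell \<sigma> \<in> aff" "ell \<sigma> \<noteq> 0" "\<And>w. w \<in> \<sigma> \<Longrightarrow> ell \<sigma> w = 0"
    unfolding ell_def by blast+
qed

lemma ell_bary:
  assumes "\<sigma> \<in> K" "card \<sigma> = 3" "a \<notin> \<sigma>" "bary_tet (insert a \<sigma>) b"
  shows "ell \<sigma> = ell \<sigma> a *\<^sub>R b a" "ell \<sigma> a \<noteq> 0"
proof -
  interpret bary_tet "insert a \<sigma>" b by (rule assms(4))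
  have "ell \<sigma> = (\<Sum>w\<in>insert a \<sigma>. ell \<sigma> w *\<^sub>R b w)" using aff_eq ell(1)[OF assms(1,2)] by blast
  also have "\<dots> = ell \<sigma> a *\<^sub>R b a"
  proof -
    have "(\<Sum>w\<in>\<sigma>. ell \<sigma> w *\<^sub>R b w) = 0" using ell(3)[OF assms(1,2)] by (intro sum.neutral) auto
    then show ?thesis using finX assms(3) by simp
  qed
  finally show 1: "ell \<sigma> = ell \<sigma> a *\<^sub>R b a" .
  show "ell \<sigma> a \<noteq> 0"
  proof
    assume "ell \<sigma> a = 0"
    then have "ell \<sigma> = 0" by (subst 1) simp
    then show False using ell(2)[OF assms(1,2)] by blast
  qed
qed

lemma two_tets_sg:
  assumes "\<sigma> \<in> SS"
  shows "\<exists>Y Y'. Y \<noteq> Y' \<and> {Y \<in> T4. \<sigma> \<subseteq> Y} = {Y, Y'} \<and> sg \<sigma> Y' = - sg \<sigma> Y \<and> sg \<sigma> Y \<noteq> 0"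
proof -
  have s: "\<sigma> \<in> K" "card \<sigma> = 3" using assms by (auto simp: Int_faces_def)
  obtain a c where ac: "a \<noteq> c" "a \<notin> \<sigma>" "c \<notin> \<sigma>" "{Y \<in> T4. \<sigma> \<subseteq> Y} = {insert a \<sigma>, insert c \<sigma>}"
    using two_tets[OF assms] by blast
  have Y: "insert a \<sigma> \<in> T4" "insert c \<sigma> \<in> T4" using ac(4) by blast+
  obtain b where b: "bary_tet (insert a \<sigma>) b" using tet_bary[OF Y(1)] by blast
  have "ell \<sigma> c = ell \<sigma> a * b a c"
    using ell_bary(1)[OF s ac(2) b] by (metis scaleR_fun_apply real_scaleR_def)
  moreover have "b a c < 0" using opposite_side[OF Y s(2) ac(1-3) b] .
  ultimately have "sgn (ell \<sigma> c) = - sgn (ell \<sigma> a)" by (simp add: sgn_mult)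
  moreover have "sg \<sigma> (insert a \<sigma>) = sgn (ell \<sigma> a)" "sg \<sigma> (insert c \<sigma>) = sgn (ell \<sigma> c)"
    using ac by (auto simp: sg_def insert_Diff_if)
  moreover have "sgn (ell \<sigma> a) \<noteq> 0" using ell_bary(2)[OF s ac(2) b] by (simp add: sgn_zero_iff)
  moreover have "insert a \<sigma> \<noteq> insert c \<sigma>" using ac by blast
  ultimately show ?thesis using ac(4) by metis
qed

text \<open>On an interior triangle the two signs are opposite, so up to sign this is the difference
  of the two polynomials.\<close>

definition \<delta> :: "((real^3) set \<Rightarrow> 'v::real_vector) \<Rightarrow> (real^3) set \<Rightarrow> 'v" where
  "\<delta> p \<sigma> = (\<Sum>Y\<in>{Y \<in> T4. \<sigma> \<subseteq> Y}. sg \<sigma> Y *\<^sub>R p Y)"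

definition J :: "nat \<Rightarrow> nat \<Rightarrow> (real^3) set \<Rightarrow> (real^3 \<Rightarrow> real) set" where
  "J r d \<sigma> = (\<lambda>q. ell \<sigma> ^ (r + 1) * q) ` P (d - (r + 1))"

definition Salg :: "nat \<Rightarrow> nat \<Rightarrow> ((real^3) set \<Rightarrow> real^3 \<Rightarrow> real) set" where
  "Salg r d = {p \<in> dsum T4 (\<lambda>_. P d). \<forall>\<sigma>\<in>SS. \<delta> p \<sigma> \<in> J r d \<sigma>}"

lemma adj_SS:
  assumes "adj Z Y Y'" shows "Y \<inter> Y' \<in> SS"
proof -
  have Y: "Y \<in> T4" "Y' \<in> T4" "card (Y \<inter> Y') = 3" using assms by (auto simp: adj_def)
  have ne: "Y \<noteq> Y'" using Y T4_card by auto
  have s: "Y \<inter> Y' \<in> K" by (rule K_subset[OF T4_K[OF Y(1)]]) blast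
  have "Y \<inter> Y' \<notin> BD" using Y ne by (auto simp: BD_def)
  moreover have "Z = Y \<inter> Y'" if "Z \<in> BD" "Y \<inter> Y' \<subseteq> Z" for Z
    using that Y(3) K_D(1)[of Z] by (intro card_subset_eq[symmetric]) (auto simp: BD_def)
  ultimately show ?thesis using s Y(3) unfolding Int_faces_def by blast
qed

text \<open>Two tetrahedra with a common point need not share a triangle. They are joined by a chain
  of tetrahedra containing their intersection, and each step changes the polynomial by a multiple of
  the power of a form that is zero at \<open>x\<close>.\<close>

lemma Salg_vanish:
  assumes p: "p \<in> Salg r d" and Y: "Y \<in> T4" "Y' \<in> T4" and x: "x \<in> convex hull Y" "x \<in> convex hull Y'"
  shows "vanish r x (\<lambda>y. p Y y - p Y' y)"
proof -
  have pP: "p Y \<in> P d" if "Y \<in> T4" for Y using p that by (auto simp: Salg_def dsum_def)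
  have xZ: "x \<in> convex hull (Y \<inter> Y')" using K_Int[of Y Y'] T4_K Y x by blast
  then have ne: "Y \<inter> Y' \<noteq> {}" by (metis convex_hull_empty empty_iff)
  have diffP: "(\<lambda>y. f y - g y) \<in> P d" if "f \<in> P d" "g \<in> P d" for f g :: "real^3 \<Rightarrow> real"
    using subspace_diff[OF subspace_pw that] unfolding fun_diff_def .
  have "vanish r x (\<lambda>y. p Y y - p Y' y)" if "reach (Y \<inter> Y') Y Y''" "Y'' = Y'" for Y''
  proof -
    have "vanish r x (\<lambda>y. p Y y - p Y'' y)"
      using that(1)
    proof (induction rule: rtranclp_induct)
      case base
      show ?case using vanish_zero by simp
    next
      case (step U W)
      have UW: "U \<in> T4" "W \<in> T4" "Y \<inter> Y' \<subseteq> U \<inter> W" using step(2) by (auto simp: adj_def)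
      let ?\<sigma> = "U \<inter> W"
      have \<sigma>: "?\<sigma> \<in> SS" using adj_SS[OF step(2)] .
      then have sK: "?\<sigma> \<in> K" "card ?\<sigma> = 3" by (auto simp: Int_faces_def)
      have UneW: "U \<noteq> W" using sK(2) T4_card UW by auto
      obtain A B where AB: "A \<noteq> B" "{Y \<in> T4. ?\<sigma> \<subseteq> Y} = {A, B}" "sg ?\<sigma> B = - sg ?\<sigma> A" "sg ?\<sigma> A \<noteq> 0"
        using two_tets_sg[OF \<sigma>] by blast
      have "U \<in> {A, B}" "W \<in> {A, B}" using AB(2) UW by blast+
      then have cases: "(U = A \<and> W = B) \<or> (U = B \<and> W = A)" using UneW by blast
      have "\<delta> p ?\<sigma> = sg ?\<sigma> A *\<^sub>R p A + sg ?\<sigma> B *\<^sub>R p B" unfolding \<delta>_def AB(2) using AB(1) by simp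
      also have "\<dots> = sg ?\<sigma> A *\<^sub>R (p A - p B)" unfolding AB(3) by (simp add: scaleR_diff_right del: scaleR_fun_apply)
      finally have d: "\<delta> p ?\<sigma> = sg ?\<sigma> A *\<^sub>R (p A - p B)" .
      have "\<delta> p ?\<sigma> \<in> J r d ?\<sigma>" using p \<sigma> by (simp add: Salg_def)
      then obtain q where q: "\<delta> p ?\<sigma> = ell ?\<sigma> ^ (r + 1) * q" "q \<in> P (d - (r + 1))" by (auto simp: J_def)
      have x\<sigma>: "ell ?\<sigma> x = 0"
        using xZ UW(3) hull_mono[of "Y \<inter> Y'" ?\<sigma> convex]
        by (intro aff_zero_on_hull[OF ell(1)[OF sK] ell(3)[OF sK]]) auto
      have ag: "vanish r x (ell ?\<sigma> ^ (r + 1) * q)" by (rule vanish_power[OF ell(1)[OF sK] x\<sigma> q(2)])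
      have PP: "\<delta> p ?\<sigma> \<in> P d" unfolding d using cases UW pP by (intro subspace_scale subspace_diff subspace_pw) auto
      \<comment> \<open>The factor that recovers the difference from the jump, whichever of the two
        tetrahedra comes first.\<close>
      define k where "k = (if U = A then 1 / sg ?\<sigma> A else - 1 / sg ?\<sigma> A)"
      have kk: "p U y - p W y = k * \<delta> p ?\<sigma> y" for y
        using cases AB(1,4) unfolding d k_def by (auto simp: field_simps)
      have PU: "(\<lambda>y. p Y y - p U y) \<in> P d" by (rule diffP[OF pP[OF Y(1)] pP[OF UW(1)]])
      have "vanish r x (\<lambda>y. k * \<delta> p ?\<sigma> y + (p Y y - p U y))"
        using ag q(1) step.IH by (intro vanish_comb[OF PP PU]) simp_all
      moreover have "(\<lambda>y. k * \<delta> p ?\<sigma> y + (p Y y - p U y)) = (\<lambda>y. p Y y - p W y)"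
        unfolding kk[symmetric] by simp
      ultimately show ?case by simp
    qed
    then show ?thesis using that(2) by simp
  qed
  then show ?thesis using reach_Int[OF Y ne] by blast
qed

definition tetof :: "real^3 \<Rightarrow> (real^3) set" where
  "tetof x = (SOME Y. Y \<in> T4 \<and> x \<in> convex hull Y)"

definition Ext :: "((real^3) set \<Rightarrow> real^3 \<Rightarrow> real) \<Rightarrow> real^3 \<Rightarrow> real" where
  "Ext p x = (if x \<in> \<Union>\<Delta> then p (tetof x) x else 0)"

lemma Union_Delta: "\<Union>\<Delta> = (\<Union>Y\<in>T4. convex hull Y)"
proof (intro subset_antisym subsetI)
  fix x assume "x \<in> \<Union>\<Delta>"
  then obtain S where S: "S \<in> \<Delta>" "x \<in> S" by blast
  obtain T where "T \<in> faces 3 \<Delta>" "S \<subseteq> T"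
    using tp S(1) unfolding tetrahedral_partition_def by blast
  then show "x \<in> (\<Union>Y\<in>T4. convex hull Y)" using S(2) unfolding faces3_eq by blast
next
  fix x assume "x \<in> (\<Union>Y\<in>T4. convex hull Y)"
  then show "x \<in> \<Union>\<Delta>" using K_D(3) T4_K by blast
qed

lemma tetof: "x \<in> \<Union>\<Delta> \<Longrightarrow> tetof x \<in> T4 \<and> x \<in> convex hull (tetof x)"
  unfolding tetof_def Union_Delta by (rule someI_ex) blast

lemma linear_Ext: "linear Ext"
  by (rule linearI) (auto simp: Ext_def fun_eq_iff)

lemma Ext_eq:
  assumes "p \<in> Salg r d" "Y \<in> T4" "x \<in> convex hull Y"
  shows "Ext p x = p Y x"
proof -
  have x: "x \<in> \<Union>\<Delta>" using assms Union_Delta by blast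
  then have t: "tetof x \<in> T4" "x \<in> convex hull (tetof x)" using tetof by blast+
  from vanish_0[OF Salg_vanish[OF assms(1) t(1) assms(2) t(2) assms(3)]] show ?thesis using x by (simp add: Ext_def)
qed

lemma closed_tet: "Y \<in> T4 \<Longrightarrow> closed (convex hull Y)"
  using T4_finite by (intro compact_imp_closed compact_convex_hull finite_imp_compact)

lemma Ext_in_spline_space:
  assumes "p \<in> Salg r d" shows "Ext p \<in> spline_space r d \<Delta>"
  unfolding spline_space_def
proof (intro CollectI conjI allI impI ballI)
  show "Ext p x = 0" if "x \<notin> \<Union>\<Delta>" for x using that by (simp add: Ext_def)
  have pP: "p Y \<in> P d" if "Y \<in> T4" for Y using assms that by (auto simp: Salg_def dsum_def)
  show "cont_diff_on r (\<Union>\<Delta>) (Ext p)"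
    unfolding Union_Delta
    by (rule glue_cont_diff[where p = p and d = d]) (use finite_T4 closed_tet pP Ext_eq[OF assms] Salg_vanish[OF assms] in auto)
  fix T assume "T \<in> faces 3 \<Delta>"
  then obtain Y where "Y \<in> T4" "T = convex hull Y" unfolding faces3_eq by auto
  then show "\<exists>q. polynomial3 d q \<and> (\<forall>x\<in>T. Ext p x = q x)"
    using P_polynomial3[OF pP] Ext_eq[OF assms] by blast
qed

text \<open>A spline is a combination of monomials cut off to the points that \<open>tetof\<close>
  assigns to one tetrahedron. Finite dimension is what permits comparing
  \<open>dim (Salg r d)\<close> with \<open>spline_dim\<close>.\<close>

lemma fin_dim_spline_space: "fin_dim (spline_space r d \<Delta>)"
proof -
  let ?I = "{(i, j, k). i + j + k \<le> d}"
  let ?G = "\<lambda>(Y, i, j, k) x. if x \<in> \<Union>\<Delta> \<and> tetof x = Y then x$1 ^ i * x$2 ^ j * x$3 ^ k else (0::real)"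
  have finI: "finite ?I" by (rule finite_subset[of _ "{..d} \<times> {..d} \<times> {..d}"]) auto
  have "spline_space r d \<Delta> \<subseteq> span (?G ` (T4 \<times> ?I))"
  proof
    fix F assume F: "F \<in> spline_space r d \<Delta>"
    have "\<forall>Y\<in>T4. \<exists>c. \<forall>x\<in>convex hull Y. F x = (\<Sum>(i,j,k) | i + j + k \<le> d. c i j k * (x$1)^i * (x$2)^j * (x$3)^k)"
    proof
      fix Y assume "Y \<in> T4"
      then have "convex hull Y \<in> faces 3 \<Delta>" unfolding faces3_eq by blast
      then obtain p where p: "polynomial3 d p" "\<forall>x\<in>convex hull Y. F x = p x" using F unfolding spline_space_def by blast
      obtain c where "\<forall>x. p x = (\<Sum>(i,j,k) | i + j + k \<le> d. c i j k * (x$1)^i * (x$2)^j * (x$3)^k)"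
        using p(1) unfolding polynomial3_def by blast
      then show "\<exists>c. \<forall>x\<in>convex hull Y. F x = (\<Sum>(i,j,k) | i + j + k \<le> d. c i j k * (x$1)^i * (x$2)^j * (x$3)^k)"
        using p(2) by (intro exI[of _ c] ballI) simp
    qed
    from bchoice[OF this] obtain c where c: "\<And>Y x. Y \<in> T4 \<Longrightarrow> x \<in> convex hull Y \<Longrightarrow>
        F x = (\<Sum>(i,j,k) | i + j + k \<le> d. c Y i j k * (x$1)^i * (x$2)^j * (x$3)^k)" by blast
    have "F = (\<Sum>t\<in>T4 \<times> ?I. (case t of (Y, i, j, k) \<Rightarrow> c Y i j k) *\<^sub>R ?G t)"
    proof
      fix x
      have "(\<Sum>t\<in>T4 \<times> ?I. (case t of (Y, i, j, k) \<Rightarrow> c Y i j k) *\<^sub>R ?G t) x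
        = (\<Sum>Y\<in>T4. \<Sum>s\<in>?I. (case s of (i, j, k) \<Rightarrow> c Y i j k * ?G (Y, i, j, k) x))"
        unfolding sum_fun_apply sum.cartesian_product by (intro sum.cong) auto
      also have "\<dots> = F x"
      proof (cases "x \<in> \<Union>\<Delta>")
        case True
        then have t: "tetof x \<in> T4" "x \<in> convex hull (tetof x)" using tetof by blast+
        have "(\<Sum>Y\<in>T4. \<Sum>s\<in>?I. (case s of (i, j, k) \<Rightarrow> c Y i j k * ?G (Y, i, j, k) x))
           = (\<Sum>Y\<in>T4. if Y = tetof x then F x else 0)"
        proof (rule sum.cong[OF refl])
          fix Y assume Y: "Y \<in> T4"
          show "(\<Sum>s\<in>?I. (case s of (i, j, k) \<Rightarrow> c Y i j k * ?G (Y, i, j, k) x)) = (if Y = tetof x then F x else 0)"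
          proof (cases "Y = tetof x")
            case True
            then show ?thesis using c[OF t] \<open>x \<in> \<Union>\<Delta>\<close> by (auto simp: mult.assoc intro!: sum.cong)
          qed (auto intro!: sum.neutral)
        qed
        also have "\<dots> = F x" using t finite_T4 by simp
        finally show ?thesis .
      next
        case False
        then have "F x = 0" using F by (simp add: spline_space_def)
        then show ?thesis using False by (auto intro!: sum.neutral)
      qed
      finally show "F x = (\<Sum>t\<in>T4 \<times> ?I. (case t of (Y, i, j, k) \<Rightarrow> c Y i j k) *\<^sub>R ?G t) x" by simp
    qed
    also have "\<dots> \<in> span (?G ` (T4 \<times> ?I))" by (intro span_sum span_scale span_base imageI)
    finally show "F \<in> span (?G ` (T4 \<times> ?I))" .
  qed
  moreover have "finite (?G ` (T4 \<times> ?I))" using finite_T4 finI by blast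
  ultimately show ?thesis unfolding fin_dim_def by blast
qed

lemma linear_\<delta>: "linear \<delta>"
  by (rule linearI) (auto simp: \<delta>_def fun_eq_iff scaleR_add_right sum.distrib scaleR_sum_right mult.commute)

lemma subspace_J: "subspace (J r d \<sigma>)"
  unfolding J_def by (intro subspace_mult_image subspace_pw)

lemma fin_dim_P: "fin_dim (P d)"
  using K_nonempty tet_bary bary_tet.fin_dim_P by blast

lemma fin_dim_J: "fin_dim (J r d \<sigma>)"
  unfolding J_def by (intro fin_dim_image linear_mult_left fin_dim_P)

lemma Salg_eq: "Salg r d = {p \<in> dsum T4 (\<lambda>_. P d). (\<lambda>\<sigma>. if \<sigma> \<in> SS then \<delta> p \<sigma> else 0) \<in> dsum SS (J r d)}"
  unfolding Salg_def by (auto simp: dsum_def)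

lemma dim_Salg_le: "dim (Salg r d) \<le> spline_dim r d \<Delta>"
proof -
  have lin: "linear (\<lambda>p \<sigma>. if \<sigma> \<in> SS then \<delta> p \<sigma> else 0 :: real^3 \<Rightarrow> real)"
    by (intro linearI ext) (auto simp: linear_add[OF linear_\<delta>] linear_scale[OF linear_\<delta>])
  have sub: "subspace (Salg r d)"
    using subspace_inter[OF subspace_dsum[of T4 "\<lambda>_. P d", OF subspace_pw]
        linear_subspace_vimage[OF lin subspace_dsum[of SS "J r d", OF subspace_J]]]
    unfolding Salg_eq by (simp only: Int_def vimage_def mem_Collect_eq)
  have "dim (Salg r d) = dim (Ext ` Salg r d)"
  proof (rule dim_image_inj[symmetric, OF linear_Ext sub])
    show "fin_dim (Salg r d)"
      by (rule fin_dim_mono[OF fin_dim_dsum[OF finite_T4, of "\<lambda>_. P d"]]) (auto simp: Salg_def fin_dim_P)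
    fix p assume p: "p \<in> Salg r d" "Ext p = 0"
    have "p Y = 0" for Y
    proof (cases "Y \<in> T4")
      case True
      obtain b where b: "bary_tet Y b" using tet_bary[OF True] by blast
      show ?thesis
        by (rule bary_tet.P_zero_on_hull[OF b, of _ d])
          (use p True Ext_eq[OF p(1) True] in \<open>auto simp: Salg_def dsum_def\<close>)
    qed (use p in \<open>auto simp: Salg_def dsum_def\<close>)
    then show "p = 0" by (auto simp: fun_eq_iff)
  qed
  also have "\<dots> \<le> dim (spline_space r d \<Delta>)"
    using Ext_in_spline_space by (intro dim_mono' fin_dim_spline_space) auto
  also have "\<dots> = spline_dim r d \<Delta>"
  proof -
    \<comment> \<open>\<open>spline_dim\<close> is formed with \<open>fun_scale\<close>, which
      coincides with the scalar multiplication of the function space instance.\<close>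
    have "fun_scale = scaleR" by (auto simp: fun_scale_def fun_eq_iff)
    then show ?thesis by (simp add: spline_dim_def dim_raw_def)
  qed
  finally show ?thesis .
qed

end

subsection \<open>Gluing conditions at a vertex\<close>

lemma parallel_cross:
  assumes "n \<bullet> u = 0" "n \<bullet> v = 0"
  shows "cross3 n (cross3 u v) = 0"
  using assms by (simp add: Lagrange)

text \<open>\<open>n\<close> is orthogonal to \<open>u\<close> and \<open>v\<close>, hence parallel
  to their cross product; the identity for products of cross products relates the two without naming
  the factor.\<close>

lemma dot_cross_sgn:
  assumes "n \<bullet> u = 0" "n \<bullet> v = 0" "cross3 u v \<noteq> 0" "n \<bullet> w \<noteq> 0"
  shows "n \<bullet> cross3 u v \<noteq> 0" "sgn (n \<bullet> w) * sgn (n \<bullet> cross3 u v) = sgn (cross3 u v \<bullet> w)"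
proof -
  let ?m = "cross3 u v"
  have "0 = cross3 n ?m \<bullet> cross3 w ?m" using parallel_cross[OF assms(1,2)] by simp
  also have "\<dots> = (n \<bullet> w) * (?m \<bullet> ?m) - (n \<bullet> ?m) * (?m \<bullet> w)"
    by (simp add: dot_cross inner_commute)
  finally have eq: "(n \<bullet> w) * (?m \<bullet> ?m) = (n \<bullet> ?m) * (?m \<bullet> w)" by simp
  have mm: "?m \<bullet> ?m > 0" using assms(3) by simp
  then have "(n \<bullet> w) * (?m \<bullet> ?m) \<noteq> 0" using assms(4) by simp
  then show nm: "n \<bullet> ?m \<noteq> 0" unfolding eq by auto
  have "sgn (n \<bullet> w) = sgn ((n \<bullet> w) * (?m \<bullet> ?m))" using mm by (simp add: sgn_mult)
  also have "\<dots> = sgn (n \<bullet> ?m) * sgn (?m \<bullet> w)" unfolding eq by (simp add: sgn_mult)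
  finally have "sgn (n \<bullet> w) * sgn (n \<bullet> ?m) = (sgn (n \<bullet> ?m) * sgn (n \<bullet> ?m)) * sgn (?m \<bullet> w)"
    by (simp add: mult_ac)
  also have "sgn (n \<bullet> ?m) * sgn (n \<bullet> ?m) = 1" using nm by (simp add: sgn_real_def)
  finally show "sgn (n \<bullet> w) * sgn (n \<bullet> ?m) = sgn (?m \<bullet> w)" by simp
qed

lemma parallel_to_cross:
  assumes "cross3 u v \<noteq> 0" "c \<bullet> u = 0" "c \<bullet> v = 0"
  shows "\<exists>k. c = k *\<^sub>R cross3 u v"
proof -
  have "cross3 (cross3 u v) c = 0" using parallel_cross[OF assms(2,3)] by (metis cross_skew neg_equal_0_iff_equal)
  then have "collinear {0, cross3 u v, c}" by (simp add: cross_eq_0)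
  then show ?thesis using assms(1) by (auto simp: collinear_lemma intro: exI[of _ 0])
qed

section \<open>Orientation signs\<close>

context tet_part
begin

abbreviation nml :: "(real^3) set \<Rightarrow> real^3 \<Rightarrow> real" where "nml \<sigma> \<equiv> ldir (ell \<sigma>)"

lemma nml_inner:
  assumes "\<sigma> \<in> K" "card \<sigma> = 3"
  obtains n where "nml \<sigma> = (\<lambda>x. n \<bullet> x)"
  using ldir_lin[OF ell(1)[OF assms]] unfolding lin_def by blast

lemma nml_diff:
  assumes "\<sigma> \<in> K" "card \<sigma> = 3" "a \<in> \<sigma>"
  shows "nml \<sigma> (x - a) = ell \<sigma> x"
proof -
  have "ell \<sigma> (a + (x - a)) = ell \<sigma> a + nml \<sigma> (x - a)" by (rule aff_plus[OF ell(1)[OF assms(1,2)]])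
  then show ?thesis using ell(3)[OF assms] by simp
qed

lemma nml_lin: "\<sigma> \<in> K \<Longrightarrow> card \<sigma> = 3 \<Longrightarrow> nml \<sigma> \<in> lin"
  by (intro ldir_lin ell)

text \<open>The sign \<open>eps \<tau> \<sigma>\<close> compares the side of \<open>\<sigma>\<close> on which \<open>ell \<sigma>\<close> is positive with a fixed sense of rotation
  about the edge \<open>\<tau>\<close>; this choice makes the composition \<open>\<psi> \<circ> \<delta>\<close> below vanish on interior edges.\<close>

definition base :: "(real^3) set \<Rightarrow> real^3" where "base \<tau> = (SOME a. a \<in> \<tau>)"
definition dir :: "(real^3) set \<Rightarrow> real^3" where "dir \<tau> = (\<Sum>b\<in>\<tau> - {base \<tau>}. b - base \<tau>)"
definition eps :: "(real^3) set \<Rightarrow> (real^3) set \<Rightarrow> real" where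
  "eps \<tau> \<sigma> = (\<Sum>c\<in>\<sigma> - \<tau>. sgn (nml \<sigma> (cross3 (dir \<tau>) (c - base \<tau>))))"
text \<open>For an edge at \<open>g\<close>, whether \<open>dir \<tau>\<close> leaves
  \<open>g\<close> or points to it; this translates the fixed direction of an edge into the view
  from one of its ends.\<close>

definition ori :: "real^3 \<Rightarrow> (real^3) set \<Rightarrow> real" where
  "ori g \<tau> = (if base \<tau> = g then 1 else - 1)"

lemma ori_sq: "ori g \<tau> * ori g \<tau> = 1" by (simp add: ori_def)

lemma tri_cross:
  assumes \<sigma>: "{a, b, c} \<in> K" "card {a, b, c} = 3"
  shows "cross3 (b - a) (c - a) \<noteq> 0"
proof
  assume "cross3 (b - a) (c - a) = 0"
  then have "collinear {0, b - a, c - a}" by (simp add: cross_eq_0)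
  then have "collinear {b, a, c}" using collinear_3[of b a c] by (simp add: NO_MATCH_def)
  then have "b = a \<or> b = c \<or> a = c \<or> affine_dependent {b, a, c}"
    using collinear_3_eq_affine_dependent by auto
  moreover have "a \<noteq> b" "a \<noteq> c" "b \<noteq> c" using \<sigma>(2) by (auto simp: card_insert_if split: if_splits)
  moreover have "\<not> affine_dependent {b, a, c}" using K_D(2)[OF \<sigma>(1)] by (simp add: insert_commute)
  ultimately show False by auto
qed

lemma tri_orient:
  assumes \<sigma>: "{a, b, c} \<in> K" "card {a, b, c} = 3" and d: "insert d {a, b, c} \<in> T4" "d \<notin> {a, b, c}"
  shows "nml {a, b, c} (cross3 (b - a) (c - a)) \<noteq> 0"
    "sgn (ell {a, b, c} d) * sgn (nml {a, b, c} (cross3 (b - a) (c - a))) = sgn (cross3 (b - a) (c - a) \<bullet> (d - a))"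
proof -
  let ?\<sigma> = "{a, b, c}"
  obtain n where n: "nml ?\<sigma> = (\<lambda>x. n \<bullet> x)" using nml_inner[OF \<sigma>] .
  have "nml ?\<sigma> (b - a) = 0" "nml ?\<sigma> (c - a) = 0"
    using nml_diff[OF \<sigma>, of a] ell(3)[OF \<sigma>] by auto
  then have 0: "n \<bullet> (b - a) = 0" "n \<bullet> (c - a) = 0" by (simp_all add: n)
  obtain bb where "bary_tet (insert d ?\<sigma>) bb" using tet_bary[OF d(1)] by blast
  then have "ell ?\<sigma> d \<noteq> 0" using ell_bary(2)[OF \<sigma> d(2)] by blast
  moreover have e: "ell ?\<sigma> d = n \<bullet> (d - a)" using nml_diff[OF \<sigma>, of a d] by (simp add: n)
  ultimately have "n \<bullet> (d - a) \<noteq> 0" by simp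
  from dot_cross_sgn[OF 0 tri_cross[OF \<sigma>] this]
  show "nml ?\<sigma> (cross3 (b - a) (c - a)) \<noteq> 0"
    "sgn (ell ?\<sigma> d) * sgn (nml ?\<sigma> (cross3 (b - a) (c - a))) = sgn (cross3 (b - a) (c - a) \<bullet> (d - a))"
    unfolding n e by auto
qed

text \<open>Exchanging the base point reverses the direction of the edge and changes the cross
  product only by its sign.\<close>

lemma eps_vertex:
  assumes \<sigma>: "{g, h, k} \<in> K" "card {g, h, k} = 3"
  shows "eps {g, h} {g, h, k} = ori g {g, h} * sgn (nml {g, h, k} (cross3 (h - g) (k - g)))"
proof -
  have ne: "g \<noteq> h" "g \<noteq> k" "h \<noteq> k" using \<sigma>(2) by (auto simp: card_insert_if split: if_splits)
  have third: "{g, h, k} - {g, h} = {k}" using ne by auto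
  have "base {g, h} \<in> {g, h}" unfolding base_def by (rule someI[of _ g]) simp
  then consider "base {g, h} = g" | "base {g, h} = h" by blast
  then show ?thesis
  proof cases
    case 1
    then have "dir {g, h} = h - g" using ne by (simp add: dir_def insert_Diff_if)
    then show ?thesis using 1 third by (simp add: eps_def ori_def)
  next
    case 2
    then have d: "dir {g, h} = g - h" using ne by (simp add: dir_def insert_Diff_if)
    have "cross3 (g - h) (k - h) = - cross3 (h - g) (k - g)"
      by (simp add: cross3_simps)
    moreover have "nml {g, h, k} (- x) = - nml {g, h, k} x" for x
      using linear_neg[OF lin_linear[OF nml_lin[OF \<sigma>]]] .
    ultimately show ?thesis using 2 third d ne by (simp add: eps_def ori_def sgn_minus)
  qed
qed

text \<open>Up to the common factor \<open>ori\<close>, the two products are the signs of the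
  determinants for the orders a, b, c, d and a, b, d, c, which are opposite.\<close>

lemma eps_sg_cancel:
  assumes Y: "{a, b, c, d} \<in> T4" and dist: "distinct [a, b, c, d]"
  shows "eps {a, b} {a, b, c} * sg {a, b, c} {a, b, c, d} + eps {a, b} {a, b, d} * sg {a, b, d} {a, b, c, d} = 0"
proof -
  have K3: "{a, b, c} \<in> K" "{a, b, d} \<in> K" using K_subset[OF T4_K[OF Y]] by auto
  have c3: "card {a, b, c} = 3" "card {a, b, d} = 3" using dist by auto
  have Y': "insert d {a, b, c} \<in> T4" "insert c {a, b, d} \<in> T4" using Y by (simp_all add: insert_commute)
  have sgs: "sg {a, b, c} {a, b, c, d} = sgn (ell {a, b, c} d)" "sg {a, b, d} {a, b, c, d} = sgn (ell {a, b, d} c)"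
  proof -
    have "{a, b, c, d} - {a, b, c} = {d}" "{a, b, c, d} - {a, b, d} = {c}" using dist by auto
    then show "sg {a, b, c} {a, b, c, d} = sgn (ell {a, b, c} d)" "sg {a, b, d} {a, b, c, d} = sgn (ell {a, b, d} c)"
      by (simp_all add: sg_def)
  qed
  have 1: "sgn (ell {a, b, c} d) * sgn (nml {a, b, c} (cross3 (b - a) (c - a))) = sgn (cross3 (b - a) (c - a) \<bullet> (d - a))"
    by (rule tri_orient(2)[OF K3(1) c3(1) Y'(1)]) (use dist in auto)
  have 2: "sgn (ell {a, b, d} c) * sgn (nml {a, b, d} (cross3 (b - a) (d - a))) = sgn (cross3 (b - a) (d - a) \<bullet> (c - a))"
    by (rule tri_orient(2)[OF K3(2) c3(2) Y'(2)]) (use dist in auto)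
  have "cross3 (b - a) (d - a) \<bullet> (c - a) = - (cross3 (b - a) (c - a) \<bullet> (d - a))"
    by (simp add: cross3_simps)
  then have "sgn (ell {a, b, c} d) * sgn (nml {a, b, c} (cross3 (b - a) (c - a)))
      + sgn (ell {a, b, d} c) * sgn (nml {a, b, d} (cross3 (b - a) (d - a))) = 0"
    unfolding 1 2 by (simp add: sgn_minus)
  then have "ori a {a, b} * (sgn (ell {a, b, c} d) * sgn (nml {a, b, c} (cross3 (b - a) (c - a)))
      + sgn (ell {a, b, d} c) * sgn (nml {a, b, d} (cross3 (b - a) (d - a)))) = 0" by simp
  then show ?thesis
    unfolding sgs eps_vertex[OF K3(1) c3(1)] eps_vertex[OF K3(2) c3(2)] by (simp add: algebra_simps)
qed

definition \<psi> :: "((real^3) set \<Rightarrow> 'v::real_vector) \<Rightarrow> (real^3) set \<Rightarrow> 'v" where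
  "\<psi> q \<tau> = (\<Sum>\<sigma>\<in>{\<sigma> \<in> SS. \<tau> \<subseteq> \<sigma>}. eps \<tau> \<sigma> *\<^sub>R q \<sigma>)"

lemma linear_\<psi>: "linear \<psi>"
  by (rule linearI) (auto simp: \<psi>_def fun_eq_iff scaleR_add_right sum.distrib scaleR_sum_right mult.commute)

lemma SS_D: "\<sigma> \<in> SS \<Longrightarrow> \<sigma> \<in> K" "\<sigma> \<in> SS \<Longrightarrow> card \<sigma> = 3" "\<sigma> \<in> SS \<Longrightarrow> finite \<sigma>"
  using K_D(1) by (auto simp: Int_faces_def)

lemma EE_D: "\<tau> \<in> EE \<Longrightarrow> \<tau> \<in> K" "\<tau> \<in> EE \<Longrightarrow> card \<tau> = 2" "\<tau> \<in> EE \<Longrightarrow> finite \<tau>"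
  using K_D(1) by (auto simp: Int_faces_def)

lemma finite_SS: "finite SS" and finite_EE: "finite EE"
  by (simp_all add: finite_Int_faces)

lemma EE_SS: "\<tau> \<in> EE \<Longrightarrow> \<tau> \<subseteq> \<sigma> \<Longrightarrow> \<sigma> \<in> K \<Longrightarrow> card \<sigma> = 3 \<Longrightarrow> \<sigma> \<in> SS"
  by (rule Int_faces_up)

lemma edge_tet_triangles:
  assumes \<tau>: "\<tau> \<in> EE" and Y: "Y \<in> T4" "\<tau> \<subseteq> Y"
  shows "(\<Sum>\<sigma>\<in>{\<sigma> \<in> SS. \<tau> \<subseteq> \<sigma> \<and> \<sigma> \<subseteq> Y}. eps \<tau> \<sigma> * sg \<sigma> Y) = 0"
proof -
  obtain a b where ab: "\<tau> = {a, b}" "a \<noteq> b" using EE_D(2)[OF \<tau>] by (auto simp: card_2_iff)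
  have "card (Y - \<tau>) = 2" using EE_D[OF \<tau>] T4_card[OF Y(1)] Y(2) by (simp add: card_Diff_subset)
  then obtain c d where cd: "Y - \<tau> = {c, d}" "c \<noteq> d" by (auto simp: card_2_iff)
  have Yeq: "Y = {a, b, c, d}" using cd(1) Y(2) ab(1) by blast
  have dist: "distinct [a, b, c, d]" using cd ab by auto
  have K3: "{a, b, c} \<in> K" "{a, b, d} \<in> K" using K_subset[OF T4_K[OF Y(1)]] unfolding Yeq by auto
  have s: "{a, b, c} \<in> SS" "{a, b, d} \<in> SS"
    by (rule EE_SS[OF \<tau> _ K3(1)], use ab dist in auto) (rule EE_SS[OF \<tau> _ K3(2)], use ab dist in auto)
  have "{\<sigma> \<in> SS. \<tau> \<subseteq> \<sigma> \<and> \<sigma> \<subseteq> Y} = {{a, b, c}, {a, b, d}}"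
  proof (intro subset_antisym subsetI)
    fix \<sigma> assume \<sigma>: "\<sigma> \<in> {\<sigma> \<in> SS. \<tau> \<subseteq> \<sigma> \<and> \<sigma> \<subseteq> Y}"
    then have "card (\<sigma> - \<tau>) = 1" using SS_D EE_D[OF \<tau>] by (simp add: card_Diff_subset)
    then obtain x where x: "\<sigma> - \<tau> = {x}" by (metis card_1_singletonE)
    then have "x \<in> {c, d}" using \<sigma> cd(1) by blast
    moreover have "\<sigma> = insert x \<tau>" using x \<sigma> by blast
    ultimately show "\<sigma> \<in> {{a, b, c}, {a, b, d}}" using ab(1) by (auto simp: insert_commute)
  next
    fix \<sigma> assume "\<sigma> \<in> {{a, b, c}, {a, b, d}}"
    then show "\<sigma> \<in> {\<sigma> \<in> SS. \<tau> \<subseteq> \<sigma> \<and> \<sigma> \<subseteq> Y}" using s ab(1) Yeq by auto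
  qed
  moreover have "{a, b, c} \<noteq> {a, b, d}" using dist by auto
  ultimately show ?thesis using eps_sg_cancel[of a b c d] Y(1) dist unfolding Yeq ab(1) by simp
qed

text \<open>After exchanging the sums, each tetrahedron at the edge contributes its two triangles
  there, and their signs cancel. Both are interior because the edge is, so no term is
  missing.\<close>

lemma \<psi>_\<delta>:
  assumes \<tau>: "\<tau> \<in> EE" and q: "\<And>\<sigma>. \<sigma> \<in> SS \<Longrightarrow> \<tau> \<subseteq> \<sigma> \<Longrightarrow> q \<sigma> = \<delta> p \<sigma>"
  shows "\<psi> q \<tau> = 0"
proof -
  have "\<psi> q \<tau> = (\<Sum>\<sigma>\<in>{\<sigma> \<in> SS. \<tau> \<subseteq> \<sigma>}. \<Sum>Y\<in>{Y \<in> T4. \<sigma> \<subseteq> Y}. (eps \<tau> \<sigma> * sg \<sigma> Y) *\<^sub>R p Y)"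
    unfolding \<psi>_def using q by (intro sum.cong) (auto simp: \<delta>_def scaleR_sum_right)
  also have "\<dots> = (\<Sum>Y\<in>T4. \<Sum>\<sigma>\<in>{\<sigma> \<in> {\<sigma> \<in> SS. \<tau> \<subseteq> \<sigma>}. \<sigma> \<subseteq> Y}. (eps \<tau> \<sigma> * sg \<sigma> Y) *\<^sub>R p Y)"
    using finite_SS finite_T4 by (intro sum.swap_restrict) auto
  also have "\<dots> = (\<Sum>Y\<in>T4. 0)"
  proof (rule sum.cong[OF refl])
    fix Y assume Y: "Y \<in> T4"
    have "(\<Sum>\<sigma>\<in>{\<sigma> \<in> {\<sigma> \<in> SS. \<tau> \<subseteq> \<sigma>}. \<sigma> \<subseteq> Y}. (eps \<tau> \<sigma> * sg \<sigma> Y) *\<^sub>R p Y)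
       = (\<Sum>\<sigma>\<in>{\<sigma> \<in> SS. \<tau> \<subseteq> \<sigma> \<and> \<sigma> \<subseteq> Y}. eps \<tau> \<sigma> * sg \<sigma> Y) *\<^sub>R p Y"
      unfolding scaleR_sum_left by (intro sum.cong) auto
    also have "\<dots> = 0"
    proof (cases "\<tau> \<subseteq> Y")
      case True
      then show ?thesis using edge_tet_triangles[OF \<tau> Y True] by simp
    next
      case False
      then have "{\<sigma> \<in> SS. \<tau> \<subseteq> \<sigma> \<and> \<sigma> \<subseteq> Y} = {}" by blast
      then show ?thesis by (simp only: sum.empty scaleR_zero_left)
    qed
    finally show "(\<Sum>\<sigma>\<in>{\<sigma> \<in> {\<sigma> \<in> SS. \<tau> \<subseteq> \<sigma>}. \<sigma> \<subseteq> Y}. (eps \<tau> \<sigma> * sg \<sigma> Y) *\<^sub>R p Y) = 0" .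
  qed
  finally show ?thesis by simp
qed

section \<open>Edges and triangles at a vertex\<close>

definition Sg :: "real^3 \<Rightarrow> (real^3) set set" where "Sg g = {\<sigma> \<in> SS. g \<in> \<sigma>}"
definition Eg :: "real^3 \<Rightarrow> (real^3) set set" where "Eg g = {\<tau> \<in> EE. g \<in> \<tau>}"

lemma finite_Sg: "finite (Sg g)" and finite_Eg: "finite (Eg g)" and finite_Stf: "finite (Stf g)"
  using finite_SS finite_EE finite_T4 by (simp_all add: Sg_def Eg_def Stf_def)

lemma edge_at: "\<tau> \<in> Eg g \<Longrightarrow> \<exists>h. \<tau> = {g, h} \<and> h \<noteq> g"
proof -
  assume \<tau>: "\<tau> \<in> Eg g"
  then have "card (\<tau> - {g}) = 1" using EE_D(2,3) by (auto simp: Eg_def)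
  then obtain h where "\<tau> - {g} = {h}" by (metis card_1_singletonE)
  then show ?thesis using \<tau> by (auto simp: Eg_def)
qed

text \<open>The value \<open>x\<close> on the edge to \<open>h\<close>, oriented away from
  \<open>g\<close>. Boundary edges give 0, so \<open>h\<close> may range over all neighbours of
  \<open>g\<close>.\<close>

definition \<nu> :: "real^3 \<Rightarrow> real^3 \<Rightarrow> 'v::real_vector \<Rightarrow> (real^3) set \<Rightarrow> 'v" where
  "\<nu> g h x = (if {g, h} \<in> Eg g then unit {g, h} (ori g {g, h} *\<^sub>R x) else 0)"

lemma linear_\<nu>: "linear (\<nu> g h)"
  by (rule linearI) (auto simp: \<nu>_def unit_def fun_eq_iff scaleR_add_right)

definition res :: "'i set \<Rightarrow> ('i \<Rightarrow> 'v::real_vector) \<Rightarrow> 'i \<Rightarrow> 'v" where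
  "res I q = (\<lambda>i. if i \<in> I then q i else 0)"

lemma linear_res: "linear (res I)"
  by (rule linearI) (auto simp: res_def fun_eq_iff)

lemma triangle_unit:
  assumes \<sigma>: "{g, h, k} \<in> SS" and dist: "h \<noteq> g" "k \<noteq> g" "h \<noteq> k"
  shows "res (Eg g) (\<psi> (unit {g, h, k} x))
    = sgn (nml {g, h, k} (cross3 (h - g) (k - g))) *\<^sub>R (\<nu> g h x - \<nu> g k x)"
    and "sgn (nml {g, h, k} (cross3 (h - g) (k - g))) \<noteq> 0"
proof -
  let ?\<sigma> = "{g, h, k}"
  have \<sigma>': "{g, k, h} = ?\<sigma>" by auto
  let ?s = "sgn (nml ?\<sigma> (cross3 (h - g) (k - g)))"
  have nlin: "linear (nml ?\<sigma>)" using lin_linear[OF nml_lin[OF SS_D(1,2)[OF \<sigma>]]] .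
  have sk: "sgn (nml ?\<sigma> (cross3 (k - g) (h - g))) = - ?s"
    using linear_neg[OF nlin, of "cross3 (h - g) (k - g)"] cross_skew[of "k - g" "h - g"] by (simp add: sgn_minus)
  have e1: "eps {g, h} ?\<sigma> = ori g {g, h} * ?s" using eps_vertex[of g h k] SS_D[OF \<sigma>] by simp
  have e2: "eps {g, k} ?\<sigma> = - (ori g {g, k} * ?s)" using eps_vertex[of g k h] SS_D[OF \<sigma>] sk unfolding \<sigma>' by simp
  show "res (Eg g) (\<psi> (unit ?\<sigma> x)) = ?s *\<^sub>R (\<nu> g h x - \<nu> g k x)"
  proof
    fix \<tau>
    show "res (Eg g) (\<psi> (unit ?\<sigma> x)) \<tau> = (?s *\<^sub>R (\<nu> g h x - \<nu> g k x)) \<tau>"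
    proof (cases "\<tau> \<in> Eg g")
      case False
      then show ?thesis by (auto simp: res_def \<nu>_def unit_def)
    next
      case True
      obtain i where i: "\<tau> = {g, i}" "i \<noteq> g" using edge_at[OF True] by blast
      have "\<psi> (unit ?\<sigma> x) \<tau> = (if \<tau> \<subseteq> ?\<sigma> then eps \<tau> ?\<sigma> *\<^sub>R x else 0)"
      proof -
        have "\<psi> (unit ?\<sigma> x) \<tau> = (\<Sum>\<sigma>\<in>{\<sigma> \<in> SS. \<tau> \<subseteq> \<sigma>}. if \<sigma> = ?\<sigma> then eps \<tau> ?\<sigma> *\<^sub>R x else 0)"
          unfolding \<psi>_def by (intro sum.cong) (auto simp: unit_def)
        then show ?thesis using finite_SS \<sigma> by simp
      qed
      moreover have "\<tau> \<subseteq> ?\<sigma> \<longleftrightarrow> i = h \<or> i = k" using i by auto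
      moreover have "{g, h} \<noteq> {g, k}" using dist by (auto simp: doubleton_eq_iff)
      ultimately show ?thesis using True i dist e1 e2
        by (auto simp: res_def \<nu>_def unit_def doubleton_eq_iff mult.commute)
    qed
  qed
  obtain Y where Y: "Y \<in> T4" "?\<sigma> \<subseteq> Y" using pure[OF SS_D(1)[OF \<sigma>]] by blast
  have "card (Y - ?\<sigma>) = 1" using SS_D[OF \<sigma>] T4_card[OF Y(1)] Y(2) by (simp add: card_Diff_subset)
  then obtain d where d: "Y - ?\<sigma> = {d}" by (metis card_1_singletonE)
  then have "Y = insert d ?\<sigma>" "d \<notin> ?\<sigma>" using Y(2) by blast+
  then show "?s \<noteq> 0" using tri_orient(1)[of g h k d] SS_D[OF \<sigma>] Y(1) by (simp add: sgn_zero_iff)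
qed

text \<open>By \<open>triangle_unit\<close> an interior triangle at \<open>g\<close> identifies,
  modulo \<open>U\<close>, the values on its two edges there; the edge graph of the link is
  connected, so this spreads to all edges.\<close>

lemma edges_connected:
  fixes V :: "'v::real_vector set"
  assumes g: "{g} \<in> K" and U: "subspace U" and V: "subspace V"
    and im: "res (Eg g) ` \<psi> ` dsum (Sg g) (\<lambda>_. V) \<subseteq> U"
    and h: "{g, h} \<in> K" "h \<noteq> g" and h0: "{g, h0} \<in> K" "h0 \<noteq> g" and x: "x \<in> V"
  shows "\<nu> g h x - \<nu> g h0 x \<in> U"
proof (rule ccontr)
  assume no: "\<nu> g h x - \<nu> g h0 x \<notin> U"
  let ?A = "{h. \<nu> g h x - \<nu> g h0 x \<in> U}"
  have "h0 \<in> ?A" using subspace_0[OF U] by simp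
  then obtain a k where ak: "a \<in> ?A" "k \<notin> ?A" "a \<noteq> g" "k \<noteq> g" "{g, a, k} \<in> K"
    using skeleton_connected[OF g, of h0 ?A h] h h0 no by blast
  have ne: "a \<noteq> k" using ak by blast
  have ak_U: "\<nu> g a x - \<nu> g k x \<in> U"
  proof (cases "{g, a, k} \<in> SS")
    case True
    have "unit {g, a, k} x \<in> dsum (Sg g) (\<lambda>_. V)"
      using True x V by (intro unit_in_dsum) (auto simp: Sg_def)
    then have "res (Eg g) (\<psi> (unit {g, a, k} x)) \<in> U" using im by blast
    then have "sgn (nml {g, a, k} (cross3 (a - g) (k - g))) *\<^sub>R (\<nu> g a x - \<nu> g k x) \<in> U"
      unfolding triangle_unit(1)[OF True ak(3,4) ne] .
    then have "inverse (sgn (nml {g, a, k} (cross3 (a - g) (k - g)))) *\<^sub>R (sgn (nml {g, a, k} (cross3 (a - g) (k - g))) *\<^sub>R (\<nu> g a x - \<nu> g k x)) \<in> U"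
      by (rule subspace_scale[OF U])
    then show ?thesis by (simp only: scaleR_scaleR left_inverse[OF triangle_unit(2)[OF True ak(3,4) ne]] scaleR_one)
  next
    \<comment> \<open>If the triangle is not interior, neither are its edges at \<open>g\<close>,
      and both values are 0.\<close>
    case False
    have "card {g, a, k} = 3" using ak ne by auto
    then have "{g, a} \<notin> EE" "{g, k} \<notin> EE"
      using False EE_SS[of "{g, a}" "{g, a, k}"] EE_SS[of "{g, k}" "{g, a, k}"] ak(5) by auto
    then have "\<nu> g a x = 0" "\<nu> g k x = 0" by (auto simp: \<nu>_def Eg_def)
    then show ?thesis using subspace_0[OF U] by simp
  qed
  have "\<nu> g a x - \<nu> g h0 x \<in> U" using ak(1) by simp
  from subspace_diff[OF U this ak_U] have "(\<nu> g a x - \<nu> g h0 x) - (\<nu> g a x - \<nu> g k x) \<in> U" .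
  then show False using ak(2) by simp
qed

section \<open>Homogeneous gluing data at a vertex\<close>

definition Jh :: "((real^3) set \<Rightarrow> real^3 \<Rightarrow> real) \<Rightarrow> nat \<Rightarrow> nat \<Rightarrow> (real^3) set \<Rightarrow> (real^3 \<Rightarrow> real) set" where
  "Jh lam r e \<sigma> = (if r + 1 \<le> e then (\<lambda>q. lam \<sigma> ^ (r + 1) * q) ` H (e - (r + 1)) else {0})"

definition \<delta>g :: "real^3 \<Rightarrow> ((real^3) set \<Rightarrow> 'v::real_vector) \<Rightarrow> (real^3) set \<Rightarrow> 'v" where
  "\<delta>g g p = res (Sg g) (\<delta> p)"

text \<open>The degree-\<open>e\<close> Taylor component at \<open>g\<close> of the data \<open>\<delta> p + q\<close> with \<open>q \<sigma> \<in> J r d \<sigma>\<close> lies in \<open>W nml r e g\<close>.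
  The linear forms are a parameter because they are perturbed into general position.\<close>

definition W :: "((real^3) set \<Rightarrow> real^3 \<Rightarrow> real) \<Rightarrow> nat \<Rightarrow> nat \<Rightarrow> real^3 \<Rightarrow> ((real^3) set \<Rightarrow> real^3 \<Rightarrow> real) set" where
  "W lam r e g = span (\<delta>g g ` dsum (Stf g) (\<lambda>_. H e) \<union> dsum (Sg g) (Jh lam r e))"

lemma linear_\<delta>g: "linear (\<delta>g g)"
  unfolding \<delta>g_def using linear_compose[OF linear_\<delta> linear_res] by (simp add: o_def)

lemma subspace_Jh: "subspace (Jh lam r e \<sigma>)"
  by (cases "r + 1 \<le> e") (simp_all only: Jh_def if_True if_False subspace_mult_image subspace_pw subspace_single_0)

lemma fin_dim_Jh: "fin_dim (Jh lam r e \<sigma>)"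
  unfolding Jh_def using fin_dim_image[OF linear_mult_left fin_dim_H] by (simp add: fin_dim_finite)

definition hdim :: "nat \<Rightarrow> nat" where "hdim e = (e + 2) choose 2"

lemma dim_Jh: "dim (Jh lam r e \<sigma>) \<le> (if r + 1 \<le> e then hdim (e - (r + 1)) else 0)"
proof (cases "r + 1 \<le> e")
  case True
  have "dim ((\<lambda>q. lam \<sigma> ^ (r + 1) * q) ` H (e - (r + 1))) \<le> dim (H (e - (r + 1)))"
    by (rule dim_image_le'[OF linear_mult_left subspace_pw fin_dim_H])
  then show ?thesis using True by (simp add: Jh_def dim_H hdim_def)
qed (simp add: Jh_def)

lemma fin_dim_dsum_H: "finite I \<Longrightarrow> fin_dim (dsum I (\<lambda>_. H e))"
  by (intro fin_dim_dsum fin_dim_H)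

lemma dim_dsum_H: "finite I \<Longrightarrow> dim (dsum I (\<lambda>_. H e)) = card I * hdim e"
  by (simp add: dim_dsum fin_dim_H dim_H hdim_def)

lemma Stf_nonempty: "{g} \<in> K \<Longrightarrow> Stf g \<noteq> {}"
  using pure[of "{g}"] by (auto simp: Stf_def)

lemma \<delta>_const:
  assumes "\<sigma> \<in> SS" "\<And>Y. Y \<in> T4 \<Longrightarrow> \<sigma> \<subseteq> Y \<Longrightarrow> p Y = x"
  shows "\<delta> p \<sigma> = 0"
proof -
  obtain A B where AB: "A \<noteq> B" "{Y \<in> T4. \<sigma> \<subseteq> Y} = {A, B}" "sg \<sigma> B = - sg \<sigma> A"
    using two_tets_sg[OF assms(1)] by blast
  have "p A = x" "p B = x" using assms(2) AB(2) by blast+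
  then show ?thesis unfolding \<delta>_def AB(2) using AB(1,3) by simp
qed

lemma dim_\<delta>g_le:
  assumes g: "{g} \<in> K"
  shows "dim (\<delta>g g ` dsum (Stf g) (\<lambda>_. H e)) + hdim e \<le> card (Stf g) * hdim e"
proof -
  let ?V = "dsum (Stf g) (\<lambda>_. H e)"
  let ?c = "\<lambda>p Y. if Y \<in> Stf g then p else (0 :: real^3 \<Rightarrow> real)"
  have "dim ?V = dim {v\<in>?V. \<delta>g g v = 0} + dim (\<delta>g g ` ?V)"
    by (intro dim_kernel_image linear_\<delta>g subspace_dsum fin_dim_dsum_H finite_Stf) simp
  moreover have "hdim e \<le> dim {v\<in>?V. \<delta>g g v = 0}"
  proof -
    have "dim (?c ` H e) = dim (H e)"
    proof (rule dim_image_inj)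
      show "linear ?c" by (rule linearI) (auto simp: fun_eq_iff)
      fix v assume v: "?c v = 0"
      obtain Y where "Y \<in> Stf g" using Stf_nonempty[OF g] by blast
      then show "v = 0" using fun_cong[OF v, of Y] by simp
    qed (auto simp: fin_dim_H)
    moreover have "dim (?c ` H e) \<le> dim {v\<in>?V. \<delta>g g v = 0}"
    proof (rule dim_mono')
      show "fin_dim {v\<in>?V. \<delta>g g v = 0}"
        by (rule fin_dim_mono[OF fin_dim_dsum_H[OF finite_Stf]]) auto
      show "?c ` H e \<subseteq> {v\<in>?V. \<delta>g g v = 0}"
      proof (rule image_subsetI)
        fix p assume p: "p \<in> H e"
        have "\<delta> (?c p) \<sigma> = 0" if "\<sigma> \<in> Sg g" for \<sigma>
          using that by (intro \<delta>_const) (auto simp: Sg_def Stf_def)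
        then have "\<delta>g g (?c p) = 0" by (auto simp: \<delta>g_def res_def fun_eq_iff)
        then show "?c p \<in> {v\<in>?V. \<delta>g g v = 0}" using p by (auto simp: dsum_def)
      qed
    qed
    ultimately show ?thesis by (simp add: dim_H hdim_def)
  qed
  ultimately show ?thesis using dim_dsum_H[OF finite_Stf, of g e] by linarith
qed

text \<open>Counting generators: constant tuples have no jumps and so remove one copy of the forms,
  and each triangle adds at most the multiples of one power.\<close>

lemma dim_W_A:
  assumes g: "{g} \<in> K"
  shows "dim (W lam r e g) + hdim e \<le> card (Stf g) * hdim e + card (Sg g) * (if r + 1 \<le> e then hdim (e - (r + 1)) else 0)"
proof -
  have "dim (W lam r e g) \<le> dim (\<delta>g g ` dsum (Stf g) (\<lambda>_. H e)) + dim (dsum (Sg g) (Jh lam r e))"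
    unfolding W_def dim_span
    by (intro dim_span_Un_le fin_dim_image linear_\<delta>g fin_dim_dsum_H fin_dim_dsum finite_Stf finite_Sg fin_dim_Jh)
  moreover have "dim (dsum (Sg g) (Jh lam r e)) = (\<Sum>\<sigma>\<in>Sg g. dim (Jh lam r e \<sigma>))"
    by (intro dim_dsum finite_Sg subspace_Jh fin_dim_Jh)
  moreover have "\<dots> \<le> (\<Sum>\<sigma>\<in>Sg g. if r + 1 \<le> e then hdim (e - (r + 1)) else 0)"
    by (intro sum_mono dim_Jh)
  ultimately show ?thesis using dim_\<delta>g_le[OF g, of e] by simp
qed

definition Jt :: "((real^3) set \<Rightarrow> real^3 \<Rightarrow> real) \<Rightarrow> nat \<Rightarrow> nat \<Rightarrow> (real^3) set \<Rightarrow> (real^3 \<Rightarrow> real) set" where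
  "Jt lam r e \<tau> = span {lam \<sigma> ^ (r + 1) * q |\<sigma> q. \<sigma> \<in> {\<sigma> \<in> SS. \<tau> \<subseteq> \<sigma>} \<and> r + 1 \<le> e \<and> q \<in> H (e - (r + 1))}"

definition ne :: "(real^3) set \<Rightarrow> nat" where "ne \<tau> = card {\<sigma> \<in> SS. \<tau> \<subseteq> \<sigma>}"

lemma Jh_subset_Jt: "\<sigma> \<in> SS \<Longrightarrow> \<tau> \<subseteq> \<sigma> \<Longrightarrow> Jh lam r e \<sigma> \<subseteq> Jt lam r e \<tau>"
proof
  fix x assume \<sigma>: "\<sigma> \<in> SS" "\<tau> \<subseteq> \<sigma>" and x: "x \<in> Jh lam r e \<sigma>"
  show "x \<in> Jt lam r e \<tau>"
  proof (cases "r + 1 \<le> e")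
    case True
    then obtain q where "x = lam \<sigma> ^ (r + 1) * q" "q \<in> H (e - (r + 1))" using x by (auto simp: Jh_def)
    then show ?thesis unfolding Jt_def using \<sigma> True by (intro span_base) blast
  next
    case False
    then have "x = 0" using x by (simp add: Jh_def)
    then show ?thesis unfolding Jt_def by (simp only: span_zero)
  qed
qed

lemma Jt_subset_H:
  assumes "\<And>\<sigma>. \<sigma> \<in> SS \<Longrightarrow> \<tau> \<subseteq> \<sigma> \<Longrightarrow> lam \<sigma> \<in> lin"
  shows "Jt lam r e \<tau> \<subseteq> H e"
  unfolding Jt_def
proof (rule span_minimal[OF _ subspace_pw], rule subsetI)
  fix x assume "x \<in> {lam \<sigma> ^ (r + 1) * q |\<sigma> q. \<sigma> \<in> {\<sigma> \<in> SS. \<tau> \<subseteq> \<sigma>} \<and> r + 1 \<le> e \<and> q \<in> H (e - (r + 1))}"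
  then obtain \<sigma> q where x: "x = lam \<sigma> ^ (r + 1) * q" "\<sigma> \<in> SS" "\<tau> \<subseteq> \<sigma>" "r + 1 \<le> e" "q \<in> H (e - (r + 1))" by blast
  have "lam \<sigma> ^ (r + 1) * q \<in> H ((r + 1) + (e - (r + 1)))"
    by (rule pw_mult[OF pw_power1[OF assms[OF x(2,3)]] x(5)])
  then show "x \<in> H e" using x(1,4) by simp
qed

lemma Jh_subset_H: "lam \<sigma> \<in> lin \<Longrightarrow> Jh lam r e \<sigma> \<subseteq> H e"
proof
  fix x assume lam: "lam \<sigma> \<in> lin" and x: "x \<in> Jh lam r e \<sigma>"
  show "x \<in> H e"
  proof (cases "r + 1 \<le> e")
    case True
    then obtain q where q: "x = lam \<sigma> ^ (r + 1) * q" "q \<in> H (e - (r + 1))" using x by (auto simp: Jh_def)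
    have "lam \<sigma> ^ (r + 1) * q \<in> H ((r + 1) + (e - (r + 1)))"
      by (rule pw_mult[OF pw_power1[OF lam] q(2)])
    then show ?thesis using q(1) True by simp
  next
    case False
    then have "x = 0" using x by (simp add: Jh_def)
    then show ?thesis using subspace_0[OF subspace_pw] by (simp only:)
  qed
qed

text \<open>Jumps satisfy the edge conditions because \<open>\<psi>\<close> annihilates them;
  multiples of powers do because the ideal of an edge contains those of its triangles.\<close>

lemma W_subset:
  assumes lam: "\<And>\<sigma>. \<sigma> \<in> Sg g \<Longrightarrow> lam \<sigma> \<in> lin"
  shows "W lam r e g \<subseteq> {q \<in> dsum (Sg g) (\<lambda>_. H e). res (Eg g) (\<psi> q) \<in> dsum (Eg g) (Jt lam r e)}"
    (is "_ \<subseteq> ?Z")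
  unfolding W_def
proof (rule span_minimal)
  have sJt: "subspace (Jt lam r e \<tau>)" for \<tau> by (simp add: Jt_def)
  have lin: "linear (\<lambda>q. res (Eg g) (\<psi> q :: (real^3) set \<Rightarrow> real^3 \<Rightarrow> real))"
    using linear_compose[OF linear_\<psi> linear_res] by (simp add: o_def)
  show "subspace ?Z"
    using subspace_inter[OF subspace_dsum[of "Sg g" "\<lambda>_. H e", OF subspace_pw]
        linear_subspace_vimage[OF lin subspace_dsum[of "Eg g" "Jt lam r e", OF sJt]]]
    by (simp only: Int_def vimage_def mem_Collect_eq)
  show "\<delta>g g ` dsum (Stf g) (\<lambda>_. H e) \<union> dsum (Sg g) (Jh lam r e) \<subseteq> ?Z"
  proof (rule Un_least)
    show "\<delta>g g ` dsum (Stf g) (\<lambda>_. H e) \<subseteq> ?Z"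
    proof (rule image_subsetI)
      fix p assume p: "p \<in> dsum (Stf g) (\<lambda>_. H e)"
      have "\<delta> p \<sigma> \<in> H e" if "\<sigma> \<in> Sg g" for \<sigma>
        unfolding \<delta>_def using p that
        by (intro subspace_sum subspace_scale subspace_pw) (auto simp: dsum_def Sg_def Stf_def)
      then have "\<delta>g g p \<in> dsum (Sg g) (\<lambda>_. H e)" by (simp add: \<delta>g_def res_def dsum_def)
      moreover have "\<psi> (\<delta>g g p) \<tau> = 0" if "\<tau> \<in> Eg g" for \<tau>
        using that by (intro \<psi>_\<delta>) (auto simp: \<delta>g_def res_def Sg_def Eg_def)
      then have "res (Eg g) (\<psi> (\<delta>g g p)) \<in> dsum (Eg g) (Jt lam r e)"
        using subspace_0[OF sJt] by (simp add: res_def dsum_def)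
      ultimately show "\<delta>g g p \<in> ?Z" by blast
    qed
    show "dsum (Sg g) (Jh lam r e) \<subseteq> ?Z"
    proof
      fix q assume q: "q \<in> dsum (Sg g) (Jh lam r e)"
      have "\<psi> q \<tau> \<in> Jt lam r e \<tau>" if \<tau>: "\<tau> \<in> Eg g" for \<tau>
        unfolding \<psi>_def
      proof (intro subspace_sum subspace_scale sJt)
        fix \<sigma> assume \<sigma>: "\<sigma> \<in> {\<sigma> \<in> SS. \<tau> \<subseteq> \<sigma>}"
        then have "\<sigma> \<in> Sg g" using \<tau> by (auto simp: Sg_def Eg_def)
        then show "q \<sigma> \<in> Jt lam r e \<tau>" using q \<sigma> Jh_subset_Jt[of \<sigma> \<tau> lam r e] by (auto simp: dsum_def)
      qed
      then have "res (Eg g) (\<psi> q) \<in> dsum (Eg g) (Jt lam r e)" by (simp add: res_def dsum_def)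
      moreover have "q \<sigma> \<in> H e" if "\<sigma> \<in> Sg g" for \<sigma>
        using subsetD[OF Jh_subset_H[of lam \<sigma> r e, OF lam[OF that]]] q that by (simp add: dsum_def)
      then have "q \<in> dsum (Sg g) (\<lambda>_. H e)" using q by (simp add: dsum_def)
      ultimately show "q \<in> ?Z" by blast
    qed
  qed
qed

text \<open>\<open>surj\<close> expresses independence of the edge conditions, so each interior edge
  costs the full codimension of its ideal, at least the sum of \<open>gdim\<close>. The vector
  \<open>u\<close> is a common zero of the forms at an edge, as \<open>hom_edge_dim\<close>
  requires.\<close>

lemma dim_W_B:
  assumes lam: "\<And>\<sigma>. \<sigma> \<in> Sg g \<Longrightarrow> lam \<sigma> \<in> lin"
    and u: "\<And>\<tau>. \<tau> \<in> Eg g \<Longrightarrow> \<exists>u. u \<noteq> 0 \<and> (\<forall>\<sigma>\<in>SS. \<tau> \<subseteq> \<sigma> \<longrightarrow> lam \<sigma> u = 0)"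
    and surj: "dsum (Eg g) (\<lambda>_. H e) \<subseteq> span (res (Eg g) ` \<psi> ` dsum (Sg g) (\<lambda>_. H e) \<union> dsum (Eg g) (Jt lam r e))"
  shows "dim (W lam r e g) + (\<Sum>\<tau>\<in>Eg g. \<Sum>i\<le>e. gdim (ne \<tau>) r i) \<le> card (Sg g) * hdim e"
proof -
  let ?f = "\<lambda>q. res (Eg g) (\<psi> q :: (real^3) set \<Rightarrow> real^3 \<Rightarrow> real)"
  let ?B = "dsum (Sg g) (\<lambda>_. H e)" and ?D = "dsum (Eg g) (Jt lam r e)"
  have lamE: "lam \<sigma> \<in> lin" if "\<tau> \<in> Eg g" "\<sigma> \<in> SS" "\<tau> \<subseteq> \<sigma>" for \<tau> \<sigma>
    using lam that by (auto simp: Sg_def Eg_def)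
  have lin: "linear ?f" using linear_compose[OF linear_\<psi> linear_res] by (simp add: o_def)
  have sJt: "subspace (Jt lam r e \<tau>)" for \<tau> by (simp add: Jt_def)
  have fJt: "fin_dim (Jt lam r e \<tau>)" if "\<tau> \<in> Eg g" for \<tau>
    using fin_dim_mono[OF fin_dim_H Jt_subset_H] lamE[OF that] by blast
  have sB: "subspace ?B" by (intro subspace_dsum subspace_pw)
  have fB: "fin_dim ?B" by (rule fin_dim_dsum_H[OF finite_Sg])
  have sD: "subspace ?D" by (intro subspace_dsum sJt)
  have fD: "fin_dim ?D" using fJt by (intro fin_dim_dsum finite_Eg)
  have "dim (W lam r e g) \<le> dim {q \<in> ?B. ?f q \<in> ?D}"
    by (rule dim_mono'[OF fin_dim_mono[OF fB] W_subset[OF lam]]) auto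
  moreover have "dim {q \<in> ?B. ?f q \<in> ?D} + dim (span (?f ` ?B \<union> ?D)) = dim ?B + dim ?D"
    by (rule dim_vimage[OF lin sB fB sD fD])
  moreover have "card (Eg g) * hdim e \<le> dim (span (?f ` ?B \<union> ?D))"
  proof -
    have "dim (dsum (Eg g) (\<lambda>_. H e)) \<le> dim (span (?f ` ?B \<union> ?D))"
      using surj by (intro dim_mono' fin_dim_span fin_dim_Un fin_dim_image lin fB fD) (simp add: image_image)
    then show ?thesis by (simp add: dim_dsum_H[OF finite_Eg])
  qed
  moreover have "dim ?D = (\<Sum>\<tau>\<in>Eg g. dim (Jt lam r e \<tau>))"
    by (intro dim_dsum finite_Eg sJt fJt)
  moreover have "(\<Sum>\<tau>\<in>Eg g. dim (Jt lam r e \<tau>)) + (\<Sum>\<tau>\<in>Eg g. \<Sum>i\<le>e. gdim (ne \<tau>) r i) \<le> (\<Sum>\<tau>\<in>Eg g. hdim e)"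
    unfolding sum.distrib[symmetric]
  proof (rule sum_mono)
    fix \<tau> assume \<tau>: "\<tau> \<in> Eg g"
    obtain u where "u \<noteq> 0" "\<forall>\<sigma>\<in>SS. \<tau> \<subseteq> \<sigma> \<longrightarrow> lam \<sigma> u = 0" using u[OF \<tau>] by blast
    then show "dim (Jt lam r e \<tau>) + (\<Sum>i\<le>e. gdim (ne \<tau>) r i) \<le> hdim e"
      unfolding Jt_def ne_def hdim_def using lamE[OF \<tau>] finite_SS
      by (intro hom_edge_dim) auto
  qed
  moreover have "dim ?B = card (Sg g) * hdim e" by (rule dim_dsum_H[OF finite_Sg])
  ultimately show ?thesis by simp
qed

end

lemma span_Un_span: "span (span A \<union> span B) = span (A \<union> B)"
proof (rule subset_antisym)
  show "span (span A \<union> span B) \<subseteq> span (A \<union> B)"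
    by (intro span_minimal subspace_span Un_least span_mono) auto
  show "span (A \<union> B) \<subseteq> span (span A \<union> span B)"
    by (intro span_mono Un_mono span_superset)
qed

lemma dsum_span:
  assumes "finite I"
  shows "dsum I (\<lambda>i. span (B i)) = span (\<Union>i\<in>I. unit i ` B i)"
proof (rule subset_antisym)
  have "unit i ` span (B i) \<subseteq> span (\<Union>i\<in>I. unit i ` B i)" if "i \<in> I" for i
    unfolding linear_span_image[OF linear_unit, symmetric] using that by (intro span_mono) blast
  then show "dsum I (\<lambda>i. span (B i)) \<subseteq> span (\<Union>i\<in>I. unit i ` B i)"
    by (intro order_trans[OF dsum_subset_span_unit[OF assms]] span_minimal subspace_span) blast
  show "span (\<Union>i\<in>I. unit i ` B i) \<subseteq> dsum I (\<lambda>i. span (B i))"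
    by (intro span_minimal subspace_dsum subspace_span UN_least image_subsetI unit_in_dsum) (auto intro: span_base)
qed

section \<open>General position of three vectors\<close>

abbreviation det3 :: "real^3 \<Rightarrow> real^3 \<Rightarrow> real^3 \<Rightarrow> real" where "det3 u v w \<equiv> u \<bullet> cross3 v w"

text \<open>Moving along the moment curve puts any finite set of vectors into general position.\<close>

definition moment :: "real \<Rightarrow> real^3" where "moment s = vector [1, s, s\<^sup>2]"

lemma det3_moment: "det3 (moment a) (moment b) (moment c) = (b - a) * (c - a) * (c - b)"
  by (simp add: moment_def cross3_def inner_vec_def sum_3 vector_3 power2_eq_square algebra_simps)

text \<open>The determinant is a cubic polynomial in \<open>t\<close> whose leading coefficient is
  the determinant of the directions of motion, so it has finitely many roots.\<close>

lemma eventually_det3_perturbed: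
  assumes "det3 m1 m2 m3 \<noteq> 0"
  shows "eventually (\<lambda>t. det3 (a1 + t *\<^sub>R m1) (a2 + t *\<^sub>R m2) (a3 + t *\<^sub>R m3) \<noteq> 0) (at 0)"
proof -
  let ?p = "[:det3 a1 a2 a3, det3 m1 a2 a3 + det3 a1 m2 a3 + det3 a1 a2 m3,
    det3 a1 m2 m3 + det3 m1 a2 m3 + det3 m1 m2 a3, det3 m1 m2 m3:]"
  have eq: "det3 (a1 + t *\<^sub>R m1) (a2 + t *\<^sub>R m2) (a3 + t *\<^sub>R m3) = poly ?p t" for t
    by (simp add: cross_add_left cross_add_right cross_mult_left cross_mult_right inner_add_left inner_add_right algebra_simps)
  have "?p \<noteq> 0" using assms by simp
  then have "finite {t. poly ?p t = 0}" by (rule poly_roots_finite)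
  then have "\<not> 0 islimpt {t. poly ?p t = 0}" by (rule islimpt_finite)
  then show ?thesis unfolding islimpt_iff_eventually eq by simp
qed

section \<open>Edge conditions at boundary and interior vertices\<close>

context tet_part
begin

lemma hdim_0 [simp]: "hdim 0 = 1" by (simp add: hdim_def choose_two)

lemma \<delta>_eq_0_adj:
  assumes "adj {g} Y Y'" "\<delta>g g p = 0"
  shows "p Y = p Y'"
proof -
  have s: "Y \<inter> Y' \<in> SS" by (rule adj_SS[OF assms(1)])
  have Y: "Y \<in> T4" "Y' \<in> T4" "g \<in> Y" "g \<in> Y'" "card (Y \<inter> Y') = 3" using assms(1) by (auto simp: adj_def)
  have ne: "Y \<noteq> Y'" using Y T4_card by auto
  obtain A B where AB: "A \<noteq> B" "{Z \<in> T4. Y \<inter> Y' \<subseteq> Z} = {A, B}" "sg (Y \<inter> Y') B = - sg (Y \<inter> Y') A" "sg (Y \<inter> Y') A \<noteq> 0"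
    using two_tets_sg[OF s] by blast
  have "Y \<in> {Z \<in> T4. Y \<inter> Y' \<subseteq> Z}" "Y' \<in> {Z \<in> T4. Y \<inter> Y' \<subseteq> Z}" using Y by auto
  then have YAB: "Y = A \<and> Y' = B \<or> Y = B \<and> Y' = A" using ne unfolding AB(2) by auto
  have "\<delta> p (Y \<inter> Y') = 0"
    using fun_cong[OF assms(2), of "Y \<inter> Y'"] s Y by (simp add: \<delta>g_def res_def Sg_def)
  then have "sg (Y \<inter> Y') A *\<^sub>R p A - sg (Y \<inter> Y') A *\<^sub>R p B = 0" unfolding \<delta>_def AB(2) using AB(1,3) by simp
  then have "sg (Y \<inter> Y') A *\<^sub>R (p A - p B) = 0" by (simp only: scaleR_diff_right)
  then have "p A = p B" using AB(4) by (simp only: scaleR_eq_0_iff right_minus_eq) simp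
  then show ?thesis using YAB by auto
qed

text \<open>Only constant tuples have no jumps, since any two tetrahedra at \<open>g\<close> are
  joined by steps through interior triangles.\<close>

lemma dim_\<delta>g_ge:
  assumes g: "{g} \<in> K"
  shows "card (Stf g) * hdim e \<le> dim (\<delta>g g ` dsum (Stf g) (\<lambda>_. H e)) + hdim e"
proof -
  let ?V = "dsum (Stf g) (\<lambda>_. H e)"
  let ?c = "\<lambda>p Y. if Y \<in> Stf g then p else (0 :: real^3 \<Rightarrow> real)"
  have c: "linear ?c" by (rule linearI) (auto simp: fun_eq_iff)
  have "dim ?V = dim {v\<in>?V. \<delta>g g v = 0} + dim (\<delta>g g ` ?V)"
    by (intro dim_kernel_image linear_\<delta>g subspace_dsum fin_dim_dsum_H finite_Stf) simp
  moreover have "dim {v\<in>?V. \<delta>g g v = 0} \<le> dim (?c ` H e)"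
  proof (rule dim_mono')
    show "fin_dim (?c ` H e)" by (intro fin_dim_image c fin_dim_H)
    show "{v\<in>?V. \<delta>g g v = 0} \<subseteq> ?c ` H e"
    proof
      fix v assume v: "v \<in> {v\<in>?V. \<delta>g g v = 0}"
      obtain Y where Y: "Y \<in> Stf g" using Stf_nonempty[OF g] by blast
      have eq: "v Z = v Y" if "Z \<in> Stf g" for Z
        using reach_vertex[OF Y that]
      proof (induction rule: rtranclp_induct)
        case (step Z Z')
        then show ?case using \<delta>_eq_0_adj[OF step(2), of v] v by simp
      qed simp
      have "v = ?c (v Y)"
      proof
        fix Z show "v Z = ?c (v Y) Z" using eq[of Z] v by (cases "Z \<in> Stf g") (simp_all add: dsum_def)
      qed
      moreover have "v Y \<in> H e" using v Y by (simp add: dsum_def)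
      ultimately show "v \<in> ?c ` H e" by (rule image_eqI)
    qed
  qed
  moreover have "dim (?c ` H e) \<le> hdim e"
    using dim_image_le'[OF c subspace_pw fin_dim_H, of e] by (simp add: dim_H hdim_def)
  ultimately show ?thesis using dim_dsum_H[OF finite_Stf, of g e] by linarith
qed

text \<open>By \<open>edges_connected\<close> it is enough to realize all values on one starting
  edge, which may be a boundary edge.\<close>

lemma dsum_Eg_subset:
  fixes U :: "((real^3) set \<Rightarrow> real^3 \<Rightarrow> real) set"
  assumes g: "{g} \<in> K" and U: "subspace U" and im: "res (Eg g) ` \<psi> ` dsum (Sg g) (\<lambda>_. H e) \<subseteq> U"
    and h0: "{g, h0} \<in> K" "h0 \<noteq> g" "\<And>x. x \<in> H e \<Longrightarrow> \<nu> g h0 x \<in> U"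
  shows "dsum (Eg g) (\<lambda>_. H e) \<subseteq> U"
proof (rule order_trans[OF dsum_subset_span_unit[OF finite_Eg]], rule span_minimal[OF _ U], intro UN_least image_subsetI)
  fix \<tau> x assume \<tau>: "\<tau> \<in> Eg g" and x: "x \<in> H e"
  obtain h where h: "\<tau> = {g, h}" "h \<noteq> g" using edge_at[OF \<tau>] by blast
  have hK: "{g, h} \<in> K" using \<tau> EE_D(1) unfolding h(1) Eg_def by blast
  have x': "ori g \<tau> *\<^sub>R x \<in> H e" by (rule subspace_scale[OF subspace_pw x])
  have "\<nu> g h (ori g \<tau> *\<^sub>R x) - \<nu> g h0 (ori g \<tau> *\<^sub>R x) \<in> U"
    by (rule edges_connected[OF g U subspace_pw im hK h(2) h0(1,2) x'])
  from subspace_add[OF U this h0(3)[OF x']] have "\<nu> g h (ori g \<tau> *\<^sub>R x) \<in> U" by simp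
  moreover have "\<nu> g h (ori g \<tau> *\<^sub>R x) = unit \<tau> x"
    unfolding \<nu>_def h(1)[symmetric] using \<tau> by (simp only: if_True scaleR_scaleR ori_sq scaleR_one)
  ultimately show "unit \<tau> x \<in> U" by simp
qed

text \<open>A boundary vertex has a boundary edge to start from, on which \<open>\<nu>\<close> is
  0.\<close>

lemma W_open_B:
  assumes g: "{g} \<in> K" "{g} \<notin> Int_faces 1"
  shows "dim (W nml r e g) + (\<Sum>\<tau>\<in>Eg g. \<Sum>i\<le>e. gdim (ne \<tau>) r i) \<le> card (Sg g) * hdim e"
proof (rule dim_W_B)
  show "nml \<sigma> \<in> lin" if "\<sigma> \<in> Sg g" for \<sigma> using that SS_D nml_lin by (simp add: Sg_def)
  show "\<exists>u. u \<noteq> 0 \<and> (\<forall>\<sigma>\<in>SS. \<tau> \<subseteq> \<sigma> \<longrightarrow> nml \<sigma> u = 0)" if \<tau>: "\<tau> \<in> Eg g" for \<tau>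
  proof -
    obtain h where h: "\<tau> = {g, h}" "h \<noteq> g" using edge_at[OF \<tau>] by blast
    have "nml \<sigma> (h - g) = 0" if "\<sigma> \<in> SS" "\<tau> \<subseteq> \<sigma>" for \<sigma>
      using nml_diff[of \<sigma> g h] ell(3)[of \<sigma> h] SS_D[OF that(1)] that(2) h by simp
    then show ?thesis using h(2) by (intro exI[of _ "h - g"]) auto
  qed
  obtain h0 where h0: "h0 \<noteq> g" "{g, h0} \<in> K" "{g, h0} \<notin> EE" using boundary_edge_exists[OF g] by blast
  let ?U = "span (res (Eg g) ` \<psi> ` dsum (Sg g) (\<lambda>_. H e) \<union> dsum (Eg g) (Jt nml r e))"
  have "\<nu> g h0 x \<in> ?U" for x :: "real^3 \<Rightarrow> real"
  proof -
    have "\<nu> g h0 x = 0" using h0(3) by (simp add: \<nu>_def Eg_def)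
    then show ?thesis by (simp only: span_zero)
  qed
  then show "dsum (Eg g) (\<lambda>_. H e) \<subseteq> ?U"
    by (intro dsum_Eg_subset[OF g(1) subspace_span _ h0(2,1)]) (auto intro: span_base)
qed

lemma dim_W_0_ge:
  assumes g: "{g} \<in> K"
  shows "card (Stf g) \<le> dim (W lam r 0 g) + 1"
proof -
  have "dim (\<delta>g g ` dsum (Stf g) (\<lambda>_. H 0)) \<le> dim (W lam r 0 g)"
    unfolding W_def
    by (intro dim_mono' fin_dim_span fin_dim_Un fin_dim_image linear_\<delta>g fin_dim_dsum_H fin_dim_dsum finite_Stf finite_Sg fin_dim_Jh)
      (auto intro: span_base)
  then show ?thesis using dim_\<delta>g_ge[OF g, of 0] by simp
qed

text \<open>The Euler characteristic of the link enters only through these two inequalities, which come from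
  counting dimensions in degree 0.\<close>

lemma euler_open:
  assumes g: "{g} \<in> K" "{g} \<notin> Int_faces 1"
  shows "card (Stf g) + card (Eg g) \<le> card (Sg g) + 1"
  \<comment> \<open>In degree 0 every \<open>gdim\<close> is 1, so the sum counts the interior
    edges.\<close>
  using W_open_B[OF g, of 0 0] dim_W_0_ge[OF g(1), of nml 0] by (simp add: gdim_def)

text \<open>Without a boundary edge the values on the starting edge are adjoined, at the cost of one
  dimension; hence 2 in place of 1.\<close>

lemma euler_closed:
  assumes g: "{g} \<in> K"
  shows "card (Stf g) + card (Eg g) \<le> card (Sg g) + 2"
proof -
  let ?f = "\<lambda>q. res (Eg g) (\<psi> q :: (real^3) set \<Rightarrow> real^3 \<Rightarrow> real)"
  let ?B = "dsum (Sg g) (\<lambda>_. H 0)"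
  have lin: "linear ?f" using linear_compose[OF linear_\<psi> linear_res] by (simp add: o_def)
  have sB: "subspace ?B" by (intro subspace_dsum subspace_pw)
  have fB: "fin_dim ?B" by (rule fin_dim_dsum_H[OF finite_Sg])
  have lam: "nml \<sigma> \<in> lin" if "\<sigma> \<in> Sg g" for \<sigma> using that SS_D nml_lin by (simp add: Sg_def)
  have D0: "dsum (Eg g) (Jt nml 0 0) = {0}" 
  proof (intro subset_antisym subsetI)
    fix q :: "(real^3) set \<Rightarrow> real^3 \<Rightarrow> real" assume q: "q \<in> dsum (Eg g) (Jt nml 0 0)"
    have "q \<tau> = 0" for \<tau> using q by (cases "\<tau> \<in> Eg g") (auto simp: Jt_def dsum_def)
    then show "q \<in> {0}" by (simp add: fun_eq_iff)
  qed (simp add: Jt_def dsum_def)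
  have "dim (W nml 0 0 g) \<le> dim {q \<in> ?B. ?f q = 0}"
    using W_subset[of g nml 0 0, OF lam] unfolding D0 singleton_iff
    by (intro dim_mono'[OF fin_dim_mono[OF fB]]) auto
  moreover have "dim ?B = dim {q \<in> ?B. ?f q = 0} + dim (?f ` ?B)"
    by (rule dim_kernel_image[OF lin sB fB])
  moreover have "dim ?B = card (Sg g)" using dim_dsum_H[OF finite_Sg, of g 0] by simp
  moreover have "card (Eg g) \<le> dim (?f ` ?B) + 1"
  proof -
    obtain Y where Y: "Y \<in> T4" "g \<in> Y" using pure[OF g] by blast
    have "card (Y - {g}) = 3" using T4_card[OF Y(1)] T4_finite[OF Y(1)] Y(2) by simp
    then have "Y - {g} \<noteq> {}" by (metis card.empty zero_neq_numeral)
    then obtain h0 where h0: "h0 \<in> Y" "h0 \<noteq> g" by blast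
    have hK: "{g, h0} \<in> K" by (rule K_subset[OF T4_K[OF Y(1)]]) (use h0 Y in blast)
    let ?U = "span (?f ` ?B \<union> \<nu> g h0 ` H 0)"
    have "dsum (Eg g) (\<lambda>_. H 0) \<subseteq> ?U"
      by (rule dsum_Eg_subset[OF g subspace_span _ hK h0(2)]) (auto intro: span_base)
    then have "dim (dsum (Eg g) (\<lambda>_. H 0)) \<le> dim ?U"
      by (intro dim_mono' fin_dim_span fin_dim_Un fin_dim_image lin linear_\<nu> fB fin_dim_H)
    also have "\<dots> \<le> dim (?f ` ?B) + dim (\<nu> g h0 ` (H 0 :: (real^3 \<Rightarrow> real) set))"
      unfolding dim_span by (intro dim_span_Un_le fin_dim_image lin linear_\<nu> fB fin_dim_H)
    also have "dim (\<nu> g h0 ` (H 0 :: (real^3 \<Rightarrow> real) set)) \<le> dim (H 0 :: (real^3 \<Rightarrow> real) set)"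
      by (rule dim_image_le'[OF linear_\<nu> subspace_pw fin_dim_H])
    finally show ?thesis using dim_dsum_H[OF finite_Eg, of g 0] dim_H[of 0] by (simp add: choose_two)
  qed
  ultimately show ?thesis using dim_W_0_ge[OF g, of nml 0] by linarith
qed

text \<open>Explicit generators over an index set independent of \<open>lam\<close>, as
  \<open>dim_span_lower_semicontinuous\<close> needs: \<open>Inl\<close> for jumps of monomials,
  \<open>Inr\<close> for multiples of powers.\<close>

definition W_gen :: "((real^3) set \<Rightarrow> real^3 \<Rightarrow> real) \<Rightarrow> nat \<Rightarrow> real^3 \<Rightarrow>
    ((real^3) set \<times> (3 \<Rightarrow> nat)) + ((real^3) set \<times> (3 \<Rightarrow> nat)) \<Rightarrow> (real^3) set \<Rightarrow> real^3 \<Rightarrow> real" where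
  "W_gen lam r g k = (case k of
     Inl (Y, \<alpha>) \<Rightarrow> \<delta>g g (unit Y (mon UNIV (\<lambda>i x. x $ i) \<alpha>))
   | Inr (\<sigma>, \<alpha>) \<Rightarrow> unit \<sigma> (lam \<sigma> ^ (r + 1) * mon UNIV (\<lambda>i x. x $ i) \<alpha>))"

lemma W_eq_span_gen:
  assumes "r + 1 \<le> e"
  shows "W lam r e g = span (W_gen lam r g ` (Stf g \<times> exps UNIV e <+> Sg g \<times> exps UNIV (e - (r + 1))))"
proof -
  let ?m = "mon UNIV (\<lambda>i x. x $ i :: real) :: (3 \<Rightarrow> nat) \<Rightarrow> _"
  have 1: "\<delta>g g ` dsum (Stf g) (\<lambda>_. H e) = span (\<delta>g g ` (\<Union>Y\<in>Stf g. unit Y ` ?m ` exps UNIV e))"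
    unfolding H_eq dsum_span[OF finite_Stf] linear_span_image[OF linear_\<delta>g] ..
  have "dsum (Sg g) (Jh lam r e) = dsum (Sg g) (\<lambda>\<sigma>. span ((\<lambda>q. lam \<sigma> ^ (r + 1) * q) ` ?m ` exps UNIV (e - (r + 1))))"
    unfolding Jh_def H_eq linear_span_image[OF linear_mult_left] using assms by (simp only: if_True)
  also have "\<dots> = span (\<Union>\<sigma>\<in>Sg g. unit \<sigma> ` (\<lambda>q. lam \<sigma> ^ (r + 1) * q) ` ?m ` exps UNIV (e - (r + 1)))"
    by (rule dsum_span[OF finite_Sg])
  finally have 2: "dsum (Sg g) (Jh lam r e) = span (\<Union>\<sigma>\<in>Sg g. unit \<sigma> ` (\<lambda>q. lam \<sigma> ^ (r + 1) * q) ` ?m ` exps UNIV (e - (r + 1)))" .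
  have 3: "W_gen lam r g ` (Stf g \<times> exps UNIV e <+> Sg g \<times> exps UNIV (e - (r + 1)))
    = \<delta>g g ` (\<Union>Y\<in>Stf g. unit Y ` ?m ` exps UNIV e) \<union> (\<Union>\<sigma>\<in>Sg g. unit \<sigma> ` (\<lambda>q. lam \<sigma> ^ (r + 1) * q) ` ?m ` exps UNIV (e - (r + 1)))"
    (is "?l = ?a \<union> ?b")
  proof -
    have "W_gen lam r g ` Inl ` (Stf g \<times> exps UNIV e) = ?a"
    proof (intro subset_antisym subsetI)
      fix x assume "x \<in> W_gen lam r g ` Inl ` (Stf g \<times> exps UNIV e)"
      then obtain Y \<alpha> where "x = \<delta>g g (unit Y (?m \<alpha>))" "Y \<in> Stf g" "\<alpha> \<in> exps UNIV e" by (auto simp: W_gen_def)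
      then show "x \<in> ?a" by blast
    next
      fix x assume "x \<in> ?a"
      then obtain Y \<alpha> where x: "x = \<delta>g g (unit Y (?m \<alpha>))" "Y \<in> Stf g" "\<alpha> \<in> exps UNIV e" by blast
      have "x = W_gen lam r g (Inl (Y, \<alpha>))" unfolding x(1) W_gen_def sum.case prod.case ..
      then show "x \<in> W_gen lam r g ` Inl ` (Stf g \<times> exps UNIV e)" using x(2,3) by blast
    qed
    moreover have "W_gen lam r g ` Inr ` (Sg g \<times> exps UNIV (e - (r + 1))) = ?b"
    proof (intro subset_antisym subsetI)
      fix x assume "x \<in> W_gen lam r g ` Inr ` (Sg g \<times> exps UNIV (e - (r + 1)))"
      then obtain k where k: "k \<in> Sg g \<times> exps UNIV (e - (r + 1))" "x = W_gen lam r g (Inr k)" by blast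
      obtain \<sigma> \<alpha> where k': "k = (\<sigma>, \<alpha>)" by (cases k)
      have "x = unit \<sigma> (lam \<sigma> ^ (r + 1) * ?m \<alpha>)" using k(2) unfolding W_gen_def k' sum.case prod.case .
      moreover have "\<sigma> \<in> Sg g" "\<alpha> \<in> exps UNIV (e - (r + 1))" using k(1) k' by simp_all
      ultimately show "x \<in> ?b" by blast
    next
      fix x assume "x \<in> ?b"
      then obtain \<sigma> \<alpha> where x: "x = unit \<sigma> (lam \<sigma> ^ (r + 1) * ?m \<alpha>)" "\<sigma> \<in> Sg g" "\<alpha> \<in> exps UNIV (e - (r + 1))" by blast
      have "x = W_gen lam r g (Inr (\<sigma>, \<alpha>))" unfolding x(1) W_gen_def sum.case prod.case ..
      then show "x \<in> W_gen lam r g ` Inr ` (Sg g \<times> exps UNIV (e - (r + 1)))" using x(2,3) by blast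
    qed
    ultimately show ?thesis unfolding Plus_def image_Un by simp
  qed
  show ?thesis unfolding W_def 1 2 3 by (rule span_Un_span)
qed

lemma Jh_scale:
  assumes "mu \<sigma> = c *\<^sub>R lam \<sigma>"
  shows "Jh mu r e \<sigma> \<subseteq> Jh lam r e \<sigma>"
proof (cases "r + 1 \<le> e")
  case True
  have "mu \<sigma> ^ (r + 1) * q = lam \<sigma> ^ (r + 1) * (c ^ (r + 1) *\<^sub>R q)" for q
    by (rule ext) (simp add: assms power_mult_distrib)
  then show ?thesis unfolding Jh_def using True
    by (simp only: if_True image_subset_iff) (intro ballI imageI subspace_scale subspace_pw)
qed (simp add: Jh_def)

lemma W_mono:
  assumes "\<And>\<sigma>. \<sigma> \<in> Sg g \<Longrightarrow> Jh mu r e \<sigma> \<subseteq> Jh lam r e \<sigma>"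
  shows "W mu r e g \<subseteq> W lam r e g"
proof -
  have "dsum (Sg g) (Jh mu r e) \<subseteq> dsum (Sg g) (Jh lam r e)" using assms unfolding dsum_def by blast
  then show ?thesis unfolding W_def by (intro span_mono) blast
qed

lemma fin_dim_W: "fin_dim (W lam r e g)"
  unfolding W_def
  by (intro fin_dim_span fin_dim_Un fin_dim_image linear_\<delta>g fin_dim_dsum_H fin_dim_dsum finite_Stf finite_Sg fin_dim_Jh)

section \<open>The link as a graph, and perturbation of the linear forms\<close>

definition lk :: "real^3 \<Rightarrow> (real^3) set" where "lk g = {h. h \<noteq> g \<and> {g, h} \<in> K}"

text \<open>An order of the two ends has to be fixed because the determinants formed from them
  change sign with it.\<close>

definition endpoints :: "(real^3) set \<Rightarrow> (real^3) \<times> (real^3)" where "endpoints a = (SOME x. a = {fst x, snd x})"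

lemma endpoints: "card a = 2 \<Longrightarrow> a = {fst (endpoints a), snd (endpoints a)}"
proof -
  assume "card a = 2"
  then obtain x y where "a = {x, y}" by (auto simp: card_2_iff)
  then have "a = {fst (x, y), snd (x, y)}" by simp
  then show ?thesis unfolding endpoints_def by (rule someI)
qed

lemma card_lk:
  assumes g: "{g} \<in> Int_faces 1"
  shows "finite (lk g)" "card (lk g) = card (Eg g)"
proof -
  have e: "Eg g = (\<lambda>h. {g, h}) ` lk g"
  proof (intro subset_antisym subsetI)
    fix \<tau> assume \<tau>: "\<tau> \<in> Eg g"
    then obtain h where "\<tau> = {g, h}" "h \<noteq> g" using edge_at by blast
    then show "\<tau> \<in> (\<lambda>h. {g, h}) ` lk g" using \<tau> EE_D(1) by (auto simp: lk_def Eg_def)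
  next
    fix \<tau> assume "\<tau> \<in> (\<lambda>h. {g, h}) ` lk g"
    then obtain h where h: "\<tau> = {g, h}" "h \<noteq> g" "{g, h} \<in> K" by (auto simp: lk_def)
    have "{g, h} \<in> EE" by (rule Int_faces_up[OF g _ h(3)]) (use h(2) in auto)
    then show "\<tau> \<in> Eg g" using h(1) by (simp add: Eg_def)
  qed
  have inj: "inj_on (\<lambda>h. {g, h}) (lk g)" by (auto simp: inj_on_def doubleton_eq_iff)
  show "finite (lk g)" using finite_imageD[OF _ inj] finite_Eg[of g] unfolding e .
  show "card (lk g) = card (Eg g)" unfolding e by (rule card_image[OF inj, symmetric])
qed

definition lkE :: "real^3 \<Rightarrow> (real^3) set set" where
  "lkE g = {a. a \<subseteq> lk g \<and> card a = 2 \<and> insert g a \<in> SS}"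

lemma Sg_lkE:
  assumes "\<sigma> \<in> Sg g"
  shows "\<sigma> - {g} \<in> lkE g" "insert g (\<sigma> - {g}) = \<sigma>"
proof -
  have \<sigma>: "\<sigma> \<in> SS" "g \<in> \<sigma>" using assms by (auto simp: Sg_def)
  show e: "insert g (\<sigma> - {g}) = \<sigma>" using \<sigma>(2) by blast
  have "{g, h} \<in> K" if "h \<in> \<sigma>" for h
    by (rule K_subset[OF SS_D(1)[OF \<sigma>(1)]]) (use that \<sigma>(2) in blast)
  then have "\<sigma> - {g} \<subseteq> lk g" by (auto simp: lk_def)
  moreover have "card (\<sigma> - {g}) = 2" using SS_D[OF \<sigma>(1)] \<sigma>(2) by simp
  ultimately show "\<sigma> - {g} \<in> lkE g" using e \<sigma>(1) by (simp add: lkE_def)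
qed

lemma lkE_degree:
  assumes g: "{g} \<in> Int_faces 1" and i: "i \<in> lk g"
  shows "3 \<le> card {a \<in> lkE g. i \<in> a}"
proof -
  have gi: "{g, i} \<in> K" "i \<noteq> g" using i by (auto simp: lk_def)
  have E: "{g, i} \<in> EE" by (rule Int_faces_up[OF g _ gi(1)]) (use gi(2) in auto)
  have fin: "finite {a \<in> lkE g. i \<in> a}"
    using card_lk(1)[OF g] by (auto simp: lkE_def intro: finite_subset[of _ "Pow (lk g)"])
  have "card {\<sigma> \<in> K. card \<sigma> = 3 \<and> {g, i} \<subseteq> \<sigma>} \<le> card {a \<in> lkE g. i \<in> a}"
  proof (rule card_inj_on_le[where f = "\<lambda>\<sigma>. \<sigma> - {g}"])
    show "inj_on (\<lambda>\<sigma>. \<sigma> - {g}) {\<sigma> \<in> K. card \<sigma> = 3 \<and> {g, i} \<subseteq> \<sigma>}"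
      by (rule inj_onI) (auto; blast)
    show "(\<lambda>\<sigma>. \<sigma> - {g}) ` {\<sigma> \<in> K. card \<sigma> = 3 \<and> {g, i} \<subseteq> \<sigma>} \<subseteq> {a \<in> lkE g. i \<in> a}"
    proof (rule image_subsetI)
      fix \<sigma> assume \<sigma>: "\<sigma> \<in> {\<sigma> \<in> K. card \<sigma> = 3 \<and> {g, i} \<subseteq> \<sigma>}"
      then have "\<sigma> \<in> Sg g" using EE_SS[OF E, of \<sigma>] by (simp add: Sg_def)
      from Sg_lkE(1)[OF this] show "\<sigma> - {g} \<in> {a \<in> lkE g. i \<in> a}" using \<sigma> gi(2) by simp
    qed
  qed (rule fin)
  then show ?thesis using edge_degree[OF E] by linarith
qed

text \<open>A vertex of the link together with its at least three neighbours.\<close>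

lemma card_lk_ge:
  assumes g: "{g} \<in> Int_faces 1"
  shows "4 \<le> card (lk g)"
proof -
  have gK: "{g} \<in> K" using g by (rule Int_faces_K)
  obtain Y where Y: "Y \<in> T4" "g \<in> Y" using pure[OF gK] by blast
  have "card (Y - {g}) = 3" using T4_card[OF Y(1)] T4_finite[OF Y(1)] Y(2) by simp
  then have "Y - {g} \<noteq> {}" by (metis card.empty zero_neq_numeral)
  then obtain i where i: "i \<in> Y" "i \<noteq> g" by blast
  have "{g, i} \<in> K" by (rule K_subset[OF T4_K[OF Y(1)]]) (use i Y in blast)
  then have il: "i \<in> lk g" using i(2) by (simp add: lk_def)
  have "{a \<in> lkE g. i \<in> a} \<subseteq> (\<lambda>j. {i, j}) ` (lk g - {i})"
  proof
    fix a assume a: "a \<in> {a \<in> lkE g. i \<in> a}"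
    then have a': "a \<subseteq> lk g" "card a = 2" "i \<in> a" by (auto simp: lkE_def)
    then obtain j where "a = {i, j}" "j \<noteq> i" by (auto simp: card_2_iff doubleton_eq_iff)
    then show "a \<in> (\<lambda>j. {i, j}) ` (lk g - {i})" using a'(1) by blast
  qed
  then have "card {a \<in> lkE g. i \<in> a} \<le> card (lk g - {i})"
    using card_lk(1)[OF g] by (intro surj_card_le) auto
  then show ?thesis using lkE_degree[OF g il] card_lk(1)[OF g] il by simp
qed

text \<open>\<open>v h\<close> replaces the direction of the edge to \<open>h\<close>, and
  \<open>lam \<sigma>\<close> vanishes on the two directions of the triangle. In general position it
  vanishes on no further direction, so \<open>ternary_forms_power_ideal\<close> applies to the link
  and the powers generate all forms of degree \<open>e\<close>; this supplies every value on the
  starting edge.\<close>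

lemma W_generic_B:
  fixes v :: "real^3 \<Rightarrow> real^3"
  assumes g: "{g} \<in> Int_faces 1"
    and gen: "\<And>h i k. h \<in> lk g \<Longrightarrow> i \<in> lk g \<Longrightarrow> k \<in> lk g \<Longrightarrow> distinct [h, i, k] \<Longrightarrow> det3 (v h) (v i) (v k) \<noteq> 0"
    and e: "r + 1 \<le> e" "2 * e < min (card (Eg g)) 6 * (e - r)"
    and lam: "lam = (\<lambda>\<sigma> x. det3 x (v (fst (endpoints (\<sigma> - {g})))) (v (snd (endpoints (\<sigma> - {g})))))"
  shows "dim (W lam r e g) + (\<Sum>\<tau>\<in>Eg g. \<Sum>i\<le>e. gdim (ne \<tau>) r i) \<le> card (Sg g) * hdim e"
proof -
  define lf where "lf a x = det3 x (v (fst (endpoints a))) (v (snd (endpoints a)))" for a x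
  have gK: "{g} \<in> K" using g by (rule Int_faces_K)
  have lam_lf: "lam \<sigma> = lf (\<sigma> - {g})" for \<sigma> by (simp add: lam lf_def fun_eq_iff)
  have lf_lin: "lf a \<in> lin" for a
    unfolding lin_def lf_def by (rule CollectI, rule exI[of _ "cross3 (v (fst (endpoints a))) (v (snd (endpoints a)))"]) (simp add: inner_commute fun_eq_iff)
  have third: "\<exists>k. k \<in> lk g \<and> k \<noteq> i \<and> k \<noteq> j" for i j
  proof (rule ccontr)
    assume "\<not> ?thesis"
    then have "lk g \<subseteq> {i, j}" by blast
    then have "card (lk g) \<le> card {i, j}" by (intro card_mono) auto
    also have "\<dots> \<le> 2" by (simp add: card_insert_if)
    finally show False using card_lk_ge[OF g] by simp
  qed
  have v0: "v i \<noteq> 0" if i: "i \<in> lk g" for i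
  proof -
    obtain j where j: "j \<in> lk g" "j \<noteq> i" using third[of i i] by blast
    obtain k where k: "k \<in> lk g" "k \<noteq> i" "k \<noteq> j" using third[of i j] by blast
    have "det3 (v i) (v j) (v k) \<noteq> 0" by (rule gen) (use i j k in auto)
    then show ?thesis by auto
  qed
  have pr_a: "a = {fst (endpoints a), snd (endpoints a)}" "fst (endpoints a) \<noteq> snd (endpoints a)" if "a \<in> lkE g" for a
  proof -
    have c: "card a = 2" using that by (simp add: lkE_def)
    show "a = {fst (endpoints a), snd (endpoints a)}" by (rule endpoints[OF c])
    then show "fst (endpoints a) \<noteq> snd (endpoints a)" using c by (metis card_2_iff insert_absorb2 is_singletonI is_singleton_altdef numeral_eq_one_iff semiring_norm(85))
  qed
  have lfv: "lf a (v i) = 0 \<longleftrightarrow> i \<in> a" if a: "a \<in> lkE g" and i: "i \<in> lk g" for a i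
  proof
    assume 0: "lf a (v i) = 0"
    show "i \<in> a"
    proof (rule ccontr)
      assume ni: "i \<notin> a"
      have "a \<subseteq> lk g" using a by (simp add: lkE_def)
      then have "det3 (v i) (v (fst (endpoints a))) (v (snd (endpoints a))) \<noteq> 0"
        using pr_a[OF a] ni i by (intro gen) auto
      then show False using 0 by (simp add: lf_def)
    qed
  next
    assume "i \<in> a"
    then have "i = fst (endpoints a) \<or> i = snd (endpoints a)" using pr_a(1)[OF a] by blast
    then show "lf a (v i) = 0" unfolding lf_def by (auto simp: dot_cross_self)
  qed
  have ker: "y \<in> span {lf a}" if a: "a \<in> lkE g" and y: "y \<in> lin" "\<And>i. i \<in> a \<Longrightarrow> y (v i) = 0" for a y
  proof -
    obtain n where n: "y = (\<lambda>x. n \<bullet> x)" using y(1) by (auto simp: lin_def)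
    obtain k where k: "k \<in> lk g" "k \<noteq> fst (endpoints a)" "k \<noteq> snd (endpoints a)" using third by blast
    have ps: "fst (endpoints a) \<in> a" "snd (endpoints a) \<in> a" using pr_a(1)[OF a] by blast+
    have "lf a (v k) \<noteq> 0" using lfv[OF a k(1)] k(2,3) pr_a(1)[OF a] by blast
    then have "cross3 (v (fst (endpoints a))) (v (snd (endpoints a))) \<noteq> 0" by (auto simp: lf_def)
    moreover have "n \<bullet> v (fst (endpoints a)) = 0" "n \<bullet> v (snd (endpoints a)) = 0"
      using y(2)[OF ps(1)] y(2)[OF ps(2)] by (simp_all add: n)
    ultimately obtain c where "n = c *\<^sub>R cross3 (v (fst (endpoints a))) (v (snd (endpoints a)))"
      using parallel_to_cross by blast
    then have "y = c *\<^sub>R lf a" by (simp add: n lf_def fun_eq_iff inner_commute)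
    then show ?thesis by (simp only: span_scale span_base singletonI)
  qed
  have He: "H e \<subseteq> span {lf a ^ (r + 1) * q |a q. a \<in> lkE g \<and> q \<in> H (e - (r + 1))}"
  proof (rule order_trans)
    show "H e \<subseteq> power_ideal lin (lkE g) lf (\<lambda>_. e - r) e"
    proof (rule ternary_forms_power_ideal[where w = v and V = "lk g"])
      show "2 * e < min (card (lk g)) 6 * (e - r)" using e(2) card_lk(2)[OF g] by simp
    qed (use card_lk(1)[OF g] lf_lin v0 lfv ker lkE_degree[OF g] card_lk_ge[OF g] in \<open>auto simp: lkE_def\<close>)
    show "power_ideal lin (lkE g) lf (\<lambda>_. e - r) e \<subseteq> span {lf a ^ (r + 1) * q |a q. a \<in> lkE g \<and> q \<in> H (e - (r + 1))}"
      by (rule power_ideal_subset_powers[OF lf_lin e(1)])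
  qed
  show ?thesis
  proof (rule dim_W_B)
    show "lam \<sigma> \<in> lin" for \<sigma> unfolding lam_lf by (rule lf_lin)
    show "\<exists>u. u \<noteq> 0 \<and> (\<forall>\<sigma>\<in>SS. \<tau> \<subseteq> \<sigma> \<longrightarrow> lam \<sigma> u = 0)" if \<tau>: "\<tau> \<in> Eg g" for \<tau>
    proof -
      obtain h where h: "\<tau> = {g, h}" "h \<noteq> g" using edge_at[OF \<tau>] by blast
      have hl: "h \<in> lk g" using \<tau> EE_D(1) h by (auto simp: lk_def Eg_def)
      have "lam \<sigma> (v h) = 0" if "\<sigma> \<in> SS" "\<tau> \<subseteq> \<sigma>" for \<sigma>
      proof -
        have "\<sigma> \<in> Sg g" using that h(1) by (simp add: Sg_def)
        from Sg_lkE(1)[OF this] show ?thesis unfolding lam_lf using lfv[OF _ hl] that(2) h by auto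
      qed
      then show ?thesis using v0[OF hl] by blast
    qed
    let ?U = "span (res (Eg g) ` \<psi> ` dsum (Sg g) (\<lambda>_. H e) \<union> dsum (Eg g) (Jt lam r e))"
    have imU: "res (Eg g) ` \<psi> ` dsum (Sg g) (\<lambda>_. H e) \<subseteq> ?U" by (auto intro: span_base)
    obtain h0 where h0: "h0 \<in> lk g" using third by blast
    have h0': "{g, h0} \<in> K" "h0 \<noteq> g" using h0 by (auto simp: lk_def)
    \<comment> \<open>A multiple of the power at a triangle lies in the ideal of an edge of that
      triangle at \<open>g\<close>; from there connectedness moves its value to
      \<open>h0\<close>.\<close>
    have "H e \<subseteq> {x. \<nu> g h0 x \<in> ?U}"
    proof (rule order_trans[OF He], rule span_minimal)
      show "subspace {x. \<nu> g h0 x \<in> ?U}"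
        using linear_subspace_vimage[OF linear_\<nu> subspace_span] by (simp only: vimage_def)
      show "{lf a ^ (r + 1) * q |a q. a \<in> lkE g \<and> q \<in> H (e - (r + 1))} \<subseteq> {x. \<nu> g h0 x \<in> ?U}"
      proof (rule subsetI, rule CollectI)
        fix x assume "x \<in> {lf a ^ (r + 1) * q |a q. a \<in> lkE g \<and> q \<in> H (e - (r + 1))}"
        then obtain a q where x: "x = lf a ^ (r + 1) * q" "a \<in> lkE g" "q \<in> H (e - (r + 1))" by blast
        have \<sigma>: "insert g a \<in> SS" "g \<notin> a" using x(2) by (auto simp: lkE_def lk_def)
        have la: "lam (insert g a) = lf a" unfolding lam_lf using \<sigma>(2) by simp
        have xJ: "x \<in> Jh lam r e (insert g a)"
          unfolding Jh_def la x(1) using e(1) x(3) by (simp only: if_True imageI)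
        define h where "h = fst (endpoints a)"
        have ha: "h \<in> a" unfolding h_def using pr_a(1)[OF x(2)] by blast
        have hl: "h \<in> lk g" using x(2) ha by (auto simp: lkE_def)
        then have hK: "{g, h} \<in> K" "h \<noteq> g" by (auto simp: lk_def)
        have sJt: "subspace (Jt lam r e \<tau>)" for \<tau> by (simp add: Jt_def)
        have xJt: "x \<in> Jt lam r e {g, h}"
          by (rule subsetD[OF Jh_subset_Jt[OF \<sigma>(1)] xJ]) (use ha in auto)
        have xH: "x \<in> H e" by (rule subsetD[OF Jh_subset_H xJ]) (simp only: la lf_lin)
        have 1: "\<nu> g h x \<in> ?U"
        proof (cases "{g, h} \<in> Eg g")
          case True
          have "unit {g, h} (ori g {g, h} *\<^sub>R x) \<in> dsum (Eg g) (Jt lam r e)"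
            
            by (rule unit_in_dsum[where V = "Jt lam r e", OF True subspace_scale[OF sJt xJt] sJt])
          then show ?thesis unfolding \<nu>_def using True by (simp only: if_True) (rule span_base, rule UnI2)
        next
          case False
          then show ?thesis unfolding \<nu>_def by (simp only: if_False span_zero)
        qed
        have "\<nu> g h x - \<nu> g h0 x \<in> ?U"
          by (rule edges_connected[OF gK subspace_span subspace_pw imU hK h0' xH])
        from subspace_diff[OF subspace_span 1 this] show "\<nu> g h0 x \<in> ?U" by simp
      qed
    qed
    then have "\<nu> g h0 x \<in> ?U" if "x \<in> H e" for x using that by blast
    then show "dsum (Eg g) (\<lambda>_. H e) \<subseteq> ?U"
      by (rule dsum_Eg_subset[OF gK subspace_span imU h0'])
  qed
qed

text \<open>The actual edge directions may be coplanar in triples. The family below gives the actual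
  forms up to scaling at \<open>t = 0\<close> and is generic for small nonzero \<open>t\<close>.
  Passing to such a \<open>t\<close> does not lower the dimension of \<open>W\<close>, which is what
  has to be bounded from above.\<close>

lemma W_closed_B:
  assumes g: "{g} \<in> Int_faces 1" and e: "r + 1 \<le> e" "2 * e < min (card (Eg g)) 6 * (e - r)"
  shows "dim (W nml r e g) + (\<Sum>\<tau>\<in>Eg g. \<Sum>i\<le>e. gdim (ne \<tau>) r i) \<le> card (Sg g) * hdim e"
proof -
  have "\<exists>s :: real^3 \<Rightarrow> nat. inj_on s (lk g)" using finite_imp_inj_to_nat_seg[OF card_lk(1)[OF g]] by blast
  \<comment> \<open>Distinct labels give distinct points of the moment curve, hence nonzero
    determinants of the directions of motion.\<close>
  then obtain s :: "real^3 \<Rightarrow> nat" where s: "inj_on s (lk g)" by blast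
  define v where "v t h = (h - g) + t *\<^sub>R moment (real (s h))" for t h
  define lam where "lam t = (\<lambda>\<sigma> x. det3 x (v t (fst (endpoints (\<sigma> - {g})))) (v t (snd (endpoints (\<sigma> - {g})))))" for t
  let ?G = "Stf g \<times> exps UNIV e <+> Sg g \<times> exps UNIV (e - (r + 1)) :: (((real^3) set \<times> (3 \<Rightarrow> nat)) + ((real^3) set \<times> (3 \<Rightarrow> nat))) set"
  have finG: "finite ?G" using finite_Stf finite_Sg by simp
  let ?ev = "\<lambda>\<sigma> x (q :: (real^3) set \<Rightarrow> real^3 \<Rightarrow> real). q \<sigma> x"
  have "eventually (\<lambda>t. dim (span ((\<lambda>k. W_gen (lam 0) r g k) ` ?G)) \<le> dim (span ((\<lambda>k. W_gen (lam t) r g k) ` ?G))) (at 0)"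
  proof (rule dim_span_lower_semicontinuous[where E = "{?ev \<sigma> x |\<sigma> x. True}" and f = "\<lambda>k t. W_gen (lam t) r g k", OF finG])
    fix \<phi> assume "\<phi> \<in> {?ev \<sigma> x |\<sigma> x. True}"
    then obtain \<sigma> x where \<phi>: "\<phi> = ?ev \<sigma> x" by blast
    show "linear \<phi>" unfolding \<phi> by (rule linearI) auto
    fix k
    have "((\<lambda>t. lam t \<sigma>' x) \<longlongrightarrow> lam 0 \<sigma>' x) (at 0)" for \<sigma>'
    proof -
      have "continuous (at 0) (\<lambda>t. lam t \<sigma>' x)"
        unfolding lam_def v_def cross3_def inner_vec_def by (simp add: sum_3 vector_3)
      then show ?thesis by (simp add: continuous_within)
    qed
    then show "((\<lambda>t. \<phi> (W_gen (lam t) r g k)) \<longlongrightarrow> \<phi> (W_gen (lam 0) r g k)) (at 0)"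
      unfolding \<phi> W_gen_def by (cases k) (auto simp: unit_def simp del: power_Suc intro!: tendsto_intros)
  next
    fix q :: "(real^3) set \<Rightarrow> real^3 \<Rightarrow> real" assume q: "\<And>\<phi>. \<phi> \<in> {?ev \<sigma> x |\<sigma> x. True} \<Longrightarrow> \<phi> q = 0"
    have "q \<sigma> x = 0" for \<sigma> x by (rule q[of "?ev \<sigma> x"]) blast
    then show "q = 0" by (simp add: fun_eq_iff)
  qed
  moreover have "eventually (\<lambda>t. \<forall>h\<in>lk g. \<forall>i\<in>lk g. \<forall>k\<in>lk g. distinct [h, i, k] \<longrightarrow> det3 (v t h) (v t i) (v t k) \<noteq> 0) (at 0)"
  proof (intro eventually_ball_finite ballI card_lk(1)[OF g])
    fix h i k assume hik: "h \<in> lk g" "i \<in> lk g" "k \<in> lk g"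
    show "eventually (\<lambda>t. distinct [h, i, k] \<longrightarrow> det3 (v t h) (v t i) (v t k) \<noteq> 0) (at 0)"
    proof (cases "distinct [h, i, k]")
      case True
      have "s h \<noteq> s i" "s h \<noteq> s k" "s i \<noteq> s k" using True hik inj_onD[OF s] by fastforce+
      then have "det3 (moment (real (s h))) (moment (real (s i))) (moment (real (s k))) \<noteq> 0"
        unfolding det3_moment by simp
      from eventually_det3_perturbed[OF this, of "h - g" "i - g" "k - g"] show ?thesis unfolding v_def by eventually_elim simp
    next
      case False
      show ?thesis by (rule always_eventually) (use False in blast)
    qed
  qed
  ultimately have "eventually (\<lambda>t. dim (span ((\<lambda>k. W_gen (lam 0) r g k) ` ?G)) \<le> dim (span ((\<lambda>k. W_gen (lam t) r g k) ` ?G))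
    \<and> (\<forall>h\<in>lk g. \<forall>i\<in>lk g. \<forall>k\<in>lk g. distinct [h, i, k] \<longrightarrow> det3 (v t h) (v t i) (v t k) \<noteq> 0)) (at 0)"
    by (rule eventually_conj)
  from eventually_happens'[OF _ this] obtain t where
    t: "dim (span ((\<lambda>k. W_gen (lam 0) r g k) ` ?G)) \<le> dim (span ((\<lambda>k. W_gen (lam t) r g k) ` ?G))"
      "\<forall>h\<in>lk g. \<forall>i\<in>lk g. \<forall>k\<in>lk g. distinct [h, i, k] \<longrightarrow> det3 (v t h) (v t i) (v t k) \<noteq> 0"
    by (auto simp: at_neq_bot)
  have "dim (W nml r e g) \<le> dim (W (lam 0) r e g)"
  proof (rule dim_mono'[OF fin_dim_W W_mono])
    fix \<sigma> assume \<sigma>: "\<sigma> \<in> Sg g"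
    then have \<sigma>': "\<sigma> \<in> K" "card \<sigma> = 3" "g \<in> \<sigma>" using SS_D by (auto simp: Sg_def)
    obtain n where n: "nml \<sigma> = (\<lambda>x. n \<bullet> x)" using nml_inner[OF \<sigma>'(1,2)] .
    define h where "h = fst (endpoints (\<sigma> - {g}))"
    define k where "k = snd (endpoints (\<sigma> - {g}))"
    have c2: "card (\<sigma> - {g}) = 2" using Sg_lkE(1)[OF \<sigma>] by (simp add: lkE_def)
    have hk: "\<sigma> - {g} = {h, k}" unfolding h_def k_def by (rule endpoints[OF c2])
    then have \<sigma>eq: "\<sigma> = {g, h, k}" using \<sigma>'(3) by blast
    have cr: "cross3 (h - g) (k - g) \<noteq> 0" using tri_cross[of g h k] \<sigma>'(1,2) unfolding \<sigma>eq by blast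
    have "n \<bullet> (h - g) = 0" "n \<bullet> (k - g) = 0"
      using nml_diff[OF \<sigma>'] ell(3)[OF \<sigma>'(1,2)] hk by (auto simp: n)
    then obtain c where c: "n = c *\<^sub>R cross3 (h - g) (k - g)" using parallel_to_cross[OF cr] by blast
    \<comment> \<open>Both forms vanish on the directions of the plane of \<open>\<sigma>\<close>;
      the multiples of their powers do not depend on the factor in a way that enlarges the
      space.\<close>
    have "nml \<sigma> = c *\<^sub>R lam 0 \<sigma>"
      unfolding n lam_def v_def h_def[symmetric] k_def[symmetric] by (simp add: c fun_eq_iff inner_commute)
    then show "Jh nml r e \<sigma> \<subseteq> Jh (lam 0) r e \<sigma>" by (rule Jh_scale)
  qed
  also have "\<dots> \<le> dim (W (lam t) r e g)" unfolding W_eq_span_gen[OF e(1)] using t(1) .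
  finally show ?thesis
    using W_generic_B[OF g, of "v t" r e "lam t"] t(2) e by (simp add: lam_def)
qed

lemma unit_apply: "unit i x j = (if j = i then x else 0)" by (simp add: unit_def)

subsection \<open>The global count\<close>

definition Je :: "nat \<Rightarrow> nat \<Rightarrow> (real^3) set \<Rightarrow> (real^3 \<Rightarrow> real) set" where
  "Je r d \<tau> = span {ell \<sigma> ^ (r + 1) * q |\<sigma> q. \<sigma> \<in> {\<sigma> \<in> SS. \<tau> \<subseteq> \<sigma>} \<and> q \<in> P (d - (r + 1))}"

definition Ct :: "nat \<Rightarrow> nat \<Rightarrow> (real^3) set \<Rightarrow> (real^3 \<Rightarrow> real) set" where
  "Ct N d S = {p \<in> P d. \<forall>\<gamma>\<in>S. \<forall>e<N. comp d \<gamma> e p = 0}"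

text \<open>Indexed by the Bernstein exponents \<open>c\<close>, \<open>e\<close> at the two ends of an edge, those too close to an end
  being left to the conditions at that vertex.\<close>

definition Gsum :: "nat \<Rightarrow> nat \<Rightarrow> nat \<Rightarrow> nat \<Rightarrow> nat" where
  "Gsum n r d N = (\<Sum>(c, e)\<in>{(c, e). c + N \<le> d \<and> e + N \<le> d \<and> c + e \<le> d}. gdim n r (d - c - e))"

lemma subspace_Ct: "subspace (Ct N d S)"
proof (rule subspaceI)
  show "0 \<in> Ct N d S" unfolding Ct_def using subspace_0[OF subspace_pw] by (simp add: linear_0[OF linear_comp])
next
  fix x y assume "x \<in> Ct N d S" "y \<in> Ct N d S"
  then show "x + y \<in> Ct N d S"
    unfolding Ct_def using subspace_add[OF subspace_pw, of x _ d y] by (simp add: linear_add[OF linear_comp])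
next
  fix c x assume "x \<in> Ct N d S"
  then show "c *\<^sub>R x \<in> Ct N d S"
    unfolding Ct_def using subspace_scale[OF subspace_pw, of x _ d c] by (simp add: linear_scale[OF linear_comp])
qed

lemma fin_dim_Ct: "fin_dim (Ct N d S)"
  by (rule fin_dim_mono[OF fin_dim_P]) (auto simp: Ct_def)

lemma Ct_mono: "S \<subseteq> S' \<Longrightarrow> Ct N d S' \<subseteq> Ct N d S"
  by (auto simp: Ct_def)

lemma dim_Ct:
  assumes "C \<in> K" "2 * N \<le> d"
  shows "dim (Ct N d C) + card C * ((N + 2) choose 3) = (d + 3) choose 3"
proof -
  obtain Y where Y: "Y \<in> T4" "C \<subseteq> Y" using pure[OF assms(1)] by blast
  obtain b where "bary_tet Y b" using tet_bary[OF Y(1)] by blast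
  from bary_tet.dim_flat_space[OF this Y(2) assms(2)] show ?thesis unfolding Ct_def .
qed

lemma dim_J:
  assumes "\<sigma> \<in> SS"
  shows "dim (J r d \<sigma>) = (d - (r + 1) + 3) choose 3"
proof -
  obtain Y where Y: "Y \<in> T4" "\<sigma> \<subseteq> Y" using pure[OF SS_D(1)[OF assms]] by blast
  have "card (Y - \<sigma>) = 1" using SS_D[OF assms] T4_card[OF Y(1)] Y(2) by (simp add: card_Diff_subset)
  then obtain a where a: "Y - \<sigma> = {a}" by (metis card_1_singletonE)
  then have Ya: "Y = insert a \<sigma>" "a \<notin> \<sigma>" using Y(2) by blast+
  obtain b where "bary_tet Y b" using tet_bary[OF Y(1)] by blast
  then interpret bary_tet "insert a \<sigma>" b unfolding Ya(1) .
  note e = ell_bary[OF SS_D(1,2)[OF assms] Ya(2) bary_tet_axioms]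
  let ?c = "ell \<sigma> a ^ (r + 1)"
  have c0: "?c \<noteq> 0" using e(2) by simp
  have sc: "ell \<sigma> ^ (r + 1) * q = ?c *\<^sub>R (b a ^ (r + 1) * q)" for q
    by (subst e(1), rule ext) (simp add: power_mult_distrib)
  have "J r d \<sigma> = scaleR ?c ` ((\<lambda>q. b a ^ (r + 1) * q) ` P (d - (r + 1)))"
    unfolding J_def image_image by (rule image_cong[OF refl sc])
  moreover have "dim (scaleR ?c ` ((\<lambda>q. b a ^ (r + 1) * q) ` P (d - (r + 1)))) = dim ((\<lambda>q. b a ^ (r + 1) * q) ` P (d - (r + 1)))"
    by (rule dim_image_inj[OF linear_scale_self subspace_mult_image[OF subspace_pw] fin_dim_image[OF linear_mult_left fin_dim_P]])
      (use c0 in \<open>simp only: scaleR_eq_0_iff simp_thms\<close>)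
  ultimately show ?thesis using dim_mult_power[of a "r + 1" "d - (r + 1)"] by simp
qed

lemma eps_nonzero:
  assumes "\<tau> \<in> EE" "\<sigma> \<in> SS" "\<tau> \<subseteq> \<sigma>"
  shows "eps \<tau> \<sigma> \<noteq> 0"
proof -
  obtain g h where gh: "\<tau> = {g, h}" "g \<noteq> h" using EE_D(2)[OF assms(1)] by (auto simp: card_2_iff)
  have "card (\<sigma> - \<tau>) = 1" using SS_D[OF assms(2)] EE_D[OF assms(1)] assms(3) by (simp add: card_Diff_subset)
  then obtain k where "\<sigma> - \<tau> = {k}" by (metis card_1_singletonE)
  then have k: "\<sigma> = {g, h, k}" "k \<noteq> g" "k \<noteq> h" using assms(3) gh by auto
  have "eps {g, h} {g, h, k} = ori g {g, h} * sgn (nml {g, h, k} (cross3 (h - g) (k - g)))"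
    using SS_D[OF assms(2)] unfolding k(1) by (intro eps_vertex) auto
  moreover have "sgn (nml {g, h, k} (cross3 (h - g) (k - g))) \<noteq> 0"
    using assms(2) gh k by (intro triangle_unit(2)) auto
  ultimately show ?thesis unfolding gh(1) k(1) by (simp add: ori_def)
qed

text \<open>Up to scaling \<open>b w\<close> is the linear form of the triangle opposite to
  \<open>w\<close>, so an exponent of at least \<open>r + 1\<close> at \<open>w\<close> means
  divisibility by the required power.\<close>

lemma mon_in_Je:
  assumes Y: "Y \<in> T4" "bary_tet Y b" and \<alpha>: "\<alpha> \<in> exps Y d" "r + 1 \<le> \<alpha> w" and w: "w \<in> Y"
    and \<tau>: "\<tau> \<in> EE" "\<tau> \<subseteq> Y - {w}"
  shows "mon Y b \<alpha> \<in> Je r d \<tau>"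
proof -
  let ?\<sigma> = "Y - {w}"
  have "?\<sigma> \<in> K" by (rule K_subset[OF T4_K[OF Y(1)]]) blast
  moreover have c3: "card ?\<sigma> = 3" using T4_card[OF Y(1)] T4_finite[OF Y(1)] w by simp
  ultimately have \<sigma>: "?\<sigma> \<in> SS" using EE_SS[OF \<tau>] by blast
  have Yi: "Y = insert w ?\<sigma>" using w by blast
  have "bary_tet (insert w ?\<sigma>) b" using Y(2) Yi by simp
  note e = ell_bary[OF SS_D(1,2)[OF \<sigma>] _ this]
  let ?m = "mon Y b (\<alpha>(w := \<alpha> w - (r + 1)))"
  have "mon Y b \<alpha> = b w ^ (r + 1) * ?m" by (rule bary_tet.mon_factor(1)[OF Y(2) w \<alpha>])
  also have "\<dots> = ell ?\<sigma> ^ (r + 1) * (inverse (ell ?\<sigma> w) ^ (r + 1) *\<^sub>R ?m)"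
  proof
    fix x
    have ex: "ell ?\<sigma> x = ell ?\<sigma> w * b w x" using fun_cong[OF e(1), of x] by simp
    have "inverse (ell ?\<sigma> w) * ell ?\<sigma> w = 1" using e(2) by simp
    then have "(inverse (ell ?\<sigma> w) * ell ?\<sigma> w) ^ (r + 1) = 1" by simp
    then have "inverse (ell ?\<sigma> w) ^ (r + 1) * ell ?\<sigma> w ^ (r + 1) = 1" by (simp only: power_mult_distrib)
    then have "b w x ^ (r + 1) * ?m x = (inverse (ell ?\<sigma> w) ^ (r + 1) * ell ?\<sigma> w ^ (r + 1)) * (b w x ^ (r + 1) * ?m x)"
      by (simp only: mult_1_left)
    then show "(b w ^ (r + 1) * ?m) x = (ell ?\<sigma> ^ (r + 1) * (inverse (ell ?\<sigma> w) ^ (r + 1) *\<^sub>R ?m)) x"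
      by (simp add: ex power_mult_distrib mult_ac del: power_Suc)
  qed
  finally have eq: "mon Y b \<alpha> = ell ?\<sigma> ^ (r + 1) * (inverse (ell ?\<sigma> w) ^ (r + 1) *\<^sub>R ?m)" .
  have "?m \<in> P (d - (r + 1))" by (rule bary_tet.mon_in_P[OF Y(2) bary_tet.mon_factor(2)[OF Y(2) w \<alpha>]])
  then have "inverse (ell ?\<sigma> w) ^ (r + 1) *\<^sub>R ?m \<in> P (d - (r + 1))" by (rule subspace_scale[OF subspace_pw])
  then show ?thesis unfolding Je_def eq using \<sigma> \<tau>(2) by (intro span_base) blast
qed

lemma mon_in_Ct:
  assumes "bary_tet Y b" "\<alpha> \<in> exps Y d" "S \<subseteq> Y" "N \<le> d" "\<And>\<gamma>. \<gamma> \<in> S \<Longrightarrow> \<alpha> \<gamma> + N \<le> d"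
  shows "mon Y b \<alpha> \<in> Ct N d S"
  unfolding Ct_def bary_tet.flat_space_eq[OF assms(1,3,4)]
  using assms(2,5) by (intro span_base imageI) (simp add: bary_tet.flat_def[OF assms(1)])

text \<open>It suffices to place one Bernstein monomial on one edge \<open>\<tau>\<close>. If an
  exponent off the edge exceeds \<open>r\<close>, it lies in the ideal of \<open>\<tau>\<close>.
  Otherwise it is put on a triangle at \<open>\<tau>\<close>; the signed sums then produce it on
  \<open>\<tau>\<close> and on the other interior edges of the triangle, where the large exponents
  at the ends of \<open>\<tau>\<close> place it in the ideals.\<close>

lemma dsum_EE_Ct_subset:
  assumes N: "3 * r + 2 \<le> N" "2 * N \<le> d"
  shows "dsum EE (Ct N d) \<subseteq> span ((\<lambda>q. res EE (\<psi> q)) ` dsum SS (Ct N d) \<union> dsum EE (\<lambda>\<tau>. Je r d \<tau> \<inter> Ct N d \<tau>))"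
    (is "_ \<subseteq> ?U")
proof (rule order_trans[OF dsum_subset_span_unit[OF finite_EE]], rule span_minimal[OF _ subspace_span], intro UN_least image_subsetI)
  fix \<tau> x assume \<tau>: "\<tau> \<in> EE" and x: "x \<in> Ct N d \<tau>"
  have sJC: "subspace (Je r d \<tau> \<inter> Ct N d \<tau>)" for \<tau>
    by (intro subspace_inter subspace_Ct) (simp add: Je_def)
  obtain Y where Y: "Y \<in> T4" "\<tau> \<subseteq> Y" using pure[OF EE_D(1)[OF \<tau>]] by blast
  obtain b where b: "bary_tet Y b" using tet_bary[OF Y(1)] by blast
  have Nd: "N \<le> d" using N by simp
  have "unit \<tau> (mon Y b \<alpha>) \<in> ?U" if \<alpha>: "\<alpha> \<in> bary_tet.flat Y d N \<tau>" for \<alpha>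
  proof -
    let ?x = "mon Y b \<alpha>"
    have \<alpha>e: "\<alpha> \<in> exps Y d" "\<And>\<gamma>. \<gamma> \<in> \<tau> \<Longrightarrow> \<alpha> \<gamma> + N \<le> d" using \<alpha> by (auto simp: bary_tet.flat_def[OF b])
    have xC: "?x \<in> Ct N d \<tau>" by (rule mon_in_Ct[OF b \<alpha>e(1) Y(2) Nd \<alpha>e(2)])
    show ?thesis
    proof (cases "\<exists>w\<in>Y - \<tau>. r + 1 \<le> \<alpha> w")
      case True
      then obtain w where w: "w \<in> Y" "w \<notin> \<tau>" "r + 1 \<le> \<alpha> w" by blast
      have "?x \<in> Je r d \<tau>" by (rule mon_in_Je[OF Y(1) b \<alpha>e(1) w(3,1) \<tau>]) (use w(2) Y(2) in blast)
      then have "unit \<tau> ?x \<in> dsum EE (\<lambda>\<tau>. Je r d \<tau> \<inter> Ct N d \<tau>)"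
        using xC by (intro unit_in_dsum[OF \<tau> _ sJC]) blast
      then show ?thesis by (intro span_base UnI2)
    next
      case False
      obtain v2 v3 where v23: "\<tau> = {v2, v3}" "v2 \<noteq> v3" using EE_D(2)[OF \<tau>] by (auto simp: card_2_iff)
      have "card (Y - \<tau>) = 2" using EE_D[OF \<tau>] T4_card[OF Y(1)] Y(2) by (simp add: card_Diff_subset)
      then obtain v0 v1 where v01: "Y - \<tau> = {v0, v1}" "v0 \<noteq> v1" by (auto simp: card_2_iff)
      have Yeq: "Y = {v0, v1, v2, v3}" using v01(1) v23(1) Y(2) by blast
      have dist: "distinct [v0, v1, v2, v3]" using v01 v23 by auto
      have small: "\<alpha> v0 \<le> r" "\<alpha> v1 \<le> r" using False v01(1) by (auto simp: not_less_eq_eq)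
      have "\<alpha> v0 + \<alpha> v1 + \<alpha> v2 + \<alpha> v3 = d" using \<alpha>e(1) dist by (simp add: exps_def Yeq)
      \<comment> \<open>The exponents off the edge are at most \<open>r\<close> and either end has
        at most \<open>d - N\<close>, so the other end has at least \<open>N - 2 * r\<close>, which
        exceeds \<open>r\<close>.\<close>
      then have big: "r + 1 \<le> \<alpha> v2" "r + 1 \<le> \<alpha> v3"
        using small \<alpha>e(2)[of v2] \<alpha>e(2)[of v3] v23(1) N by auto
      define \<sigma> where "\<sigma> = {v1, v2, v3}"
      have \<sigma>Y: "\<sigma> \<subseteq> Y" by (auto simp: \<sigma>_def Yeq)
      have \<sigma>K: "\<sigma> \<in> K" by (rule K_subset[OF T4_K[OF Y(1)] \<sigma>Y])
      have \<sigma>SS: "\<sigma> \<in> SS" by (rule EE_SS[OF \<tau> _ \<sigma>K]) (use dist in \<open>auto simp: \<sigma>_def v23(1)\<close>)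
      have xC\<sigma>: "?x \<in> Ct N d \<sigma>"
        by (rule mon_in_Ct[OF b \<alpha>e(1) \<sigma>Y Nd]) (use \<alpha>e(2) small N in \<open>auto simp: \<sigma>_def v23(1)\<close>)
      let ?q = "unit \<sigma> ?x"
      let ?R = "\<lambda>\<tau>'. if \<tau>' \<in> EE \<and> \<tau>' \<subseteq> \<sigma> \<and> \<tau>' \<noteq> \<tau> then eps \<tau>' \<sigma> *\<^sub>R ?x else 0"
      have \<psi>q: "\<psi> ?q \<tau>' = (if \<tau>' \<subseteq> \<sigma> then eps \<tau>' \<sigma> *\<^sub>R ?x else 0)" for \<tau>'
      proof -
        have "\<psi> ?q \<tau>' = (\<Sum>s\<in>{s \<in> SS. \<tau>' \<subseteq> s}. if s = \<sigma> then eps \<tau>' \<sigma> *\<^sub>R ?x else 0)"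
          unfolding \<psi>_def by (intro sum.cong) (auto simp: unit_def)
        then show ?thesis using finite_SS \<sigma>SS by simp
      qed
      have \<tau>\<sigma>: "\<tau> \<subseteq> \<sigma>" by (auto simp: \<sigma>_def v23(1))
      have split: "unit \<tau> (eps \<tau> \<sigma> *\<^sub>R ?x) = res EE (\<psi> ?q) - ?R"
      proof
        fix \<tau>'
        have "res EE (\<psi> ?q) \<tau>' = (if \<tau>' \<in> EE \<and> \<tau>' \<subseteq> \<sigma> then eps \<tau>' \<sigma> *\<^sub>R ?x else 0)"
          by (simp only: res_def \<psi>q) auto
        then show "unit \<tau> (eps \<tau> \<sigma> *\<^sub>R ?x) \<tau>' = (res EE (\<psi> ?q) - ?R) \<tau>'"
          using \<tau> \<tau>\<sigma> unfolding fun_diff_def by (simp only: unit_apply) auto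
      qed
      have "?q \<in> dsum SS (Ct N d)" by (rule unit_in_dsum[where V = "Ct N d", OF \<sigma>SS xC\<sigma> subspace_Ct])
      then have 1: "res EE (\<psi> ?q) \<in> ?U" by (intro span_base UnI1 imageI)
      have "?R \<in> dsum EE (\<lambda>\<tau>. Je r d \<tau> \<inter> Ct N d \<tau>)"
      proof -
        have xJC: "?x \<in> Je r d \<tau>' \<inter> Ct N d \<tau>'" if \<tau>': "\<tau>' \<in> EE" "\<tau>' \<subseteq> \<sigma>" "\<tau>' \<noteq> \<tau>" for \<tau>'
        proof
          show "?x \<in> Ct N d \<tau>'" using Ct_mono[OF \<tau>'(2)] xC\<sigma> by blast
          \<comment> \<open>An edge other than \<open>\<tau>\<close> misses an end of
            \<open>\<tau>\<close>, so it lies in the triangle of \<open>Y\<close> opposite to that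
            end.\<close>
          have "\<not> {v2, v3} \<subseteq> \<tau>'"
          proof
            assume "{v2, v3} \<subseteq> \<tau>'"
            then have "\<tau> = \<tau>'" using EE_D(2,3)[OF \<tau>'(1)] v23 by (intro card_subset_eq) auto
            then show False using \<tau>'(3) by simp
          qed
          then consider "v2 \<notin> \<tau>'" | "v3 \<notin> \<tau>'" by blast
          then show "?x \<in> Je r d \<tau>'"
          proof cases
            case 1
            show ?thesis by (rule mon_in_Je[OF Y(1) b \<alpha>e(1) big(1) _ \<tau>'(1)]) (use 1 \<tau>'(2) \<sigma>Y Yeq in auto)
          next
            case 2
            show ?thesis by (rule mon_in_Je[OF Y(1) b \<alpha>e(1) big(2) _ \<tau>'(1)]) (use 2 \<tau>'(2) \<sigma>Y Yeq in auto)
          qed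
        qed
        have R: "?R \<tau>' \<in> Je r d \<tau>' \<inter> Ct N d \<tau>'" for \<tau>'
        proof (cases "\<tau>' \<in> EE \<and> \<tau>' \<subseteq> \<sigma> \<and> \<tau>' \<noteq> \<tau>")
          case True
          show ?thesis unfolding if_P[OF True] by (rule subspace_scale[OF sJC]) (use xJC True in blast)
        next
          case False
          show ?thesis unfolding if_not_P[OF False] by (rule subspace_0[OF sJC])
        qed
        show ?thesis unfolding dsum_def
        proof (rule CollectI, intro conjI ballI allI impI)
          show "?R \<tau>' \<in> Je r d \<tau>' \<inter> Ct N d \<tau>'" for \<tau>' by (rule R)
          show "?R \<tau>' = 0" if "\<tau>' \<notin> EE" for \<tau>' using that by (simp only: if_False simp_thms)
        qed
      qed
      then have "?R \<in> ?U" by (intro span_base UnI2)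
      from subspace_diff[OF subspace_span 1 this] have 2: "unit \<tau> (eps \<tau> \<sigma> *\<^sub>R ?x) \<in> ?U" unfolding split .
      have "inverse (eps \<tau> \<sigma>) *\<^sub>R unit \<tau> (eps \<tau> \<sigma> *\<^sub>R ?x) \<in> ?U" by (rule subspace_scale[OF subspace_span 2])
      then show ?thesis
        by (simp only: linear_scale[OF linear_unit] scaleR_scaleR left_inverse[OF eps_nonzero[OF \<tau> \<sigma>SS \<tau>\<sigma>]] scaleR_one)
    qed
  qed
  then have "unit \<tau> ` mon Y b ` bary_tet.flat Y d N \<tau> \<subseteq> ?U" by blast
  then have "span (unit \<tau> ` mon Y b ` bary_tet.flat Y d N \<tau>) \<subseteq> ?U" by (rule span_minimal[OF _ subspace_span])
  moreover have "x \<in> span (mon Y b ` bary_tet.flat Y d N \<tau>)"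
    using x unfolding Ct_def bary_tet.flat_space_eq[OF b Y(2) Nd] .
  ultimately show "unit \<tau> x \<in> ?U" unfolding linear_span_image[OF linear_unit] by blast
qed

lemma dim_edge_defect:
  assumes \<tau>: "\<tau> \<in> EE" and d: "2 * N \<le> d" "r + 1 \<le> d"
  shows "dim (Je r d \<tau> \<inter> Ct N d \<tau>) + Gsum (ne \<tau>) r d N \<le> dim (Ct N d \<tau>)"
proof -
  obtain Y where Y: "Y \<in> T4" "\<tau> \<subseteq> Y" using pure[OF EE_D(1)[OF \<tau>]] by blast
  obtain b where b: "bary_tet Y b" using tet_bary[OF Y(1)] by blast
  obtain v2 v3 where v23: "\<tau> = {v2, v3}" "v2 \<noteq> v3" using EE_D(2)[OF \<tau>] by (auto simp: card_2_iff)
  have "card (Y - \<tau>) = 2" using EE_D[OF \<tau>] T4_card[OF Y(1)] Y(2) by (simp add: card_Diff_subset)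
  then obtain v0 v1 where v01: "Y - \<tau> = {v0, v1}" "v0 \<noteq> v1" by (auto simp: card_2_iff)
  have Yeq: "Y = {v0, v1, v2, v3}" using v01(1) v23(1) Y(2) by blast
  have dist: "distinct [v0, v1, v2, v3]" using v01 v23 by auto
  have l: "ell \<sigma> \<in> aff" "ell \<sigma> v2 = 0" "ell \<sigma> v3 = 0" if "\<sigma> \<in> {\<sigma> \<in> SS. \<tau> \<subseteq> \<sigma>}" for \<sigma>
    using that ell[OF SS_D(1,2), of \<sigma>] v23(1) by auto
  show ?thesis
    unfolding Gsum_def ne_def
    by (rule bary_tet.edge_dim[OF b Yeq dist _ l d refl])
      (use finite_SS in \<open>auto simp: Je_def Ct_def v23(1)\<close>)
qed

text \<open>On polynomial data the kernel consists of what vanishes to order \<open>N\<close> at the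
  vertices; the range is controlled by the spaces \<open>W\<close>.\<close>

definition comps :: "nat \<Rightarrow> nat \<Rightarrow> ((real^3) set \<Rightarrow> real^3 \<Rightarrow> real) \<Rightarrow> (real^3) \<times> nat \<Rightarrow> (real^3) set \<Rightarrow> real^3 \<Rightarrow> real" where
  "comps d N q = res ({g. {g} \<in> K} \<times> {..<N}) (\<lambda>(g, e). res (Sg g) (\<lambda>\<sigma>. comp d g e (q \<sigma>)))"

lemma linear_comps: "linear (comps d N)"
  by (rule linearI) (auto simp: comps_def res_def fun_eq_iff linear_add[OF linear_comp] linear_scale[OF linear_comp])

lemma finite_vertices: "finite {g. {g} \<in> K}"
proof -
  have "(\<lambda>g. {g}) ` {g. {g} \<in> K} \<subseteq> K" by blast
  then have "finite ((\<lambda>g. {g}) ` {g. {g} \<in> K})" using finite_K by (rule finite_subset)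
  then show ?thesis by (rule finite_imageD) simp
qed

text \<open>Rank-nullity for \<open>comps\<close>: its range lies in the sum of the spaces
  \<open>W\<close>, and on its kernel the edge conditions are independent by
  \<open>dsum_EE_Ct_subset\<close>, so each edge costs at least its \<open>Gsum\<close>. The
  additive form avoids subtraction of natural numbers.\<close>

lemma dim_compatible_le:
  assumes d: "2 * N \<le> d" "3 * r + 2 \<le> N"
  shows "dim {q \<in> dsum SS (\<lambda>_. P d). res EE (\<psi> q) \<in> dsum EE (Je r d)
      \<and> comps d N q \<in> dsum ({g. {g} \<in> K} \<times> {..<N}) (\<lambda>(g, e). W nml r e g)}
    + (\<Sum>\<tau>\<in>EE. Gsum (ne \<tau>) r d N) + card SS * (3 * ((N + 2) choose 3))
    \<le> card SS * ((d + 3) choose 3) + (\<Sum>g\<in>{g. {g} \<in> K}. \<Sum>e<N. dim (W nml r e g))"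
    (is "dim ?Z + ?G + _ \<le> _")
proof -
  let ?\<psi> = "\<lambda>q. res EE (\<psi> q :: (real^3) set \<Rightarrow> real^3 \<Rightarrow> real)"
  let ?B = "dsum SS (\<lambda>_. P d)" and ?I = "{g. {g} \<in> K} \<times> {..<N}"
  let ?WW = "dsum ?I (\<lambda>(g, e). W nml r e g)"
  let ?JC = "dsum EE (\<lambda>\<tau>. Je r d \<tau> \<inter> Ct N d \<tau>)" and ?B' = "dsum SS (Ct N d)"
  have lin: "linear ?\<psi>" using linear_compose[OF linear_\<psi> linear_res] by (simp add: o_def)
  have sJe: "subspace (Je r d \<tau>)" for \<tau> by (simp add: Je_def)
  have sW: "subspace (case k of (g, e) \<Rightarrow> W nml r e g)" for k by (cases k) (simp add: W_def)
  have fW: "fin_dim (case k of (g, e) \<Rightarrow> W nml r e g)" for k by (cases k) (simp add: fin_dim_W)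
  have finI: "finite ?I" using finite_vertices by simp
  have fB: "fin_dim ?B" by (intro fin_dim_dsum finite_SS fin_dim_P)
  have sWW: "subspace ?WW" by (intro subspace_dsum sW)
  have fWW: "fin_dim ?WW" by (intro fin_dim_dsum finI fW)
  have "subspace (?B \<inter> (?\<psi> -` dsum EE (Je r d) \<inter> comps d N -` ?WW))"
    by (intro subspace_inter linear_subspace_vimage lin linear_comps subspace_dsum subspace_pw sJe sW)
  moreover have "?B \<inter> (?\<psi> -` dsum EE (Je r d) \<inter> comps d N -` ?WW) = ?Z" by auto
  ultimately have sZ: "subspace ?Z" by (simp only:)
  have fZ: "fin_dim ?Z" by (rule fin_dim_mono[OF fB]) auto
  have 1: "dim ?Z = dim {q \<in> ?Z. comps d N q = 0} + dim (comps d N ` ?Z)"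
    by (rule dim_kernel_image[OF linear_comps sZ fZ])
  have 2: "dim (comps d N ` ?Z) \<le> dim ?WW"
    by (rule dim_mono'[OF fWW]) auto
  have 3: "dim ?WW = (\<Sum>g\<in>{g. {g} \<in> K}. \<Sum>e<N. dim (W nml r e g))"
    unfolding dim_dsum[OF finI sW fW] sum.cartesian_product by (intro sum.cong) auto
  have kerCt: "q \<sigma> \<in> Ct N d \<sigma>" if q: "q \<in> ?B" "comps d N q = 0" and \<sigma>: "\<sigma> \<in> SS" for q \<sigma>
  proof -
    have "comp d g e (q \<sigma>) = 0" if g: "g \<in> \<sigma>" and e: "e < N" for g e
    proof -
      have "{g} \<in> K" by (rule K_subset[OF SS_D(1)[OF \<sigma>]]) (use g in blast)
      moreover have "comps d N q (g, e) \<sigma> = 0" using q(2) by simp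
      ultimately show ?thesis using \<sigma> g e by (simp add: comps_def res_def Sg_def)
    qed
    then show ?thesis using q(1) \<sigma> by (simp add: Ct_def dsum_def)
  qed
  have sJC: "subspace (Je r d \<tau> \<inter> Ct N d \<tau>)" for \<tau> by (intro subspace_inter subspace_Ct sJe)
  have fJC: "fin_dim (Je r d \<tau> \<inter> Ct N d \<tau>)" for \<tau> by (rule fin_dim_mono[OF fin_dim_Ct]) blast
  have "dim {q \<in> ?Z. comps d N q = 0} \<le> dim {q \<in> ?B'. ?\<psi> q \<in> ?JC}"
  proof (rule dim_mono')
    show "fin_dim {q \<in> ?B'. ?\<psi> q \<in> ?JC}"
      by (rule fin_dim_mono[OF fin_dim_dsum[OF finite_SS fin_dim_Ct[of N d]]]) auto
    show "{q \<in> ?Z. comps d N q = 0} \<subseteq> {q \<in> ?B'. ?\<psi> q \<in> ?JC}"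
    proof
      fix q assume "q \<in> {q \<in> ?Z. comps d N q = 0}"
      then have q: "q \<in> ?B" "comps d N q = 0" "?\<psi> q \<in> dsum EE (Je r d)" by blast+
      have "\<psi> q \<tau> \<in> Ct N d \<tau>" for \<tau>
        unfolding \<psi>_def
      proof (intro subspace_sum subspace_scale subspace_Ct)
        fix \<sigma> assume \<sigma>: "\<sigma> \<in> {\<sigma> \<in> SS. \<tau> \<subseteq> \<sigma>}"
        then show "q \<sigma> \<in> Ct N d \<tau>" using kerCt[OF q(1,2), of \<sigma>] Ct_mono[of \<tau> \<sigma> N d] by blast
      qed
      then have "?\<psi> q \<in> ?JC" using q(3) by (simp add: dsum_def res_def)
      moreover have "q \<in> ?B'" using kerCt[OF q(1,2)] q(1) by (simp add: dsum_def)
      ultimately show "q \<in> {q \<in> ?B'. ?\<psi> q \<in> ?JC}" by blast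
    qed
  qed
  moreover have "dim {q \<in> ?B'. ?\<psi> q \<in> ?JC} + dim (span (?\<psi> ` ?B' \<union> ?JC)) = dim ?B' + dim ?JC"
    by (intro dim_vimage lin subspace_dsum fin_dim_dsum finite_SS finite_EE sJC fJC subspace_Ct fin_dim_Ct)
  moreover have "dim (dsum EE (Ct N d)) \<le> dim (span (?\<psi> ` ?B' \<union> ?JC))"
    by (intro dim_mono' fin_dim_span fin_dim_Un fin_dim_image lin fin_dim_dsum finite_SS finite_EE fJC fin_dim_Ct
        dsum_EE_Ct_subset d)
  moreover have "dim (dsum EE (Ct N d)) = (\<Sum>\<tau>\<in>EE. dim (Ct N d \<tau>))"
    by (intro dim_dsum finite_EE subspace_Ct fin_dim_Ct)
  moreover have "dim ?JC = (\<Sum>\<tau>\<in>EE. dim (Je r d \<tau> \<inter> Ct N d \<tau>))"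
    by (intro dim_dsum finite_EE sJC fJC)
  moreover have "(\<Sum>\<tau>\<in>EE. dim (Je r d \<tau> \<inter> Ct N d \<tau>)) + ?G \<le> (\<Sum>\<tau>\<in>EE. dim (Ct N d \<tau>))"
    unfolding sum.distrib[symmetric] by (rule sum_mono, rule dim_edge_defect) (use d in auto)
  moreover have "dim ?B' + card SS * (3 * ((N + 2) choose 3)) = card SS * ((d + 3) choose 3)"
  proof -
    have "dim ?B' = (\<Sum>\<sigma>\<in>SS. dim (Ct N d \<sigma>))"
      by (intro dim_dsum finite_SS subspace_Ct fin_dim_Ct)
    moreover have "(\<Sum>\<sigma>\<in>SS. dim (Ct N d \<sigma>)) + (\<Sum>\<sigma>\<in>SS. 3 * ((N + 2) choose 3)) = (\<Sum>\<sigma>\<in>SS. (d + 3) choose 3)"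
      unfolding sum.distrib[symmetric] by (intro sum.cong refl) (use dim_Ct[OF SS_D(1) d(1)] SS_D(2) in fastforce)
    ultimately show ?thesis by simp
  qed
  ultimately show ?thesis using 1 2 3 by linarith
qed

lemma gluing_data_compatible:
  assumes d: "N \<le> d" "r + 1 \<le> d"
  shows "span ((\<lambda>p. res SS (\<delta> p)) ` dsum T4 (\<lambda>_. P d) \<union> dsum SS (J r d))
    \<subseteq> {q \<in> dsum SS (\<lambda>_. P d). res EE (\<psi> q) \<in> dsum EE (Je r d)
      \<and> comps d N q \<in> dsum ({g. {g} \<in> K} \<times> {..<N}) (\<lambda>(g, e). W nml r e g)}" (is "_ \<subseteq> ?Z")
proof (rule span_minimal)
  let ?\<psi> = "\<lambda>q. res EE (\<psi> q :: (real^3) set \<Rightarrow> real^3 \<Rightarrow> real)"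
  let ?B = "dsum SS (\<lambda>_. P d)" and ?I = "{g. {g} \<in> K} \<times> {..<N}"
  let ?WW = "dsum ?I (\<lambda>(g, e). W nml r e g)"
  have lin: "linear ?\<psi>" using linear_compose[OF linear_\<psi> linear_res] by (simp add: o_def)
  have sJe: "subspace (Je r d \<tau>)" for \<tau> by (simp add: Je_def)
  have sW: "subspace (case k of (g, e) \<Rightarrow> W nml r e g)" for k by (cases k) (simp add: W_def)
  have "subspace (?B \<inter> (?\<psi> -` dsum EE (Je r d) \<inter> comps d N -` ?WW))"
    by (intro subspace_inter linear_subspace_vimage lin linear_comps subspace_dsum subspace_pw sJe sW)
  moreover have "?B \<inter> (?\<psi> -` dsum EE (Je r d) \<inter> comps d N -` ?WW) = ?Z" by auto
  ultimately show "subspace ?Z" by (simp only:)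
  have compsI: "comps d N q \<in> ?WW" if "\<And>g e. {g} \<in> K \<Longrightarrow> e < N \<Longrightarrow> res (Sg g) (\<lambda>\<sigma>. comp d g e (q \<sigma>)) \<in> W nml r e g" for q
    using that by (auto simp: comps_def dsum_def res_def)
  have "(\<lambda>p. res SS (\<delta> p)) ` dsum T4 (\<lambda>_. P d) \<subseteq> ?Z"
  proof (rule image_subsetI)
    fix p :: "(real^3) set \<Rightarrow> real^3 \<Rightarrow> real" assume p: "p \<in> dsum T4 (\<lambda>_. P d)"
    let ?q = "res SS (\<delta> p)"
    have "\<delta> p \<sigma> \<in> P d" for \<sigma>
      unfolding \<delta>_def using p by (intro subspace_sum subspace_scale subspace_pw) (auto simp: dsum_def)
    then have "?q \<in> ?B" by (simp add: dsum_def res_def)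
    moreover have "\<psi> ?q \<tau> = 0" if "\<tau> \<in> EE" for \<tau>
      by (rule \<psi>_\<delta>[OF that]) (simp add: res_def)
    then have "?\<psi> ?q \<in> dsum EE (Je r d)" using subspace_0[OF sJe] by (simp add: res_def dsum_def)
    moreover have "comps d N ?q \<in> ?WW"
    proof (rule compsI)
      fix g e assume g: "{g} \<in> K" and e: "e < N"
      let ?p = "res (Stf g) (\<lambda>Y. comp d g e (p Y))"
      have "res (Sg g) (\<lambda>\<sigma>. comp d g e (?q \<sigma>)) = \<delta>g g ?p"
      proof
        fix \<sigma>
        show "res (Sg g) (\<lambda>\<sigma>. comp d g e (?q \<sigma>)) \<sigma> = \<delta>g g ?p \<sigma>"
        proof (cases "\<sigma> \<in> Sg g")
          case True
          then have \<sigma>: "\<sigma> \<in> SS" "g \<in> \<sigma>" by (auto simp: Sg_def)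
          have "comp d g e (\<delta> p \<sigma>) = (\<Sum>Y\<in>{Y \<in> T4. \<sigma> \<subseteq> Y}. sg \<sigma> Y *\<^sub>R comp d g e (p Y))"
            unfolding \<delta>_def by (simp only: linear_sum[OF linear_comp] linear_scale[OF linear_comp])
          also have "\<dots> = \<delta> ?p \<sigma>"
            unfolding \<delta>_def by (rule sum.cong[OF refl]) (use \<sigma>(2) in \<open>auto simp: res_def Stf_def\<close>)
          finally show ?thesis using True \<sigma>(1) by (simp add: \<delta>g_def res_def)
        qed (simp add: \<delta>g_def res_def)
      qed
      moreover have "?p \<in> dsum (Stf g) (\<lambda>_. H e)"
      proof -
        have "comp d g e (p Y) \<in> H e" if "Y \<in> Stf g" for Y
          by (rule comp_in_H) (use that p e d in \<open>auto simp: Stf_def dsum_def\<close>)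
        then show ?thesis by (simp add: dsum_def res_def)
      qed
      then have "\<delta>g g ?p \<in> W nml r e g" unfolding W_def by (intro span_base UnI1 imageI)
      ultimately show "res (Sg g) (\<lambda>\<sigma>. comp d g e (?q \<sigma>)) \<in> W nml r e g" by (simp only:)
    qed
    ultimately show "?q \<in> ?Z" by blast
  qed
  moreover have "dsum SS (J r d) \<subseteq> ?Z"
  proof
    fix q assume q: "q \<in> dsum SS (J r d)"
    have qJ: "\<exists>m\<in>P (d - (r + 1)). q \<sigma> = ell \<sigma> ^ (r + 1) * m" if "\<sigma> \<in> SS" for \<sigma>
      using q that by (auto simp: dsum_def J_def)
    have "q \<sigma> \<in> P d" if \<sigma>: "\<sigma> \<in> SS" for \<sigma>
    proof -
      obtain m where m: "m \<in> P (d - (r + 1))" "q \<sigma> = ell \<sigma> ^ (r + 1) * m" using qJ[OF \<sigma>] by blast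
      have "ell \<sigma> ^ (r + 1) * m \<in> P ((r + 1) + (d - (r + 1)))"
        by (rule pw_mult[OF pw_power1[OF ell(1)[OF SS_D(1,2)[OF \<sigma>]]] m(1)])
      then show ?thesis unfolding m(2) using d(2) by simp
    qed
    then have "q \<in> ?B" using q by (simp add: dsum_def)
    moreover have "\<psi> q \<tau> \<in> Je r d \<tau>" if "\<tau> \<in> EE" for \<tau>
      unfolding \<psi>_def
    proof (intro subspace_sum subspace_scale sJe)
      fix \<sigma> assume \<sigma>: "\<sigma> \<in> {\<sigma> \<in> SS. \<tau> \<subseteq> \<sigma>}"
      then obtain m where m: "m \<in> P (d - (r + 1))" "q \<sigma> = ell \<sigma> ^ (r + 1) * m" using qJ by blast
      then show "q \<sigma> \<in> Je r d \<tau>" unfolding Je_def using \<sigma> by (intro span_base) blast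
    qed
    then have "?\<psi> q \<in> dsum EE (Je r d)" by (simp add: res_def dsum_def)
    moreover have "comps d N q \<in> ?WW"
    proof (rule compsI)
      fix g e assume g: "{g} \<in> K" and e: "e < N"
      have "comp d g e (q \<sigma>) \<in> Jh nml r e \<sigma>" if "\<sigma> \<in> Sg g" for \<sigma>
      proof -
        have \<sigma>: "\<sigma> \<in> SS" "g \<in> \<sigma>" using that by (auto simp: Sg_def)
        obtain m where m: "m \<in> P (d - (r + 1))" "q \<sigma> = ell \<sigma> ^ (r + 1) * m" using qJ[OF \<sigma>(1)] by blast
        have c: "comp d g e (q \<sigma>) = (if e < r + 1 then 0 else nml \<sigma> ^ (r + 1) * comp (d - (r + 1)) g (e - (r + 1)) m)"
          unfolding m(2) by (rule comp_power_mult[OF ell(1)[OF SS_D(1,2)[OF \<sigma>(1)]] ell(3)[OF SS_D(1,2)[OF \<sigma>(1)] \<sigma>(2)] m(1)])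
            (use d e in auto)
        have "comp (d - (r + 1)) g (e - (r + 1)) m \<in> H (e - (r + 1))"
          by (rule comp_in_H[OF m(1)]) (use d e in auto)
        then show ?thesis unfolding c Jh_def by (cases "r + 1 \<le> e") (simp_all only: if_True if_False not_le[symmetric] simp_thms imageI singletonI)
      qed
      then have "res (Sg g) (\<lambda>\<sigma>. comp d g e (q \<sigma>)) \<in> dsum (Sg g) (Jh nml r e)" by (simp add: dsum_def res_def)
      then show "res (Sg g) (\<lambda>\<sigma>. comp d g e (q \<sigma>)) \<in> W nml r e g" unfolding W_def by (intro span_base UnI2)
    qed
    ultimately show "q \<in> ?Z" by blast
  qed
  ultimately show "(\<lambda>p. res SS (\<delta> p)) ` dsum T4 (\<lambda>_. P d) \<union> dsum SS (J r d) \<subseteq> ?Z" by (rule Un_least)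
qed

lemma dim_P': "dim (P d) = (d + 3) choose 3"
  using K_nonempty tet_bary bary_tet.dim_P by blast

lemma spline_dim_ge:
  assumes d: "2 * N \<le> d" "3 * r + 2 \<le> N"
  shows "card T4 * ((d + 3) choose 3) + card SS * ((d - (r + 1) + 3) choose 3)
      + (\<Sum>\<tau>\<in>EE. Gsum (ne \<tau>) r d N) + card SS * (3 * ((N + 2) choose 3))
    \<le> spline_dim r d \<Delta> + card SS * ((d + 3) choose 3) + (\<Sum>g\<in>{g. {g} \<in> K}. \<Sum>e<N. dim (W nml r e g))"
proof -
  let ?A = "dsum T4 (\<lambda>_. P d)" and ?f = "\<lambda>p. res SS (\<delta> p :: (real^3) set \<Rightarrow> real^3 \<Rightarrow> real)"
  have lin: "linear ?f" using linear_compose[OF linear_\<delta> linear_res] by (simp add: o_def)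
  have S: "Salg r d = {p \<in> ?A. ?f p \<in> dsum SS (J r d)}" by (simp only: Salg_eq res_def)
  have "dim (Salg r d) + dim (span (?f ` ?A \<union> dsum SS (J r d))) = dim ?A + dim (dsum SS (J r d))"
    unfolding S by (intro dim_vimage lin subspace_dsum subspace_pw fin_dim_dsum finite_T4 finite_SS fin_dim_P subspace_J fin_dim_J)
  moreover have "dim ?A = card T4 * ((d + 3) choose 3)"
    by (simp add: dim_dsum[OF finite_T4 subspace_pw fin_dim_P] dim_P')
  moreover have "dim (dsum SS (J r d)) = card SS * ((d - (r + 1) + 3) choose 3)"
    unfolding dim_dsum[OF finite_SS subspace_J fin_dim_J] by (simp only: dim_J sum_constant cong: sum.cong) simp
  moreover have "dim (span (?f ` ?A \<union> dsum SS (J r d))) \<le> dim {q \<in> dsum SS (\<lambda>_. P d). res EE (\<psi> q) \<in> dsum EE (Je r d)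
      \<and> comps d N q \<in> dsum ({g. {g} \<in> K} \<times> {..<N}) (\<lambda>(g, e). W nml r e g)}"
    by (rule dim_mono'[OF fin_dim_mono[OF fin_dim_dsum[OF finite_SS fin_dim_P[of d]]] gluing_data_compatible]) (use d in auto)
  ultimately show ?thesis using dim_compatible_le[OF d] dim_Salg_le[of r d] by linarith
qed

end

subsection \<open>Evaluation of the bound\<close>

lemma bin_1: "bin n 1 = max 0 n" by (simp add: bin_def)

text \<open>The rule survives the convention for negative \<open>n\<close>: at \<open>n = -1\<close>
  the left side is \<open>bin 0 (Suc k)\<close>, which is 0 because the lower index is
  positive.\<close>

lemma bin_pascal: "bin (n + 1) (Suc k) = bin n (Suc k) + bin n k"
proof (cases "n < 0")
  case True then show ?thesis by (simp add: bin_def)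
next
  case False
  then obtain m where m: "n = int m" by (metis nat_0_le not_less)
  have bm: "bin (int j) i = int (j choose i)" for j i by (simp add: bin_def binomial_eq_0)
  have "bin (n + 1) (Suc k) = int (Suc m choose Suc k)" using bm[of "Suc m" "Suc k"] by (simp add: m add.commute)
  then show ?thesis by (simp add: m bm)
qed

lemma bin_of_nat: "bin (int n) k = int (n choose k)" by (simp add: bin_def binomial_eq_0)

text \<open>The hockey-stick identity; \<open>0 \<le> s\<close> ensures that no nonzero term is cut
  off below \<open>i = 0\<close>.\<close>

lemma sum_bin:
  assumes "0 \<le> s"
  shows "(\<Sum>i\<le>e. bin (int i + int k - s) k) = bin (int e + int k + 1 - s) (Suc k)"
proof (induction e)
  case 0
  have "bin (int k - s) (Suc k) = 0" using assms by (simp add: bin_def)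
  then show ?case using bin_pascal[of "int k - s" k] by (simp add: algebra_simps)
next
  case (Suc e)
  then show ?case using bin_pascal[of "int e + int k + 1 - s" k] by (simp add: algebra_simps)
qed

lemma sum_Un_le_nat:
  fixes f :: "_ \<Rightarrow> nat" assumes "finite A" "finite B"
  shows "sum f (A \<union> B) \<le> sum f A + sum f B"
  using sum.union_inter[OF assms, of f] by linarith

text \<open>Put T = r + 1, m = t - 1 and k = i - r. Then q = T + p with p = T div m, and a = T mod
  m, b = m - a. For 1 \<le> k \<le> p the value is T - m k; beyond p it is 0, and there the terms
  with \<open>a\<close> and \<open>b\<close> compensate the negative T - m k.\<close>

lemma gdim_formula:
  fixes n r i :: nat
  assumes n: "2 \<le> n"
    and t: "t = min (int n) (int r + 2)" and q: "q = (t * (int r + 1)) div (t - 1)"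
    and a: "a = t * (int r + 1) - (t - 1) * q" and b: "b = t - 1 - a"
  shows "int r + 1 \<le> q"
    and "int (gdim n r i) = (int i + 1) - t * max 0 (int i - int r) + a * max 0 (int i - q) + b * max 0 (int i + 1 - q)"
proof -
  define m T p k where "m = t - 1" and "T = int r + 1" and "p = T div m" and "k = int i - int r"
  have m1: "1 \<le> m" using n by (simp add: m_def t)
  have tT: "t * T = T + T * m" by (simp add: m_def algebra_simps)
  have qp: "q = T + p" unfolding q T_def[symmetric] m_def[symmetric] tT p_def using m1 by simp
  have p0: "0 \<le> p" unfolding p_def T_def using m1 by (simp add: pos_imp_zdiv_nonneg_iff)
  show "int r + 1 \<le> q" using qp p0 by (simp add: T_def)
  have aT: "a = T - m * p" unfolding a T_def[symmetric] m_def[symmetric] tT qp by (simp add: algebra_simps)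
  have "a = T mod m" unfolding aT p_def by (simp add: minus_mult_div_eq_mod)
  then have a0: "0 \<le> a" "a < m" using m1 by simp_all
  have bm: "b = m - a" by (simp add: b m_def)
  have ik: "int i = k + T - 1" by (simp add: k_def T_def)
  show "int (gdim n r i) = (int i + 1) - t * max 0 (int i - int r) + a * max 0 (int i - q) + b * max 0 (int i + 1 - q)"
  proof (cases "k \<le> 0")
    case True
    then have "i - r = 0" "int i - int r \<le> 0" "int i - q \<le> 0" "int i + 1 - q \<le> 0"
      using p0 by (auto simp: k_def qp T_def)
    then show ?thesis by (simp add: gdim_def)
  next
    case False
    then have k1: "1 \<le> k" by simp
    have kn: "int (i - r) = k" using False by (simp add: k_def)
    have g: "int (gdim n r i) = max 0 (int i + 1 - int n * k)"
    proof -
      have "int (n * (i - r)) = int n * k" by (simp only: of_nat_mult kn)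
      then show ?thesis unfolding gdim_def by linarith
    qed
    have rk: "max 0 (int i - int r) = k" using False by (simp add: k_def)
    show ?thesis
    proof (cases "k \<le> p")
      case True
      have mk: "m * k \<le> m * p" using True m1 by (intro mult_left_mono) auto
      have z: "max 0 (int i - q) = 0" "max 0 (int i + 1 - q) = 0" using True by (auto simp: ik qp)
      have "max 0 (int i + 1 - int n * k) = T - m * k"
      proof (cases "t = int n")
        case True
        then have "int i + 1 - int n * k = T - m * k" by (simp add: ik m_def algebra_simps)
        moreover have "0 \<le> T - m * k" using mk aT a0 by linarith
        ultimately show ?thesis by (simp only: max_absorb2)
      next
        \<comment> \<open>If the cap \<open>r + 2\<close> in \<open>t\<close> is below
          \<open>n\<close>, then m = T and p = 1, so only k = 1 occurs and both sides are 0.\<close>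
        case False
        then have tn: "t = int r + 2" "int r + 2 < int n" using t by (auto simp: min_def split: if_splits)
        have mT: "m = T" by (simp add: m_def T_def tn)
        then have "p = 1" using m1 by (simp add: p_def)
        then have k: "k = 1" using k1 True by simp
        show ?thesis using tn by (simp add: k mT ik T_def)
      qed
      then show ?thesis unfolding g rk z by (simp add: ik m_def algebra_simps)
    next
      case False
      then have kp: "p + 1 \<le> k" by simp
      have "m * (p + 1) \<le> m * k" using kp m1 by (intro mult_left_mono) auto
      then have "T < m * k" using aT a0 by (simp add: algebra_simps)
      moreover have "t * k \<le> int n * k" using k1 by (intro mult_right_mono) (auto simp: t)
      ultimately have "int i + 1 - int n * k \<le> 0" by (simp add: ik m_def algebra_simps)
      then have "int (gdim n r i) = 0" unfolding g by simp
      moreover have z: "max 0 (int i - q) = k - 1 - p" "max 0 (int i + 1 - q) = k - p" using kp by (auto simp: ik qp)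
      have "(int i + 1) - t * k + a * (k - 1 - p) + b * (k - p) = 0"
        unfolding bm using aT by (simp add: ik m_def algebra_simps)
      ultimately show ?thesis unfolding rk z by simp
    qed
  qed
qed

lemma sum_gdim_formula:
  fixes n r e :: nat
  assumes n: "2 \<le> n"
    and t: "t = min (int n) (int r + 2)" and q: "q = (t * (int r + 1)) div (t - 1)"
    and a: "a = t * (int r + 1) - (t - 1) * q" and b: "b = t - 1 - a"
  shows "int (\<Sum>i\<le>e. gdim n r i) = bin (int e + 2) 2 - t * bin (int e + 1 - int r) 2
      + a * bin (int e + 1 - q) 2 + b * bin (int e + 2 - q) 2"
    and "int (\<Sum>e\<le>d. \<Sum>i\<le>e. gdim n r i) = bin (int d + 3) 3 - t * bin (int d + 2 - int r) 3
      + a * bin (int d + 2 - q) 3 + b * bin (int d + 3 - q) 3"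
proof -
  have q0: "0 \<le> q" using gdim_formula(1)[OF assms] by simp
  have nn: "(0::int) \<le> 0" "0 \<le> int r + 1" "0 \<le> q + 1" using q0 by simp_all
  note sb = sum_bin[OF nn(1)] sum_bin[OF nn(2)] sum_bin[OF nn(3)] sum_bin[OF q0]
  have 1: "int (gdim n r i) = bin (int i + int 1 - 0) 1 - t * bin (int i + int 1 - (int r + 1)) 1
      + a * bin (int i + int 1 - (q + 1)) 1 + b * bin (int i + int 1 - q) 1" for i
    unfolding gdim_formula(2)[OF assms, of i] bin_1 by simp
  have 2: "int (\<Sum>i\<le>e. gdim n r i) = bin (int e + int 2 - 0) 2 - t * bin (int e + int 2 - (int r + 1)) 2
      + a * bin (int e + int 2 - (q + 1)) 2 + b * bin (int e + int 2 - q) 2" for e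
  proof -
    have "int (\<Sum>i\<le>e. gdim n r i) = (\<Sum>i\<le>e. bin (int i + int 1 - 0) 1) - t * (\<Sum>i\<le>e. bin (int i + int 1 - (int r + 1)) 1)
        + a * (\<Sum>i\<le>e. bin (int i + int 1 - (q + 1)) 1) + b * (\<Sum>i\<le>e. bin (int i + int 1 - q) 1)"
      unfolding of_nat_sum 1 by (simp only: sum.distrib sum_subtractf sum_distrib_left)
    moreover have "int e + int 1 + 1 = int e + int 2" "Suc 1 = 2" by simp_all
    ultimately show ?thesis unfolding sb by (simp only:)
  qed
  show "int (\<Sum>i\<le>e. gdim n r i) = bin (int e + 2) 2 - t * bin (int e + 1 - int r) 2
      + a * bin (int e + 1 - q) 2 + b * bin (int e + 2 - q) 2"
    unfolding 2 by (simp add: algebra_simps)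
  have "int (\<Sum>e\<le>d. \<Sum>i\<le>e. gdim n r i) = (\<Sum>e\<le>d. bin (int e + int 2 - 0) 2) - t * (\<Sum>e\<le>d. bin (int e + int 2 - (int r + 1)) 2)
      + a * (\<Sum>e\<le>d. bin (int e + int 2 - (q + 1)) 2) + b * (\<Sum>e\<le>d. bin (int e + int 2 - q) 2)"
    unfolding of_nat_sum[of "\<lambda>e. \<Sum>i\<le>e. gdim n r i"] 2 by (simp only: sum.distrib sum_subtractf sum_distrib_left)
  moreover have "int d + int 2 + 1 - 0 = int d + 3" "int d + int 2 + 1 - (int r + 1) = int d + 2 - int r"
    "int d + int 2 + 1 - (q + 1) = int d + 2 - q" "int d + int 2 + 1 - q = int d + 3 - q" "Suc 2 = 3" by simp_all
  ultimately show "int (\<Sum>e\<le>d. \<Sum>i\<le>e. gdim n r i) = bin (int d + 3) 3 - t * bin (int d + 2 - int r) 3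
      + a * bin (int d + 2 - q) 3 + b * bin (int d + 3 - q) 3"
    unfolding sb by (simp only:)
qed

context tet_part
begin

text \<open>The pairs with \<open>c + e \<le> d\<close> that are missing from \<open>Gsum\<close>
  lie in two strips next to the ends of the edge, and each strip sums to the part accounted for at
  that vertex.\<close>

lemma Gsum_ge:
  "(\<Sum>e\<le>d. \<Sum>i\<le>e. gdim n r i) \<le> Gsum n r d N + 2 * (\<Sum>e<N. \<Sum>i\<le>e. gdim n r i)" if N: "N \<le> d"
proof -
  let ?g = "\<lambda>(c, e). gdim n r (d - c - e)"
  let ?T = "{(c, e). c + e \<le> d}"
  let ?G = "{(c, e). c + N \<le> d \<and> e + N \<le> d \<and> c + e \<le> d}"
  let ?A = "{(c, e). d < c + N \<and> c + e \<le> d}" and ?B = "{(c, e). d < e + N \<and> c + e \<le> d}"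
  have T: "?T = (SIGMA c:{..d}. {..d - c})" by auto
  have fin: "finite ?T" unfolding T by simp
  have fins: "finite ?G" "finite ?A" "finite ?B" by (rule finite_subset[OF _ fin], blast)+
  have col: "(\<Sum>e\<le>d - c. gdim n r (d - c - e)) = (\<Sum>i\<le>d - c. gdim n r i)" for c
    by (rule sum.reindex_bij_witness[of _ "\<lambda>i. d - c - i" "\<lambda>e. d - c - e"]) auto
  have "(\<Sum>x\<in>?T. ?g x) = (\<Sum>c\<le>d. \<Sum>e\<le>d - c. gdim n r (d - c - e))"
    unfolding T by (simp add: sum.Sigma)
  also have "\<dots> = (\<Sum>c\<le>d. \<Sum>i\<le>d - c. gdim n r i)" by (simp only: col)
  also have "\<dots> = (\<Sum>e\<le>d. \<Sum>i\<le>e. gdim n r i)"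
    by (rule sum.reindex_bij_witness[of _ "\<lambda>e. d - e" "\<lambda>c. d - c"]) auto
  finally have 1: "(\<Sum>x\<in>?T. ?g x) = (\<Sum>e\<le>d. \<Sum>i\<le>e. gdim n r i)" .
  have A: "?A = (SIGMA c:{d - N<..d}. {..d - c})" using N by auto
  have 2: "(\<Sum>x\<in>?A. ?g x) = (\<Sum>e<N. \<Sum>i\<le>e. gdim n r i)"
  proof -
    have "(\<Sum>x\<in>?A. ?g x) = (\<Sum>c\<in>{d - N<..d}. \<Sum>i\<le>d - c. gdim n r i)"
      unfolding A by (simp add: sum.Sigma[symmetric]) (simp only: col[unfolded diff_diff_left])
    also have "\<dots> = (\<Sum>e<N. \<Sum>i\<le>e. gdim n r i)"
      by (rule sum.reindex_bij_witness[of _ "\<lambda>e. d - e" "\<lambda>c. d - c"]) (use N in auto)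
    finally show ?thesis .
  qed
  have 3: "(\<Sum>x\<in>?B. ?g x) = (\<Sum>x\<in>?A. ?g x)"
    by (rule sum.reindex_bij_witness[of _ prod.swap prod.swap]) (auto simp: diff_commute add.commute)
  have "(\<Sum>x\<in>?T. ?g x) \<le> (\<Sum>x\<in>?G \<union> (?A \<union> ?B). ?g x)"
    by (rule sum_mono2) (use fins in auto)
  also have "\<dots> \<le> (\<Sum>x\<in>?G. ?g x) + (\<Sum>x\<in>?A \<union> ?B. ?g x)"
    by (rule sum_Un_le_nat) (use fins in auto)
  also have "(\<Sum>x\<in>?A \<union> ?B. ?g x) \<le> (\<Sum>x\<in>?A. ?g x) + (\<Sum>x\<in>?B. ?g x)"
    by (rule sum_Un_le_nat) (use fins in auto)
  finally show ?thesis unfolding 1 2 3 Gsum_def by simp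
qed

lemma ne_eq:
  assumes "\<tau> \<in> EE"
  shows "ne \<tau> = card {\<sigma> \<in> K. card \<sigma> = 3 \<and> \<tau> \<subseteq> \<sigma>}"
proof -
  have "{\<sigma> \<in> SS. \<tau> \<subseteq> \<sigma>} = {\<sigma> \<in> K. card \<sigma> = 3 \<and> \<tau> \<subseteq> \<sigma>}"
    using SS_D EE_SS[OF assms] by blast
  then show ?thesis by (simp only: ne_def)
qed

lemma n_edge_eq:
  assumes "\<tau> \<in> EE"
  shows "n_edge \<Delta> (convex hull \<tau>) = ne \<tau>"
proof -
  have "{\<sigma> \<in> faces 2 \<Delta>. convex hull \<tau> \<subseteq> \<sigma>} = (hull) convex ` {\<sigma> \<in> K. card \<sigma> = 3 \<and> \<tau> \<subseteq> \<sigma>}"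
    unfolding faces_eq using hull_subset_iff[OF EE_D(1)[OF assms]] by auto
  moreover have "card ((hull) convex ` {\<sigma> \<in> K. card \<sigma> = 3 \<and> \<tau> \<subseteq> \<sigma>}) = card {\<sigma> \<in> K. card \<sigma> = 3 \<and> \<tau> \<subseteq> \<sigma>}"
    by (rule card_image, rule inj_hull) blast
  ultimately show ?thesis unfolding n_edge_def ne_eq[OF assms] by simp
qed

lemma edge_sums:
  assumes "\<tau> \<in> EE"
  shows "int (\<Sum>i\<le>e. gdim (ne \<tau>) r i) = bin (int e + 2) 2 - t_edge r \<Delta> (convex hull \<tau>) * bin (int e + 1 - int r) 2
      + a_edge r \<Delta> (convex hull \<tau>) * bin (int e + 1 - q_edge r \<Delta> (convex hull \<tau>)) 2
      + b_edge r \<Delta> (convex hull \<tau>) * bin (int e + 2 - q_edge r \<Delta> (convex hull \<tau>)) 2"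
    and "int (\<Sum>e\<le>d. \<Sum>i\<le>e. gdim (ne \<tau>) r i) = bin (int d + 3) 3 - t_edge r \<Delta> (convex hull \<tau>) * bin (int d + 2 - int r) 3
      + a_edge r \<Delta> (convex hull \<tau>) * bin (int d + 2 - q_edge r \<Delta> (convex hull \<tau>)) 3
      + b_edge r \<Delta> (convex hull \<tau>) * bin (int d + 3 - q_edge r \<Delta> (convex hull \<tau>)) 3"
    and "int r + 1 \<le> q_edge r \<Delta> (convex hull \<tau>)"
proof -
  have n: "2 \<le> ne \<tau>" using edge_degree[OF assms] ne_eq[OF assms] by simp
  have t: "t_edge r \<Delta> (convex hull \<tau>) = min (int (ne \<tau>)) (int r + 2)" by (simp add: t_edge_def n_edge_eq[OF assms])
  have q: "q_edge r \<Delta> (convex hull \<tau>) = (t_edge r \<Delta> (convex hull \<tau>) * (int r + 1)) div (t_edge r \<Delta> (convex hull \<tau>) - 1)"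
    unfolding q_edge_def by (rule floor_divide_of_int_eq)
  note f = n t q a_edge_def b_edge_def
  show "int (\<Sum>i\<le>e. gdim (ne \<tau>) r i) = bin (int e + 2) 2 - t_edge r \<Delta> (convex hull \<tau>) * bin (int e + 1 - int r) 2
      + a_edge r \<Delta> (convex hull \<tau>) * bin (int e + 1 - q_edge r \<Delta> (convex hull \<tau>)) 2
      + b_edge r \<Delta> (convex hull \<tau>) * bin (int e + 2 - q_edge r \<Delta> (convex hull \<tau>)) 2"
    by (rule sum_gdim_formula(1)[OF f])
  show "int (\<Sum>e\<le>d. \<Sum>i\<le>e. gdim (ne \<tau>) r i) = bin (int d + 3) 3 - t_edge r \<Delta> (convex hull \<tau>) * bin (int d + 2 - int r) 3
      + a_edge r \<Delta> (convex hull \<tau>) * bin (int d + 2 - q_edge r \<Delta> (convex hull \<tau>)) 3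
      + b_edge r \<Delta> (convex hull \<tau>) * bin (int d + 3 - q_edge r \<Delta> (convex hull \<tau>)) 3"
    by (rule sum_gdim_formula(2)[OF f])
  show "int r + 1 \<le> q_edge r \<Delta> (convex hull \<tau>)" by (rule gdim_formula(1)[OF f])
qed

lemma star_faces:
  assumes g: "{g} \<in> K"
  shows "card (interior_faces 2 (vertex_star {g} \<Delta>)) = card (Sg g)"
    and "card (interior_faces 1 (vertex_star {g} \<Delta>)) = card (Eg g)"
    and "(\<Sum>\<tau>\<in>interior_faces 1 (vertex_star {g} \<Delta>). f \<tau>) = (\<Sum>\<tau>\<in>Eg g. f (convex hull \<tau>))"
proof -
  have inj: "inj_on ((hull) convex) (Sg g)" "inj_on ((hull) convex) (Eg g)"
    by (rule inj_hull; use SS_D EE_D in \<open>auto simp: Sg_def Eg_def\<close>)+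
  have e: "interior_faces 2 (vertex_star {g} \<Delta>) = (hull) convex ` Sg g"
    "interior_faces 1 (vertex_star {g} \<Delta>) = (hull) convex ` Eg g"
    using star_interior_eq[OF g, of 2] star_interior_eq[OF g, of 1] by (simp_all add: Sg_def Eg_def numeral_eq_Suc)
  show "card (interior_faces 2 (vertex_star {g} \<Delta>)) = card (Sg g)"
    "card (interior_faces 1 (vertex_star {g} \<Delta>)) = card (Eg g)"
    unfolding e by (rule card_image[OF inj(1)], rule card_image[OF inj(2)])
  show "(\<Sum>\<tau>\<in>interior_faces 1 (vertex_star {g} \<Delta>). f \<tau>) = (\<Sum>\<tau>\<in>Eg g. f (convex hull \<tau>))"
    unfolding e by (simp add: sum.reindex[OF inj(2)])
qed

text \<open>How far \<open>dim W\<close> stays below the count by independent edge conditions; an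
  integer, as its sign is not known beforehand.\<close>

definition defect :: "nat \<Rightarrow> real^3 \<Rightarrow> nat \<Rightarrow> int" where
  "defect r g e = int (card (Sg g) * hdim e) - int (\<Sum>\<tau>\<in>Eg g. \<Sum>i\<le>e. gdim (ne \<tau>) r i) - int (dim (W nml r e g))"

lemma hdim_bin: "int (hdim e) = bin (int e + 2) 2"
  unfolding hdim_def using bin_of_nat[of "e + 2" 2] by (simp only: of_nat_add of_nat_numeral)

lemma L_common_eq:
  assumes g: "{g} \<in> K"
  shows "L_common r \<Delta> {g} e = int (card (Sg g)) * bin (int e + 1 - int r) 2
    + int (\<Sum>\<tau>\<in>Eg g. \<Sum>i\<le>e. gdim (ne \<tau>) r i) - int (card (Eg g)) * bin (int e + 2) 2"
proof -
  have "int (\<Sum>\<tau>\<in>Eg g. \<Sum>i\<le>e. gdim (ne \<tau>) r i) = (\<Sum>\<tau>\<in>Eg g. int (\<Sum>i\<le>e. gdim (ne \<tau>) r i))" by (rule of_nat_sum)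
  also have "\<dots> = (\<Sum>\<tau>\<in>Eg g. bin (int e + 2) 2 - t_edge r \<Delta> (convex hull \<tau>) * bin (int e + 1 - int r) 2
      + (a_edge r \<Delta> (convex hull \<tau>) * bin (int e + 1 - q_edge r \<Delta> (convex hull \<tau>)) 2
      + b_edge r \<Delta> (convex hull \<tau>) * bin (int e + 2 - q_edge r \<Delta> (convex hull \<tau>)) 2))"
  proof (rule sum.cong[OF refl])
    fix \<tau> assume "\<tau> \<in> Eg g"
    then have \<tau>: "\<tau> \<in> EE" by (simp add: Eg_def)
    show "int (\<Sum>i\<le>e. gdim (ne \<tau>) r i) = bin (int e + 2) 2 - t_edge r \<Delta> (convex hull \<tau>) * bin (int e + 1 - int r) 2
      + (a_edge r \<Delta> (convex hull \<tau>) * bin (int e + 1 - q_edge r \<Delta> (convex hull \<tau>)) 2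
      + b_edge r \<Delta> (convex hull \<tau>) * bin (int e + 2 - q_edge r \<Delta> (convex hull \<tau>)) 2)"
      by (simp only: edge_sums(1)[OF \<tau>] add.assoc)
  qed
  finally have S: "int (\<Sum>\<tau>\<in>Eg g. \<Sum>i\<le>e. gdim (ne \<tau>) r i) = (\<Sum>\<tau>\<in>Eg g. bin (int e + 2) 2 - t_edge r \<Delta> (convex hull \<tau>) * bin (int e + 1 - int r) 2
      + (a_edge r \<Delta> (convex hull \<tau>) * bin (int e + 1 - q_edge r \<Delta> (convex hull \<tau>)) 2
      + b_edge r \<Delta> (convex hull \<tau>) * bin (int e + 2 - q_edge r \<Delta> (convex hull \<tau>)) 2))" .
  show ?thesis
    unfolding L_common_def star_faces[OF g] S
    by (simp only: sum.distrib sum_subtractf sum_distrib_right[symmetric] sum_constant) (simp add: algebra_simps)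
qed

text \<open>The Euler characteristic of the link appears as the coefficient of the full space of
  forms.\<close>

lemma defect_A:
  assumes g: "{g} \<in> K"
  shows "(int (card (Sg g)) + 1 - int (card (Stf g)) - int (card (Eg g))) * bin (int e + 2) 2 - L_common r \<Delta> {g} e \<le> defect r g e"
proof -
  have "int (if r + 1 \<le> e then hdim (e - (r + 1)) else 0) = bin (int e + 1 - int r) 2"
    using bin_of_nat[of "e - (r + 1) + 2" 2] by (auto simp: hdim_def bin_def algebra_simps)
  moreover have "int (dim (W nml r e g)) + int (hdim e)
      \<le> int (card (Stf g)) * int (hdim e) + int (card (Sg g)) * int (if r + 1 \<le> e then hdim (e - (r + 1)) else 0)"
    using dim_W_A[OF g, of nml r e] by (simp only: of_nat_add[symmetric] of_nat_mult[symmetric] of_nat_le_iff)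
  ultimately show ?thesis unfolding defect_def L_common_eq[OF g] hdim_bin by (simp add: hdim_bin algebra_simps)
qed

lemma bin_nonneg: "0 \<le> bin n k" by (simp add: bin_def)

lemma defect_open:
  assumes g: "{g} \<in> K" "{g} \<notin> Int_faces 1"
  shows "pos_part (bin (int e + 2) 2 - L_open r \<Delta> {g} e) \<le> defect r g e"
proof -
  have "0 * bin (int e + 2) 2 \<le> (int (card (Sg g)) + 1 - int (card (Stf g)) - int (card (Eg g))) * bin (int e + 2) 2"
    using euler_open[OF g] by (intro mult_right_mono bin_nonneg) linarith
  then have "bin (int e + 2) 2 - L_open r \<Delta> {g} e \<le> defect r g e"
    using defect_A[OF g(1), of e r] by (simp add: L_open_def)
  moreover have "0 \<le> defect r g e" using W_open_B[OF g, of r e] unfolding defect_def by linarith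
  ultimately show ?thesis by (simp add: pos_part_def)
qed

text \<open>The Euler coefficient is at least -1 here, against 0 at a boundary vertex; this is the
  second copy of \<open>bin (int e + 2) 2\<close> in \<open>L_closed\<close>.\<close>

lemma defect_closed:
  assumes g: "{g} \<in> K"
  shows "bin (int e + 2) 2 - L_closed r \<Delta> {g} e \<le> defect r g e"
proof -
  have "(-1) * bin (int e + 2) 2 \<le> (int (card (Sg g)) + 1 - int (card (Stf g)) - int (card (Eg g))) * bin (int e + 2) 2"
    using euler_closed[OF g] by (intro mult_right_mono bin_nonneg) linarith
  then show ?thesis using defect_A[OF g, of e r] by (simp add: L_closed_def)
qed

lemma L_common_small:
  assumes g: "{g} \<in> K" and e: "e \<le> r"
  shows "L_common r \<Delta> {g} e = 0"
proof -
  have "bin (int e + 1 - q_edge r \<Delta> (convex hull \<tau>)) 2 = 0 \<and> bin (int e + 2 - q_edge r \<Delta> (convex hull \<tau>)) 2 = 0" if "\<tau> \<in> Eg g" for \<tau>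
    using edge_sums(3)[of \<tau> r] that e by (simp add: bin_def Eg_def)
  moreover have "bin (int e + 1 - int r) 2 = 0" using e by (simp add: bin_def)
  ultimately show ?thesis unfolding L_common_def star_faces[OF g] by simp
qed

lemma D_vertex_bounds:
  shows "r \<le> D_vertex r \<Delta> \<gamma>" "D_vertex r \<Delta> \<gamma> \<le> 3 * r + 1"
  by (auto simp: D_vertex_def Let_def)

lemma defect_closed_pos:
  assumes g: "{g} \<in> Int_faces 1" and e: "D_vertex r \<Delta> {g} < e"
  shows "pos_part (bin (int e + 2) 2 - L_closed r \<Delta> {g} e) \<le> defect r g e"
proof -
  have gK: "{g} \<in> K" using g by (rule Int_faces_K)
  have n4: "4 \<le> card (Eg g)" using card_lk_ge[OF g] card_lk(2)[OF g] by simp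
  have re: "r + 1 \<le> e" using e D_vertex_bounds(1)[of r "{g}"] by simp
  have D: "D_vertex r \<Delta> {g} = (if card (Eg g) = 4 then 2 * r else if card (Eg g) = 5 then (5 * r + 2) div 3 else (3 * r + 1) div 2)"
    unfolding D_vertex_def star_faces(2)[OF gK] Let_def ..
  \<comment> \<open>For k edges this reads e > k r / (k - 2), with the bounds 2r, 5r/3 and 3r/2 for
    k = 4, 5, 6; \<open>D_vertex\<close> is this bound rounded up.\<close>
  have "2 * e < min (card (Eg g)) 6 * (e - r)"
  proof -
    consider "card (Eg g) = 4" | "card (Eg g) = 5" | "6 \<le> card (Eg g)" using n4 by linarith
    then show ?thesis
    proof cases
      case 1 then show ?thesis using e re D by simp
    next
      case 2 then show ?thesis using e re D by simp
    next
      case 3 then have "min (card (Eg g)) 6 = 6" by simp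
      then show ?thesis using 3 e re D by simp
    qed
  qed
  from W_closed_B[OF g re this] have "0 \<le> defect r g e" unfolding defect_def by linarith
  then show ?thesis using defect_closed[OF gK, of e r] by (simp add: pos_part_def)
qed

text \<open>At an interior vertex each degree up to \<open>r\<close> may contribute as little as
  minus the number of forms, in total \<open>bin (int r + 3) 3\<close>; the later degrees match the
  summands of \<open>N_vertex\<close> one by one.\<close>

lemma defect_sum:
  assumes g: "{g} \<in> K"
  shows "N_vertex r \<Delta> {g} - (if {g} \<in> Int_faces 1 then bin (int r + 3) 3 else 0) \<le> (\<Sum>e<3 * r + 2. defect r g e)"
proof -
  have mem: "{g} \<in> interior_faces 0 \<Delta> \<longleftrightarrow> {g} \<in> Int_faces 1"
  proof -
    have "interior_faces 0 \<Delta> = (\<lambda>C. C) ` Int_faces 1"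
    proof -
      have "convex hull C = C" if "C \<in> Int_faces 1" for C
      proof -
        have "card C = 1" using that by (simp add: Int_faces_def)
        then obtain x where "C = {x}" by (rule card_1_singletonE)
        then show ?thesis by simp
      qed
      then show ?thesis unfolding interior_faces_eq by (simp only: add_0) (rule image_cong[OF refl])
    qed
    then show ?thesis by simp
  qed
  have split: "(\<Sum>e<3 * r + 2. defect r g e) = (\<Sum>e\<le>r. defect r g e) + (\<Sum>e = r + 1..3 * r + 1. defect r g e)"
  proof -
    have "{..<3 * r + 2} = {..r} \<union> {r + 1..3 * r + 1}" by auto
    then show ?thesis by (simp only:) (rule sum.union_disjoint; auto)
  qed
  show ?thesis
  proof (cases "{g} \<in> Int_faces 1")
    case False
    have pd: "pos_part (bin (int e + 2) 2 - L_open r \<Delta> {g} e) \<le> defect r g e" for e by (rule defect_open[OF g False])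
    have "0 \<le> defect r g e" for e using pd[of e] by (simp add: pos_part_def)
    then have "0 \<le> (\<Sum>e\<le>r. defect r g e)" by (simp add: sum_nonneg)
    moreover have "N_vertex r \<Delta> {g} \<le> (\<Sum>e = r + 1..3 * r + 1. defect r g e)"
      unfolding N_vertex_def mem if_not_P[OF False] by (rule sum_mono) (rule pd)
    ultimately show ?thesis using False split by simp
  next
    case True
    let ?D = "D_vertex r \<Delta> {g}"
    have "- (\<Sum>e\<le>r. bin (int e + int 2 - 0) 2) \<le> (\<Sum>e\<le>r. defect r g e)"
      unfolding sum_negf[symmetric]
    proof (rule sum_mono)
      fix e assume "e \<in> {..r}"
      then show "- bin (int e + int 2 - 0) 2 \<le> defect r g e"
        using defect_closed[OF g, of e r] L_common_small[OF g, of e r] by (simp add: L_closed_def)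
    qed
    moreover have "(\<Sum>e\<le>r. bin (int e + int 2 - 0) 2) = bin (int r + 3) 3"
      using sum_bin[of 0 2 r] by (simp add: eval_nat_numeral algebra_simps)
    moreover have "(\<Sum>e = r + 1..3 * r + 1. defect r g e) = (\<Sum>e = r + 1..?D. defect r g e) + (\<Sum>e = ?D + 1..3 * r + 1. defect r g e)"
    proof -
      have "{r + 1..3 * r + 1} = {r + 1..?D} \<union> {?D + 1..3 * r + 1}" using D_vertex_bounds[of r "{g}"] by auto
      then show ?thesis by (simp only:) (rule sum.union_disjoint; auto)
    qed
    moreover have "N_vertex r \<Delta> {g} \<le> (\<Sum>e = r + 1..?D. defect r g e) + (\<Sum>e = ?D + 1..3 * r + 1. defect r g e)"
      unfolding N_vertex_def mem if_P[OF True]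
      by (intro add_mono sum_mono defect_closed[OF g] defect_closed_pos[OF True]) simp
    ultimately show ?thesis using True split by simp
  qed
qed

text \<open>Double counting: a face with \<open>k\<close> vertices occurs once at each of
  them.\<close>

lemma sum_vertices:
  assumes fin: "finite F" and F: "\<And>C. C \<in> F \<Longrightarrow> C \<in> K \<and> card C = k"
  shows "(\<Sum>g\<in>{g. {g} \<in> K}. \<Sum>C\<in>{C \<in> F. g \<in> C}. f C) = int k * (\<Sum>C\<in>F. f C :: int)"
proof -
  have "(\<Sum>g\<in>{g. {g} \<in> K}. \<Sum>C\<in>{C \<in> F. g \<in> C}. f C) = (\<Sum>C\<in>F. \<Sum>g\<in>{g \<in> {g. {g} \<in> K}. g \<in> C}. f C)"
    by (rule sum.swap_restrict[OF finite_vertices fin])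
  also have "\<dots> = (\<Sum>C\<in>F. int k * f C)"
  proof (rule sum.cong[OF refl])
    fix C assume C: "C \<in> F"
    have "{g \<in> {g. {g} \<in> K}. g \<in> C} = C" using K_subset[of C] F[OF C] by auto
    then show "(\<Sum>g\<in>{g \<in> {g. {g} \<in> K}. g \<in> C}. f C) = int k * f C" using F[OF C] by simp
  qed
  finally show ?thesis by (simp add: sum_distrib_left)
qed

lemma hull_singletons:
  assumes "\<And>C. C \<in> F \<Longrightarrow> card C = 1"
  shows "(hull) convex ` F = (\<lambda>g. {g}) ` {g. {g} \<in> F}"
proof (intro subset_antisym subsetI)
  fix S assume "S \<in> (hull) convex ` F"
  then obtain C where C: "C \<in> F" "S = convex hull C" by blast
  obtain g where "C = {g}" using card_1_singletonE[OF assms[OF C(1)]] by blast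
  then show "S \<in> (\<lambda>g. {g}) ` {g. {g} \<in> F}" using C by simp
next
  fix S assume "S \<in> (\<lambda>g. {g}) ` {g. {g} \<in> F}"
  then obtain g where "{g} \<in> F" "S = convex hull {g}" by auto
  then show "S \<in> (hull) convex ` F" by blast
qed

text \<open>For \<open>N = 3 * r + 2\<close> the vertex conditions cover the degrees up to
  \<open>3 * r + 1\<close>. The terms of \<open>spline_dim_ge\<close> and \<open>Gsum_ge\<close>
  that involve \<open>N\<close> add up to the sum of the defects, a triangle being counted at three
  vertices and an edge at two.\<close>

lemma LB_le_spline_dim:
  assumes d: "2 * (3 * r + 2) \<le> d"
  shows "LB \<Delta> d r \<le> int (spline_dim r d \<Delta>)"
proof -
  define N where "N = 3 * r + 2"
  let ?V = "{g. {g} \<in> K}"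
  let ?P = "bin (int d + 3) 3" and ?J = "bin (int d + 2 - int r) 3"
  let ?G = "\<lambda>\<tau>. \<Sum>e\<le>d. \<Sum>i\<le>e. gdim (ne \<tau>) r i" and ?g = "\<lambda>\<tau> e. \<Sum>i\<le>e. gdim (ne \<tau>) r i"
  have N: "2 * N \<le> d" "3 * r + 2 \<le> N" using d by (auto simp: N_def)
  have P: "int ((d + 3) choose 3) = ?P" using bin_of_nat[of "d + 3" 3] by simp
  have J: "int ((d - (r + 1) + 3) choose 3) = ?J"
    using bin_of_nat[of "d - (r + 1) + 3" 3] d by (simp add: of_nat_diff algebra_simps)
  have ge: "int (card T4) * ?P + int (card SS) * ?J + (\<Sum>\<tau>\<in>EE. int (Gsum (ne \<tau>) r d N)) + int (card SS) * (3 * int ((N + 2) choose 3))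
      \<le> int (spline_dim r d \<Delta>) + int (card SS) * ?P + (\<Sum>g\<in>?V. \<Sum>e<N. int (dim (W nml r e g)))"
  proof -
    have "int (card T4 * ((d + 3) choose 3) + card SS * ((d - (r + 1) + 3) choose 3)
        + (\<Sum>\<tau>\<in>EE. Gsum (ne \<tau>) r d N) + card SS * (3 * ((N + 2) choose 3)))
      \<le> int (spline_dim r d \<Delta> + card SS * ((d + 3) choose 3) + (\<Sum>g\<in>?V. \<Sum>e<N. dim (W nml r e g)))"
      using spline_dim_ge[OF N] by (simp only: of_nat_le_iff)
    then show ?thesis by (simp only: of_nat_add of_nat_mult of_nat_sum of_nat_numeral P J)
  qed
  have G: "(\<Sum>\<tau>\<in>EE. int (?G \<tau>)) \<le> (\<Sum>\<tau>\<in>EE. int (Gsum (ne \<tau>) r d N)) + 2 * (\<Sum>\<tau>\<in>EE. \<Sum>e<N. int (?g \<tau> e))"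
    unfolding sum_distrib_left sum.distrib[symmetric]
  proof (rule sum_mono)
    fix \<tau>
    have "?G \<tau> \<le> Gsum (ne \<tau>) r d N + 2 * (\<Sum>e<N. ?g \<tau> e)" by (rule Gsum_ge) (use N in simp)
    then have "int (?G \<tau>) \<le> int (Gsum (ne \<tau>) r d N + 2 * (\<Sum>e<N. ?g \<tau> e))" by (simp only: of_nat_le_iff)
    also have "\<dots> = int (Gsum (ne \<tau>) r d N) + (\<Sum>e<N. 2 * int (?g \<tau> e))" by (simp add: sum_distrib_left)
    finally show "int (?G \<tau>) \<le> int (Gsum (ne \<tau>) r d N) + (\<Sum>e<N. 2 * int (?g \<tau> e))" .
  qed
  have h: "(\<Sum>e<N. int (hdim e)) = int ((N + 2) choose 3)"
  proof -
    have "{..<N} = {..N - 1}" using N(2) by auto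
    then have "(\<Sum>e<N. int (hdim e)) = bin (int N + 2) 3"
      using sum_bin[of 0 2 "N - 1"] N(2) by (simp add: hdim_bin numeral_eq_Suc of_nat_diff add.commute)
    then show ?thesis using bin_of_nat[of "N + 2" 3] by (simp only: of_nat_add of_nat_numeral)
  qed
  have def_sum: "(\<Sum>g\<in>?V. \<Sum>e<N. defect r g e)
      = int (card SS) * (3 * int ((N + 2) choose 3)) - 2 * (\<Sum>\<tau>\<in>EE. \<Sum>e<N. int (?g \<tau> e)) - (\<Sum>g\<in>?V. \<Sum>e<N. int (dim (W nml r e g)))"
  proof -
    have "(\<Sum>e<N. defect r g e) = (\<Sum>\<sigma>\<in>{\<sigma> \<in> SS. g \<in> \<sigma>}. int ((N + 2) choose 3))
        - (\<Sum>\<tau>\<in>{\<tau> \<in> EE. g \<in> \<tau>}. \<Sum>e<N. int (?g \<tau> e)) - (\<Sum>e<N. int (dim (W nml r e g)))" for g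
    proof -
      have "(\<Sum>e<N. int (\<Sum>\<tau>\<in>Eg g. ?g \<tau> e)) = (\<Sum>\<tau>\<in>{\<tau> \<in> EE. g \<in> \<tau>}. \<Sum>e<N. int (?g \<tau> e))"
        unfolding of_nat_sum[of "\<lambda>\<tau>. ?g \<tau> _"] Eg_def by (rule sum.swap)
      moreover have "(\<Sum>e<N. int (card (Sg g) * hdim e)) = (\<Sum>\<sigma>\<in>{\<sigma> \<in> SS. g \<in> \<sigma>}. int ((N + 2) choose 3))"
        unfolding h[symmetric] by (simp add: Sg_def sum_distrib_left)
      ultimately show ?thesis unfolding defect_def by (simp only: sum_subtractf)
    qed
    then have "(\<Sum>g\<in>?V. \<Sum>e<N. defect r g e) = (\<Sum>g\<in>?V. \<Sum>\<sigma>\<in>{\<sigma> \<in> SS. g \<in> \<sigma>}. int ((N + 2) choose 3))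
        - (\<Sum>g\<in>?V. \<Sum>\<tau>\<in>{\<tau> \<in> EE. g \<in> \<tau>}. \<Sum>e<N. int (?g \<tau> e)) - (\<Sum>g\<in>?V. \<Sum>e<N. int (dim (W nml r e g)))"
      by (simp only: sum_subtractf)
    also have "(\<Sum>g\<in>?V. \<Sum>\<sigma>\<in>{\<sigma> \<in> SS. g \<in> \<sigma>}. int ((N + 2) choose 3)) = int 3 * (\<Sum>\<sigma>\<in>SS. int ((N + 2) choose 3))"
      by (rule sum_vertices[OF finite_SS]) (use SS_D in blast)
    also have "(\<Sum>g\<in>?V. \<Sum>\<tau>\<in>{\<tau> \<in> EE. g \<in> \<tau>}. \<Sum>e<N. int (?g \<tau> e)) = int 2 * (\<Sum>\<tau>\<in>EE. \<Sum>e<N. int (?g \<tau> e))"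
      by (rule sum_vertices[OF finite_EE]) (use EE_D in blast)
    finally show ?thesis by simp
  qed
  have vert: "(\<Sum>\<gamma>\<in>faces 0 \<Delta>. N_vertex r \<Delta> \<gamma>) - int (card (interior_faces 0 \<Delta>)) * bin (int r + 3) 3
      \<le> (\<Sum>g\<in>?V. \<Sum>e<N. defect r g e)"
  proof -
    have f0: "faces 0 \<Delta> = (\<lambda>g. {g}) ` ?V"
      unfolding faces_eq by (subst hull_singletons) auto
    have "interior_faces 0 \<Delta> = (\<lambda>g. {g}) ` {g \<in> ?V. {g} \<in> Int_faces 1}"
      unfolding interior_faces_eq using Int_faces_K by (subst hull_singletons) (auto simp: Int_faces_def)
    then have "card (interior_faces 0 \<Delta>) = card {g \<in> ?V. {g} \<in> Int_faces 1}"
      by (simp add: card_image)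
    then have "int (card (interior_faces 0 \<Delta>)) * bin (int r + 3) 3 = (\<Sum>g\<in>?V. if {g} \<in> Int_faces 1 then bin (int r + 3) 3 else 0)"
      using finite_vertices by (simp add: sum.inter_filter[symmetric])
    moreover have "(\<Sum>\<gamma>\<in>faces 0 \<Delta>. N_vertex r \<Delta> \<gamma>) = (\<Sum>g\<in>?V. N_vertex r \<Delta> {g})"
      unfolding f0 by (simp add: sum.reindex)
    ultimately have "(\<Sum>\<gamma>\<in>faces 0 \<Delta>. N_vertex r \<Delta> \<gamma>) - int (card (interior_faces 0 \<Delta>)) * bin (int r + 3) 3
      = (\<Sum>g\<in>?V. N_vertex r \<Delta> {g} - (if {g} \<in> Int_faces 1 then bin (int r + 3) 3 else 0))"
      by (simp only: sum_subtractf)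
    also have "\<dots> \<le> (\<Sum>g\<in>?V. \<Sum>e<N. defect r g e)"
      unfolding N_def by (intro sum_mono defect_sum) simp
    finally show ?thesis .
  qed
  have inj: "inj_on ((hull) convex) EE" by (rule inj_hull) (use EE_D(1) in blast)
  have e1: "interior_faces 1 \<Delta> = (hull) convex ` EE" using interior_faces_eq[of 1] by (simp add: numeral_eq_Suc)
  have c: "card (faces 3 \<Delta>) = card T4" "card (interior_faces 2 \<Delta>) = card SS" "card (interior_faces 1 \<Delta>) = card EE"
    unfolding faces3_eq e1 using interior_faces_eq[of 2] card_image[OF inj_hull[of T4]] card_image[OF inj_hull[of SS]] card_image[OF inj]
      T4_K SS_D(1) by (auto simp: numeral_eq_Suc)
  have es: "(\<Sum>\<tau>\<in>interior_faces 1 \<Delta>. f \<tau>) = (\<Sum>\<tau>\<in>EE. f (convex hull \<tau>) :: int)" for f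
    unfolding e1 by (simp add: sum.reindex[OF inj])
  have "(\<Sum>\<tau>\<in>EE. int (?G \<tau>)) = (\<Sum>\<tau>\<in>EE. ?P - t_edge r \<Delta> (convex hull \<tau>) * ?J
      + (a_edge r \<Delta> (convex hull \<tau>) * bin (int d + 2 - q_edge r \<Delta> (convex hull \<tau>)) 3
      + b_edge r \<Delta> (convex hull \<tau>) * bin (int d + 3 - q_edge r \<Delta> (convex hull \<tau>)) 3))"
    by (rule sum.cong[OF refl]) (simp only: edge_sums(2)[unfolded add.assoc] add.assoc)
  then have LBeq: "LB \<Delta> d r = int (card T4) * ?P - int (card SS) * ?P + int (card SS) * ?J + (\<Sum>\<tau>\<in>EE. int (?G \<tau>))
      + ((\<Sum>\<gamma>\<in>faces 0 \<Delta>. N_vertex r \<Delta> \<gamma>) - int (card (interior_faces 0 \<Delta>)) * bin (int r + 3) 3)"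
    unfolding LB_def c es
    by (simp only: sum.distrib sum_subtractf sum_distrib_right[symmetric] sum_constant) (simp add: algebra_simps)
  show ?thesis unfolding LBeq using ge G def_sum vert by linarith
qed

end

theorem theorem2p4:
  fixes r :: nat and \<Delta> :: "(real^3) set set"
  assumes "tetrahedral_partition \<Delta>"
  shows "\<exists>d\<^sub>0. \<forall>d\<ge>d\<^sub>0. int (spline_dim r d \<Delta>) \<ge> LB \<Delta> d r"
proof -
  interpret tet_part \<Delta> by unfold_locales (rule assms)
  show ?thesis using LB_le_spline_dim by blast
qed

end
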